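(* Let $n\geqslant1$, let $\psi_j\in H^{-2j}(\mathbb{R}^n)\cap L^1(\mathbb{R}^n)$ for $j=0,1,2$, and suppose additionally that $\psi_2\in L^{1,1}$. Let $\psi=\psi(t,x)$ be the solution of the Cauchy problem $$(\partial_t-\kappa\Delta)(\psi_{tt}-\Delta\psi-\delta\Delta\psi_t)+\kappa(\gamma-1)(b\nu-\kappa)\Delta^2\psi_t=0,\quad x\in\mathbb{R}^n,\ t>0,$$ $$\psi(0,x)=\psi_0(x),\quad \psi_t(0,x)=\psi_1(x),\quad \psi_{tt}(0,x)=\psi_2(x),\quad x\in\mathbb{R}^n.$$ Then the following refined estimates hold for $t\gg1$: $$\|\psi(t,\cdot)-\psi^{(1)}(t,\cdot)-\psi^{(2)}(t,\cdot)\|_{L^2}=o\big(\mathcal{D}_n^{(1)}(t)\big)$$ as well as $$\|\psi(t,\cdot)-\psi^{(1)}(t,\cdot)\|_{L^2}\lesssim\mathcal{D}_n^{(1)}(t)\left(\sum_{j=0,1}\|\psi_j\|_{H^{-2j}\cap L^1}+\|\psi_2\|_{H^{-4}\cap L^{1,1}}\right).$$ Moreover, the following lower bounds hold. (I) Lower dimensional cases $n=1,2$. If $|M_{\psi_2}|$ and $|P_{\Psi_{1,2}}|$ do not vanish simultaneously, then for $t\gg1$ $$\left(|P_{\Psi_{1,2}}|+|M_{\psi_2}|\right)\mathcal{D}_n^{(1)}(t)\lesssim\|\psi(t,\cdot)-\psi^{(1)}(t,\cdot)\|_{L^2}.$$ (II) Higher dimensional cases $n\geqslant3$. If $|M_{\psi_2}|$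 and $|2\delta P_{\Psi_{1,2}}+nP_2|$ do not vanish simultaneously, then for $t\gg1$ $$\left(|2\delta P_{\Psi_{1,2}}+nP_2|+|M_{\psi_2}|\right)\mathcal{D}_n^{(1)}(t)\lesssim\|\psi(t,\cdot)-\psi^{(1)}(t,\cdot)\|_{L^2}.$$
   Context: Parameters: $\gamma\in(1,\tfrac53]$, $b>0$, $\nu>0$, $\kappa>0$, $\delta:=b\nu+(\gamma-1)\kappa$, and $\hat\delta:=-\kappa^2(\delta-\gamma b\nu)$. It is assumed throughout that $0<\kappa\ll\delta$. Fourier transform: $\widehat f(\xi)=\int_{\mathbb{R}^n}e^{-ix\cdot\xi}f(x)\,dx$, with inverse $\mathcal{F}^{-1}_{\xi\to x}$. The solution $\psi$ is understood via the partial Fourier transform in $x$: for each $\xi$, $\widehat\psi(t,\xi)$ solves the linear ODE in $t$ obtained by transforming the equation, with data $\widehat\psi_0(\xi),\widehat\psi_1(\xi),\widehat\psi_2(\xi)$. For $s\geqslant0$, $H^{-s}$ is the space of $f$ with $\mathcal{F}^{-1}(\langle\xi\rangle^{-s}\widehat f)\in L^2$, $\langle\xi\rangle=\sqrt{1+|\xi|^2}$ (so $H^0=L^2$). $L^{1,1}$ is the space of $f\in L^1$ with $\|f\|_{L^{1,1}}:=\int_{\mathbb{R}^n}(1+|x|)|f(x)|\,dx<\infty$. The norm of an intersection of spaces is the sum of the norms. For a function $f$, $P_f:=\int_{\mathbb{R}^n}f(x)\,dx\in\mathbb{R}$ and $M_f:=\int_{\mathbb{R}^n}xf(x)\,dx\in\mathbb{R}^n$.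 The symbol $\circ$ is the Euclidean inner product in $\mathbb{R}^n$, and $\nabla$ is the gradient in $x$. Set $$G_0(t,x):=\mathcal{F}^{-1}_{\xi\to x}\left(\tfrac{1}{|\xi|^2}\left(e^{-\kappa|\xi|^2t}-\cos(|\xi|t)e^{-\frac\delta2|\xi|^2t}\right)\right),\qquad G_1(t,x):=\mathcal{F}^{-1}_{\xi\to x}\left(\tfrac{1}{|\xi|}\sin(|\xi|t)e^{-\frac\delta2|\xi|^2t}\right),$$ $$H_0(t,x):=\frac{4\hat\delta-\kappa\delta^2}{8\kappa}\,t\,\mathcal{F}^{-1}_{\xi\to x}\left(|\xi|\sin(|\xi|t)e^{-\frac\delta2|\xi|^2t}\right)=-\frac{4\hat\delta-\kappa\delta^2}{8\kappa}\,t\,\Delta G_1(t,x),$$ $$P_{\Psi_{1,2}}:=P_{\psi_1}+\frac{2\kappa-\delta}{2}P_{\psi_2},\qquad P_2:=\frac{4\hat\delta-\kappa\delta^2}{8\kappa}P_{\psi_2},$$ $$\psi^{(1)}(t,x):=G_0(t,x)P_{\psi_2},$$ $$\psi^{(2)}(t,x):=\nabla G_0(t,x)\circ M_{\psi_2}+H_0(t,x)P_{\psi_2}+G_1(t,x)\left(P_{\psi_1}+\frac{2\kappa-\delta}{2}P_{\psi_2}\right).$$ Rate function: $\mathcal{D}_n^{(1)}(t)=t^{\frac12}$ if $n=1$; $(\ln t)^{\frac12}$ if $n=2$; $t^{\frac12-\frac n4}$ if $n\geqslant3$. $f\lesssim g$ means that there is a positive constant $C$ with $f\leqslant Cg$.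 "For $t\gg1$" means for all sufficiently large $t$, and the $o(\cdot)$ relation is understood as $t\to\infty$.
   Formalization: In ψ^(2) the term +∇G_0∘M_{ψ_2} is replaced by −∇G_0∘M_{ψ_2}: with the stated Fourier convention and M_f=∫x f, the printed sign makes the o(D_n) estimate false whenever M_{ψ_2}≠0 (e.g. ψ_0=ψ_1=0, ψ_2 odd Schwartz with M_{ψ_2}≠0). *)

theory Defs
  imports "HOL-Analysis.Analysis" "HOL-Library.Landau_Symbols"
begin

text \<open>Lebesgue spaces. Members are Borel representatives of the classes of functions.\<close>

definition L1 :: "(real^'n \<Rightarrow> real) \<Rightarrow> bool" where
  "L1 f \<longleftrightarrow> integrable lborel f"

definition L1norm :: "(real^'n \<Rightarrow> real) \<Rightarrow> real" where
  "L1norm f = (\<integral>x. \<bar>f x\<bar> \<partial>lborel)"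

definition L11 :: "(real^'n \<Rightarrow> real) \<Rightarrow> bool" where
  "L11 f \<longleftrightarrow> integrable lborel f \<and> integrable lborel (\<lambda>x. (1 + norm x) * \<bar>f x\<bar>)"

definition L11norm :: "(real^'n \<Rightarrow> real) \<Rightarrow> real" where
  "L11norm f = (\<integral>x. (1 + norm x) * \<bar>f x\<bar> \<partial>lborel)"

definition L2 :: "(real^'n \<Rightarrow> 'b::real_normed_vector) \<Rightarrow> bool" where
  "L2 f \<longleftrightarrow> f \<in> borel_measurable lborel \<and> integrable lborel (\<lambda>x. (norm (f x))\<^sup>2)"

text \<open>Meaningful only together with membership in \<open>L2\<close>, since the Bochner integral of a
  non-integrable function is 0.\<close>

definition L2norm :: "(real^'n \<Rightarrow> 'b::real_normed_vector) \<Rightarrow> real" where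
  "L2norm f = sqrt (\<integral>x. (norm (f x))\<^sup>2 \<partial>lborel)"

definition fourier :: "(real^'n \<Rightarrow> complex) \<Rightarrow> real^'n \<Rightarrow> complex" where
  "fourier f \<xi> = (\<integral>x. exp (- \<i> * complex_of_real (x \<bullet> \<xi>)) * f x \<partial>lborel)"

definition inv_fourier :: "(real^'n \<Rightarrow> complex) \<Rightarrow> real^'n \<Rightarrow> complex" where
  "inv_fourier g x =
     complex_of_real (1 / (2 * pi) ^ CARD('n)) *
       (\<integral>\<xi>. exp (\<i> * complex_of_real (x \<bullet> \<xi>)) * g \<xi> \<partial>lborel)"

text \<open>\<open>L2_fourier f F\<close>: \<open>F\<close> is the Fourier transform of \<open>f\<close> in the sense of Plancherel, i.e. for the
  extension of \<^const>\<open>fourier\<close> from \<open>L\<^sup>1 \<inter> L\<^sup>2\<close> to \<open>L\<^sup>2\<close> by density. It determines each of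
  \<open>f\<close> and \<open>F\<close> from the other up to null sets, so it also expresses that \<open>f\<close> is the inverse
  transform of \<open>F\<close>.\<close>

definition L2_fourier :: "(real^'n \<Rightarrow> complex) \<Rightarrow> (real^'n \<Rightarrow> complex) \<Rightarrow> bool" where
  "L2_fourier f F \<longleftrightarrow> L2 f \<and> L2 F \<and>
     (\<exists>g. (\<forall>k::nat. integrable lborel (g k) \<and> L2 (g k) \<and> L2 (fourier (g k))) \<and>
          (\<lambda>k. L2norm (\<lambda>x. g k x - f x)) \<longlonglongrightarrow> 0 \<and>
          (\<lambda>k. L2norm (\<lambda>\<xi>. fourier (g k) \<xi> - F \<xi>)) \<longlonglongrightarrow> 0)"

definition fourier_real :: "(real^'n \<Rightarrow> real) \<Rightarrow> real^'n \<Rightarrow> complex" where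
  "fourier_real f = fourier (\<lambda>x. complex_of_real (f x))"

text \<open>The space \<open>H\<^sup>-\<^sup>s\<close> is used only intersected with \<open>L\<^sup>1\<close>, so that the Fourier transform of
  its members is given by the integral. \<open>bessel s f g\<close> says that \<open>g \<in> L\<^sup>2\<close> is the inverse
  Fourier transform of \<open>(1 + |\<xi>|\<^sup>2) powr (-s/2)\<close> times the transform of \<open>f\<close>.\<close>

definition bessel :: "real \<Rightarrow> (real^'n \<Rightarrow> real) \<Rightarrow> (real^'n \<Rightarrow> complex) \<Rightarrow> bool" where
  "bessel s f g \<longleftrightarrow>
     L2_fourier g (\<lambda>\<xi>. complex_of_real (sqrt (1 + (norm \<xi>)\<^sup>2) powr (- s)) * fourier_real f \<xi>)"

definition Hneg_L1 :: "real \<Rightarrow> (real^'n \<Rightarrow> real) \<Rightarrow> bool" where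
  "Hneg_L1 s f \<longleftrightarrow> L1 f \<and> (\<exists>g. bessel s f g)"

definition Hnegnorm :: "real \<Rightarrow> (real^'n \<Rightarrow> real) \<Rightarrow> real" where
  "Hnegnorm s f = L2norm (SOME g. bessel s f g)"

definition P_of :: "(real^'n \<Rightarrow> real) \<Rightarrow> real" where
  "P_of f = (\<integral>x. f x \<partial>lborel)"

definition M_of :: "(real^'n \<Rightarrow> real) \<Rightarrow> real^'n" where
  "M_of f = (\<integral>x. f x *\<^sub>R x \<partial>lborel)"

definition grad :: "(real^'n \<Rightarrow> real) \<Rightarrow> real^'n \<Rightarrow> real^'n" where
  "grad f x = (THE D. GDERIV f x :> D)"

definition dlt :: "real \<Rightarrow> real \<Rightarrow> real \<Rightarrow> real \<Rightarrow> real" where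
  "dlt \<gamma> b \<nu> \<kappa> = b * \<nu> + (\<gamma> - 1) * \<kappa>"

definition dlt_hat :: "real \<Rightarrow> real \<Rightarrow> real \<Rightarrow> real \<Rightarrow> real" where
  "dlt_hat \<gamma> b \<nu> \<kappa> = - \<kappa>\<^sup>2 * (dlt \<gamma> b \<nu> \<kappa> - \<gamma> * b * \<nu>)"

text \<open>The Fourier image of the Cauchy problem at one frequency, with \<open>L = - |\<xi>|\<^sup>2\<close> the symbol of the
  Laplacian, \<open>v\<close> and \<open>w\<close> the first two time derivatives of \<open>u\<close>, and \<open>D\<close> the time derivative of
  \<open>w - L u - \<delta> L v\<close>.\<close>

definition ode_solution ::
  "real \<Rightarrow> real \<Rightarrow> real \<Rightarrow> real \<Rightarrow> real \<Rightarrow> complex \<Rightarrow> complex \<Rightarrow> complex \<Rightarrow> (real \<Rightarrow> complex) \<Rightarrow> bool" where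
  "ode_solution \<gamma> b \<nu> \<kappa> L u0 u1 u2 u \<longleftrightarrow>
     (let \<delta> = dlt \<gamma> b \<nu> \<kappa> in
      \<exists>v w. (\<forall>t\<ge>0. (u has_vector_derivative v t) (at t within {0..})) \<and>
            (\<forall>t\<ge>0. (v has_vector_derivative w t) (at t within {0..})) \<and>
            continuous_on {0..} w \<and>
            u 0 = u0 \<and> v 0 = u1 \<and> w 0 = u2 \<and>
            (\<forall>t>0. \<exists>D.
               ((\<lambda>s. w s - L *\<^sub>R u s - (\<delta> * L) *\<^sub>R v s) has_vector_derivative D) (at t) \<and>
               D - (\<kappa> * L) *\<^sub>R (w t - L *\<^sub>R u t - (\<delta> * L) *\<^sub>R v t)
                 + (\<kappa> * (\<gamma> - 1) * (b * \<nu> - \<kappa>) * L\<^sup>2) *\<^sub>R v t = 0))"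

definition cauchy_solution ::
  "real \<Rightarrow> real \<Rightarrow> real \<Rightarrow> real \<Rightarrow> (real^'n \<Rightarrow> real) \<Rightarrow> (real^'n \<Rightarrow> real) \<Rightarrow> (real^'n \<Rightarrow> real) \<Rightarrow>
     (real \<Rightarrow> real^'n \<Rightarrow> real) \<Rightarrow> bool" where
  "cauchy_solution \<gamma> b \<nu> \<kappa> \<psi>0 \<psi>1 \<psi>2 \<psi> \<longleftrightarrow>
     (\<exists>U :: real \<Rightarrow> real^'n \<Rightarrow> complex.
        (\<forall>\<xi>. ode_solution \<gamma> b \<nu> \<kappa> (- (norm \<xi>)\<^sup>2)
               (fourier_real \<psi>0 \<xi>) (fourier_real \<psi>1 \<xi>) (fourier_real \<psi>2 \<xi>) (\<lambda>t. U t \<xi>)) \<and>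
        (\<forall>t\<ge>0. L2_fourier (\<lambda>x. complex_of_real (\<psi> t x)) (U t)))"

text \<open>The three symbols below are real, even and (for \<open>t > 0\<close>) integrable, so their inverse
  transforms are real-valued functions; \<^const>\<open>Re\<close> only changes the type. The value at
  the single frequency 0, where \<open>1/0 = 0\<close>, is irrelevant.\<close>

definition G0 :: "real \<Rightarrow> real \<Rightarrow> real \<Rightarrow> real^'n \<Rightarrow> real" where
  "G0 \<kappa> \<delta> t x = Re (inv_fourier (\<lambda>\<xi>. complex_of_real
     (1 / (norm \<xi>)\<^sup>2 *
       (exp (- \<kappa> * (norm \<xi>)\<^sup>2 * t) - cos (norm \<xi> * t) * exp (- (\<delta> / 2) * (norm \<xi>)\<^sup>2 * t)))) x)"

definition G1 :: "real \<Rightarrow> real \<Rightarrow> real^'n \<Rightarrow> real" where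
  "G1 \<delta> t x = Re (inv_fourier (\<lambda>\<xi>. complex_of_real
     (1 / norm \<xi> * sin (norm \<xi> * t) * exp (- (\<delta> / 2) * (norm \<xi>)\<^sup>2 * t))) x)"

definition H0 :: "real \<Rightarrow> real \<Rightarrow> real \<Rightarrow> real \<Rightarrow> real^'n \<Rightarrow> real" where
  "H0 \<kappa> \<delta> \<delta>h t x = (4 * \<delta>h - \<kappa> * \<delta>\<^sup>2) / (8 * \<kappa>) * t *
     Re (inv_fourier (\<lambda>\<xi>. complex_of_real
       (norm \<xi> * sin (norm \<xi> * t) * exp (- (\<delta> / 2) * (norm \<xi>)\<^sup>2 * t))) x)"

definition P_Psi12 :: "real \<Rightarrow> real \<Rightarrow> (real^'n \<Rightarrow> real) \<Rightarrow> (real^'n \<Rightarrow> real) \<Rightarrow> real" where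
  "P_Psi12 \<kappa> \<delta> \<psi>1 \<psi>2 = P_of \<psi>1 + (2 * \<kappa> - \<delta>) / 2 * P_of \<psi>2"

definition P_2 :: "real \<Rightarrow> real \<Rightarrow> real \<Rightarrow> (real^'n \<Rightarrow> real) \<Rightarrow> real" where
  "P_2 \<kappa> \<delta> \<delta>h \<psi>2 = (4 * \<delta>h - \<kappa> * \<delta>\<^sup>2) / (8 * \<kappa>) * P_of \<psi>2"

definition profile1 :: "real \<Rightarrow> real \<Rightarrow> (real^'n \<Rightarrow> real) \<Rightarrow> real \<Rightarrow> real^'n \<Rightarrow> real" where
  "profile1 \<kappa> \<delta> \<psi>2 t x = G0 \<kappa> \<delta> t x * P_of \<psi>2"

text \<open>Sign of the first moment term. In the source this term is printed as
  \<open>+ \<nabla>G\<^sub>0 \<circ> M\<close>. Since the transform of \<open>\<psi>\<^sub>2\<close> is \<open>P - i \<xi> \<bullet> M + o(|\<xi>|)\<close>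
  (equivalently, \<open>(K * f)(x) = K(x) P - \<nabla>K(x) \<bullet> M + \<dots>\<close>), while \<open>\<nabla>\<close> has symbol
  \<open>i \<xi>\<close>, the term that occurs in the expansion is \<open>- \<nabla>G\<^sub>0 \<circ> M\<close>. With the printed sign the
  difference \<open>\<psi> - \<psi>\<^sup>(\<^sup>1\<^sup>) - \<psi>\<^sup>(\<^sup>2\<^sup>)\<close> would keep the term \<open>- 2 \<nabla>G\<^sub>0 \<circ> M\<close>, whose norm is
  of the exact order of the rate, and the little-o estimate would fail whenever \<open>M \<noteq> 0\<close>.\<close>

definition profile2 ::
  "real \<Rightarrow> real \<Rightarrow> real \<Rightarrow> (real^'n \<Rightarrow> real) \<Rightarrow> (real^'n \<Rightarrow> real) \<Rightarrow> real \<Rightarrow> real^'n \<Rightarrow> real" where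
  "profile2 \<kappa> \<delta> \<delta>h \<psi>1 \<psi>2 t x =
     - (grad (G0 \<kappa> \<delta> t) x \<bullet> M_of \<psi>2) + H0 \<kappa> \<delta> \<delta>h t x * P_of \<psi>2
     + G1 \<delta> t x * (P_of \<psi>1 + (2 * \<kappa> - \<delta>) / 2 * P_of \<psi>2)"

definition rate :: "nat \<Rightarrow> real \<Rightarrow> real" where
  "rate n t = (if n = 1 then t powr (1/2)
               else if n = 2 then (ln t) powr (1/2)
               else t powr (1/2 - real n / 4))"

end

theory Submission
  imports Defs "HOL-Probability.Probability" "HOL-Real_Asymp.Real_Asymp"
begin

text \<open>By Plancherel everything is an estimate of the symbols. At frequency \<open>r = |\<xi>|\<close> the
  solution is a combination of \<open>exp (- \<sigma> t)\<close>, \<open>\<sigma> \<approx> \<kappa> r\<^sup>2\<close>, and of an oscillation of frequency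
  \<open>r + d r\<^sup>3 + \<dots>\<close> damped like \<open>exp (- \<delta> r\<^sup>2 t / 2)\<close>. For small \<open>r\<close> the phase correction \<open>d r\<^sup>3 t\<close>
  gives the term \<open>H\<^sub>0\<close>, and what remains is bounded by \<open>min t (1 / r) exp (- c r\<^sup>2 t)\<close> times the size
  of the data errors; the \<open>L\<^sup>2\<close> norm of that weight is of the order of the rate. For large \<open>r\<close> an energy
  functional gives exponential decay. The symbol of \<open>\<psi>\<^sup>(\<^sup>2\<^sup>)\<close> has the real part
  \<open>sin (r t) / r (P\<^sub>2 r\<^sup>2 t + P\<^sub>\<Psi>) exp (- \<delta> r\<^sup>2 t / 2)\<close> and an odd imaginary part containing \<open>M\<close>, so the
  two contributions can be bounded from below separately, on suitable annuli.\<close>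

section \<open>Translations in L1 and Gaussians\<close>

text \<open>The obstacle is the factor 1/r^2 in the symbol of G_0. Near zero frequency it amplifies
  every error in the data, and only one power of r is regained, from the first moment of \<psi>_2.
  What remains is 1/r, capped at t because sin (r t) and 1 - cos (r t) are at most r t. Integrated
  against r^(n-1), the square of this weight gives t, ln t or t^(1 - n/2), the squared rate. The
  same 1/r^2 makes the phase error r^3 t visible at this order, whereas behind the amplitude 1/r of
  G_1 it is harmless. The dimension selects the annulus for the lower bounds. For n \<le> 2 it is
  1/t \<le> r \<le> t^(-3/4), where r^2 t tends to 0: the P_2 term fades and P_\<Psi> alone is seen.
  For n \<ge> 3 the mass sits at r of order t^(-1/2), where r^2 t is of order one and both numbers
  enter. As P_2 s + P_\<Psi> may vanish for some s, one of two windows of s is chosen that stays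
  away from the zero. This bounds the norm below by a multiple of |P_2| + |P_\<Psi>|, which
  dominates |2 \<delta> P_\<Psi> + n P_2|.\<close>

lemma integrable_lborel_translate:
  fixes f :: "'a::euclidean_space \<Rightarrow> 'b::{banach, second_countable_topology}"
  assumes "integrable lborel f"
  shows "integrable lborel (\<lambda>x. f (x + z))"
proof -
  have "integrable (distr lborel borel ((+) z)) f"
    using assms lborel_distr_plus[of z] by metis
  then have "integrable lborel (\<lambda>x. f (z + x))"
    by (subst (asm) integrable_distr_eq) (use assms in auto)
  then show ?thesis by (simp add: add.commute)
qed

lemma integral_lborel_translate:
  fixes f :: "'a::euclidean_space \<Rightarrow> 'b::{banach, second_countable_topology}"
  assumes "f \<in> borel_measurable borel"
  shows "(\<integral>x. f (x + z) \<partial>lborel) = (\<integral>x. f x \<partial>lborel)"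
proof -
  have "(\<integral>x. f x \<partial>lborel) = (\<integral>x. f x \<partial>distr lborel borel ((+) z))"
    using lborel_distr_plus[of z] by metis
  also have "\<dots> = (\<integral>x. f (z + x) \<partial>lborel)"
    by (subst integral_distr) (use assms in auto)
  finally show ?thesis by (simp add: add.commute)
qed

text \<open>For an open set the indicator is lower semicontinuous, so only the decrease has to be
  controlled; translation invariance of the measure turns that into control of the variation.\<close>

lemma tendsto_translate_indicator_open:
  fixes U :: "'a::euclidean_space set" and z :: "nat \<Rightarrow> 'a"
  assumes U: "open U" "emeasure lborel U < \<infinity>" and z: "z \<longlonglongrightarrow> 0"
  shows "(\<lambda>k. \<integral>x. \<bar>indicator U (x + z k) - indicator U x :: real\<bar> \<partial>lborel) \<longlonglongrightarrow> 0"
proof -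
  let ?I = "indicator U :: 'a \<Rightarrow> real"
  have [measurable]: "U \<in> sets borel" using U by auto
  have int: "integrable lborel ?I" using U by auto
  have intz: "integrable lborel (\<lambda>x. ?I (x + z k))" for k
    by (rule integrable_lborel_translate[OF int])
  let ?d = "\<lambda>k x. max 0 (?I x - ?I (x + z k))"
  have intd: "integrable lborel (?d k)" for k
    by (intro integrable_max Bochner_Integration.integrable_diff int intz) auto
  have lim: "(\<lambda>k. \<integral>x. ?d k x \<partial>lborel) \<longlonglongrightarrow> (\<integral>x. 0 \<partial>(lborel :: 'a measure))"
  proof (rule integral_dominated_convergence[where w = ?I])
    show "AE x in lborel. (\<lambda>k. ?d k x) \<longlonglongrightarrow> 0"
    proof (rule AE_I2)
      fix x :: 'a
      have "eventually (\<lambda>k. ?d k x = 0) sequentially"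
      proof (cases "x \<in> U")
        case True
        have "(\<lambda>k. x + z k) \<longlonglongrightarrow> x" using tendsto_add[OF tendsto_const z] by simp
        then have "eventually (\<lambda>k. x + z k \<in> U) sequentially"
          using U(1) True topological_tendstoD by blast
        then show ?thesis by eventually_elim (use True in simp)
      qed (simp add: indicator_def)
      then show "(\<lambda>k. ?d k x) \<longlonglongrightarrow> 0" by (rule tendsto_eventually)
    qed
    show "AE x in lborel. norm (?d k x) \<le> ?I x" for k
      by (rule AE_I2) (auto simp: indicator_def)
  qed (use int in auto)
  have "(\<integral>x. \<bar>?I (x + z k) - ?I x\<bar> \<partial>lborel) = 2 * (\<integral>x. ?d k x \<partial>lborel)" for k
  proof -
    have "(\<integral>x. \<bar>?I (x + z k) - ?I x\<bar> \<partial>lborel)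
        = (\<integral>x. 2 * ?d k x + (?I (x + z k) - ?I x) \<partial>lborel)"
      by (rule Bochner_Integration.integral_cong) (auto simp: indicator_def)
    also have "\<dots> = 2 * (\<integral>x. ?d k x \<partial>lborel) + ((\<integral>x. ?I (x + z k) \<partial>lborel) - (\<integral>x. ?I x \<partial>lborel))"
      using int intz intd by (subst Bochner_Integration.integral_add) auto
    also have "(\<integral>x. ?I (x + z k) \<partial>lborel) = (\<integral>x. ?I x \<partial>lborel)"
      by (rule integral_lborel_translate) simp
    finally show ?thesis by simp
  qed
  then show ?thesis using tendsto_mult_right[OF lim, of 2] by simp
qed

text \<open>Induction over integrable functions. For an indicator, outer regularity supplies an open
  superset, and passing to it costs twice the measure of the difference set. For a limit, three
  terms are estimated, and translation invariance makes the two approximation errors equal.\<close>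

lemma tendsto_translate_L1:
  fixes f :: "'a::euclidean_space \<Rightarrow> real" and z :: "nat \<Rightarrow> 'a"
  assumes f: "integrable lborel f" and z: "z \<longlonglongrightarrow> 0"
  shows "(\<lambda>k. \<integral>x. \<bar>f (x + z k) - f x\<bar> \<partial>lborel) \<longlonglongrightarrow> 0"
  using f
proof (induction rule: integrable_induct)
  case (base A c)
  then have [measurable]: "A \<in> sets borel" by simp
  let ?v = "\<lambda>A k. \<integral>x. \<bar>indicator A (x + z k) - indicator A x :: real\<bar> \<partial>lborel"
  have "?v A \<longlonglongrightarrow> 0"
  proof (rule LIMSEQ_I)
    fix e :: real assume e: "e > 0"
    obtain U where U: "open U" "A \<subseteq> U" "emeasure lborel (U - A) < e / 4"
      using outer_regular_lborel[of A "e/4"] e \<open>A \<in> sets borel\<close> by auto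
    have [measurable]: "U \<in> sets borel" using U by auto
    have "emeasure lborel U = emeasure lborel A + emeasure lborel (U - A)"
      using U(2) plus_emeasure[of A lborel "U - A"] by (auto simp: Un_absorb1)
    then have finU: "emeasure lborel U < \<infinity>" using base(2) U(3)
      by (metis ennreal_add_less_top ennreal_less_top infinity_ennreal_def order_less_trans)
    have finD: "emeasure lborel (U - A) < \<infinity>"
      using U(3) by (metis ennreal_less_top infinity_ennreal_def order_less_trans)
    have D: "(\<integral>x. indicator (U - A) x \<partial>lborel) \<le> e / 4"
    proof -
      have "measure lborel (U - A) \<le> e / 4"
        unfolding measure_def using U(3) e by (intro enn2real_leI) auto
      then show ?thesis by simp
    qed
    have iU: "integrable lborel (indicator U :: 'a \<Rightarrow> real)"
      and iA: "integrable lborel (indicator A :: 'a \<Rightarrow> real)"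
      and iD: "integrable lborel (indicator (U - A) :: 'a \<Rightarrow> real)"
      using finU finD base by auto
    note tr = integrable_lborel_translate
    obtain N where N: "\<And>k. k \<ge> N \<Longrightarrow> ?v U k < e / 4"
      using LIMSEQ_D[OF tendsto_translate_indicator_open[OF U(1) finU z], of "e/4"] e by auto
    show "\<exists>N. \<forall>k\<ge>N. norm (?v A k - 0) < e"
    proof (intro exI allI impI)
      fix k assume k: "k \<ge> N"
      have "?v A k \<le> (\<integral>x. \<bar>indicator U (x + z k) - indicator U x\<bar> + indicator (U - A) (x + z k)
           + indicator (U - A) x \<partial>lborel)"
        using U(2) by (intro integral_mono Bochner_Integration.integrable_add integrable_abs
          Bochner_Integration.integrable_diff iU iA iD tr) (auto simp: indicator_def)
      also have "\<dots> = ?v U k + (\<integral>x. indicator (U - A) (x + z k) \<partial>lborel) + (\<integral>x. indicator (U - A) x \<partial>lborel)"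
        using iU iD tr[OF iU] tr[OF iD] by (subst Bochner_Integration.integral_add; (subst Bochner_Integration.integral_add)?)
          (auto intro!: Bochner_Integration.integrable_diff integrable_abs)
      also have "(\<integral>x. indicator (U - A) (x + z k) \<partial>lborel) = (\<integral>x. indicator (U - A) x \<partial>lborel :: real)"
        by (rule integral_lborel_translate) simp
      finally have "?v A k \<le> ?v U k + 2 * (e / 4)" using D by linarith
      moreover have "0 \<le> ?v A k" by (rule integral_nonneg_AE) simp
      ultimately show "norm (?v A k - 0) < e" using N[OF k] e by (simp add: field_simps)
    qed
  qed
  then have "(\<lambda>k. ?v A k * \<bar>c\<bar>) \<longlonglongrightarrow> 0" by (rule tendsto_mult_left_zero)
  moreover have "?v A k * \<bar>c\<bar> = (\<integral>x. \<bar>indicator A (x + z k) *\<^sub>R c - indicator A x *\<^sub>R c\<bar> \<partial>lborel)" for k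
    by (subst integral_mult_left_zero[symmetric]) (simp add: left_diff_distrib[symmetric] abs_mult)
  ultimately show ?case by simp
next
  case (add f g)
  have [measurable]: "f \<in> borel_measurable borel" "g \<in> borel_measurable borel" using add by auto
  note tr = integrable_lborel_translate
  show ?case
  proof (rule tendsto_sandwich[OF _ _ tendsto_const tendsto_add_zero[OF add.IH]])
    show "\<forall>\<^sub>F k in sequentially. (\<integral>x. \<bar>f (x + z k) + g (x + z k) - (f x + g x)\<bar> \<partial>lborel)
      \<le> (\<integral>x. \<bar>f (x + z k) - f x\<bar> \<partial>lborel) + (\<integral>x. \<bar>g (x + z k) - g x\<bar> \<partial>lborel)"
    proof (intro always_eventually allI)
      fix k
      have "(\<integral>x. \<bar>f (x + z k) + g (x + z k) - (f x + g x)\<bar> \<partial>lborel)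
        \<le> (\<integral>x. \<bar>f (x + z k) - f x\<bar> + \<bar>g (x + z k) - g x\<bar> \<partial>lborel)"
        using tr[OF add.hyps(1)] tr[OF add.hyps(2)] add.hyps by (intro integral_mono) auto
      also have "\<dots> = (\<integral>x. \<bar>f (x + z k) - f x\<bar> \<partial>lborel) + (\<integral>x. \<bar>g (x + z k) - g x\<bar> \<partial>lborel)"
        using tr[OF add.hyps(1)] tr[OF add.hyps(2)] add.hyps
        by (intro Bochner_Integration.integral_add integrable_abs Bochner_Integration.integrable_diff)
      finally show "(\<integral>x. \<bar>f (x + z k) + g (x + z k) - (f x + g x)\<bar> \<partial>lborel)
        \<le> (\<integral>x. \<bar>f (x + z k) - f x\<bar> \<partial>lborel) + (\<integral>x. \<bar>g (x + z k) - g x\<bar> \<partial>lborel)" .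
    qed
  qed (auto intro!: always_eventually integral_nonneg_AE)
next
  case (lim f s)
  have [measurable]: "f \<in> borel_measurable borel" "\<And>i. s i \<in> borel_measurable borel" using lim by auto
  note tr = integrable_lborel_translate
  have 1: "(\<lambda>i. \<integral>x. \<bar>s i x - f x\<bar> \<partial>lborel) \<longlonglongrightarrow> (\<integral>x. 0 \<partial>(lborel :: 'a measure))"
  \<comment> \<open>The approximants satisfy |s i| \<le> 2 |f|, hence the majorant 3 |f|.\<close>
  proof (rule integral_dominated_convergence[where w = "\<lambda>x. 3 * \<bar>f x\<bar>"])
    show "AE x in lborel. (\<lambda>i. \<bar>s i x - f x\<bar>) \<longlonglongrightarrow> 0"
      using lim.hyps(2) by (auto intro!: tendsto_rabs_zero simp: LIM_zero)
    show "AE x in lborel. norm \<bar>s i x - f x\<bar> \<le> 3 * \<bar>f x\<bar>" for i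
    proof (rule AE_I2)
      fix x :: 'a
      have "norm (s i x) \<le> 2 * norm (f x)" using lim.hyps(3) by simp
      then show "norm \<bar>s i x - f x\<bar> \<le> 3 * \<bar>f x\<bar>" by simp
    qed
  qed (use lim in auto)
  show ?case
  proof (rule LIMSEQ_I)
    fix e :: real assume e: "e > 0"
    have "\<exists>N. \<forall>i\<ge>N. norm ((\<integral>x. \<bar>s i x - f x\<bar> \<partial>lborel) - 0) < e / 4"
      using LIMSEQ_D[OF 1, of "e/4"] e by simp
    then obtain i where i: "(\<integral>x. \<bar>s i x - f x\<bar> \<partial>lborel) < e / 4"
      by auto
    obtain N where N: "\<And>k. k \<ge> N \<Longrightarrow> (\<integral>x. \<bar>s i (x + z k) - s i x\<bar> \<partial>lborel) < e / 4"
      using LIMSEQ_D[OF lim.IH[of i], of "e/4"] e by auto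
    show "\<exists>N. \<forall>k\<ge>N. norm ((\<integral>x. \<bar>f (x + z k) - f x\<bar> \<partial>lborel) - 0) < e"
    proof (intro exI allI impI)
      fix k assume k: "k \<ge> N"
      have "(\<integral>x. \<bar>f (x + z k) - f x\<bar> \<partial>lborel)
         \<le> (\<integral>x. \<bar>s i (x + z k) - f (x + z k)\<bar> + \<bar>s i (x + z k) - s i x\<bar> + \<bar>s i x - f x\<bar> \<partial>lborel)"
        using tr[OF lim.hyps(4)] tr[OF lim.hyps(1)[of i]] lim.hyps
        by (intro integral_mono) auto
      also have "\<dots> = (\<integral>x. \<bar>s i (x + z k) - f (x + z k)\<bar> \<partial>lborel) + (\<integral>x. \<bar>s i (x + z k) - s i x\<bar> \<partial>lborel)
          + (\<integral>x. \<bar>s i x - f x\<bar> \<partial>lborel)"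
        using tr[OF lim.hyps(4)] tr[OF lim.hyps(1)[of i]] lim.hyps by simp
      also have "(\<integral>x. \<bar>s i (x + z k) - f (x + z k)\<bar> \<partial>lborel) = (\<integral>x. \<bar>s i x - f x\<bar> \<partial>lborel)"
        by (rule integral_lborel_translate[where f = "\<lambda>x. \<bar>s i x - f x\<bar>"]) simp
      finally have "(\<integral>x. \<bar>f (x + z k) - f x\<bar> \<partial>lborel) < e" using i N[OF k] e by simp
      moreover have "0 \<le> (\<integral>x. \<bar>f (x + z k) - f x\<bar> \<partial>lborel)" by (rule integral_nonneg_AE) simp
      ultimately show "norm ((\<integral>x. \<bar>f (x + z k) - f x\<bar> \<partial>lborel) - 0) < e" by simp
    qed
  qed
qed

section \<open>Fourier transforms of Gaussians\<close>

lemma gaussian_fourier_real: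
  fixes a e :: real assumes e: "e > 0"
  shows "integrable lborel (\<lambda>s. iexp (a * s) * complex_of_real (exp (- (e\<^sup>2 * s\<^sup>2) / 2)))" (is ?I)
    and "(\<integral>s. iexp (a * s) * complex_of_real (exp (- (e\<^sup>2 * s\<^sup>2) / 2)) \<partial>lborel)
       = complex_of_real (sqrt (2 * pi) / e * exp (- (a / e)\<^sup>2 / 2))" (is ?E)
proof -
  let ?g = "\<lambda>s::real. iexp (a / e * s) * complex_of_real (exp (- s\<^sup>2 / 2))"
  \<comment> \<open>The characteristic function of the standard normal law is the transform for unit
    width; the substitution s -> e s then yields width 1/e.\<close>
  have "(\<integral>s. std_normal_density s *\<^sub>R iexp (a / e * s) \<partial>lborel) = complex_of_real (exp (- (a / e)\<^sup>2 / 2))"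
    using fun_cong[OF char_std_normal_distribution, of "a/e"]
    unfolding char_def std_normal_density_def
    by (subst (asm) integral_density) (auto simp: std_normal_density_def)
  then have "complex_of_real (1 / sqrt (2 * pi)) * (\<integral>s. ?g s \<partial>lborel) = complex_of_real (exp (- (a / e)\<^sup>2 / 2))"
    by (subst integral_mult_right_zero[symmetric]) (simp add: std_normal_density_def scaleR_conv_of_real mult_ac)
  then have E: "(\<integral>s. ?g s \<partial>lborel) = complex_of_real (sqrt (2 * pi) * exp (- (a / e)\<^sup>2 / 2))"
    by (simp add: field_simps)
  have i: "integrable lborel (\<lambda>s::real. exp (- s\<^sup>2 / 2))"
    using integrable_mult_right[OF integrable_normal_density[of 1 0], of "sqrt (2*pi)"]
    by (simp add: std_normal_density_def)
  have I: "integrable lborel ?g"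
    by (rule Bochner_Integration.integrable_bound[OF i]) (auto simp: norm_mult)
  have *: "?g (0 + e * s) = iexp (a * s) * complex_of_real (exp (- (e\<^sup>2 * s\<^sup>2) / 2))" for s
    using e by (simp add: power_mult_distrib)
  show ?I using lborel_integrable_real_affine[OF I, of e 0] e unfolding * by simp
  show ?E using lborel_integral_real_affine[of e ?g 0] e unfolding * E
    by (simp add: scaleR_conv_of_real field_simps)
qed

text \<open>Up to the identification of a vector with its coordinates, Lebesgue measure is a product
  measure, so Fubini acts factor by factor. This carries the one-dimensional Gaussian to the whole
  space.\<close>

lemma
  fixes f :: "'a::euclidean_space \<Rightarrow> real \<Rightarrow> complex"
  assumes f: "\<And>b. b \<in> Basis \<Longrightarrow> integrable lborel (f b)"
  shows integrable_lborel_prod: "integrable lborel (\<lambda>x::'a. \<Prod>b\<in>Basis. f b (x \<bullet> b))"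
    and integral_lborel_prod: "(\<integral>x. (\<Prod>b\<in>Basis. f b (x \<bullet> b)) \<partial>(lborel :: 'a measure)) = (\<Prod>b\<in>Basis. \<integral>x. f b x \<partial>lborel)"
proof -
  interpret product_sigma_finite "\<lambda>b::'a. lborel :: real measure" ..
  have [measurable]: "b \<in> Basis \<Longrightarrow> f b \<in> borel_measurable borel" for b using f[of b] by auto
  have *: "(\<Prod>b\<in>Basis. f b ((\<Sum>b\<in>Basis. g b *\<^sub>R b) \<bullet> b)) = (\<Prod>b\<in>Basis. f b (g b))" for g :: "'a \<Rightarrow> real"
    by (rule prod.cong) auto
  have m: "(\<lambda>x::'a. \<Prod>b\<in>Basis. f b (x \<bullet> b)) \<in> borel_measurable borel" by measurable
  have m2: "(\<lambda>f. \<Sum>b\<in>Basis. f b *\<^sub>R b) \<in> measurable (\<Pi>\<^sub>M b\<in>Basis. lborel) (borel :: 'a measure)"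
    by measurable
  show "integrable lborel (\<lambda>x::'a. \<Prod>b\<in>Basis. f b (x \<bullet> b))"
    unfolding lborel_eq[where 'a='a] using product_integrable_prod[OF finite_Basis f]
    by (subst integrable_distr_eq[OF m2 m]) (simp add: *)
  show "(\<integral>x. (\<Prod>b\<in>Basis. f b (x \<bullet> b)) \<partial>(lborel :: 'a measure)) = (\<Prod>b\<in>Basis. \<integral>x. f b x \<partial>lborel)"
    unfolding lborel_eq[where 'a='a] using product_integral_prod[OF finite_Basis f]
    by (subst integral_distr[OF m2 m]) (simp add: *)
qed

lemma gaussian_fourier:
  fixes z :: "'a::euclidean_space" and e :: real assumes e: "e > 0"
  shows "integrable lborel (\<lambda>x::'a. iexp (z \<bullet> x) * complex_of_real (exp (- (e\<^sup>2 * (norm x)\<^sup>2) / 2)))" (is ?I)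
    and "(\<integral>x. iexp (z \<bullet> x) * complex_of_real (exp (- (e\<^sup>2 * (norm x)\<^sup>2) / 2)) \<partial>lborel)
       = complex_of_real ((sqrt (2 * pi) / e) ^ DIM('a) * exp (- (norm z / e)\<^sup>2 / 2))" (is ?E)
proof -
  have n2: "(norm x)\<^sup>2 = (\<Sum>b\<in>Basis. (x \<bullet> b)\<^sup>2)" for x :: 'a
    by (subst euclidean_inner[of x x, unfolded power2_norm_eq_inner[symmetric]]) (simp add: power2_eq_square)
  have *: "iexp (z \<bullet> x) * complex_of_real (exp (- (e\<^sup>2 * (norm x)\<^sup>2) / 2)) =
     (\<Prod>b\<in>Basis. iexp ((z \<bullet> b) * (x \<bullet> b)) * complex_of_real (exp (- (e\<^sup>2 * (x \<bullet> b)\<^sup>2) / 2)))" for x :: 'a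
  proof -
    have "z \<bullet> x = (\<Sum>b\<in>Basis. (z \<bullet> b) * (x \<bullet> b))" by (rule euclidean_inner)
    then have "iexp (z \<bullet> x) = (\<Prod>b\<in>Basis. iexp ((z \<bullet> b) * (x \<bullet> b)))"
      by (simp add: exp_sum[symmetric] sum_distrib_left)
    moreover have "exp (- (e\<^sup>2 * (norm x)\<^sup>2) / 2) = (\<Prod>b\<in>Basis. exp (- (e\<^sup>2 * (x \<bullet> b)\<^sup>2) / 2))"
      by (simp add: exp_sum[symmetric] n2 sum_distrib_left sum_negf sum_divide_distrib)
    ultimately show ?thesis by (simp add: prod.distrib)
  qed
  show ?I unfolding * by (rule integrable_lborel_prod) (rule gaussian_fourier_real[OF e])
  have "(\<integral>x. iexp (z \<bullet> x) * complex_of_real (exp (- (e\<^sup>2 * (norm x)\<^sup>2) / 2)) \<partial>lborel)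
     = (\<Prod>b\<in>(Basis::'a set). complex_of_real (sqrt (2 * pi) / e * exp (- ((z \<bullet> b) / e)\<^sup>2 / 2)))"
    unfolding * by (subst integral_lborel_prod) (simp_all only: gaussian_fourier_real[OF e])
  also have "\<dots> = complex_of_real (\<Prod>b\<in>(Basis::'a set). sqrt (2 * pi) / e * exp (- ((z \<bullet> b) / e)\<^sup>2 / 2))"
    by simp
  also have "(\<Prod>b\<in>(Basis::'a set). sqrt (2 * pi) / e * exp (- ((z \<bullet> b) / e)\<^sup>2 / 2))
     = (sqrt (2 * pi) / e) ^ DIM('a) * exp (\<Sum>b\<in>Basis. - ((z \<bullet> b) / e)\<^sup>2 / 2)"
    unfolding prod.distrib by (simp add: exp_sum)
  also have "(\<Sum>b\<in>Basis. - ((z \<bullet> b) / e)\<^sup>2 / 2) = - (norm z / e)\<^sup>2 / 2"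
    by (simp add: n2 power_divide sum_negf sum_divide_distrib)
  finally show ?E .
qed

lemma gaussian_integrable:
  fixes c :: real assumes c: "c > 0"
  shows "integrable lborel (\<lambda>x::'a::euclidean_space. exp (- c * (norm x)\<^sup>2))"
proof -
  have "integrable lborel (\<lambda>x::'a. norm (iexp (0 \<bullet> x) * complex_of_real (exp (- ((sqrt (2 * c))\<^sup>2 * (norm x)\<^sup>2) / 2))))"
    by (rule integrable_norm[OF gaussian_fourier(1)]) (use c in simp)
  then show ?thesis using c by (simp add: norm_mult)
qed

section \<open>The Plancherel identity\<close>

lemma integral_lborel_scale:
  fixes f :: "'a::euclidean_space \<Rightarrow> 'b::{banach, second_countable_topology}"
  assumes c: "c > 0" and [measurable]: "f \<in> borel_measurable borel"
  shows "(\<integral>x. f (c *\<^sub>R x) \<partial>lborel) = (1 / c ^ DIM('a)) *\<^sub>R (\<integral>x. f x \<partial>lborel)"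
proof -
  have "(\<integral>x. f x \<partial>lborel) = c ^ DIM('a) *\<^sub>R (\<integral>x. f (c *\<^sub>R x) \<partial>lborel)"
    using c by (subst lborel_affine[of c 0]) (auto simp: integral_density integral_distr)
  then show ?thesis using c by simp
qed

lemma integrable_pair_mult:
  fixes f g :: "'a::euclidean_space \<Rightarrow> complex"
  assumes f: "integrable lborel f" and g: "integrable lborel g"
  shows "integrable (lborel \<Otimes>\<^sub>M lborel) (\<lambda>(x, y). f x * g y)"
proof -
  have [measurable]: "f \<in> borel_measurable borel" "g \<in> borel_measurable borel" using f g by auto
  show ?thesis
  proof (rule lborel_pair.Fubini_integrable)
    show "integrable lborel (\<lambda>x. \<integral>y. norm (case (x, y) of (x, y) \<Rightarrow> f x * g y) \<partial>lborel)"
      using f by (simp add: norm_mult)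
    show "AE x in lborel. integrable lborel (\<lambda>y. case (x, y) of (x, y) \<Rightarrow> f x * g y)"
      using g by simp
  qed measurable
qed

lemma L2_measurable: "L2 f \<Longrightarrow> f \<in> borel_measurable borel"
  by (simp add: L2_def)

lemma L2_integrable: "L2 f \<Longrightarrow> integrable lborel (\<lambda>x. (norm (f x))\<^sup>2)"
  by (simp add: L2_def)

text \<open>The signed square a |a| turns a square-integrable function into an integrable one, and
  this inequality lets continuity of translations in L1 imply continuity in L2. For equal signs it
  says (a - b)^2 \<le> 2 |a^2 - b^2|, for opposite signs (a - b)^2 \<le> 2 (a^2 + b^2).\<close>

lemma square_diff_le_signed_square:
  fixes a b :: real
  shows "(a - b)\<^sup>2 \<le> 2 * \<bar>a * \<bar>a\<bar> - b * \<bar>b\<bar>\<bar>"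
proof -
  have *: "(a - b)\<^sup>2 \<le> 2 * \<bar>a * \<bar>a\<bar> - b * \<bar>b\<bar>\<bar>" if "0 \<le> a" "b \<le> a" for a b :: real
  proof (cases "0 \<le> b")
    case True
    have "0 \<le> (a - b) * (a + 3 * b)" using that True by simp
    then have "(a - b)\<^sup>2 \<le> 2 * (a * a - b * b)" by (simp add: power2_eq_square algebra_simps)
    moreover have "b * b \<le> a * a" using that True by (intro mult_mono) auto
    ultimately show ?thesis using that True by simp
  next
    case False
    have "0 \<le> (a + b)\<^sup>2" by simp
    then have "(a - b)\<^sup>2 \<le> 2 * (a * a + b * b)" by (simp add: power2_eq_square algebra_simps)
    then show ?thesis using that False by (simp add: abs_if)
  qed
  have **: "(a - b)\<^sup>2 \<le> 2 * \<bar>a * \<bar>a\<bar> - b * \<bar>b\<bar>\<bar>" if "b \<le> a" for a b :: real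
  proof (cases "0 \<le> a")
    case False
    then show ?thesis using *[of "- b" "- a"] that by (simp add: power2_commute abs_minus_commute)
  qed (use * that in auto)
  show ?thesis using **[of a b] **[of b a]
    by (cases "b \<le> a") (auto simp: power2_commute abs_minus_commute)
qed

lemma tendsto_translate_L2:
  fixes g :: "real^'n \<Rightarrow> complex" and z :: "nat \<Rightarrow> real^'n"
  assumes g: "L2 g" and z: "z \<longlonglongrightarrow> 0"
  shows "(\<lambda>k. \<integral>x. (norm (g (x + z k) - g x))\<^sup>2 \<partial>lborel) \<longlonglongrightarrow> 0"
proof -
  have [measurable]: "g \<in> borel_measurable borel" using g by (rule L2_measurable)
  \<comment> \<open>\<open>s p\<close> is the signed square of the real or of the imaginary
    part.\<close>
  define s where "s p x = p (g x) * \<bar>p (g x)\<bar>" for p :: "complex \<Rightarrow> real" and x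
  have is2: "integrable lborel (s p)" if p: "p = Re \<or> p = Im" for p
  proof (rule Bochner_Integration.integrable_bound[OF L2_integrable[OF g]])
    show "s p \<in> borel_measurable lborel" unfolding s_def using p by auto
    show "AE x in lborel. norm (s p x) \<le> norm ((norm (g x))\<^sup>2)"
      unfolding s_def using p
      by (intro AE_I2) (auto simp: abs_mult power2_eq_square intro!: mult_mono abs_Re_le_cmod abs_Im_le_cmod
            simp del: abs_mult_self_eq)
  qed
  have lim: "(\<lambda>k. 2 * (\<integral>x. \<bar>s Re (x + z k) - s Re x\<bar> \<partial>lborel) + 2 * (\<integral>x. \<bar>s Im (x + z k) - s Im x\<bar> \<partial>lborel)) \<longlonglongrightarrow> 2 * 0 + 2 * 0"
    by (intro tendsto_intros tendsto_translate_L1 is2 z) auto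
  have iz: "integrable lborel (\<lambda>x. \<bar>s p (x + z k) - s p x\<bar>)" if p: "p = Re \<or> p = Im" for p k
    using integrable_lborel_translate[OF is2[OF p], of "z k"] is2[OF p] by auto
  show ?thesis
  proof (rule tendsto_sandwich[OF _ _ tendsto_const lim[simplified]])
    show "\<forall>\<^sub>F k in sequentially. (\<integral>x. (norm (g (x + z k) - g x))\<^sup>2 \<partial>lborel)
      \<le> 2 * (\<integral>x. \<bar>s Re (x + z k) - s Re x\<bar> \<partial>lborel) + 2 * (\<integral>x. \<bar>s Im (x + z k) - s Im x\<bar> \<partial>lborel)"
    proof (intro always_eventually allI)
      fix k
      have pt: "(norm (g (x + z k) - g x))\<^sup>2 \<le> 2 * \<bar>s Re (x + z k) - s Re x\<bar> + 2 * \<bar>s Im (x + z k) - s Im x\<bar>" for x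
        unfolding cmod_power2 s_def
        using square_diff_le_signed_square[of "Re (g (x + z k))" "Re (g x)"]
          square_diff_le_signed_square[of "Im (g (x + z k))" "Im (g x)"] by simp
      have "(\<integral>x. (norm (g (x + z k) - g x))\<^sup>2 \<partial>lborel)
        \<le> (\<integral>x. 2 * \<bar>s Re (x + z k) - s Re x\<bar> + 2 * \<bar>s Im (x + z k) - s Im x\<bar> \<partial>lborel)"
      proof (rule integral_mono_AE)
        show "integrable lborel (\<lambda>x. 2 * \<bar>s Re (x + z k) - s Re x\<bar> + 2 * \<bar>s Im (x + z k) - s Im x\<bar>)"
          using iz[of Re k] iz[of Im k] by auto
        then show "integrable lborel (\<lambda>x. (norm (g (x + z k) - g x))\<^sup>2)"
        proof (rule Bochner_Integration.integrable_bound)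
          show "AE x in lborel. norm ((norm (g (x + z k) - g x))\<^sup>2)
             \<le> norm (2 * \<bar>s Re (x + z k) - s Re x\<bar> + 2 * \<bar>s Im (x + z k) - s Im x\<bar>)"
            using pt by (intro AE_I2) (simp add: order_trans[OF pt])
        qed measurable
      qed (use pt in auto)
      also have "\<dots> = 2 * (\<integral>x. \<bar>s Re (x + z k) - s Re x\<bar> \<partial>lborel) + 2 * (\<integral>x. \<bar>s Im (x + z k) - s Im x\<bar> \<partial>lborel)"
        using iz[of Re k] iz[of Im k] by simp
      finally show "(\<integral>x. (norm (g (x + z k) - g x))\<^sup>2 \<partial>lborel)
        \<le> 2 * (\<integral>x. \<bar>s Re (x + z k) - s Re x\<bar> \<partial>lborel) + 2 * (\<integral>x. \<bar>s Im (x + z k) - s Im x\<bar> \<partial>lborel)" .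
    qed
  qed (auto intro!: always_eventually integral_nonneg_AE)
qed

lemma fourier_measurable [measurable]:
  assumes [measurable]: "g \<in> borel_measurable borel"
  shows "fourier g \<in> borel_measurable borel"
  unfolding fourier_def
  by (rule lborel.borel_measurable_lebesgue_integral) (auto intro!: borel_measurable_continuous_onI continuous_intros simp: split_beta)

lemma fourier_integrand_integrable:
  fixes g :: "real^'n \<Rightarrow> complex"
  assumes "integrable lborel g"
  shows "integrable lborel (\<lambda>x. exp (- \<i> * complex_of_real (x \<bullet> \<xi>)) * g x)"
proof (rule Bochner_Integration.integrable_bound[OF assms])
  show "(\<lambda>x. exp (- \<i> * complex_of_real (x \<bullet> \<xi>)) * g x) \<in> borel_measurable lborel"
    using assms by (auto intro!: borel_measurable_times borel_measurable_continuous_onI continuous_intros)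
qed (auto simp: norm_mult)

lemma cnj_measurable [measurable]: "cnj \<in> borel_measurable borel"
  by (intro borel_measurable_continuous_onI continuous_intros)

text \<open>The autocorrelation is what the exchange of integrals in Plancherel's identity produces.
  Polarisation writes its real part as the squared norm minus half the squared distance between g
  and its translate, so continuity of translations gives the limit at z = 0.\<close>

lemma autocorrelation_integrable:
  fixes g :: "real^'n \<Rightarrow> complex"
  assumes g: "L2 g"
  shows "integrable lborel (\<lambda>x. g x * cnj (g (x + z)))"
    and "(\<integral>x. norm (g x * cnj (g (x + z))) \<partial>lborel) \<le> (\<integral>x. (norm (g x))\<^sup>2 \<partial>lborel)"
    and "integrable lborel (\<lambda>x. (norm (g (x + z) - g x))\<^sup>2)"
    and "Re (\<integral>x. g x * cnj (g (x + z)) \<partial>lborel) =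
         (\<integral>x. (norm (g x))\<^sup>2 \<partial>lborel) - (\<integral>x. (norm (g (x + z) - g x))\<^sup>2 \<partial>lborel) / 2"
proof -
  have [measurable]: "g \<in> borel_measurable borel" using g by (rule L2_measurable)
  have i0: "integrable lborel (\<lambda>x. (norm (g x))\<^sup>2)" using g by (rule L2_integrable)
  have iz: "integrable lborel (\<lambda>x. (norm (g (x + z)))\<^sup>2)" using integrable_lborel_translate[OF i0] .
  have eqz: "(\<integral>x. (norm (g (x + z)))\<^sup>2 \<partial>lborel) = (\<integral>x. (norm (g x))\<^sup>2 \<partial>lborel)"
    by (rule integral_lborel_translate) simp
  have amgm: "norm (g x * cnj (g (x + z))) \<le> ((norm (g x))\<^sup>2 + (norm (g (x + z)))\<^sup>2) / 2" for x
    using sum_squares_bound[of "norm (g x)" "norm (g (x + z))"] by (simp add: norm_mult)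
  have is2: "integrable lborel (\<lambda>x. ((norm (g x))\<^sup>2 + (norm (g (x + z)))\<^sup>2) / 2)" using i0 iz by auto
  show i: "integrable lborel (\<lambda>x. g x * cnj (g (x + z)))"
    by (rule Bochner_Integration.integrable_bound[OF is2]) (use amgm in \<open>auto intro!: AE_I2 order_trans[OF amgm]\<close>)
  have "(\<integral>x. norm (g x * cnj (g (x + z))) \<partial>lborel) \<le> (\<integral>x. ((norm (g x))\<^sup>2 + (norm (g (x + z)))\<^sup>2) / 2 \<partial>lborel)"
    by (rule integral_mono[OF integrable_norm[OF i] is2 amgm])
  also have "\<dots> = (\<integral>x. (norm (g x))\<^sup>2 \<partial>lborel)" using i0 iz eqz by simp
  finally show "(\<integral>x. norm (g x * cnj (g (x + z))) \<partial>lborel) \<le> (\<integral>x. (norm (g x))\<^sup>2 \<partial>lborel)" .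
  define r where "r x = Re (g x * cnj (g (x + z)))" for x
  have ir: "integrable lborel r" and intr: "(\<integral>x. r x \<partial>lborel) = Re (\<integral>x. g x * cnj (g (x + z)) \<partial>lborel)"
    unfolding r_def by (rule integrable_Re[OF i]) (rule integral_Re[OF i])
  have pol: "(norm (g (x + z) - g x))\<^sup>2 = (norm (g x))\<^sup>2 + (norm (g (x + z)))\<^sup>2 - 2 * r x" for x
    unfolding cmod_power2 r_def by (simp add: power2_eq_square algebra_simps)
  show "integrable lborel (\<lambda>x. (norm (g (x + z) - g x))\<^sup>2)"
    unfolding pol using i0 iz ir by auto
  have "(\<integral>x. (norm (g (x + z) - g x))\<^sup>2 \<partial>lborel)
     = 2 * (\<integral>x. (norm (g x))\<^sup>2 \<partial>lborel) - 2 * Re (\<integral>x. g x * cnj (g (x + z)) \<partial>lborel)"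
    unfolding pol intr[symmetric] using i0 iz ir eqz by simp
  then show "Re (\<integral>x. g x * cnj (g (x + z)) \<partial>lborel) =
         (\<integral>x. (norm (g x))\<^sup>2 \<partial>lborel) - (\<integral>x. (norm (g (x + z) - g x))\<^sup>2 \<partial>lborel) / 2" by (simp add: diff_divide_distrib)
qed

lemma norm_fourier_le:
  fixes g :: "real^'n \<Rightarrow> complex"
  assumes "integrable lborel g"
  shows "norm (fourier g \<xi>) \<le> (\<integral>x. norm (g x) \<partial>lborel)"
proof -
  have "norm (fourier g \<xi>) \<le> (\<integral>x. norm (exp (- \<i> * complex_of_real (x \<bullet> \<xi>)) * g x) \<partial>lborel)"
    unfolding fourier_def by (rule integral_norm_bound)
  then show ?thesis by (simp add: norm_mult)
qed

text \<open>The Gaussian factor makes the triple integral over \<xi>, x and y absolutely convergent.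
  Integrating over \<xi> first turns it into a kernel concentrated near y = x, and y = x + z leaves
  an average of the autocorrelation.\<close>

lemma gaussian_regularised_norm:
  fixes g :: "real^'n \<Rightarrow> complex"
  assumes g1: "integrable lborel g" and g2: "L2 g" and e: "e > 0"
  defines "K \<equiv> \<lambda>z::real^'n. exp (- (norm z / e)\<^sup>2 / 2)"
  shows "complex_of_real (\<integral>\<xi>. (norm (fourier g \<xi>))\<^sup>2 * exp (- (e\<^sup>2 * (norm \<xi>)\<^sup>2) / 2) \<partial>lborel)
     = complex_of_real ((sqrt (2 * pi) / e) ^ CARD('n)) *
        (\<integral>z. complex_of_real (K z) * (\<integral>x. g x * cnj (g (x + z)) \<partial>lborel) \<partial>lborel)"
proof -
  have [measurable]: "g \<in> borel_measurable borel" using g1 by auto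
  let ?\<gamma> = "\<lambda>\<xi>::real^'n. exp (- (e\<^sup>2 * (norm \<xi>)\<^sup>2) / 2)"
  let ?E = "\<lambda>x \<xi>::real^'n. exp (- (\<i> * complex_of_real (x \<bullet> \<xi>)))"
  let ?C = "(sqrt (2 * pi) / e) ^ CARD('n)"
  let ?N = "\<integral>x. (norm (g x))\<^sup>2 \<partial>lborel"
  have i\<gamma>: "integrable lborel ?\<gamma>" using gaussian_integrable[of "e\<^sup>2/2", where 'a="real^'n"] e by simp
  have gc: "integrable lborel (\<lambda>x. cnj (g x))" using g1 by simp
  \<comment> \<open>\<open>\<Phi>\<close> is the regularised |fourier g|^2 with both transforms
    written as integrals; integrating first over (x, y) or first over \<xi> gives the two
    sides.\<close>
  define \<Phi> where "\<Phi> \<xi> p = (case p of (x, y) \<Rightarrow> ?E x \<xi> * g x * cnj (?E y \<xi> * g y) * complex_of_real (?\<gamma> \<xi>))" for \<xi> p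
  have m\<Phi>[measurable]: "case_prod \<Phi> \<in> borel_measurable (lborel \<Otimes>\<^sub>M (lborel \<Otimes>\<^sub>M lborel))"
    unfolding \<Phi>_def by measurable
  have n\<Phi>: "norm (\<Phi> \<xi> p) = ?\<gamma> \<xi> * norm (case p of (x, y) \<Rightarrow> g x * cnj (g y))" for \<xi> p
    unfolding \<Phi>_def by (cases p) (simp add: norm_mult)
  interpret P: pair_sigma_finite "lborel :: (real^'n) measure" "lborel \<Otimes>\<^sub>M lborel :: ((real^'n) \<times> (real^'n)) measure"
    by (intro pair_sigma_finite.intro lborel.sigma_finite_measure_axioms)
       (metis lborel_prod lborel.sigma_finite_measure_axioms)
  have ig: "integrable (lborel \<Otimes>\<^sub>M lborel) (\<lambda>(x, y). g x * cnj (g y))"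
    by (rule integrable_pair_mult[OF g1 gc])
  have i\<Phi>1: "integrable (lborel \<Otimes>\<^sub>M lborel) (\<Phi> \<xi>)" for \<xi>
    by (rule Bochner_Integration.integrable_bound[OF integrable_mult_right[OF integrable_norm[OF ig], of "?\<gamma> \<xi>"]])
       (auto simp: n\<Phi>)
  have i\<Phi>: "integrable (lborel \<Otimes>\<^sub>M (lborel \<Otimes>\<^sub>M lborel)) (case_prod \<Phi>)"
  proof (rule P.Fubini_integrable)
    show "integrable lborel (\<lambda>\<xi>. \<integral>p. norm (case (\<xi>, p) of (\<xi>, p) \<Rightarrow> \<Phi> \<xi> p) \<partial>(lborel \<Otimes>\<^sub>M lborel))"
      using i\<gamma> by (simp add: n\<Phi>)
    show "AE \<xi> in lborel. integrable (lborel \<Otimes>\<^sub>M lborel) (\<lambda>p. case (\<xi>, p) of (\<xi>, p) \<Rightarrow> \<Phi> \<xi> p)"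
      using i\<Phi>1 by simp
  qed measurable
  have in1: "(\<integral>p. \<Phi> \<xi> p \<partial>(lborel \<Otimes>\<^sub>M lborel)) = complex_of_real ((norm (fourier g \<xi>))\<^sup>2 * ?\<gamma> \<xi>)" for \<xi>
  proof -
    have "(\<integral>p. \<Phi> \<xi> p \<partial>(lborel \<Otimes>\<^sub>M lborel)) = (\<integral>x. (\<integral>y. \<Phi> \<xi> (x, y) \<partial>lborel) \<partial>lborel)"
      using lborel_pair.integral_fst'[OF i\<Phi>1] by simp
    also have "\<dots> = (\<integral>x. ?E x \<xi> * g x * (cnj (fourier g \<xi>) * complex_of_real (?\<gamma> \<xi>)) \<partial>lborel)"
    proof (rule Bochner_Integration.integral_cong[OF refl])
      fix x
      have "(\<integral>y. \<Phi> \<xi> (x, y) \<partial>lborel) = (\<integral>y. (?E x \<xi> * g x * complex_of_real (?\<gamma> \<xi>)) * cnj (?E y \<xi> * g y) \<partial>lborel)"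
        unfolding \<Phi>_def by (rule Bochner_Integration.integral_cong) (simp_all add: mult_ac)
      also have "\<dots> = (?E x \<xi> * g x * complex_of_real (?\<gamma> \<xi>)) * (\<integral>y. cnj (?E y \<xi> * g y) \<partial>lborel)"
        by (rule integral_mult_right_zero)
      also have "(\<integral>y. cnj (?E y \<xi> * g y) \<partial>lborel) = cnj (fourier g \<xi>)"
        using integral_bounded_linear[OF bounded_linear_cnj fourier_integrand_integrable[OF g1, of \<xi>]]
        by (simp add: fourier_def)
      finally show "(\<integral>y. \<Phi> \<xi> (x, y) \<partial>lborel) = ?E x \<xi> * g x * (cnj (fourier g \<xi>) * complex_of_real (?\<gamma> \<xi>))" by (simp add: mult_ac)
    qed
    also have "\<dots> = fourier g \<xi> * (cnj (fourier g \<xi>) * complex_of_real (?\<gamma> \<xi>))"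
      by (subst integral_mult_left_zero) (simp add: fourier_def)
    also have "\<dots> = complex_of_real ((norm (fourier g \<xi>))\<^sup>2 * ?\<gamma> \<xi>)"
      by (simp only: mult.assoc[symmetric] of_real_mult complex_norm_square[symmetric] of_real_power)
    finally show ?thesis .
  qed
  have in2: "(\<integral>\<xi>. \<Phi> \<xi> (x, y) \<partial>lborel) = g x * cnj (g y) * complex_of_real (?C * K (y - x))" for x y
  proof -
    have "(\<integral>\<xi>. \<Phi> \<xi> (x, y) \<partial>lborel) = (\<integral>\<xi>. g x * cnj (g y) * (iexp ((y - x) \<bullet> \<xi>) * complex_of_real (?\<gamma> \<xi>)) \<partial>lborel)"
      by (rule Bochner_Integration.integral_cong)
         (simp_all add: \<Phi>_def exp_cnj inner_diff_left exp_diff exp_minus field_simps)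
    also have "\<dots> = g x * cnj (g y) * (\<integral>\<xi>. iexp ((y - x) \<bullet> \<xi>) * complex_of_real (?\<gamma> \<xi>) \<partial>lborel)"
      by simp
    finally show ?thesis using gaussian_fourier(2)[OF e, of "y - x"] by (simp add: K_def)
  qed
  have iK: "integrable lborel K"
    using gaussian_integrable[of "1/(2*e\<^sup>2)", where 'a="real^'n"] e unfolding K_def by (simp add: power_divide mult.commute)
  have [measurable]: "K \<in> borel_measurable borel" using iK by auto
  have nK: "K z \<ge> 0" for z by (simp add: K_def)
  \<comment> \<open>After y = x + z the integrals over x and z are exchanged once more; bounding the
    autocorrelation by the squared norm of g gives integrability in z.\<close>
  define \<Psi> where "\<Psi> z x = complex_of_real (?C * K z) * (g x * cnj (g (x + z)))" for z x
  have i\<Psi>: "integrable (lborel \<Otimes>\<^sub>M lborel) (case_prod \<Psi>)"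
  proof (rule lborel_pair.Fubini_integrable)
    show m[measurable]: "case_prod \<Psi> \<in> borel_measurable (lborel \<Otimes>\<^sub>M lborel)" unfolding \<Psi>_def by measurable
    have mm: "(\<lambda>z. \<integral>x. norm (case (z, x) of (z, x) \<Rightarrow> \<Psi> z x) \<partial>lborel) \<in> borel_measurable lborel"
      by (intro lborel.borel_measurable_lebesgue_integral) simp
    show "integrable lborel (\<lambda>z. \<integral>x. norm (case (z, x) of (z, x) \<Rightarrow> \<Psi> z x) \<partial>lborel)"
    proof (rule Bochner_Integration.integrable_bound[OF integrable_mult_left[OF iK, of "?C * ?N"] mm], rule AE_I2)
      fix z :: "real^'n"
      have "(\<integral>x. norm (\<Psi> z x) \<partial>lborel) = ?C * K z * (\<integral>x. norm (g x * cnj (g (x + z))) \<partial>lborel)"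
        using e nK by (simp add: \<Psi>_def norm_mult abs_mult norm_power norm_divide)
      also have "\<dots> \<le> ?C * K z * ?N"
        using e nK autocorrelation_integrable(2)[OF g2, of z] by (intro mult_left_mono) auto
      finally have "(\<integral>x. norm (\<Psi> z x) \<partial>lborel) \<le> K z * (?C * ?N)" by (simp add: mult_ac)
      moreover have "0 \<le> (\<integral>x. norm (\<Psi> z x) \<partial>lborel)" by (rule integral_nonneg_AE) simp
      ultimately show "norm (\<integral>x. norm (case (z, x) of (z, x) \<Rightarrow> \<Psi> z x) \<partial>lborel) \<le> norm (K z * (?C * ?N))"
        by simp
    qed
    show "AE z in lborel. integrable lborel (\<lambda>x. case (z, x) of (z, x) \<Rightarrow> \<Psi> z x)"
      unfolding \<Psi>_def using autocorrelation_integrable(1)[OF g2] by simp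
  qed
  have "complex_of_real (\<integral>\<xi>. (norm (fourier g \<xi>))\<^sup>2 * ?\<gamma> \<xi> \<partial>lborel)
      = (\<integral>\<xi>. (\<integral>p. \<Phi> \<xi> p \<partial>(lborel \<Otimes>\<^sub>M lborel)) \<partial>lborel)"
    unfolding in1 by (rule integral_complex_of_real[symmetric])
  also have "\<dots> = (\<integral>p. (\<integral>\<xi>. \<Phi> \<xi> p \<partial>lborel) \<partial>(lborel \<Otimes>\<^sub>M lborel))"
    by (rule P.Fubini_integral[OF i\<Phi>, symmetric])
  also have "\<dots> = (\<integral>p. (case p of (x, y) \<Rightarrow> g x * cnj (g y) * complex_of_real (?C * K (y - x))) \<partial>(lborel \<Otimes>\<^sub>M lborel))"
    by (rule Bochner_Integration.integral_cong) (auto simp: in2)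
  also have "\<dots> = (\<integral>x. (\<integral>y. g x * cnj (g y) * complex_of_real (?C * K (y - x)) \<partial>lborel) \<partial>lborel)"
  proof -
    have "integrable (lborel \<Otimes>\<^sub>M lborel) (\<lambda>p. \<integral>\<xi>. \<Phi> \<xi> p \<partial>lborel)"
      using P.integrable_snd[OF i\<Phi>] .
    then have "integrable (lborel \<Otimes>\<^sub>M lborel) (\<lambda>p. case p of (x, y) \<Rightarrow> g x * cnj (g y) * complex_of_real (?C * K (y - x)))"
      by (rule Bochner_Integration.integrable_cong[THEN iffD1, rotated -1]) (auto simp: in2)
    from lborel_pair.integral_fst'[OF this] show ?thesis by simp
  qed
  also have "\<dots> = (\<integral>x. (\<integral>z. \<Psi> z x \<partial>lborel) \<partial>lborel)"
  proof (rule Bochner_Integration.integral_cong[OF refl])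
    fix x
    have "(\<integral>y. g x * cnj (g y) * complex_of_real (?C * K (y - x)) \<partial>lborel)
       = (\<integral>z. g x * cnj (g (z + x)) * complex_of_real (?C * K (z + x - x)) \<partial>lborel)"
      by (rule integral_lborel_translate[symmetric]) measurable
    also have "\<dots> = (\<integral>z. \<Psi> z x \<partial>lborel)" by (simp add: \<Psi>_def add.commute mult_ac)
    finally show "(\<integral>y. g x * cnj (g y) * complex_of_real (?C * K (y - x)) \<partial>lborel) = (\<integral>z. \<Psi> z x \<partial>lborel)" .
  qed
  also have "\<dots> = (\<integral>z. (\<integral>x. \<Psi> z x \<partial>lborel) \<partial>lborel)"
    by (rule lborel_pair.Fubini_integral[OF i\<Psi>])
  also have "\<dots> = complex_of_real ?C * (\<integral>z. complex_of_real (K z) * (\<integral>x. g x * cnj (g (x + z)) \<partial>lborel) \<partial>lborel)"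
    by (simp add: \<Psi>_def mult.assoc del: of_real_power of_real_divide)
  finally show ?thesis .
qed

text \<open>The regularisation parameter tends to 0. On the side of g the rescaling z =
  \<open>e k\<close> w fixes the Gaussian, and dominated convergence applies since the
  autocorrelation tends to the squared norm. On the side of the transform the Gaussian factors
  increase to 1, so monotone convergence delivers integrability of |fourier g|^2 together with the
  value.\<close>

theorem plancherel:
  fixes g :: "real^'n \<Rightarrow> complex"
  assumes g1: "integrable lborel g" and g2: "L2 g"
  shows "integrable lborel (\<lambda>\<xi>. (norm (fourier g \<xi>))\<^sup>2)"
    and "(\<integral>\<xi>. (norm (fourier g \<xi>))\<^sup>2 \<partial>lborel) = (2 * pi) ^ CARD('n) * (\<integral>x. (norm (g x))\<^sup>2 \<partial>lborel)"
proof -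
  have [measurable]: "g \<in> borel_measurable borel" using g1 by auto
  let ?N = "\<integral>x. (norm (g x))\<^sup>2 \<partial>lborel"
  let ?S = "sqrt (2 * pi) ^ CARD('n)"
  define h where "h z = (\<integral>x. g x * cnj (g (x + z)) \<partial>lborel)" for z
  define D where "D z = (\<integral>x. (norm (g (x + z) - g x))\<^sup>2 \<partial>lborel)" for z
  have [measurable]: "h \<in> borel_measurable borel" unfolding h_def
    by (rule lborel.borel_measurable_lebesgue_integral) measurable
  have Reh: "Re (h z) = ?N - D z / 2" for z
    using autocorrelation_integrable(4)[OF g2, of z] by (simp add: h_def D_def)
  have hb: "norm (h z) \<le> ?N" for z
    unfolding h_def using integral_norm_bound[of lborel "\<lambda>x. g x * cnj (g (x + z))"]
      autocorrelation_integrable(2)[OF g2, of z] by linarith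
  define e where "e k = 1 / real (Suc k)" for k
  have e0: "e k > 0" for k by (simp add: e_def)
  have elim: "e \<longlonglongrightarrow> 0" unfolding e_def using LIMSEQ_inverse_real_of_nat by (simp add: inverse_eq_divide)
  let ?G = "\<lambda>z::real^'n. exp (- (norm z)\<^sup>2 / 2)"
  have iG: "integrable lborel ?G" using gaussian_integrable[of "1/2", where 'a="real^'n"] by simp
  have valG: "(\<integral>z. ?G z \<partial>lborel) = ?S"
  proof -
    have "complex_of_real (\<integral>z. ?G z \<partial>lborel) = complex_of_real ?S"
      using gaussian_fourier(2)[of 1 "0::real^'n"] by (simp add: integral_complex_of_real[symmetric] del: integral_complex_of_real of_real_power)
    then show ?thesis using of_real_eq_iff by blast
  qed
  have iGh: "integrable lborel (\<lambda>w. complex_of_real (?G w) * h (e k *\<^sub>R w))" for k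
  proof (rule Bochner_Integration.integrable_bound[OF integrable_mult_left[OF iG, of ?N]])
    show "AE w in lborel. norm (complex_of_real (?G w) * h (e k *\<^sub>R w)) \<le> norm (?G w * ?N)"
      using hb by (intro AE_I2) (auto simp: norm_mult intro!: mult_left_mono order_trans[OF hb])
  qed measurable
  define I where "I k = (\<integral>\<xi>. (norm (fourier g \<xi>))\<^sup>2 * exp (- ((e k)\<^sup>2 * (norm \<xi>)\<^sup>2) / 2) \<partial>lborel)" for k
  have Ieq: "I k = ?S * (\<integral>w. ?G w * Re (h (e k *\<^sub>R w)) \<partial>lborel)" for k
  proof -
    let ?K = "\<lambda>z::real^'n. exp (- (norm z / e k)\<^sup>2 / 2)"
    have "complex_of_real (I k) = complex_of_real ((sqrt (2 * pi) / e k) ^ CARD('n)) * (\<integral>z. complex_of_real (?K z) * h z \<partial>lborel)"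
      unfolding I_def h_def by (rule gaussian_regularised_norm[OF g1 g2 e0])
    also have "(\<integral>z. complex_of_real (?K z) * h z \<partial>lborel)
        = (e k ^ CARD('n)) *\<^sub>R (\<integral>w. complex_of_real (?K (e k *\<^sub>R w)) * h (e k *\<^sub>R w) \<partial>lborel)"
      using e0[of k] by (subst integral_lborel_scale[OF e0, where f = "\<lambda>z. complex_of_real (?K z) * h z"]) auto
    also have "(\<integral>w. complex_of_real (?K (e k *\<^sub>R w)) * h (e k *\<^sub>R w) \<partial>lborel) = (\<integral>w. complex_of_real (?G w) * h (e k *\<^sub>R w) \<partial>lborel)"
      using e0[of k] by simp
    finally have "complex_of_real (I k) = complex_of_real ?S * (\<integral>w. complex_of_real (?G w) * h (e k *\<^sub>R w) \<partial>lborel)"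
      using e0[of k] by (simp add: scaleR_conv_of_real power_divide)
    then have "I k = Re (complex_of_real ?S * (\<integral>w. complex_of_real (?G w) * h (e k *\<^sub>R w) \<partial>lborel))"
      by (metis Re_complex_of_real)
    also have "\<dots> = ?S * Re (\<integral>w. complex_of_real (?G w) * h (e k *\<^sub>R w) \<partial>lborel)"
      by (simp del: of_real_power)
    also have "Re (\<integral>w. complex_of_real (?G w) * h (e k *\<^sub>R w) \<partial>lborel) = (\<integral>w. ?G w * Re (h (e k *\<^sub>R w)) \<partial>lborel)"
      using integral_Re[OF iGh[of k]] by simp
    finally show ?thesis .
  qed
  have "(\<lambda>k. \<integral>w. ?G w * Re (h (e k *\<^sub>R w)) \<partial>lborel) \<longlonglongrightarrow> (\<integral>w. ?G w * ?N \<partial>lborel)"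
  proof (rule integral_dominated_convergence[where w = "\<lambda>w. ?G w * ?N"])
    show "AE w in lborel. (\<lambda>k. ?G w * Re (h (e k *\<^sub>R w))) \<longlonglongrightarrow> ?G w * ?N"
    proof (rule AE_I2)
      fix w :: "real^'n"
      have "(\<lambda>k. e k *\<^sub>R w) \<longlonglongrightarrow> 0" using tendsto_scaleR[OF elim tendsto_const[of w]] by simp
      then have "(\<lambda>k. D (e k *\<^sub>R w)) \<longlonglongrightarrow> 0" unfolding D_def by (rule tendsto_translate_L2[OF g2])
      then have "(\<lambda>k. ?G w * (?N - D (e k *\<^sub>R w) / 2)) \<longlonglongrightarrow> ?G w * (?N - 0 / 2)"
        by (intro tendsto_intros) auto
      then show "(\<lambda>k. ?G w * Re (h (e k *\<^sub>R w))) \<longlonglongrightarrow> ?G w * ?N" by (simp add: Reh)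
    qed
    show "AE w in lborel. norm (?G w * Re (h (e k *\<^sub>R w))) \<le> ?G w * ?N" for k
      using hb abs_Re_le_cmod by (intro AE_I2) (auto simp: abs_mult intro!: mult_left_mono order_trans[OF abs_Re_le_cmod hb])
  qed (use iG in auto)
  then have "(\<lambda>k. ?S * (\<integral>w. ?G w * Re (h (e k *\<^sub>R w)) \<partial>lborel)) \<longlonglongrightarrow> ?S * (?S * ?N)"
    using valG by (intro tendsto_intros) auto
  moreover have "?S * (?S * ?N) = (2 * pi) ^ CARD('n) * ?N"
    by (simp only: mult.assoc[symmetric] power_mult_distrib[symmetric]) simp
  ultimately have Ilim: "I \<longlonglongrightarrow> (2 * pi) ^ CARD('n) * ?N"
    unfolding Ieq[abs_def, symmetric] by metis
  let ?f = "\<lambda>k \<xi>. (norm (fourier g \<xi>))\<^sup>2 * exp (- ((e k)\<^sup>2 * (norm \<xi>)\<^sup>2) / 2)"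
  let ?B = "\<integral>x. norm (g x) \<partial>lborel"
  have "integrable lborel (\<lambda>\<xi>. (norm (fourier g \<xi>))\<^sup>2) \<and>
     (\<integral>\<xi>. (norm (fourier g \<xi>))\<^sup>2 \<partial>lborel) = (2 * pi) ^ CARD('n) * ?N"
  proof (rule conjI)
    have i: "integrable lborel (?f k)" for k
    proof (rule Bochner_Integration.integrable_bound)
      show "integrable lborel (\<lambda>\<xi>::real^'n. ?B\<^sup>2 * exp (- ((e k)\<^sup>2 * (norm \<xi>)\<^sup>2) / 2))"
        using gaussian_integrable[of "(e k)\<^sup>2/2", where 'a="real^'n"] e0[of k] by simp
      show "AE \<xi> in lborel. norm (?f k \<xi>) \<le> norm (?B\<^sup>2 * exp (- ((e k)\<^sup>2 * (norm \<xi>)\<^sup>2) / 2))"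
        using norm_fourier_le[OF g1] by (intro AE_I2) (auto intro!: mult_right_mono power_mono simp: abs_mult)
    qed measurable
    have mono: "AE \<xi> in lborel. mono (\<lambda>k. ?f k \<xi>)"
    proof (intro AE_I2 monoI mult_left_mono)
      fix \<xi> :: "real^'n" and j k :: nat assume "j \<le> k"
      then have "(e k)\<^sup>2 \<le> (e j)\<^sup>2" by (intro power_mono) (auto simp: e_def frac_le)
      then have "(e k)\<^sup>2 * (norm \<xi>)\<^sup>2 \<le> (e j)\<^sup>2 * (norm \<xi>)\<^sup>2" by (rule mult_right_mono) simp
      then show "exp (- ((e j)\<^sup>2 * (norm \<xi>)\<^sup>2) / 2) \<le> exp (- ((e k)\<^sup>2 * (norm \<xi>)\<^sup>2) / 2)" by simp
    qed simp
    have lim: "AE \<xi> in lborel. (\<lambda>k. ?f k \<xi>) \<longlonglongrightarrow> (norm (fourier g \<xi>))\<^sup>2"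
    proof (rule AE_I2)
      fix \<xi> :: "real^'n"
      have "(\<lambda>k. ?f k \<xi>) \<longlonglongrightarrow> (norm (fourier g \<xi>))\<^sup>2 * exp (- (0\<^sup>2 * (norm \<xi>)\<^sup>2) / 2)"
        by (intro tendsto_intros elim) simp
      then show "(\<lambda>k. ?f k \<xi>) \<longlonglongrightarrow> (norm (fourier g \<xi>))\<^sup>2" by simp
    qed
    show "integrable lborel (\<lambda>\<xi>. (norm (fourier g \<xi>))\<^sup>2)"
      by (rule integrable_monotone_convergence[OF i mono lim Ilim[unfolded I_def]]) simp
    show "(\<integral>\<xi>. (norm (fourier g \<xi>))\<^sup>2 \<partial>lborel) = (2 * pi) ^ CARD('n) * ?N"
      by (rule integral_monotone_convergence[OF i mono lim Ilim[unfolded I_def]]) simp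
  qed
  then show "integrable lborel (\<lambda>\<xi>. (norm (fourier g \<xi>))\<^sup>2)"
    and "(\<integral>\<xi>. (norm (fourier g \<xi>))\<^sup>2 \<partial>lborel) = (2 * pi) ^ CARD('n) * ?N" by auto
qed

section \<open>The Fourier transform on L2\<close>

lemma lborel_uminus:
  fixes f :: "'a::euclidean_space \<Rightarrow> 'b::{banach, second_countable_topology}"
  assumes [measurable]: "f \<in> borel_measurable borel"
  shows "(\<integral>x. f (- x) \<partial>lborel) = (\<integral>x. f x \<partial>lborel)"
    and "integrable lborel (\<lambda>x. f (- x)) \<longleftrightarrow> integrable lborel f"
proof -
  have d: "(lborel :: 'a measure) = distr lborel borel uminus"
    using lborel_affine[of "-1" "0::'a"] by (simp add: density_1)
  show "(\<integral>x. f (- x) \<partial>lborel) = (\<integral>x. f x \<partial>lborel)"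
    by (subst (2) d) (simp add: integral_distr)
  show "integrable lborel (\<lambda>x. f (- x)) \<longleftrightarrow> integrable lborel f"
    by (subst (2) d) (simp add: integrable_distr_eq)
qed

lemma L2norm_sq: "(L2norm f)\<^sup>2 = (\<integral>x. (norm (f x))\<^sup>2 \<partial>lborel)"
  unfolding L2norm_def by (simp add: integral_nonneg_AE)

lemma L2norm_nonneg [simp]: "0 \<le> L2norm f"
  unfolding L2norm_def by (simp add: integral_nonneg_AE)

lemma L2_of_real_iff:
  "L2 (\<lambda>x. complex_of_real (f x)) \<longleftrightarrow> L2 f" "L2norm (\<lambda>x. complex_of_real (f x)) = L2norm f"
proof -
  have "f \<in> borel_measurable borel \<longleftrightarrow> (\<lambda>x. complex_of_real (f x)) \<in> borel_measurable borel"
  proof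
    assume "(\<lambda>x. complex_of_real (f x)) \<in> borel_measurable borel"
    from measurable_compose[OF this borel_measurable_Re] show "f \<in> borel_measurable borel"
      by (simp only: Re_complex_of_real)
  qed measurable
  then show "L2 (\<lambda>x. complex_of_real (f x)) \<longleftrightarrow> L2 f" by (simp only: L2_def measurable_lborel2 norm_of_real real_norm_def)
qed (simp add: L2norm_def)

lemma L2_bound:
  fixes f :: "real^'n \<Rightarrow> complex"
  assumes "integrable lborel G" "f \<in> borel_measurable borel" "AE x in lborel. (norm (f x))\<^sup>2 \<le> G x"
  shows "L2 f" "(L2norm f)\<^sup>2 \<le> (\<integral>x. G x \<partial>lborel)"
proof -
  have i: "integrable lborel (\<lambda>x. (norm (f x))\<^sup>2)"
  proof (rule Bochner_Integration.integrable_bound[OF assms(1)])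
    show "AE x in lborel. norm ((norm (f x))\<^sup>2) \<le> norm (G x)"
      using assms(3) by eventually_elim (simp add: order_trans[OF _ abs_ge_self])
  qed (use assms(2) in measurable)
  then show "L2 f" using assms(2) by (simp add: L2_def)
  show "(L2norm f)\<^sup>2 \<le> (\<integral>x. G x \<partial>lborel)"
    unfolding L2norm_sq by (rule integral_mono_AE[OF i assms(1) assms(3)])
qed

text \<open>Young's inequality for the mixed term. The weight \<open>l\<close> is kept free so that
  Minkowski's inequality can be recovered by choosing it well.\<close>

lemma norm_add_sq_le:
  fixes a b :: "'a::real_normed_vector"
  assumes "l > 0"
  shows "(norm (a + b))\<^sup>2 \<le> (1 + l) * (norm a)\<^sup>2 + (1 + 1 / l) * (norm b)\<^sup>2"
proof -
  have "(norm (a + b))\<^sup>2 \<le> (norm a + norm b)\<^sup>2" by (intro power_mono norm_triangle_ineq) simp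
  moreover have "0 \<le> (l * norm a - norm b)\<^sup>2 / l" using assms by simp
  then have "2 * norm a * norm b \<le> l * (norm a)\<^sup>2 + 1 / l * (norm b)\<^sup>2"
    using assms by (simp add: power2_eq_square field_simps)
  ultimately show ?thesis by (simp add: power2_sum algebra_simps)
qed

lemma L2_add:
  fixes f g :: "real^'n \<Rightarrow> complex"
  assumes f: "L2 f" and g: "L2 g"
  shows "L2 (\<lambda>x. f x + g x)"
    and "L2norm (\<lambda>x. f x + g x) \<le> L2norm f + L2norm g"
proof -
  have [measurable]: "f \<in> borel_measurable borel" "g \<in> borel_measurable borel"
    using f g by (auto intro: L2_measurable)
  note i = L2_integrable[OF f] L2_integrable[OF g]
  have b: "L2 (\<lambda>x. f x + g x) \<and> (L2norm (\<lambda>x. f x + g x))\<^sup>2 \<le> (1 + l) * (L2norm f)\<^sup>2 + (1 + 1 / l) * (L2norm g)\<^sup>2"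
    if "l > 0" for l
    using L2_bound[of "\<lambda>x. (1 + l) * (norm (f x))\<^sup>2 + (1 + 1 / l) * (norm (g x))\<^sup>2" "\<lambda>x. f x + g x"]
      norm_add_sq_le[OF that] i unfolding L2norm_sq by auto
  show "L2 (\<lambda>x. f x + g x)" using b[of 1] by simp
  show "L2norm (\<lambda>x. f x + g x) \<le> L2norm f + L2norm g"
  proof (rule field_le_epsilon)
    fix e :: real assume e: "e > 0"
    \<comment> \<open>The ratio q / p is the optimal weight; the summands e / 2 keep p and q
      positive when a norm vanishes.\<close>
    define p q where "p = L2norm f + e / 2" and "q = L2norm g + e / 2"
    have pq: "p > 0" "q > 0" "L2norm f \<le> p" "L2norm g \<le> q"
      using e L2norm_nonneg[of f] L2norm_nonneg[of g] unfolding p_def q_def by linarith+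
    have "(L2norm (\<lambda>x. f x + g x))\<^sup>2 \<le> (1 + q / p) * (L2norm f)\<^sup>2 + (1 + 1 / (q / p)) * (L2norm g)\<^sup>2"
      using b[of "q / p"] pq by simp
    also have "\<dots> \<le> (1 + q / p) * p\<^sup>2 + (1 + 1 / (q / p)) * q\<^sup>2"
      using pq by (intro add_mono mult_left_mono power_mono) auto
    also have "\<dots> = (p + q)\<^sup>2" using pq by (simp add: power2_eq_square field_simps)
    finally have "L2norm (\<lambda>x. f x + g x) \<le> p + q" by (rule power2_le_imp_le) (use pq in simp)
    then show "L2norm (\<lambda>x. f x + g x) \<le> L2norm f + L2norm g + e" by (simp add: p_def q_def)
  qed
qed

lemma L2_cmult:
  fixes f :: "real^'n \<Rightarrow> complex"
  assumes "L2 f" shows "L2 (\<lambda>x. c * f x)" "L2norm (\<lambda>x. c * f x) = norm c * L2norm f"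
  using assms by (auto simp: L2_def L2norm_def norm_mult power_mult_distrib real_sqrt_mult)

lemma L2_diff:
  fixes f g :: "real^'n \<Rightarrow> complex"
  assumes f: "L2 f" and g: "L2 g"
  shows "L2 (\<lambda>x. f x - g x)" and "L2norm (\<lambda>x. f x - g x) \<le> L2norm f + L2norm g"
  using L2_add[OF f L2_cmult(1)[OF g, of "-1"]] L2_cmult(2)[OF g, of "-1"] by auto

lemma L2norm_tendsto:
  fixes g :: "nat \<Rightarrow> real^'n \<Rightarrow> complex"
  assumes g: "\<And>k. L2 (g k)" and f: "L2 f" and h: "L2 h"
    and lim: "(\<lambda>k. L2norm (\<lambda>x. g k x - f x)) \<longlonglongrightarrow> 0"
  shows "(\<lambda>k. L2norm (\<lambda>x. g k x - h x)) \<longlonglongrightarrow> L2norm (\<lambda>x. f x - h x)"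
proof (rule LIM_zero_cancel, rule Lim_null_comparison[OF _ lim], intro always_eventually allI)
  fix k
  have fg: "L2norm (\<lambda>x. f x - g k x) = L2norm (\<lambda>x. g k x - f x)"
    by (simp add: L2norm_def norm_minus_commute)
  have "L2norm (\<lambda>x. g k x - h x) \<le> L2norm (\<lambda>x. g k x - f x) + L2norm (\<lambda>x. f x - h x)"
    using L2_add(2)[OF L2_diff(1)[OF g f] L2_diff(1)[OF f h], of k] by simp
  moreover have "L2norm (\<lambda>x. f x - h x) \<le> L2norm (\<lambda>x. f x - g k x) + L2norm (\<lambda>x. g k x - h x)"
    using L2_add(2)[OF L2_diff(1)[OF f g] L2_diff(1)[OF g h], of k k] by simp
  ultimately show "norm (L2norm (\<lambda>x. g k x - h x) - L2norm (\<lambda>x. f x - h x)) \<le> L2norm (\<lambda>x. g k x - f x)"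
    using fg by simp
qed

lemma inv_fourier_eq:
  fixes F :: "real^'n \<Rightarrow> complex"
  shows "inv_fourier F x = complex_of_real (1 / (2 * pi) ^ CARD('n)) * fourier F (- x)"
  unfolding inv_fourier_def fourier_def by (simp add: inner_commute)

lemma inv_fourier_measurable [measurable]:
  assumes [measurable]: "F \<in> borel_measurable borel"
  shows "inv_fourier F \<in> borel_measurable borel"
  unfolding inv_fourier_eq[abs_def] by measurable

lemma
  fixes F :: "real^'n \<Rightarrow> complex"
  assumes F1: "integrable lborel F" and F2: "L2 F"
  shows inv_fourier_L2: "L2 (inv_fourier F)"
    and inv_fourier_L2norm: "(L2norm (inv_fourier F))\<^sup>2 = 1 / (2 * pi) ^ CARD('n) * (L2norm F)\<^sup>2"
proof -
  have [measurable]: "F \<in> borel_measurable borel" using F1 by auto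
  have eq: "(norm (inv_fourier F x))\<^sup>2 = (1 / (2 * pi) ^ CARD('n))\<^sup>2 * (norm (fourier F (- x)))\<^sup>2" for x
    unfolding inv_fourier_eq by (simp add: norm_mult power_mult_distrib norm_divide norm_power power_divide)
  have i: "integrable lborel (\<lambda>x. (norm (fourier F (- x)))\<^sup>2)"
    using plancherel(1)[OF F1 F2] lborel_uminus(2)[of "\<lambda>x. (norm (fourier F x))\<^sup>2"] by simp
  show "L2 (inv_fourier F)" unfolding L2_def using i eq by simp
  have "(\<integral>x. (norm (fourier F (- x)))\<^sup>2 \<partial>lborel) = (2 * pi) ^ CARD('n) * (L2norm F)\<^sup>2"
    using lborel_uminus(1)[of "\<lambda>x. (norm (fourier F x))\<^sup>2"] plancherel(2)[OF F1 F2] by (simp add: L2norm_sq)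
  then show "(L2norm (inv_fourier F))\<^sup>2 = 1 / (2 * pi) ^ CARD('n) * (L2norm F)\<^sup>2"
    unfolding L2norm_sq[of "inv_fourier F"] eq by (simp add: power2_eq_square)
qed

text \<open>Fubini applies because the exponential is bounded and both functions are integrable. The
  identity supplies the mixed term when the squared distance in \<open>L2_fourier_isometry\<close>
  is expanded.\<close>

lemma parseval_cross:
  fixes g F :: "real^'n \<Rightarrow> complex"
  assumes g: "integrable lborel g" and F: "integrable lborel F"
  shows "(\<integral>x. g x * cnj (inv_fourier F x) \<partial>lborel)
       = complex_of_real (1 / (2 * pi) ^ CARD('n)) * (\<integral>\<xi>. fourier g \<xi> * cnj (F \<xi>) \<partial>lborel)"
proof -
  have [measurable]: "g \<in> borel_measurable borel" "F \<in> borel_measurable borel" using g F by auto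
  let ?c = "complex_of_real (1 / (2 * pi) ^ CARD('n))"
  let ?E = "\<lambda>x \<xi>::real^'n. exp (- (\<i> * complex_of_real (x \<bullet> \<xi>)))"
  define \<Theta> where "\<Theta> x \<xi> = ?E x \<xi> * g x * cnj (F \<xi>)" for x \<xi>
  have cF: "integrable lborel (\<lambda>\<xi>. cnj (F \<xi>))" using F by simp
  have i: "integrable (lborel \<Otimes>\<^sub>M lborel) (case_prod \<Theta>)"
  proof (rule Bochner_Integration.integrable_bound[OF integrable_pair_mult[OF g cF]])
    show "case_prod \<Theta> \<in> borel_measurable (lborel \<Otimes>\<^sub>M lborel)" unfolding \<Theta>_def by measurable
    show "AE p in lborel \<Otimes>\<^sub>M lborel. norm (case_prod \<Theta> p) \<le> norm (case p of (x, y) \<Rightarrow> g x * cnj (F y))"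
    proof (rule AE_I2)
      fix p :: "(real^'n) \<times> (real^'n)"
      obtain x y where p: "p = (x, y)" by (cases p)
      show "norm (case_prod \<Theta> p) \<le> norm (case p of (x, y) \<Rightarrow> g x * cnj (F y))"
        unfolding p by (simp add: \<Theta>_def norm_mult)
    qed
  qed
  have 1: "g x * cnj (inv_fourier F x) = ?c * (\<integral>\<xi>. \<Theta> x \<xi> \<partial>lborel)" for x
  proof -
    have "cnj (fourier F (- x)) = (\<integral>\<xi>. cnj (exp (- (\<i> * complex_of_real (\<xi> \<bullet> (- x)))) * F \<xi>) \<partial>lborel)"
      by (simp only: fourier_def Bochner_Integration.integral_cnj mult_minus_left)
    then have "g x * cnj (fourier F (- x)) = (\<integral>\<xi>. g x * cnj (exp (- (\<i> * complex_of_real (\<xi> \<bullet> (- x)))) * F \<xi>) \<partial>lborel)"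
      by (simp only: integral_mult_right_zero)
    moreover have "\<Theta> x \<xi> = g x * cnj (exp (- (\<i> * complex_of_real (\<xi> \<bullet> (- x)))) * F \<xi>)" for \<xi>
      by (simp add: \<Theta>_def exp_cnj inner_commute mult_ac)
    ultimately have e: "(\<integral>\<xi>. \<Theta> x \<xi> \<partial>lborel) = g x * cnj (fourier F (- x))" by (simp only:)
    show ?thesis unfolding e inv_fourier_eq complex_cnj_mult complex_cnj_complex_of_real by (rule mult.left_commute)
  qed
  have 2: "(\<integral>x. \<Theta> x \<xi> \<partial>lborel) = fourier g \<xi> * cnj (F \<xi>)" for \<xi>
    unfolding \<Theta>_def fourier_def integral_mult_left_zero by simp
  have "(\<integral>x. g x * cnj (inv_fourier F x) \<partial>lborel) = ?c * (\<integral>x. (\<integral>\<xi>. \<Theta> x \<xi> \<partial>lborel) \<partial>lborel)"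
    by (simp only: 1 integral_mult_right_zero)
  also have "(\<integral>x. (\<integral>\<xi>. \<Theta> x \<xi> \<partial>lborel) \<partial>lborel) = (\<integral>\<xi>. (\<integral>x. \<Theta> x \<xi> \<partial>lborel) \<partial>lborel)"
    by (rule lborel_pair.Fubini_integral[OF i, symmetric])
  finally show ?thesis unfolding 2 .
qed

lemma L2norm_diff_sq:
  fixes f g :: "real^'n \<Rightarrow> complex"
  assumes f: "L2 f" and g: "L2 g"
  shows "(L2norm (\<lambda>x. f x - g x))\<^sup>2 = (L2norm f)\<^sup>2 + (L2norm g)\<^sup>2 - 2 * Re (\<integral>x. f x * cnj (g x) \<partial>lborel)"
proof -
  have [measurable]: "f \<in> borel_measurable borel" "g \<in> borel_measurable borel"
    using f g by (auto intro: L2_measurable)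
  note i = L2_integrable[OF f] L2_integrable[OF g]
  have ip: "integrable lborel (\<lambda>x. f x * cnj (g x))"
  proof (rule Bochner_Integration.integrable_bound[OF Bochner_Integration.integrable_add[OF i]])
    show "AE x in lborel. norm (f x * cnj (g x)) \<le> norm ((norm (f x))\<^sup>2 + (norm (g x))\<^sup>2)"
    proof (rule AE_I2)
      fix x
      have "2 * (norm (f x) * norm (g x)) \<le> (norm (f x))\<^sup>2 + (norm (g x))\<^sup>2"
        using sum_squares_bound[of "norm (f x)" "norm (g x)"] by (simp add: mult.assoc)
      moreover have "0 \<le> norm (f x) * norm (g x)" by simp
      ultimately have "norm (f x) * norm (g x) \<le> (norm (f x))\<^sup>2 + (norm (g x))\<^sup>2" by linarith
      then show "norm (f x * cnj (g x)) \<le> norm ((norm (f x))\<^sup>2 + (norm (g x))\<^sup>2)"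
        by (simp add: norm_mult)
    qed
  qed measurable
  define r where "r x = Re (f x * cnj (g x))" for x
  have ir: "integrable lborel r" and intr: "(\<integral>x. r x \<partial>lborel) = Re (\<integral>x. f x * cnj (g x) \<partial>lborel)"
    unfolding r_def by (rule integrable_Re[OF ip]) (rule integral_Re[OF ip])
  have pol: "(norm (f x - g x))\<^sup>2 = (norm (f x))\<^sup>2 + (norm (g x))\<^sup>2 - 2 * r x" for x
    unfolding cmod_power2 r_def by (simp add: power2_eq_square algebra_simps)
  show ?thesis unfolding L2norm_sq pol intr[symmetric] using i ir by simp
qed

text \<open>The solution has a transform only in the sense of Plancherel, while the profiles are
  inverse transforms of explicit integrable symbols; this compares the two. For the approximating
  \<open>g k\<close> the squared distance is expanded: \<open>plancherel\<close> matches the squares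
  and \<open>parseval_cross\<close> the mixed terms. Both sides then pass to the limit.\<close>

theorem L2_fourier_isometry:
  fixes f U F :: "real^'n \<Rightarrow> complex"
  assumes fU: "L2_fourier f U" and F1: "integrable lborel F" and F2: "L2 F"
  shows "L2 (\<lambda>x. f x - inv_fourier F x)"
    and "L2norm (\<lambda>x. f x - inv_fourier F x) = sqrt (1 / (2 * pi) ^ CARD('n)) * L2norm (\<lambda>\<xi>. U \<xi> - F \<xi>)"
proof -
  define c where "c = 1 / (2 * pi) ^ CARD('n)"
  have c0: "c \<ge> 0" by (simp add: c_def)
  have f: "L2 f" and U: "L2 U" using fU by (auto simp: L2_fourier_def)
  note IF = inv_fourier_L2[OF F1 F2]
  show "L2 (\<lambda>x. f x - inv_fourier F x)" by (rule L2_diff(1)[OF f IF])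
  obtain g where g1: "\<And>k::nat. integrable lborel (g k)" and g2: "\<And>k. L2 (g k)" and g3: "\<And>k. L2 (fourier (g k))"
    and lim: "(\<lambda>k. L2norm (\<lambda>x. g k x - f x)) \<longlonglongrightarrow> 0"
      "(\<lambda>k. L2norm (\<lambda>\<xi>. fourier (g k) \<xi> - U \<xi>)) \<longlonglongrightarrow> 0"
    using fU unfolding L2_fourier_def by blast
  have eq: "L2norm (\<lambda>x. g k x - inv_fourier F x) = sqrt c * L2norm (\<lambda>\<xi>. fourier (g k) \<xi> - F \<xi>)" for k
  proof -
    have "(L2norm (\<lambda>x. g k x - inv_fourier F x))\<^sup>2
       = (L2norm (g k))\<^sup>2 + c * (L2norm F)\<^sup>2 - 2 * (c * Re (\<integral>\<xi>. fourier (g k) \<xi> * cnj (F \<xi>) \<partial>lborel))"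
      unfolding L2norm_diff_sq[OF g2 IF] inv_fourier_L2norm[OF F1 F2] parseval_cross[OF g1 F1] c_def by simp
    moreover have "(L2norm (g k))\<^sup>2 = c * (L2norm (fourier (g k)))\<^sup>2"
      using plancherel(2)[OF g1 g2, of k] by (simp add: L2norm_sq c_def)
    ultimately have "(L2norm (\<lambda>x. g k x - inv_fourier F x))\<^sup>2 = c * (L2norm (\<lambda>\<xi>. fourier (g k) \<xi> - F \<xi>))\<^sup>2"
      unfolding L2norm_diff_sq[OF g3 F2] by (simp add: field_simps)
    also have "\<dots> = (sqrt c * L2norm (\<lambda>\<xi>. fourier (g k) \<xi> - F \<xi>))\<^sup>2"
      using c0 by (simp add: power_mult_distrib)
    finally show ?thesis by (rule power2_eq_imp_eq) (use c0 in auto)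
  qed
  have "(\<lambda>k. L2norm (\<lambda>x. g k x - inv_fourier F x)) \<longlonglongrightarrow> L2norm (\<lambda>x. f x - inv_fourier F x)"
    by (rule L2norm_tendsto[OF g2 f IF lim(1)])
  moreover have "(\<lambda>k. L2norm (\<lambda>x. g k x - inv_fourier F x)) \<longlonglongrightarrow> sqrt c * L2norm (\<lambda>\<xi>. U \<xi> - F \<xi>)"
    unfolding eq by (intro tendsto_intros L2norm_tendsto[OF g3 U F2 lim(2)])
  ultimately show "L2norm (\<lambda>x. f x - inv_fourier F x) = sqrt (1 / (2 * pi) ^ CARD('n)) * L2norm (\<lambda>\<xi>. U \<xi> - F \<xi>)"
    unfolding c_def by (rule LIMSEQ_unique)
qed

text \<open>The isometry with the zero symbol.\<close>

lemma L2_fourier_norm: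
  fixes f U :: "real^'n \<Rightarrow> complex"
  assumes fU: "L2_fourier f U"
  shows "L2norm U = sqrt ((2 * pi) ^ CARD('n)) * L2norm f"
proof -
  have z: "integrable lborel (\<lambda>\<xi>::real^'n. 0::complex)" "L2 (\<lambda>\<xi>::real^'n. 0::complex)" by (auto simp: L2_def)
  have "L2norm f = sqrt (1 / (2 * pi) ^ CARD('n)) * L2norm U"
    using L2_fourier_isometry(2)[OF fU z] by (simp add: inv_fourier_def)
  then show ?thesis by (simp add: real_sqrt_divide)
qed

section \<open>Radial integrals and the rate function\<close>

definition sphere_area :: "nat \<Rightarrow> real" where
  "sphere_area n = real n * unit_ball_vol (real n)"

lemma sphere_area_pos: "n > 0 \<Longrightarrow> sphere_area n > 0"
  by (simp add: sphere_area_def)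

text \<open>The image of Lebesgue measure under the norm and the weighted measure on the half-line
  agree on every {..a}, by the formula for the volume of a ball, and these sets generate the Borel
  sets.\<close>

theorem nn_integral_radial:
  fixes f :: "real \<Rightarrow> ennreal"
  assumes [measurable]: "f \<in> borel_measurable borel"
  shows "(\<integral>\<^sup>+x. f (norm (x :: 'a::euclidean_space)) \<partial>lborel)
    = (\<integral>\<^sup>+r. ennreal (sphere_area DIM('a) * r ^ (DIM('a) - 1)) * indicator {0..} r * f r \<partial>lborel)"
proof -
  let ?n = "DIM('a)" and ?K = "sphere_area DIM('a)"
  have K: "?K \<ge> 0" by (simp add: sphere_area_def)
  define \<nu> where "\<nu> = distr (lborel :: 'a measure) borel norm"
  define \<mu> where "\<mu> = density lborel (\<lambda>r. ennreal (?K * r ^ (?n - 1)) * indicator {0..} r)"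
  have e\<nu>: "emeasure \<nu> {..a} = ennreal (if a < 0 then 0 else unit_ball_vol ?n * a ^ ?n)" for a
  proof -
    have "norm -` {..a} \<inter> space lborel = (cball 0 a :: 'a set)" by (auto simp: dist_norm)
    then have "emeasure \<nu> {..a} = emeasure lborel (cball 0 a :: 'a set)"
      unfolding \<nu>_def by (subst emeasure_distr) auto
    then show ?thesis by (auto simp: emeasure_cball)
  qed
  have e\<mu>: "emeasure \<mu> {..a} = ennreal (if a < 0 then 0 else unit_ball_vol ?n * a ^ ?n)" for a
  proof (cases "a < 0")
    case True
    have "emeasure \<mu> {..a} = (\<integral>\<^sup>+r. ennreal (?K * r ^ (?n - 1)) * indicator {0..} r * indicator {..a} r \<partial>lborel)"
      unfolding \<mu>_def by (subst emeasure_density) auto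
    also have "\<dots> = (\<integral>\<^sup>+(r::real). 0 \<partial>lborel)"
      by (rule nn_integral_cong) (use True in \<open>auto simp: indicator_def\<close>)
    finally show ?thesis using True by simp
  next
    case False
    have "emeasure \<mu> {..a} = (\<integral>\<^sup>+r. ennreal (?K * r ^ (?n - 1)) * indicator {0..} r * indicator {..a} r \<partial>lborel)"
      unfolding \<mu>_def by (subst emeasure_density) auto
    also have "\<dots> = (\<integral>\<^sup>+r. ennreal (?K * r ^ (?n - 1)) * indicator {0..a} r \<partial>lborel)"
      by (rule nn_integral_cong) (auto simp: indicator_def)
    also have "\<dots> = ennreal (unit_ball_vol ?n * a ^ ?n - unit_ball_vol ?n * 0 ^ ?n)"
    proof (rule nn_integral_FTC_Icc)
      fix r
      show "((\<lambda>r. unit_ball_vol ?n * r ^ ?n) has_real_derivative ?K * r ^ (?n - 1)) (at r)"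
        unfolding sphere_area_def by (auto intro!: derivative_eq_intros)
    qed (use False K in auto)
    finally show ?thesis using False by simp
  qed
  have "\<nu> = \<mu>"
  proof (rule measure_eqI_generator_eq[where E = "range atMost" and \<Omega> = UNIV and A = "\<lambda>i. {..real i}"])
    show "Int_stable (range atMost :: real set set)"
      by (auto simp: Int_stable_def)
    show "sets \<nu> = sigma_sets UNIV (range atMost)" "sets \<mu> = sigma_sets UNIV (range atMost)"
      unfolding \<nu>_def \<mu>_def by (simp_all add: borel_eq_atMost)
    show "(\<Union>i. {..real i}) = UNIV" using real_arch_simple by auto
    show "emeasure \<nu> X = emeasure \<mu> X" if "X \<in> range atMost" for X using that e\<nu> e\<mu> by auto
  qed (auto simp: e\<nu>)
  have "(\<integral>\<^sup>+x. f (norm (x :: 'a)) \<partial>lborel) = (\<integral>\<^sup>+r. f r \<partial>\<nu>)"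
    unfolding \<nu>_def by (subst nn_integral_distr) auto
  also have "\<dots> = (\<integral>\<^sup>+r. ennreal (?K * r ^ (?n - 1)) * indicator {0..} r * f r \<partial>lborel)"
    unfolding \<open>\<nu> = \<mu>\<close> \<mu>_def by (subst nn_integral_density) auto
  finally show ?thesis .
qed

section \<open>Symmetries of Lebesgue measure and angular averages\<close>

lemma lborel_distr_flip:
  fixes b0 :: "'a::euclidean_space"
  assumes b0: "b0 \<in> Basis"
  shows "distr lborel borel (\<lambda>x. x - (2 * (x \<bullet> b0)) *\<^sub>R b0) = lborel"
proof -
  define c where "c b = (if b = b0 then - 1 else 1 :: real)" for b :: 'a
  have "(\<Sum>j\<in>Basis. (c j * (x \<bullet> j)) *\<^sub>R j) = x - (2 * (x \<bullet> b0)) *\<^sub>R b0" for x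
  proof (rule euclidean_eqI)
    fix b :: 'a assume b: "b \<in> Basis"
    then show "(\<Sum>j\<in>Basis. (c j * (x \<bullet> j)) *\<^sub>R j) \<bullet> b = (x - (2 * (x \<bullet> b0)) *\<^sub>R b0) \<bullet> b"
      using b0 by (auto simp: c_def inner_diff_left inner_Basis)
  qed
  moreover have "lborel = density (distr lborel borel (\<lambda>x. 0 + (\<Sum>j\<in>Basis. (c j * (x \<bullet> j)) *\<^sub>R j))) (\<lambda>_. (\<Prod>j\<in>(Basis::'a set). \<bar>c j\<bar>))"
    by (rule lborel_affine_euclidean) (simp add: c_def)
  moreover have "(\<Prod>j\<in>(Basis::'a set). \<bar>c j\<bar>) = 1" by (rule prod.neutral) (simp add: c_def)
  ultimately show ?thesis by (simp add: density_1)
qed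

text \<open>Lebesgue measure is determined by its values on boxes, and permuting the coordinates
  only permutes the side lengths of a box.\<close>

lemma lborel_distr_permute:
  fixes p :: "'n::finite \<Rightarrow> 'n"
  assumes p: "p permutes UNIV"
  shows "distr lborel borel (\<lambda>x::real^'n. \<chi> i. x $ p i) = lborel"
proof (rule lborel_eqI[symmetric])
  have [measurable]: "(\<lambda>x::real^'n. \<chi> i. x $ p i) \<in> borel_measurable borel"
    by (intro borel_measurable_continuous_onI continuous_intros)
  have P: "(\<Prod>b\<in>Basis. x \<bullet> b) = (\<Prod>i\<in>UNIV. x $ i)" for x :: "real^'n"
    unfolding Basis_vec_def by (subst prod.reindex_bij_betw[where h = "\<lambda>i. axis i (1::real)" and S = UNIV, symmetric])
      (auto simp: cart_eq_inner_axis bij_betw_def inj_on_def axis_eq_axis)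
  fix l u :: "real^'n" assume lu: "\<And>b. b \<in> Basis \<Longrightarrow> l \<bullet> b \<le> u \<bullet> b"
  let ?q = "\<lambda>x::real^'n. \<chi> i. x $ inv p i"
  have "(\<lambda>x::real^'n. \<chi> i. x $ p i) -` box l u \<inter> space lborel = box (?q l) (?q u)"
  proof -
    have "(\<forall>i. l $ i < x $ p i \<and> x $ p i < u $ i) \<longleftrightarrow> (\<forall>i. l $ inv p i < x $ i \<and> x $ i < u $ inv p i)" for x :: "real^'n"
      by (metis permutes_inverses[OF p])
    then show ?thesis by (auto simp: mem_box_cart)
  qed
  then have "emeasure (distr lborel borel (\<lambda>x::real^'n. \<chi> i. x $ p i)) (box l u) = emeasure lborel (box (?q l) (?q u))"
    by (subst emeasure_distr) auto
  also have "\<dots> = ennreal (\<Prod>b\<in>Basis. (?q u - ?q l) \<bullet> b)"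
  proof -
    have "?q l \<bullet> b \<le> ?q u \<bullet> b" if "b \<in> Basis" for b
    proof -
      obtain i where b: "b = axis i 1" using \<open>b \<in> Basis\<close> by (auto simp: Basis_vec_def)
      show ?thesis using lu[of "axis (inv p i) 1"] unfolding b by (simp add: cart_eq_inner_axis[symmetric] axis_in_Basis_iff)
    qed
    then show ?thesis by (simp add: emeasure_lborel_box_eq)
  qed
  also have "(\<Prod>b\<in>Basis. (?q u - ?q l) \<bullet> b) = (\<Prod>b\<in>Basis. (u - l) \<bullet> b)"
    unfolding P using prod.permute[OF permutes_inv[OF p], of "\<lambda>i. (u - l) $ i"] by (simp add: o_def)
  finally show "emeasure (distr lborel borel (\<lambda>x::real^'n. \<chi> i. x $ p i)) (box l u) = ennreal (\<Prod>b\<in>Basis. (u - l) \<bullet> b)" .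
qed simp

text \<open>Transposing two coordinates preserves the measure and the norm, so all coordinates
  contribute equally; their squares add up to the squared norm.\<close>

lemma nn_integral_coord_sq_radial:
  fixes f :: "real \<Rightarrow> ennreal" and i :: "'n::finite"
  assumes [measurable]: "f \<in> borel_measurable borel"
  shows "of_nat CARD('n) * (\<integral>\<^sup>+\<xi>. ennreal ((\<xi> $ i)\<^sup>2) * f (norm \<xi>) \<partial>lborel)
     = (\<integral>\<^sup>+\<xi>. ennreal ((norm \<xi>)\<^sup>2) * f (norm \<xi>) \<partial>(lborel :: (real^'n) measure))"
proof -
  let ?I = "\<lambda>j. \<integral>\<^sup>+\<xi>. ennreal ((\<xi> $ j)\<^sup>2) * f (norm \<xi>) \<partial>(lborel :: (real^'n) measure)"
  have n2: "(norm \<xi>)\<^sup>2 = (\<Sum>j\<in>UNIV. (\<xi> $ j)\<^sup>2)" for \<xi> :: "real^'n"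
    unfolding power2_norm_eq_inner inner_vec_def by (simp add: power2_eq_square)
  have sw: "?I j = ?I i" for j
  proof -
    define p where "p = Transposition.transpose i j"
    have p: "p permutes UNIV" unfolding p_def by (rule permutes_swap_id) auto
    define T where "T = (\<lambda>x::real^'n. \<chi> k. x $ p k)"
    have m[measurable]: "T \<in> borel_measurable borel"
      unfolding T_def by (intro borel_measurable_continuous_onI continuous_intros)
    have nT: "norm (T x) = norm x" for x
    proof (rule power2_eq_imp_eq)
      show "(norm (T x))\<^sup>2 = (norm x)\<^sup>2"
        unfolding n2 T_def using sum.permute[OF p, of "\<lambda>j. (x $ j)\<^sup>2"] by (simp add: o_def)
    qed auto
    have "?I i = (\<integral>\<^sup>+\<xi>. ennreal ((\<xi> $ i)\<^sup>2) * f (norm \<xi>) \<partial>distr lborel borel T)"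
      unfolding T_def by (simp only: lborel_distr_permute[OF p])
    also have "\<dots> = (\<integral>\<^sup>+\<xi>. ennreal ((T \<xi> $ i)\<^sup>2) * f (norm (T \<xi>)) \<partial>lborel)"
      by (subst nn_integral_distr) auto
    finally show ?thesis by (simp add: nT) (simp add: T_def p_def)
  qed
  have "of_nat CARD('n) * ?I i = (\<Sum>j\<in>(UNIV :: 'n set). ?I j)"
    by (subst sum.cong[OF refl sw]) simp
  also have "\<dots> = (\<integral>\<^sup>+\<xi>. (\<Sum>j\<in>(UNIV :: 'n set). ennreal ((\<xi> $ j)\<^sup>2) * f (norm \<xi>)) \<partial>lborel)"
    by (rule nn_integral_sum[symmetric]) auto
  also have "\<dots> = (\<integral>\<^sup>+\<xi>. ennreal ((norm \<xi>)\<^sup>2) * f (norm \<xi>) \<partial>(lborel :: (real^'n) measure))"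
    unfolding n2 by (simp add: sum_distrib_right[symmetric] sum_ennreal)
  finally show ?thesis .
qed

text \<open>Reflecting the coordinate in which \<open>M\<close> is largest removes the mixed terms.\<close>

lemma nn_integral_inner_sq_radial:
  fixes M :: "real^'n" and f :: "real \<Rightarrow> ennreal"
  assumes [measurable]: "f \<in> borel_measurable borel"
  shows "ennreal ((norm M)\<^sup>2) * (\<integral>\<^sup>+\<xi>. ennreal ((norm \<xi>)\<^sup>2) * f (norm \<xi>) \<partial>(lborel :: (real^'n) measure))
     \<le> (of_nat CARD('n))\<^sup>2 * (\<integral>\<^sup>+\<xi>. ennreal ((\<xi> \<bullet> M)\<^sup>2) * f (norm \<xi>) \<partial>lborel)"
proof -
  let ?I = "\<integral>\<^sup>+\<xi>. ennreal ((\<xi> \<bullet> M)\<^sup>2) * f (norm \<xi>) \<partial>lborel"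
  obtain i where i: "\<And>j. \<bar>M $ j\<bar> \<le> \<bar>M $ i\<bar>"
  proof -
    have "Max (range (\<lambda>j. \<bar>M $ j\<bar>)) \<in> range (\<lambda>j. \<bar>M $ j\<bar>)" by (rule Max_in) auto
    then obtain i where "\<bar>M $ i\<bar> = Max (range (\<lambda>j. \<bar>M $ j\<bar>))"
      by (metis (no_types, lifting) imageE)
    then show ?thesis by (intro that[of i]) simp
  qed
  have M: "(norm M)\<^sup>2 \<le> real CARD('n) * (M $ i)\<^sup>2"
  proof -
    have "(norm M)\<^sup>2 = (\<Sum>j\<in>UNIV. (M $ j)\<^sup>2)"
      unfolding power2_norm_eq_inner inner_vec_def by (simp add: power2_eq_square)
    also have "\<dots> \<le> (\<Sum>j\<in>(UNIV::'n set). (M $ i)\<^sup>2)"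
      using i by (intro sum_mono) (simp add: abs_le_square_iff)
    finally show ?thesis by simp
  qed
  define b where "b = (axis i 1 :: real^'n)"
  have b: "b \<in> Basis" by (simp add: b_def axis_in_Basis_iff)
  have xb: "x \<bullet> b = x $ i" for x by (simp add: b_def cart_eq_inner_axis)
  define T where "T x = x - (2 * (x \<bullet> b)) *\<^sub>R b" for x
  have m[measurable]: "T \<in> borel_measurable borel"
    unfolding T_def by (intro borel_measurable_continuous_onI continuous_intros)
  have bb: "b \<bullet> b = 1" using b by (simp add: inner_Basis)
  have nT: "norm (T x) = norm x" for x
    unfolding norm_eq_sqrt_inner T_def by (simp add: inner_diff_left inner_diff_right bb inner_commute algebra_simps)
  have "?I = (\<integral>\<^sup>+\<xi>. ennreal ((\<xi> \<bullet> M)\<^sup>2) * f (norm \<xi>) \<partial>distr lborel borel T)"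
    unfolding T_def by (simp only: lborel_distr_flip[OF b])
  also have "\<dots> = (\<integral>\<^sup>+\<xi>. ennreal ((T \<xi> \<bullet> M)\<^sup>2) * f (norm \<xi>) \<partial>lborel)"
    by (subst nn_integral_distr) (auto simp: nT)
  finally have T: "?I = (\<integral>\<^sup>+\<xi>. ennreal ((T \<xi> \<bullet> M)\<^sup>2) * f (norm \<xi>) \<partial>lborel)" .
  have "2 * (ennreal ((M $ i)\<^sup>2) * (\<integral>\<^sup>+\<xi>. ennreal ((\<xi> $ i)\<^sup>2) * f (norm \<xi>) \<partial>lborel))
     = (\<integral>\<^sup>+\<xi>. ennreal (2 * (M $ i)\<^sup>2) * (ennreal ((\<xi> $ i)\<^sup>2) * f (norm \<xi>)) \<partial>lborel)"
    by (subst nn_integral_cmult) (auto simp: ennreal_mult mult.assoc)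
  also have "\<dots> \<le> (\<integral>\<^sup>+\<xi>. ennreal ((\<xi> \<bullet> M)\<^sup>2) * f (norm \<xi>) + ennreal ((T \<xi> \<bullet> M)\<^sup>2) * f (norm \<xi>) \<partial>lborel)"
  proof (rule nn_integral_mono)
    fix \<xi> :: "real^'n"
    have TM: "T \<xi> \<bullet> M = \<xi> \<bullet> M - 2 * (\<xi> $ i * M $ i)"
      unfolding T_def by (simp add: inner_diff_left xb) (simp add: inner_commute[of b] xb)
    have "(\<xi> \<bullet> M)\<^sup>2 + (T \<xi> \<bullet> M)\<^sup>2 = 2 * (\<xi> \<bullet> M - \<xi> $ i * M $ i)\<^sup>2 + 2 * (M $ i)\<^sup>2 * (\<xi> $ i)\<^sup>2"
      unfolding TM by (simp add: power2_eq_square algebra_simps)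
    then have "2 * (M $ i)\<^sup>2 * (\<xi> $ i)\<^sup>2 \<le> (\<xi> \<bullet> M)\<^sup>2 + (T \<xi> \<bullet> M)\<^sup>2" by simp
    then have "ennreal (2 * (M $ i)\<^sup>2 * (\<xi> $ i)\<^sup>2) \<le> ennreal ((\<xi> \<bullet> M)\<^sup>2 + (T \<xi> \<bullet> M)\<^sup>2)" by (rule ennreal_leI)
    then have "ennreal (2 * (M $ i)\<^sup>2) * ennreal ((\<xi> $ i)\<^sup>2) \<le> ennreal ((\<xi> \<bullet> M)\<^sup>2) + ennreal ((T \<xi> \<bullet> M)\<^sup>2)"
      by (simp only: ennreal_mult'' ennreal_plus zero_le_power2)
    then show "ennreal (2 * (M $ i)\<^sup>2) * (ennreal ((\<xi> $ i)\<^sup>2) * f (norm \<xi>))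
      \<le> ennreal ((\<xi> \<bullet> M)\<^sup>2) * f (norm \<xi>) + ennreal ((T \<xi> \<bullet> M)\<^sup>2) * f (norm \<xi>)"
      unfolding distrib_right[symmetric] mult.assoc[symmetric] by (rule mult_right_mono) simp
  qed
  also have "\<dots> = ?I + ?I" by (subst nn_integral_add) (auto simp: T[symmetric])
  also have "\<dots> = 2 * ?I" by (simp add: mult_2)
  finally have le: "ennreal ((M $ i)\<^sup>2) * (\<integral>\<^sup>+\<xi>. ennreal ((\<xi> $ i)\<^sup>2) * f (norm \<xi>) \<partial>lborel) \<le> ?I"
    by (simp add: ennreal_mult_le_mult_iff)
  \<comment> \<open>One factor n comes from |M|^2 \<le> n M_i^2, the other from the share 1/n that
    each coordinate has in the squared norm.\<close>
  have "ennreal ((norm M)\<^sup>2) * (of_nat CARD('n) * (\<integral>\<^sup>+\<xi>. ennreal ((\<xi> $ i)\<^sup>2) * f (norm \<xi>) \<partial>lborel))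
     \<le> ennreal (real CARD('n) * (M $ i)\<^sup>2) * (of_nat CARD('n) * (\<integral>\<^sup>+\<xi>. ennreal ((\<xi> $ i)\<^sup>2) * f (norm \<xi>) \<partial>lborel))"
    by (intro mult_right_mono ennreal_leI M) simp
  also have "\<dots> = (of_nat CARD('n))\<^sup>2 * (ennreal ((M $ i)\<^sup>2) * (\<integral>\<^sup>+\<xi>. ennreal ((\<xi> $ i)\<^sup>2) * f (norm \<xi>) \<partial>lborel))"
  proof -
    have "ennreal (real CARD('n) * (M $ i)\<^sup>2) = of_nat CARD('n) * ennreal ((M $ i)\<^sup>2)"
      by (simp add: ennreal_mult ennreal_of_nat_eq_real_of_nat)
    then show ?thesis by (simp only: power2_eq_square[of "of_nat CARD('n) :: ennreal"] mult_ac)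
  qed
  also have "\<dots> \<le> (of_nat CARD('n))\<^sup>2 * ?I" by (intro mult_left_mono le) simp
  finally show ?thesis unfolding nn_integral_coord_sq_radial[OF assms] .
qed

text \<open>The square of \<open>min t (1 / r) * exp (- (c / 2) * r\<^sup>2 * t)\<close>, the shape
  of all low-frequency error bounds.\<close>

definition low_weight :: "real \<Rightarrow> real \<Rightarrow> real \<Rightarrow> real" where
  "low_weight c t r = min (t\<^sup>2) (1 / r\<^sup>2) * exp (- c * r\<^sup>2 * t)"

lemma low_weight_measurable [measurable]: "low_weight c t \<in> borel_measurable borel"
  unfolding low_weight_def by measurable

section \<open>The integral of the low-frequency weight\<close>

lemma rate_sq:
  assumes "t \<ge> 1" "n > 0"
  shows "(rate n t)\<^sup>2 = (if n = 1 then t else if n = 2 then ln t else t powr (1 - real n / 2))"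
  using assms by (auto simp: rate_def powr_half_sqrt power2_eq_square simp flip: powr_add)

text \<open>The bound t^2 up to r = 1/t and the bound 1/r^2 beyond contribute t each.\<close>

lemma nn_radial_weight_dim1:
  assumes t: "t > 0" and c: "c > 0"
  shows "(\<integral>\<^sup>+r. ennreal (indicator {0..} r * low_weight c t r) \<partial>lborel) \<le> ennreal (2 * t)"
proof -
  have "(\<integral>\<^sup>+r. ennreal (indicator {0..} r * low_weight c t r) \<partial>lborel)
     \<le> (\<integral>\<^sup>+r. ennreal (t\<^sup>2) * indicator {0..1/t} r + ennreal (1 / r\<^sup>2) * indicator {1/t..} r \<partial>lborel)"
  proof (rule nn_integral_mono)
    fix r :: real
    have "low_weight c t r \<le> min (t\<^sup>2) (1 / r\<^sup>2) * 1" unfolding low_weight_def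
      using t c by (intro mult_left_mono) auto
    then show "ennreal (indicator {0..} r * low_weight c t r)
      \<le> ennreal (t\<^sup>2) * indicator {0..1/t} r + ennreal (1 / r\<^sup>2) * indicator {1/t..} r"
      by (auto simp: indicator_def ennreal_leI intro!: add_increasing2 zero_le)
  qed
  also have "\<dots> = ennreal (t\<^sup>2) * ennreal (1 / t) + (\<integral>\<^sup>+r. ennreal (1 / r\<^sup>2) * indicator {1/t..} r \<partial>lborel)"
    using t by (subst nn_integral_add) (auto simp: nn_integral_cmult)
  also have "(\<integral>\<^sup>+r. ennreal (1 / r\<^sup>2) * indicator {1/t..} r \<partial>lborel) = ennreal (0 - (- inverse (1 / t)))"
  proof (rule nn_integral_FTC_atLeast)
    fix r assume "1 / t \<le> r"
    then have "r > 0" using t by (meson divide_pos_pos less_le_trans zero_less_one)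
    then show "((\<lambda>r. - inverse r) has_real_derivative 1 / r\<^sup>2) (at r)"
      by (auto intro!: derivative_eq_intros simp: power2_eq_square field_simps)
  next
    show "((\<lambda>r::real. - inverse r) \<longlongrightarrow> 0) at_top"
      using tendsto_minus[OF tendsto_inverse_0_at_top[OF filterlim_ident]] by simp
  qed auto
  finally show ?thesis using t by (simp add: ennreal_mult[symmetric] ennreal_plus[symmetric] power2_eq_square del: ennreal_plus)
qed

text \<open>Three zones: t^2 r up to 1/t gives 1/2, then 1/r up to 1 gives ln t, and the Gaussian
  tail beyond 1 gives at most 1/(2 c).\<close>

lemma nn_radial_weight_dim2:
  assumes t: "t \<ge> 1" and c: "c > 0"
  shows "(\<integral>\<^sup>+r. ennreal (indicator {0..} r * (r * low_weight c t r)) \<partial>lborel) \<le> ennreal (1 / 2 + ln t + 1 / (2 * c))"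
proof -
  have "(\<integral>\<^sup>+r. ennreal (indicator {0..} r * (r * low_weight c t r)) \<partial>lborel)
     \<le> (\<integral>\<^sup>+r. (ennreal (t\<^sup>2 * r) * indicator {0..1/t} r + ennreal (1 / r) * indicator {1/t..1} r)
          + ennreal (r * exp (- c * r\<^sup>2)) * indicator {1..} r \<partial>lborel)"
  proof (rule nn_integral_mono)
    fix r :: real
    have e: "exp (- c * r\<^sup>2 * t) \<le> 1" using t c by simp
    have 1: "r * low_weight c t r \<le> t\<^sup>2 * r" if "0 \<le> r"
    proof -
      have "r * (min (t\<^sup>2) (1 / r\<^sup>2) * exp (- c * r\<^sup>2 * t)) \<le> r * (t\<^sup>2 * 1)"
        using e that by (intro mult_mono) auto
      then show ?thesis by (simp add: low_weight_def mult.commute)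
    qed
    have 2: "r * low_weight c t r \<le> 1 / r" if "0 < r"
    proof -
      have "r * (min (t\<^sup>2) (1 / r\<^sup>2) * exp (- c * r\<^sup>2 * t)) \<le> r * ((1 / r\<^sup>2) * 1)"
        using e that by (intro mult_mono) auto
      then show ?thesis using that by (simp add: low_weight_def power2_eq_square)
    qed
    have 3: "r * low_weight c t r \<le> r * exp (- c * r\<^sup>2)" if "1 \<le> r"
    proof -
      have "1 / r\<^sup>2 \<le> 1" using that by (simp add: divide_le_eq)
      moreover have "c * r\<^sup>2 * 1 \<le> c * r\<^sup>2 * t" using t c by (intro mult_left_mono) auto
      ultimately have "r * (min (t\<^sup>2) (1 / r\<^sup>2) * exp (- c * r\<^sup>2 * t)) \<le> r * (1 * exp (- c * r\<^sup>2))"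
        using that by (intro mult_mono) (auto intro: min.coboundedI2)
      then show ?thesis by (simp add: low_weight_def)
    qed
    consider "r < 0" | "0 \<le> r" "r \<le> 1 / t" | "1 / t < r" "r < 1" | "1 \<le> r" "1 / t < r" by linarith
    then show "ennreal (indicator {0..} r * (r * low_weight c t r))
      \<le> (ennreal (t\<^sup>2 * r) * indicator {0..1/t} r + ennreal (1 / r) * indicator {1/t..1} r)
          + ennreal (r * exp (- c * r\<^sup>2)) * indicator {1..} r"
    proof cases
      case 2
      then have "ennreal (indicator {0..} r * (r * low_weight c t r)) \<le> ennreal (t\<^sup>2 * r) * indicator {0..1/t} r"
        using 1 by (auto simp: ennreal_leI)
      then show ?thesis by (simp add: add.assoc add_increasing2)
    next
      case 3
      have "0 < 1 / t" using t by simp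
      then have "0 < r" using 3 by linarith
      then have "ennreal (indicator {0..} r * (r * low_weight c t r)) \<le> ennreal (1 / r) * indicator {1/t..1} r"
        using 2 3 by (auto simp: ennreal_leI)
      then show ?thesis by (simp add: add_increasing add_increasing2)
    next
      case 4
      then have "ennreal (indicator {0..} r * (r * low_weight c t r)) \<le> ennreal (r * exp (- c * r\<^sup>2)) * indicator {1..} r"
        using 3 by (auto simp: ennreal_leI)
      then show ?thesis by (simp add: add_increasing)
    qed (simp add: indicator_def)
  qed
  also have "\<dots> = (\<integral>\<^sup>+r. ennreal (t\<^sup>2 * r) * indicator {0..1/t} r \<partial>lborel) + (\<integral>\<^sup>+r. ennreal (1 / r) * indicator {1/t..1} r \<partial>lborel)
      + (\<integral>\<^sup>+r. ennreal (r * exp (- c * r\<^sup>2)) * indicator {1..} r \<partial>lborel)"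
    by (subst nn_integral_add, simp, simp, subst nn_integral_add) auto
  also have "(\<integral>\<^sup>+r. ennreal (t\<^sup>2 * r) * indicator {0..1/t} r \<partial>lborel) = ennreal (t\<^sup>2 * (1/t)\<^sup>2 / 2 - t\<^sup>2 * 0\<^sup>2 / 2)"
    by (rule nn_integral_FTC_Icc) (use t in \<open>auto intro!: derivative_eq_intros\<close>)
  also have "(\<integral>\<^sup>+r. ennreal (1 / r) * indicator {1/t..1} r \<partial>lborel) = ennreal (ln 1 - ln (1 / t))"
  proof (rule nn_integral_FTC_Icc[where F = ln])
    fix r assume "r \<in> {1 / t..1}"
    then have "1 / t \<le> r" by simp
    then have r: "r > 0" using t by (meson divide_pos_pos less_le_trans zero_less_one)
    show "(ln has_real_derivative 1 / r) (at r)" using r by (auto intro!: derivative_eq_intros)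
    show "0 \<le> 1 / r" using r by simp
  qed (use t in auto)
  also have "(\<integral>\<^sup>+r. ennreal (r * exp (- c * r\<^sup>2)) * indicator {1..} r \<partial>lborel) = ennreal (0 - (- exp (- c * 1\<^sup>2) / (2 * c)))"
  proof (rule nn_integral_FTC_atLeast)
    fix r :: real assume r: "1 \<le> r"
    show "((\<lambda>r. - exp (- c * r\<^sup>2) / (2 * c)) has_real_derivative r * exp (- c * r\<^sup>2)) (at r)"
      using c by (auto intro!: derivative_eq_intros)
    show "0 \<le> r * exp (- c * r\<^sup>2)" using r by simp
  next
    show "((\<lambda>r. - exp (- c * r\<^sup>2) / (2 * c)) \<longlongrightarrow> 0) at_top" using c by real_asymp
  qed auto
  also have "ennreal (t\<^sup>2 * (1/t)\<^sup>2 / 2 - t\<^sup>2 * 0\<^sup>2 / 2) + ennreal (ln 1 - ln (1 / t)) + ennreal (0 - (- exp (- c * 1\<^sup>2) / (2 * c)))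
     = ennreal (1 / 2 + ln t + exp (- c) / (2 * c))"
  proof -
    have "t\<^sup>2 * (1/t)\<^sup>2 / 2 - t\<^sup>2 * 0\<^sup>2 / 2 = 1 / 2" "ln 1 - ln (1 / t) = ln t"
      "0 - (- exp (- c * 1\<^sup>2) / (2 * c)) = exp (- c) / (2 * c)"
      using t by (auto simp: ln_div power_divide)
    moreover have "ennreal (1 / 2 + ln t + exp (- c) / (2 * c)) = ennreal (1 / 2 + ln t) + ennreal (exp (- c) / (2 * c))"
      "ennreal (1 / 2 + ln t) = ennreal (1 / 2) + ennreal (ln t)"
      by (rule ennreal_plus; use t c in simp)+
    ultimately show ?thesis by (simp only:)
  qed
  also have "\<dots> \<le> ennreal (1 / 2 + ln t + 1 / (2 * c))"
    using c by (intro ennreal_leI add_left_mono divide_right_mono) auto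
  finally show ?thesis .
qed

text \<open>With m = n - 3 the power of r from polar coordinates cancels 1/r^2 and leaves r^m times
  a Gaussian. The substitution r = s / sqrt t extracts t^(-(m+1)/2) = t^(1 - n/2).\<close>

lemma nn_radial_weight_dim3:
  assumes c: "c > 0"
  obtains J where "\<And>t. t > 0 \<Longrightarrow> (\<integral>\<^sup>+r. ennreal (indicator {0..} r * (r ^ (m + 2) * low_weight c t r)) \<partial>lborel) \<le> ennreal (J * t powr (- real (m + 1) / 2))" "J \<ge> 0"
proof -
  let ?h = "\<lambda>s. indicator {0..} s * (s ^ m * exp (- c * s\<^sup>2)) :: real"
  \<comment> \<open>s^m exp (- c s^2) is, up to a constant, a moment integrand of the normal law of
    variance 1/(2 c).\<close>
  have "integrable lborel (\<lambda>s. normal_density 0 (sqrt (1 / (2 * c))) s * \<bar>s - 0\<bar> ^ m)"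
    by (rule integrable_normal_moment_abs) (use c in simp)
  then have "integrable lborel (\<lambda>s. sqrt (2 * pi * (1 / (2 * c))) * (normal_density 0 (sqrt (1 / (2 * c))) s * \<bar>s - 0\<bar> ^ m))"
    by simp
  then have i: "integrable lborel (\<lambda>s. exp (- c * s\<^sup>2) * \<bar>s\<bar> ^ m)"
    by (rule Bochner_Integration.integrable_cong[THEN iffD1, OF refl, rotated])
      (use c in \<open>simp add: normal_density_def\<close>)
  have ih: "integrable lborel ?h"
    by (rule Bochner_Integration.integrable_bound[OF i]) (auto simp: indicator_def)
  define J where "J = (\<integral>s. ?h s \<partial>lborel)"
  have J: "(\<integral>\<^sup>+s. ennreal (?h s) \<partial>lborel) = ennreal J" "J \<ge> 0"
    unfolding J_def by (rule nn_integral_eq_integral[OF ih], simp add: indicator_def) (rule integral_nonneg_AE, simp add: indicator_def)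
  show thesis
  proof (rule that[OF _ J(2)])
    fix t :: real assume t: "t > 0"
    have "(\<integral>\<^sup>+r. ennreal (indicator {0..} r * (r ^ (m + 2) * low_weight c t r)) \<partial>lborel)
      \<le> (\<integral>\<^sup>+r. ennreal (indicator {0..} r * (r ^ m * exp (- c * r\<^sup>2 * t))) \<partial>lborel)"
    proof (intro nn_integral_mono ennreal_leI)
      fix r :: real
      show "indicator {0..} r * (r ^ (m + 2) * low_weight c t r) \<le> indicator {0..} r * (r ^ m * exp (- c * r\<^sup>2 * t))"
      proof (cases "r > 0")
        case True
        have "r ^ (m + 2) * (min (t\<^sup>2) (1 / r\<^sup>2) * exp (- c * r\<^sup>2 * t)) \<le> r ^ (m + 2) * ((1 / r\<^sup>2) * exp (- c * r\<^sup>2 * t))"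
          using True by (intro mult_left_mono mult_right_mono) auto
        also have "\<dots> = r ^ m * exp (- c * r\<^sup>2 * t)" using True by (simp add: power_add power2_eq_square)
        finally show ?thesis using True by (simp add: low_weight_def)
      qed (auto simp: indicator_def low_weight_def)
    qed
    also have "\<dots> = ennreal (1 / sqrt t) * (\<integral>\<^sup>+s. ennreal (indicator {0..} (0 + 1 / sqrt t * s) * ((0 + 1 / sqrt t * s) ^ m * exp (- c * (0 + 1 / sqrt t * s)\<^sup>2 * t))) \<partial>lborel)"
      using t by (subst nn_integral_real_affine[where c = "1 / sqrt t" and t = 0]) auto
    also have "(\<integral>\<^sup>+s. ennreal (indicator {0..} (0 + 1 / sqrt t * s) * ((0 + 1 / sqrt t * s) ^ m * exp (- c * (0 + 1 / sqrt t * s)\<^sup>2 * t))) \<partial>lborel)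
       = (\<integral>\<^sup>+s. ennreal ((1 / sqrt t) ^ m) * ennreal (?h s) \<partial>lborel)"
    proof (rule nn_integral_cong)
      fix s :: real
      have "indicator {0..} (0 + 1 / sqrt t * s) = (indicator {0..} s :: real)"
        using t by (auto simp: indicator_def zero_le_divide_iff)
      moreover have "(0 + 1 / sqrt t * s)\<^sup>2 * t = s\<^sup>2" using t by (simp add: power_divide)
      moreover have "(0 + 1 / sqrt t * s) ^ m = (1 / sqrt t) ^ m * s ^ m" by (simp add: power_divide)
      ultimately show "ennreal (indicator {0..} (0 + 1 / sqrt t * s) * ((0 + 1 / sqrt t * s) ^ m * exp (- c * (0 + 1 / sqrt t * s)\<^sup>2 * t)))
         = ennreal ((1 / sqrt t) ^ m) * ennreal (?h s)"
        using t by (subst ennreal_mult'[symmetric]) (auto simp: mult_ac mult.assoc)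
    qed
    also have "\<dots> = ennreal ((1 / sqrt t) ^ m) * ennreal J"
      using J by (subst nn_integral_cmult) auto
    also have "ennreal (1 / sqrt t) * (ennreal ((1 / sqrt t) ^ m) * ennreal J) = ennreal ((1 / sqrt t) ^ (m + 1) * J)"
      using t J by (simp add: ennreal_mult[symmetric])
    also have "(1 / sqrt t) ^ (m + 1) = t powr (- real (m + 1) / 2)"
    proof -
      have "1 / sqrt t = t powr (- 1 / 2)" using t by (simp add: powr_minus_divide powr_half_sqrt)
      then have "(1 / sqrt t) ^ (m + 1) = (t powr (- 1 / 2)) powr real (m + 1)" using t by (simp only: powr_realpow powr_gt_zero)
      also have "\<dots> = t powr ((- 1 / 2) * real (m + 1))" by (rule powr_powr)
      also have "(- 1 / 2) * real (m + 1) = - real (m + 1) / 2" by (simp add: field_simps)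
      finally show ?thesis .
    qed
    finally show "(\<integral>\<^sup>+r. ennreal (indicator {0..} r * (r ^ (m + 2) * low_weight c t r)) \<partial>lborel) \<le> ennreal (J * t powr (- real (m + 1) / 2))"
      by (simp add: mult.commute)
  qed
qed

lemma integrable_of_nn_bound:
  fixes f :: "'a \<Rightarrow> real"
  assumes "f \<in> borel_measurable M" "\<And>x. 0 \<le> f x" "(\<integral>\<^sup>+x. ennreal (f x) \<partial>M) \<le> ennreal B" "0 \<le> B"
  shows "integrable M f" "(\<integral>x. f x \<partial>M) \<le> B"
proof -
  show i: "integrable M f"
    using assms by (intro integrableI_nonneg) (auto intro: le_less_trans)
  have "ennreal (\<integral>x. f x \<partial>M) \<le> ennreal B"
    using assms nn_integral_eq_integral[OF i] by simp
  then show "(\<integral>x. f x \<partial>M) \<le> B" using assms(4) by (simp add: ennreal_le_iff)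
qed

lemma nn_integral_radial_real:
  fixes f :: "real \<Rightarrow> real"
  assumes [measurable]: "f \<in> borel_measurable borel" and f: "\<And>r. 0 \<le> f r"
  shows "(\<integral>\<^sup>+\<xi>. ennreal (f (norm \<xi>)) \<partial>(lborel :: (real^'n) measure))
     = ennreal (sphere_area CARD('n)) * (\<integral>\<^sup>+r. ennreal (indicator {0..} r * (r ^ (CARD('n) - 1) * f r)) \<partial>lborel)"
proof -
  have K: "0 \<le> sphere_area CARD('n)" by (simp add: sphere_area_def)
  have "(\<integral>\<^sup>+\<xi>. ennreal (f (norm \<xi>)) \<partial>(lborel :: (real^'n) measure))
     = (\<integral>\<^sup>+r. ennreal (sphere_area CARD('n) * r ^ (CARD('n) - 1)) * indicator {0..} r * ennreal (f r) \<partial>lborel)"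
    using nn_integral_radial[of "\<lambda>r. ennreal (f r)", where 'a = "real^'n"] by simp
  also have "\<dots> = (\<integral>\<^sup>+r. ennreal (sphere_area CARD('n)) * ennreal (indicator {0..} r * (r ^ (CARD('n) - 1) * f r)) \<partial>lborel)"
    by (rule nn_integral_cong) (use K f in \<open>auto simp: indicator_def ennreal_mult mult.assoc\<close>)
  finally show ?thesis by (simp add: nn_integral_cmult)
qed

lemma low_weight_nonneg [simp]: "0 \<le> low_weight c t r"
  by (simp add: low_weight_def)

theorem low_weight_integral:
  assumes c: "c > 0"
  obtains C T where "C > 0" "T \<ge> 1"
    "\<And>t. t \<ge> T \<Longrightarrow> integrable lborel (\<lambda>\<xi>::real^'n. low_weight c t (norm \<xi>))"
    "\<And>t. t \<ge> T \<Longrightarrow> (\<integral>\<xi>. low_weight c t (norm \<xi>) \<partial>(lborel :: (real^'n) measure)) \<le> C * (rate CARD('n) t)\<^sup>2"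
proof -
  let ?n = "CARD('n)"
  define K where "K = sphere_area ?n"
  have K: "K > 0" unfolding K_def by (rule sphere_area_pos) simp
  \<comment> \<open>From t = exp 1 on, ln t \<ge> 1, so in dimension two the additive constants are
    absorbed into a multiple of ln t.\<close>
  obtain B where B: "B \<ge> 0"
    "\<And>t. t \<ge> exp 1 \<Longrightarrow> (\<integral>\<^sup>+r. ennreal (indicator {0..} r * (r ^ (?n - 1) * low_weight c t r)) \<partial>lborel) \<le> ennreal (B * (rate ?n t)\<^sup>2)"
  proof -
    consider "?n = 1" | "?n = 2" | "?n \<ge> 3" by (metis One_nat_def Suc_1 Suc_leI le_neq_implies_less numeral_3_eq_3 zero_less_card_finite)
    then show thesis
    proof cases
      case 1
      show ?thesis
      proof (rule that[of 2])
        fix t :: real assume t: "t \<ge> exp 1"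
        then have t1: "t \<ge> 1" using exp_ge_add_one_self[of 1] by linarith
        show "(\<integral>\<^sup>+r. ennreal (indicator {0..} r * (r ^ (?n - 1) * low_weight c t r)) \<partial>lborel) \<le> ennreal (2 * (rate ?n t)\<^sup>2)"
          using nn_radial_weight_dim1[of t c] t1 c 1 by (simp add: rate_sq)
      qed simp
    next
      case 2
      show ?thesis
      proof (rule that[of "1 / 2 + 1 + 1 / (2 * c)"])
        fix t :: real assume t: "t \<ge> exp 1"
        then have t1: "t \<ge> 1" using exp_ge_add_one_self[of 1] by linarith
        have l: "ln t \<ge> 1" using t t1 by (subst ln_ge_iff) auto
        have "1 / 2 + ln t + 1 / (2 * c) \<le> 1 / 2 * ln t + ln t + 1 / (2 * c) * ln t"
          using l c by (intro add_mono) (auto simp: divide_right_mono)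
        also have "\<dots> = (1 / 2 + 1 + 1 / (2 * c)) * (rate ?n t)\<^sup>2" using t1 2 by (simp add: rate_sq algebra_simps)
        finally have b: "1 / 2 + ln t + 1 / (2 * c) \<le> (1 / 2 + 1 + 1 / (2 * c)) * (rate ?n t)\<^sup>2" .
        show "(\<integral>\<^sup>+r. ennreal (indicator {0..} r * (r ^ (?n - 1) * low_weight c t r)) \<partial>lborel) \<le> ennreal ((1 / 2 + 1 + 1 / (2 * c)) * (rate ?n t)\<^sup>2)"
          using order_trans[OF nn_radial_weight_dim2[OF t1 c] ennreal_leI[OF b]] 2 by simp
      qed (use c in simp)
    next
      case 3
      obtain J where J: "\<And>t. t > 0 \<Longrightarrow> (\<integral>\<^sup>+r. ennreal (indicator {0..} r * (r ^ (?n - 3 + 2) * low_weight c t r)) \<partial>lborel) \<le> ennreal (J * t powr (- real (?n - 3 + 1) / 2))" "J \<ge> 0"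
        by (rule nn_radial_weight_dim3[OF c, of "?n - 3"]) (rule that; assumption)
      show ?thesis
      proof (rule that[OF J(2)])
        fix t :: real assume t: "t \<ge> exp 1"
        then have t1: "t \<ge> 1" using exp_ge_add_one_self[of 1] by linarith
        have e: "- real (?n - 3 + 1) / 2 = 1 - real ?n / 2" using 3 by (simp add: of_nat_diff field_simps)
        have e2: "?n - 3 + 2 = ?n - 1" using 3 by simp
        have "(rate ?n t)\<^sup>2 = t powr (1 - real ?n / 2)" using t1 3 by (simp add: rate_sq)
        then show "(\<integral>\<^sup>+r. ennreal (indicator {0..} r * (r ^ (?n - 1) * low_weight c t r)) \<partial>lborel) \<le> ennreal (J * (rate ?n t)\<^sup>2)"
          using J(1)[of t] t1 unfolding e e2 by simp
      qed
    qed
  qed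
  have e1: "exp 1 \<ge> (1::real)" by simp
  \<comment> \<open>The summand 1 keeps the constant positive even if B = 0.\<close>
  have main: "(\<integral>\<^sup>+\<xi>. ennreal (low_weight c t (norm \<xi>)) \<partial>(lborel :: (real^'n) measure)) \<le> ennreal ((K * B + 1) * (rate ?n t)\<^sup>2)"
    if t: "t \<ge> exp 1" for t
  proof -
    have "(\<integral>\<^sup>+\<xi>. ennreal (low_weight c t (norm \<xi>)) \<partial>(lborel :: (real^'n) measure)) \<le> ennreal K * ennreal (B * (rate ?n t)\<^sup>2)"
      unfolding nn_integral_radial_real[of "low_weight c t", OF low_weight_measurable low_weight_nonneg] K_def
      by (rule mult_left_mono[OF B(2)[OF t] zero_le])
    also have "\<dots> = ennreal (K * B * (rate ?n t)\<^sup>2)" using K B(1) by (simp add: ennreal_mult[symmetric] mult.assoc)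
    also have "\<dots> \<le> ennreal ((K * B + 1) * (rate ?n t)\<^sup>2)" by (intro ennreal_leI mult_right_mono) auto
    finally show ?thesis .
  qed
  have nn: "0 \<le> (K * B + 1) * (rate ?n t)\<^sup>2" for t using K B(1) by simp
  show thesis
    by (rule that[OF _ e1 integrable_of_nn_bound(1)[OF _ _ main nn] integrable_of_nn_bound(2)[OF _ _ main nn]])
       (use K B(1) in \<open>auto intro: add_nonneg_pos\<close>)
qed

section \<open>Lower bounds for oscillating weights on annuli\<close>

lemma nn_log_average:
  fixes q :: "real \<Rightarrow> real"
  assumes [measurable]: "q \<in> borel_measurable borel" and q0: "\<And>s. 0 \<le> q s" and p: "p > 0"
    and q1: "\<And>s. 1 \<le> q s + q (s + p)" and A: "A \<ge> 1"
  shows "ennreal (ln A) \<le> ennreal (2 + p) * (\<integral>\<^sup>+s. ennreal (indicator {1..A + p} s * (q s / s)) \<partial>lborel)"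
proof -
  let ?g = "\<lambda>s. indicator {1..A + p} s * (q s / s)"
  have g0: "0 \<le> ?g s" for s using q0 by (auto simp: indicator_def)
  have "ennreal (ln A) = ennreal (ln A - ln 1)" by simp
  also have "\<dots> = (\<integral>\<^sup>+s. ennreal (1 / s) * indicator {1..A} s \<partial>lborel)"
    by (rule nn_integral_FTC_Icc[where F = ln, symmetric]) (use A in \<open>auto intro!: derivative_eq_intros\<close>)
  \<comment> \<open>By \<open>q1\<close> the weight cannot be small at s and s + p at once, so 1/s
    is shared between the two points. The share at s + p is moved there by s + p \<le> (1 + p) s,
    valid for s \<ge> 1, and a translation brings back the same integral: in total 1 + (1 +
    p).\<close>
  also have "\<dots> \<le> (\<integral>\<^sup>+s. ennreal (?g s) + ennreal ((1 + p) * ?g (p + 1 * s)) \<partial>lborel)"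
  proof (rule nn_integral_mono)
    fix s :: real
    show "ennreal (1 / s) * indicator {1..A} s \<le> ennreal (?g s) + ennreal ((1 + p) * ?g (p + 1 * s))"
    proof (cases "1 \<le> s \<and> s \<le> A")
      case True
      have "q (s + p) / s \<le> (1 + p) * (q (s + p) / (s + p))"
      proof -
        have "p * 1 \<le> p * s" using True p by (intro mult_left_mono) auto
        then have "1 / s \<le> (1 + p) / (s + p)" using True p by (simp add: divide_le_eq le_divide_eq field_simps)
        then have "q (s + p) * (1 / s) \<le> q (s + p) * ((1 + p) / (s + p))" by (rule mult_left_mono) (rule q0)
        then show ?thesis by (simp add: mult_ac)
      qed
      moreover have "1 / s \<le> (q s + q (s + p)) / s" using q1 True by (intro divide_right_mono) auto
      ultimately have "1 / s \<le> q s / s + (1 + p) * (q (s + p) / (s + p))" by (simp add: add_divide_distrib)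
      then have "1 / s \<le> ?g s + (1 + p) * ?g (p + 1 * s)" using True p by (simp add: add.commute)
      then have "ennreal (1 / s) \<le> ennreal (?g s + (1 + p) * ?g (p + 1 * s))" by (rule ennreal_leI)
      also have "\<dots> = ennreal (?g s) + ennreal ((1 + p) * ?g (p + 1 * s))"
        by (rule ennreal_plus, rule g0, rule mult_nonneg_nonneg[OF _ g0]) (use p in simp)
      finally show ?thesis using True by simp
    qed (auto simp: indicator_def)
  qed
  also have "\<dots> = (\<integral>\<^sup>+s. ennreal (?g s) \<partial>lborel) + (\<integral>\<^sup>+s. ennreal ((1 + p) * ?g (p + 1 * s)) \<partial>lborel)"
    by (rule nn_integral_add) auto
  also have "(\<integral>\<^sup>+s. ennreal ((1 + p) * ?g (p + 1 * s)) \<partial>lborel) = (\<integral>\<^sup>+s. ennreal ((1 + p) * ?g s) \<partial>lborel)"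
    using nn_integral_real_affine[of "\<lambda>s. ennreal ((1 + p) * ?g s)" 1 p] by simp
  also have "\<dots> = ennreal (1 + p) * (\<integral>\<^sup>+s. ennreal (?g s) \<partial>lborel)"
  proof -
    have "ennreal ((1 + p) * ?g s) = ennreal (1 + p) * ennreal (?g s)" for s
      by (rule ennreal_mult[OF _ g0]) (use p in simp)
    then show ?thesis by (simp only:) (rule nn_integral_cmult, measurable)
  qed
  also have "(\<integral>\<^sup>+s. ennreal (?g s) \<partial>lborel) + ennreal (1 + p) * (\<integral>\<^sup>+s. ennreal (?g s) \<partial>lborel)
     = (1 + ennreal (1 + p)) * (\<integral>\<^sup>+s. ennreal (?g s) \<partial>lborel)" by (simp add: distrib_right)
  also have "1 + ennreal (1 + p) = ennreal (2 + p)"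
    using ennreal_plus[of 1 "1 + p"] p by simp
  finally show ?thesis .
qed

text \<open>The upper end t^(-3/4) is a compromise. It makes r^2 t at most t^(-1/2), so that the
  exponentials tend to 1 uniformly on the annulus, and still lets r t run from 1 to t^(1/4), which
  is enough for a fixed fraction of ln t in dimension two. In dimension one the piece 1 \<le> r t
  \<le> 3/2 already gives the order t.\<close>

theorem low_dim_lower_bound:
  fixes q :: "real \<Rightarrow> real"
  assumes [measurable]: "q \<in> borel_measurable borel" and q0: "\<And>s. 0 \<le> q s" and p: "p > 0"
    and q1: "\<And>s. 1 \<le> q s + q (s + p)" and a: "a > 0" "\<And>s. 1 \<le> s \<Longrightarrow> s \<le> 3 / 2 \<Longrightarrow> a \<le> q s"
    and n: "CARD('n) \<in> {1, 2}"
  obtains c T where "c > 0" "\<And>t. t \<ge> T \<Longrightarrow> ennreal (c * (rate CARD('n) t)\<^sup>2) \<le>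
    (\<integral>\<^sup>+\<xi>. ennreal (indicator {1 / t..t powr (- 3 / 4)} (norm \<xi>) * (q (norm \<xi> * t) / (norm \<xi>)\<^sup>2)) \<partial>(lborel :: (real^'n) measure))"
proof -
  let ?n = "CARD('n)"
  define K where "K = sphere_area ?n"
  have K: "K > 0" unfolding K_def by (rule sphere_area_pos) simp
  let ?f = "\<lambda>t r. indicator {1 / t..t powr (- 3 / 4)} r * (q (r * t) / r\<^sup>2)"
  have rad: "(\<integral>\<^sup>+\<xi>. ennreal (?f t (norm \<xi>)) \<partial>(lborel :: (real^'n) measure))
     = ennreal K * (\<integral>\<^sup>+r. ennreal (indicator {0..} r * (r ^ (?n - 1) * ?f t r)) \<partial>lborel)" for t
    unfolding K_def by (rule nn_integral_radial_real) (auto simp: indicator_def q0)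
  from n consider "?n = 1" | "?n = 2" by auto
  then show thesis
  proof cases
    case 1
    show ?thesis
    \<comment> \<open>For 1 \<le> r t \<le> 3/2 the integrand is at least 4/9 a t^2 on an interval
      of length 1/(2 t). As 6 exceeds (3/2)^4, this interval lies inside the annulus.\<close>
    proof (rule that[of "K * (2 / 9 * a)" 6])
      fix t :: real assume t: "t \<ge> 6"
      have pw: "3 / 2 * (1 / t) \<le> t powr (- 3 / 4)"
      proof -
        have "(3 / 2 :: real) = ((3 / 2) powr 4) powr (1 / 4)" by (simp only: powr_powr) simp
        also have "\<dots> \<le> t powr (1 / 4)" using t by (intro powr_mono2) (auto simp: power4_eq_xxxx)
        finally have "3 / 2 * (1 / t) \<le> t powr (1 / 4) * (1 / t)" using t by (intro mult_right_mono) auto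
        also have "\<dots> = t powr (1 / 4) * t powr (- 1)" using t by (simp add: powr_minus_divide)
        also have "\<dots> = t powr (- 3 / 4)" by (subst powr_add[symmetric]) simp
        finally show ?thesis .
      qed
      have "ennreal (2 / 9 * a * t) = ennreal (4 / 9 * a * t\<^sup>2) * emeasure lborel {1 / t..3 / 2 * (1 / t)}"
      proof -
        have "emeasure lborel {1 / t..3 / 2 * (1 / t)} = ennreal (1 / 2 * (1 / t))"
          using t by (subst emeasure_lborel_Icc) (auto simp: field_simps)
        then show ?thesis using t a by (simp add: ennreal_mult[symmetric] power2_eq_square)
      qed
      also have "\<dots> = (\<integral>\<^sup>+r. ennreal (4 / 9 * a * t\<^sup>2) * indicator {1 / t..3 / 2 * (1 / t)} r \<partial>lborel)"
        by (simp add: nn_integral_cmult_indicator)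
      also have "\<dots> \<le> (\<integral>\<^sup>+r. ennreal (indicator {0..} r * (r ^ (?n - 1) * ?f t r)) \<partial>lborel)"
      proof (rule nn_integral_mono)
        fix r :: real
        show "ennreal (4 / 9 * a * t\<^sup>2) * indicator {1 / t..3 / 2 * (1 / t)} r \<le> ennreal (indicator {0..} r * (r ^ (?n - 1) * ?f t r))"
        proof (cases "1 / t \<le> r \<and> r \<le> 3 / 2 * (1 / t)")
          case True
          have "0 < 1 / t" using t by simp
          then have r0: "r > 0" using True by linarith
          have rt: "1 \<le> r * t" "r * t \<le> 3 / 2" using True t by (auto simp: field_simps)
          have "(r * t)\<^sup>2 \<le> (3 / 2)\<^sup>2" using rt by (intro power_mono) auto
          then have "4 / 9 * t\<^sup>2 \<le> 1 / r\<^sup>2" using r0 by (simp add: field_simps power2_eq_square)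
          then have "a * (4 / 9 * t\<^sup>2) \<le> q (r * t) * (1 / r\<^sup>2)" using a rt by (intro mult_mono) (auto simp: q0)
          then show ?thesis using True r0 1 pw by (auto intro!: ennreal_leI simp: mult_ac)
        next
          case False
          then have "indicator {1 / t..3 / 2 * (1 / t)} r = (0 :: ennreal)" unfolding indicator_def by auto
          then show ?thesis by simp
        qed
      qed
      finally have "ennreal K * ennreal (2 / 9 * a * t) \<le> (\<integral>\<^sup>+\<xi>. ennreal (?f t (norm \<xi>)) \<partial>(lborel :: (real^'n) measure))"
        unfolding rad by (rule mult_left_mono) simp
      then show "ennreal (K * (2 / 9 * a) * (rate ?n t)\<^sup>2) \<le> (\<integral>\<^sup>+\<xi>. ennreal (?f t (norm \<xi>)) \<partial>(lborel :: (real^'n) measure))"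
        using K a t 1 by (simp add: rate_sq ennreal_mult[symmetric] mult.assoc)
    qed (use K a in simp)
  next
    case 2
    \<comment> \<open>In the variable s = r t the range must end at A + p = t^(1/4). For large t, A
      is at least t^(1/8), so ln A \<ge> ln t / 8.\<close>
    have "eventually (\<lambda>t::real. t powr (1 / 4) - p \<ge> t powr (1 / 8) \<and> t \<ge> 1) at_top"
      using p by (intro eventually_conj eventually_ge_at_top) real_asymp
    then obtain T where T: "\<And>t. t \<ge> T \<Longrightarrow> t powr (1 / 4) - p \<ge> t powr (1 / 8) \<and> t \<ge> 1"
      unfolding eventually_at_top_linorder by blast
    show ?thesis
    proof (rule that[of "K / (8 * (2 + p))" T])
      fix t :: real assume tT: "t \<ge> T"
      define A where "A = t powr (1 / 4) - p"
      have t: "t \<ge> 1" and At: "A \<ge> t powr (1 / 8)" using T[OF tT] by (auto simp: A_def)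
      have "t powr (1 / 8) \<ge> 1" using t by (simp add: ge_one_powr_ge_zero)
      then have A: "A \<ge> 1" using At by linarith
      have lnA: "ln t / 8 \<le> ln A"
      proof -
        have "ln (t powr (1 / 8)) \<le> ln A" using At t A by (subst ln_le_cancel_iff) auto
        then show ?thesis using t by (simp add: ln_powr)
      qed
      have cov: "(\<integral>\<^sup>+r. ennreal (indicator {0..} r * (r ^ (?n - 1) * ?f t r)) \<partial>lborel)
         = (\<integral>\<^sup>+s. ennreal (indicator {1..A + p} s * (q s / s)) \<partial>lborel)"
      proof -
        have "(\<integral>\<^sup>+s. ennreal (indicator {1..A + p} s * (q s / s)) \<partial>lborel)
          = ennreal t * (\<integral>\<^sup>+r. ennreal (indicator {1..A + p} (0 + t * r) * (q (0 + t * r) / (0 + t * r))) \<partial>lborel)"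
          using t by (subst nn_integral_real_affine[where c = t and t = 0]) auto
        also have "\<dots> = (\<integral>\<^sup>+r. ennreal t * ennreal (indicator {1..A + p} (0 + t * r) * (q (0 + t * r) / (0 + t * r))) \<partial>lborel)"
          by (rule nn_integral_cmult[symmetric]) measurable
        also have "\<dots> = (\<integral>\<^sup>+r. ennreal (indicator {0..} r * (r ^ (?n - 1) * ?f t r)) \<partial>lborel)"
        proof (rule nn_integral_cong)
          fix r :: real
          have pp: "t powr (1 / 4) = t * t powr (- 3 / 4)"
            using t powr_add[of t 1 "- 3 / 4"] by simp
          have i: "1 \<le> t * r \<and> t * r \<le> A + p \<longleftrightarrow> 0 \<le> r \<and> 1 / t \<le> r \<and> r \<le> t powr (- 3 / 4)"
          proof -
            have "0 < 1 / t" using t by simp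
            then have "1 / t \<le> r \<Longrightarrow> 0 \<le> r" by linarith
            then show ?thesis unfolding A_def using t pp by (auto simp: field_simps)
          qed
          show "ennreal t * ennreal (indicator {1..A + p} (0 + t * r) * (q (0 + t * r) / (0 + t * r))) = ennreal (indicator {0..} r * (r ^ (?n - 1) * ?f t r))"
          proof (cases "1 \<le> t * r \<and> t * r \<le> A + p")
            case True
            have r0: "r > 0" using True t by (metis less_le_not_le linorder_not_le mult_nonneg_nonpos not_one_le_zero order_trans zero_less_one order_less_le_trans)
            show ?thesis using True i t r0 2 q0[of "t * r"]
              by (subst ennreal_mult[symmetric]) (auto simp: power2_eq_square mult.commute)
          qed (use i in \<open>auto simp: indicator_def\<close>)
        qed
        finally show ?thesis by simp
      qed
      have "ennreal (ln t / 8) \<le> ennreal (ln A)" by (rule ennreal_leI[OF lnA])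
      also have "\<dots> \<le> ennreal (2 + p) * (\<integral>\<^sup>+s. ennreal (indicator {1..A + p} s * (q s / s)) \<partial>lborel)"
        by (rule nn_log_average[OF assms(1) q0 p q1 A])
      finally have "ennreal (K / (2 + p)) * ennreal (ln t / 8) \<le> ennreal (K / (2 + p)) * (ennreal (2 + p) * (\<integral>\<^sup>+r. ennreal (indicator {0..} r * (r ^ (?n - 1) * ?f t r)) \<partial>lborel))"
        unfolding cov by (rule mult_left_mono) simp
      also have "\<dots> = ennreal K * (\<integral>\<^sup>+r. ennreal (indicator {0..} r * (r ^ (?n - 1) * ?f t r)) \<partial>lborel)"
      proof -
        have "ennreal (K / (2 + p)) * ennreal (2 + p) = ennreal (K / (2 + p) * (2 + p))"
          by (rule ennreal_mult'[symmetric]) (use K p in simp)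
        also have "K / (2 + p) * (2 + p) = K" using p by simp
        finally show ?thesis by (simp only: mult.assoc[symmetric])
      qed
      finally show "ennreal (K / (8 * (2 + p)) * (rate ?n t)\<^sup>2) \<le> (\<integral>\<^sup>+\<xi>. ennreal (?f t (norm \<xi>)) \<partial>(lborel :: (real^'n) measure))"
        unfolding rad using K p t 2 by (simp add: rate_sq ennreal_mult[symmetric] mult_ac)
    qed (use K p in simp)
  qed
qed

text \<open>On this annulus r^(n-3) is bounded below by its value at the inner radius, and sin^2 (r
  t) oscillates so fast that its explicit primitive r/2 - sin (2 r t)/(4 t) shows the mean
  1/2.\<close>

theorem high_dim_lower_bound:
  assumes ab: "0 < a" "a < b" and n: "CARD('n) \<ge> 3"
  obtains c T where "c > 0" "\<And>t. t \<ge> T \<Longrightarrow> ennreal (c * (rate CARD('n) t)\<^sup>2) \<le>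
    (\<integral>\<^sup>+\<xi>. ennreal (indicator {a / sqrt t..b / sqrt t} (norm \<xi>) * ((sin (norm \<xi> * t))\<^sup>2 / (norm \<xi>)\<^sup>2)) \<partial>(lborel :: (real^'n) measure))"
proof -
  let ?n = "CARD('n)"
  define K where "K = sphere_area ?n"
  have K: "K > 0" unfolding K_def by (rule sphere_area_pos) simp
  let ?f = "\<lambda>t r. indicator {a / sqrt t..b / sqrt t} r * ((sin (r * t))\<^sup>2 / r\<^sup>2)"
  have rad: "(\<integral>\<^sup>+\<xi>. ennreal (?f t (norm \<xi>)) \<partial>(lborel :: (real^'n) measure))
     = ennreal K * (\<integral>\<^sup>+r. ennreal (indicator {0..} r * (r ^ (?n - 1) * ?f t r)) \<partial>lborel)" for t
    unfolding K_def by (rule nn_integral_radial_real) (auto simp: indicator_def)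
  define m where "m = ?n - 3"
  have nm: "?n - 1 = m + 2" "real ?n = real m + 3" using n by (auto simp: m_def)
  \<comment> \<open>The oscillating part of the primitive changes by at most 1/(2 t); sqrt t \<ge>
    2/(b - a) makes this at most half of the main increment (b - a)/(2 sqrt t).\<close>
  define T where "T = max 1 ((2 / (b - a))\<^sup>2)"
  show thesis
  proof (rule that[of "K * (a ^ m * (b - a) / 4)" T])
    show "0 < K * (a ^ m * (b - a) / 4)" using K ab by simp
    fix t :: real assume tT: "t \<ge> T"
    then have t: "t \<ge> 1" by (simp add: T_def)
    define s where "s = sqrt t"
    have s: "s > 0" "s * s = t" using t by (auto simp: s_def)
    have sT: "s \<ge> 2 / (b - a)"
    proof -
      have "(2 / (b - a))\<^sup>2 \<le> t" using tT by (simp add: T_def)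
      then have "sqrt ((2 / (b - a))\<^sup>2) \<le> s" unfolding s_def by (rule real_sqrt_le_mono)
      then show ?thesis using ab by simp
    qed
    let ?F = "\<lambda>r. r / 2 - sin (2 * (r * t)) / (4 * t)"
    have F: "(b - a) / (4 * s) \<le> ?F (b / s) - ?F (a / s)"
    proof -
      have "1 / (2 * t) \<le> (b - a) / (4 * s)"
        using sT ab s t by (simp add: field_simps flip: s(2))
      moreover have "sin (2 * (b / s * t)) / (4 * t) \<le> 1 / (4 * t)" "- 1 / (4 * t) \<le> sin (2 * (a / s * t)) / (4 * t)"
        using t by (intro divide_right_mono; simp)+
      moreover have "(b - a) / (2 * s) = (b - a) / (4 * s) + (b - a) / (4 * s)" using s by (simp add: field_simps)
      moreover have "b / s / 2 - a / s / 2 = (b - a) / (2 * s)" by (simp add: diff_divide_distrib)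
      moreover have "1 / (2 * t) = 1 / (4 * t) + 1 / (4 * t)" using t by (simp add: field_simps)
      ultimately show ?thesis by linarith
    qed
    have "ennreal ((a / s) ^ m * ((b - a) / (4 * s))) \<le> ennreal ((a / s) ^ m * (?F (b / s) - ?F (a / s)))"
      using F s ab by (intro ennreal_leI mult_left_mono) auto
    also have "\<dots> = ennreal ((a / s) ^ m) * ennreal (?F (b / s) - ?F (a / s))"
      using s ab by (intro ennreal_mult') simp
    also have "ennreal (?F (b / s) - ?F (a / s)) = (\<integral>\<^sup>+r. ennreal ((sin (r * t))\<^sup>2) * indicator {a / s..b / s} r \<partial>lborel)"
    proof (rule nn_integral_FTC_Icc[where F = ?F, symmetric])
      fix r
      have "(sin (r * t))\<^sup>2 = 1 / 2 - cos (2 * (r * t)) / 2"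
        by (simp add: cos_double_sin diff_divide_distrib)
      then show "(?F has_real_derivative (sin (r * t))\<^sup>2) (at r)"
        using t by (auto intro!: derivative_eq_intros)
    qed (use s ab in \<open>auto intro: divide_right_mono\<close>)
    also have "ennreal ((a / s) ^ m) * \<dots> = (\<integral>\<^sup>+r. ennreal ((a / s) ^ m) * (ennreal ((sin (r * t))\<^sup>2) * indicator {a / s..b / s} r) \<partial>lborel)"
      by (rule nn_integral_cmult[symmetric]) measurable
    also have "\<dots> \<le> (\<integral>\<^sup>+r. ennreal (indicator {0..} r * (r ^ (?n - 1) * ?f t r)) \<partial>lborel)"
    proof (rule nn_integral_mono)
      fix r :: real
      show "ennreal ((a / s) ^ m) * (ennreal ((sin (r * t))\<^sup>2) * indicator {a / s..b / s} r) \<le> ennreal (indicator {0..} r * (r ^ (?n - 1) * ?f t r))"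
      proof (cases "a / s \<le> r \<and> r \<le> b / s")
        case True
        have "0 < a / s" using s ab by simp
        then have r0: "r > 0" using True by linarith
        have "(a / s) ^ m * (sin (r * t))\<^sup>2 \<le> r ^ m * (sin (r * t))\<^sup>2"
          using True s ab by (intro mult_right_mono power_mono) auto
        also have "\<dots> = r ^ (m + 2) * ((sin (r * t))\<^sup>2 / r\<^sup>2)" using r0 by (simp add: power_add power2_eq_square)
        finally show ?thesis using True r0 s ab unfolding nm(1) s_def[symmetric]
          by (auto simp: ennreal_mult[symmetric] intro!: ennreal_leI)
      qed (auto simp: indicator_def)
    qed
    finally have "ennreal K * ennreal ((a / s) ^ m * ((b - a) / (4 * s))) \<le> (\<integral>\<^sup>+\<xi>. ennreal (?f t (norm \<xi>)) \<partial>(lborel :: (real^'n) measure))"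
      unfolding rad by (rule mult_left_mono) simp
    moreover have "K * ((a / s) ^ m * ((b - a) / (4 * s))) = K * (a ^ m * (b - a) / 4) * (rate ?n t)\<^sup>2"
    proof -
      have "(rate ?n t)\<^sup>2 = t powr (- (real m + 1) / 2)" using t n nm(2) by (simp add: rate_sq field_simps)
      also have "\<dots> = (t powr (1 / 2)) powr (- real (m + 1))" by (simp add: powr_powr field_simps)
      also have "\<dots> = 1 / s ^ (m + 1)" using s t by (simp only: powr_minus_divide powr_realpow powr_half_sqrt s_def[symmetric])
      finally have "(rate ?n t)\<^sup>2 = 1 / s ^ (m + 1)" .
      then show ?thesis using s by (simp add: power_divide)
    qed
    ultimately show "ennreal (K * (a ^ m * (b - a) / 4) * (rate ?n t)\<^sup>2) \<le> (\<integral>\<^sup>+\<xi>. ennreal (?f t (norm \<xi>)) \<partial>(lborel :: (real^'n) measure))"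
      by (simp only: ennreal_mult'[symmetric, OF less_imp_le[OF K]])
  qed
qed

section \<open>The characteristic cubic\<close>

lemma has_vector_derivative_scaleR_const:
  "(f has_real_derivative f') F \<Longrightarrow> ((\<lambda>t. f t *\<^sub>R a) has_vector_derivative f' *\<^sub>R a) F"
  unfolding has_real_derivative_iff_has_vector_derivative
  by (rule bounded_linear.has_vector_derivative[OF bounded_linear_scaleR_left])

lemma constant_of_zero_derivative:
  fixes f :: "real \<Rightarrow> complex"
  assumes c: "continuous_on {0..} f" and d: "\<And>t. t > 0 \<Longrightarrow> (f has_vector_derivative 0) (at t)" and t: "t \<ge> 0"
  shows "f t = f 0"
proof (cases "t = 0")
  case False
  have c': "continuous_on {0..t} f" using c by (rule continuous_on_subset) auto
  have "Re (f t) = Re (f 0)"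
  proof (rule DERIV_isconst_end[where f = "\<lambda>x. Re (f x)"])
    show "((\<lambda>x. Re (f x)) has_real_derivative 0) (at x)" if "0 < x" "x < t" for x
      using bounded_linear.has_vector_derivative[OF bounded_linear_Re d[OF that(1)]]
      by (simp add: has_real_derivative_iff_has_vector_derivative)
  qed (use False t c' in \<open>auto intro: continuous_intros\<close>)
  moreover have "Im (f t) = Im (f 0)"
  proof (rule DERIV_isconst_end[where f = "\<lambda>x. Im (f x)"])
    show "((\<lambda>x. Im (f x)) has_real_derivative 0) (at x)" if "0 < x" "x < t" for x
      using bounded_linear.has_vector_derivative[OF bounded_linear_Im d[OF that(1)]]
      by (simp add: has_real_derivative_iff_has_vector_derivative)
  qed (use False t c' in \<open>auto intro: continuous_intros\<close>)
  ultimately show ?thesis by (simp add: complex_eq_iff)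
qed simp

section \<open>Damped oscillators\<close>

definition damped_oscillator :: "real \<Rightarrow> real \<Rightarrow> (real \<Rightarrow> complex) \<Rightarrow> (real \<Rightarrow> complex) \<Rightarrow> bool" where
  "damped_oscillator p q Y V \<longleftrightarrow>
     (\<forall>t\<ge>0. (Y has_vector_derivative V t) (at t within {0..}) \<and>
            (V has_vector_derivative - (p *\<^sub>R V t) - q *\<^sub>R Y t) (at t within {0..}))"

text \<open>The functional \<open>|V|\<^sup>2 + |V + p Y|\<^sup>2 + 2 q |Y|\<^sup>2\<close> has derivative \<open>- 2 p (|V|\<^sup>2 + q |Y|\<^sup>2)\<close>: the
  mixed terms cancel.\<close>

lemma damped_oscillator_energy:
  assumes osc: "damped_oscillator p q Y V" and p: "p > 0" and q: "q > 0" and c0: "c \<ge> 0"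
    and c1: "3 * c \<le> p" and c2: "c * (2 * p\<^sup>2 + 2 * q) \<le> p * q" and t: "t \<ge> 0"
  shows "2 * q * (norm (Y t))\<^sup>2 \<le> exp (- (2 * c * t)) * (3 * (norm (V 0))\<^sup>2 + (2 * p\<^sup>2 + 2 * q) * (norm (Y 0))\<^sup>2)"
proof -
  define En where "En t = V t \<bullet> V t + (V t + p *\<^sub>R Y t) \<bullet> (V t + p *\<^sub>R Y t) + 2 * q * (Y t \<bullet> Y t)" for t
  have dY: "(Y has_vector_derivative V t) (at t within {0..})"
    and dV: "(V has_vector_derivative - (p *\<^sub>R V t) - q *\<^sub>R Y t) (at t within {0..})" if "t \<ge> 0" for t
    using osc that by (auto simp: damped_oscillator_def)
  have cY: "continuous_on {0..} Y" and cV: "continuous_on {0..} V"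
    using dY dV by (auto intro!: continuous_on_vector_derivative)
  have upper: "En t \<le> 3 * (norm (V t))\<^sup>2 + (2 * p\<^sup>2 + 2 * q) * (norm (Y t))\<^sup>2" for t
  proof -
    have "2 * (V t \<bullet> (p *\<^sub>R Y t)) \<le> V t \<bullet> V t + (p *\<^sub>R Y t) \<bullet> (p *\<^sub>R Y t)"
      using inner_ge_zero[of "V t - p *\<^sub>R Y t"] by (simp only: inner_diff_left inner_diff_right) (simp add: inner_commute)
    then show ?thesis unfolding En_def power2_norm_eq_inner
      by (simp add: inner_add_left inner_add_right inner_commute power2_eq_square algebra_simps)
  qed
  have dE: "((\<lambda>s. exp (2 * c * s) * En s) has_real_derivative
      exp (2 * c * t) * (2 * c * En t - 2 * p * ((norm (V t))\<^sup>2 + q * (norm (Y t))\<^sup>2))) (at t)" if t: "t > 0" for t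
  proof -
    have at: "at t within {0..} = at t" using t by (intro at_within_interior) simp
    have r1: "((\<lambda>t. Re (f t)) has_real_derivative Re f') (at t)" if "(f has_vector_derivative f') (at t within {0..})" for f f'
      using bounded_linear.has_vector_derivative[OF bounded_linear_Re that]
      unfolding at has_real_derivative_iff_has_vector_derivative .
    have r2: "((\<lambda>t. Im (f t)) has_real_derivative Im f') (at t)" if "(f has_vector_derivative f') (at t within {0..})" for f f'
      using bounded_linear.has_vector_derivative[OF bounded_linear_Im that]
      unfolding at has_real_derivative_iff_has_vector_derivative .
    note dr = r1[OF dY[OF less_imp_le[OF t]]] r2[OF dY[OF less_imp_le[OF t]]]
      r1[OF dV[OF less_imp_le[OF t]]] r2[OF dV[OF less_imp_le[OF t]]]
    have E: "En = (\<lambda>t. (Re (V t))\<^sup>2 + (Im (V t))\<^sup>2 + ((Re (V t) + p * Re (Y t))\<^sup>2 + (Im (V t) + p * Im (Y t))\<^sup>2)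
        + 2 * q * ((Re (Y t))\<^sup>2 + (Im (Y t))\<^sup>2))"
      by (rule ext) (simp add: En_def inner_complex_def power2_eq_square)
    have "(En has_real_derivative (- 2 * p * ((norm (V t))\<^sup>2 + q * (norm (Y t))\<^sup>2))) (at t)"
      unfolding E by (rule dr derivative_eq_intros refl)+ (unfold cmod_power2, simp add: power2_eq_square algebra_simps)
    then show ?thesis by (auto intro!: derivative_eq_intros simp: algebra_simps)
  qed
  have "exp (2 * c * t) * En t \<le> exp (2 * c * 0) * En 0"
  proof (cases "t = 0")
    case False
    show ?thesis
    proof (rule DERIV_nonpos_imp_decreasing_open[where f = "\<lambda>s. exp (2 * c * s) * En s"])
      fix s assume s: "0 < s" "s < t"
      \<comment> \<open>The hypotheses \<open>c1\<close> and \<open>c2\<close> say exactly that c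
        times the upper bound of the functional is at most half of the dissipation.\<close>
      have "c * En s \<le> c * (3 * (norm (V s))\<^sup>2 + (2 * p\<^sup>2 + 2 * q) * (norm (Y s))\<^sup>2)"
        by (rule mult_left_mono[OF upper c0])
      also have "\<dots> = 3 * c * (norm (V s))\<^sup>2 + c * (2 * p\<^sup>2 + 2 * q) * (norm (Y s))\<^sup>2" by (simp add: algebra_simps)
      also have "\<dots> \<le> p * (norm (V s))\<^sup>2 + p * q * (norm (Y s))\<^sup>2"
        by (intro add_mono mult_right_mono c1 c2) auto
      finally have "2 * c * En s - 2 * p * ((norm (V s))\<^sup>2 + q * (norm (Y s))\<^sup>2) \<le> 0" by (simp add: algebra_simps)
      then show "\<exists>y. ((\<lambda>s. exp (2 * c * s) * En s) has_real_derivative y) (at s) \<and> y \<le> 0"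
        using dE[OF s(1)] by (intro exI[of _ "exp (2 * c * s) * (2 * c * En s - 2 * p * ((norm (V s))\<^sup>2 + q * (norm (Y s))\<^sup>2))"])
          (auto simp: mult_nonneg_nonpos)
    next
      have "continuous_on {0..t} Y" "continuous_on {0..t} V" using cY cV by (auto elim: continuous_on_subset)
      then show "continuous_on {0..t} (\<lambda>s. exp (2 * c * s) * En s)" unfolding En_def by (intro continuous_intros)
    qed (use False t in auto)
  qed simp
  then have "En t \<le> exp (- (2 * c * t)) * En 0" by (simp add: exp_minus field_simps)
  also have "\<dots> \<le> exp (- (2 * c * t)) * (3 * (norm (V 0))\<^sup>2 + (2 * p\<^sup>2 + 2 * q) * (norm (Y 0))\<^sup>2)"
    by (intro mult_left_mono upper) simp
  finally show ?thesis unfolding En_def power2_norm_eq_inner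
    using inner_ge_zero[of "V t"] inner_ge_zero[of "V t + p *\<^sub>R Y t"] by linarith
qed

text \<open>The closed formula is verified to solve the system with the same initial data. The
  difference is again a solution, with zero data, and the energy inequality with c = 0 forces it to
  vanish.\<close>

lemma damped_oscillator_explicit:
  assumes osc: "damped_oscillator p q Y V" and p: "p > 0" and w: "w > 0" "w\<^sup>2 = q - p\<^sup>2 / 4" and t: "t \<ge> 0"
  shows "Y t = exp (- (p / 2 * t)) *\<^sub>R (cos (w * t) *\<^sub>R Y 0 + (sin (w * t) / w) *\<^sub>R (V 0 + (p / 2) *\<^sub>R Y 0))"
proof -
  have q: "q > 0" using w p by (metis add.commute add_pos_pos diff_add_cancel divide_pos_pos zero_less_numeral zero_less_power)
  define b where "b = (1 / w) *\<^sub>R (V 0 + (p / 2) *\<^sub>R Y 0)"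
  define f g where "f t = exp (- (p / 2 * t)) * cos (w * t)" and "g t = exp (- (p / 2 * t)) * sin (w * t)" for t
  define Z where "Z t = f t *\<^sub>R Y 0 + g t *\<^sub>R b" for t
  define a1 where "a1 = w *\<^sub>R b - (p / 2) *\<^sub>R Y 0"
  define a2 where "a2 = - ((p / 2) *\<^sub>R b) - w *\<^sub>R Y 0"
  define Z' where "Z' t = f t *\<^sub>R a1 + g t *\<^sub>R a2" for t
  have df: "(f has_real_derivative - (p / 2) * f t - w * g t) (at t within S)" for t S
    unfolding f_def g_def by (auto intro!: derivative_eq_intros simp: algebra_simps)
  have dg: "(g has_real_derivative - (p / 2) * g t + w * f t) (at t within S)" for t S
    unfolding f_def g_def by (auto intro!: derivative_eq_intros simp: algebra_simps)
  have dZ: "(Z has_vector_derivative Z' t) (at t within S)" for t S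
  proof -
    have "(Z has_vector_derivative (- (p / 2) * f t - w * g t) *\<^sub>R Y 0 + (- (p / 2) * g t + w * f t) *\<^sub>R b) (at t within S)"
      unfolding Z_def by (intro has_vector_derivative_add has_vector_derivative_scaleR_const df dg)
    then show ?thesis unfolding Z'_def a1_def a2_def by (simp add: algebra_simps)
  qed
  have dZ': "(Z' has_vector_derivative - (p *\<^sub>R Z' t) - q *\<^sub>R Z t) (at t within S)" for t S
  proof -
    have "(Z' has_vector_derivative (- (p / 2) * f t - w * g t) *\<^sub>R a1 + (- (p / 2) * g t + w * f t) *\<^sub>R a2) (at t within S)"
      unfolding Z'_def by (intro has_vector_derivative_add has_vector_derivative_scaleR_const df dg)
    moreover have "(- (p / 2) * f t - w * g t) *\<^sub>R a1 + (- (p / 2) * g t + w * f t) *\<^sub>R a2 = - (p *\<^sub>R Z' t) - q *\<^sub>R Z t"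
    proof -
      have qq: "q = w * w + p * p / 4" using w(2) by (simp add: power2_eq_square)
      show ?thesis unfolding Z'_def Z_def a1_def a2_def qq
        by (simp add: complex_eq_iff algebra_simps power2_eq_square)
    qed
    ultimately show ?thesis by simp
  qed
  have osc2: "damped_oscillator p q (\<lambda>t. Y t - Z t) (\<lambda>t. V t - Z' t)"
    unfolding damped_oscillator_def
  proof (intro allI impI conjI)
    fix t :: real assume "t \<ge> 0"
    then have Y: "(Y has_vector_derivative V t) (at t within {0..})"
      and V: "(V has_vector_derivative - (p *\<^sub>R V t) - q *\<^sub>R Y t) (at t within {0..})"
      using osc by (auto simp: damped_oscillator_def)
    show "((\<lambda>t. Y t - Z t) has_vector_derivative V t - Z' t) (at t within {0..})"
      by (rule has_vector_derivative_diff[OF Y dZ])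
    show "((\<lambda>t. V t - Z' t) has_vector_derivative - (p *\<^sub>R (V t - Z' t)) - q *\<^sub>R (Y t - Z t)) (at t within {0..})"
      using has_vector_derivative_diff[OF V dZ'[of t "{0..}"]] by (simp add: algebra_simps)
  qed
  have "Y 0 - Z 0 = 0" "V 0 - Z' 0 = 0"
    using w by (auto simp: Z_def Z'_def f_def g_def a1_def b_def)
  then have "2 * q * (norm (Y t - Z t))\<^sup>2 \<le> 0"
    using damped_oscillator_energy[OF osc2 p q, of 0 t] p q t by simp
  then have "Y t = Z t" using q by (simp add: mult_le_0_iff)
  then show ?thesis by (simp add: Z_def f_def g_def b_def scaleR_add_right mult.commute)
qed

text \<open>Only a combination of the derivatives is assumed differentiable; subtracting its
  differentiable parts shows that w itself is. The coefficient of v simplifies because \<kappa>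
  \<delta> + \<kappa> (\<gamma> - 1)(b \<nu> - \<kappa>) = \<kappa> \<gamma> b \<nu>.\<close>

lemma ode_solution_third_order:
  fixes \<gamma> b \<nu> \<kappa> x :: real
  defines "\<delta> \<equiv> dlt \<gamma> b \<nu> \<kappa>" and "\<beta> \<equiv> \<gamma> * b * \<nu>"
  assumes "ode_solution \<gamma> b \<nu> \<kappa> (- x) u0 u1 u2 u"
  obtains v w where "\<And>t. t \<ge> 0 \<Longrightarrow> (u has_vector_derivative v t) (at t within {0..})"
    "\<And>t. t \<ge> 0 \<Longrightarrow> (v has_vector_derivative w t) (at t within {0..})"
    "continuous_on {0..} w" "u 0 = u0" "v 0 = u1" "w 0 = u2"
    "\<And>t. t > 0 \<Longrightarrow> (w has_vector_derivative
        - (((\<kappa> + \<delta>) * x) *\<^sub>R w t) - (x + \<kappa> * \<beta> * x\<^sup>2) *\<^sub>R v t - (\<kappa> * x\<^sup>2) *\<^sub>R u t) (at t)"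
proof -
  from assms(3) obtain v w where d: "\<And>t. t \<ge> 0 \<Longrightarrow> (u has_vector_derivative v t) (at t within {0..})"
    "\<And>t. t \<ge> 0 \<Longrightarrow> (v has_vector_derivative w t) (at t within {0..})"
    "continuous_on {0..} w" "u 0 = u0" "v 0 = u1" "w 0 = u2"
    and e: "\<And>t. t > 0 \<Longrightarrow> \<exists>D. ((\<lambda>s. w s - (- x) *\<^sub>R u s - (\<delta> * (- x)) *\<^sub>R v s) has_vector_derivative D) (at t) \<and>
               D - (\<kappa> * (- x)) *\<^sub>R (w t - (- x) *\<^sub>R u t - (\<delta> * (- x)) *\<^sub>R v t)
                 + (\<kappa> * (\<gamma> - 1) * (b * \<nu> - \<kappa>) * (- x)\<^sup>2) *\<^sub>R v t = 0"
    unfolding ode_solution_def Let_def \<delta>_def by blast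
  show thesis
  proof (rule that[OF d])
    fix t :: real assume t: "t > 0"
    then have at: "at t within {0..} = at t" by (intro at_within_interior) simp
    obtain D where D: "((\<lambda>s. w s - (- x) *\<^sub>R u s - (\<delta> * (- x)) *\<^sub>R v s) has_vector_derivative D) (at t)"
      "D - (\<kappa> * (- x)) *\<^sub>R (w t - (- x) *\<^sub>R u t - (\<delta> * (- x)) *\<^sub>R v t)
                 + (\<kappa> * (\<gamma> - 1) * (b * \<nu> - \<kappa>) * (- x)\<^sup>2) *\<^sub>R v t = 0" using e[OF t] by blast
    have u': "((\<lambda>s. (- x) *\<^sub>R u s) has_vector_derivative (- x) *\<^sub>R v t) (at t)"
      using bounded_linear.has_vector_derivative[OF bounded_linear_scaleR_right d(1)[OF less_imp_le[OF t]], of "- x"]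
      unfolding at .
    have v': "((\<lambda>s. (\<delta> * (- x)) *\<^sub>R v s) has_vector_derivative (\<delta> * (- x)) *\<^sub>R w t) (at t)"
      using bounded_linear.has_vector_derivative[OF bounded_linear_scaleR_right d(2)[OF less_imp_le[OF t]], of "\<delta> * (- x)"]
      unfolding at .
    have "(w has_vector_derivative D + (- x) *\<^sub>R v t + (\<delta> * (- x)) *\<^sub>R w t) (at t)"
    proof -
      have "(\<lambda>s. w s - (- x) *\<^sub>R u s - (\<delta> * (- x)) *\<^sub>R v s + (- x) *\<^sub>R u s + (\<delta> * (- x)) *\<^sub>R v s) = w"
        by (rule ext) simp
      then show ?thesis using has_vector_derivative_add[OF has_vector_derivative_add[OF D(1) u'] v'] by (simp only:)
    qed
    moreover have "D = (\<kappa> * (- x)) *\<^sub>R (w t - (- x) *\<^sub>R u t - (\<delta> * (- x)) *\<^sub>R v t)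
                 - (\<kappa> * (\<gamma> - 1) * (b * \<nu> - \<kappa>) * (- x)\<^sup>2) *\<^sub>R v t"
      using D(2) by (simp add: algebra_simps add_eq_0_iff)
    then have "D + (- x) *\<^sub>R v t + (\<delta> * (- x)) *\<^sub>R w t =
        - (((\<kappa> + \<delta>) * x) *\<^sub>R w t) - (x + \<kappa> * \<beta> * x\<^sup>2) *\<^sub>R v t - (\<kappa> * x\<^sup>2) *\<^sub>R u t"
      by (simp add: complex_eq_iff \<delta>_def \<beta>_def dlt_def algebra_simps power2_eq_square)
    ultimately show "(w has_vector_derivative
        - (((\<kappa> + \<delta>) * x) *\<^sub>R w t) - (x + \<kappa> * \<beta> * x\<^sup>2) *\<^sub>R v t - (\<kappa> * x\<^sup>2) *\<^sub>R u t) (at t)"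
      by (simp only:)
  qed
qed

text \<open>The bound 4 \<kappa> < \<delta> makes the smallness of \<kappa> quantitative. In the
  application \<beta> is \<gamma> b \<nu>; \<delta> < \<beta> makes \<open>m1\<close> positive, on
  which the lower bounds for \<open>qq\<close> and \<open>dd\<close> rest.\<close>

locale mgt =
  fixes \<kappa> \<delta> \<beta> :: real
  assumes kpos: "0 < \<kappa>" and ksmall: "4 * \<kappa> < \<delta>" and db: "\<delta> < \<beta>"
begin

text \<open>Putting \<lambda> = - x s into the characteristic cubic \<lambda>^3 + (\<kappa> +
  \<delta>) x \<lambda>^2 + (x + \<kappa> \<beta> x^2) \<lambda> + \<kappa> x^2 and dividing by x^2
  leaves \<kappa> - s - x s \<open>msym s\<close>.\<close>

definition msym :: "real \<Rightarrow> real" where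
  "msym s = s\<^sup>2 - (\<delta> + \<kappa>) * s + \<kappa> * \<beta>"

text \<open>The minimum of \<open>msym\<close> over [0, \<kappa>], attained at \<kappa>. It is also
  the coefficient of x^2 in the small-x expansion of \<open>qq\<close>.\<close>

definition m1 :: real where "m1 = \<kappa> * (\<beta> - \<delta>)"

definition flow :: "real \<Rightarrow> (real \<Rightarrow> complex) \<Rightarrow> (real \<Rightarrow> complex) \<Rightarrow> (real \<Rightarrow> complex) \<Rightarrow> bool" where
  "flow x u v w \<longleftrightarrow> (\<forall>t\<ge>0. (u has_vector_derivative v t) (at t within {0..})) \<and>
     (\<forall>t\<ge>0. (v has_vector_derivative w t) (at t within {0..})) \<and> continuous_on {0..} w \<and>
     (\<forall>t>0. (w has_vector_derivative
        - (((\<kappa> + \<delta>) * x) *\<^sub>R w t) - (x + \<kappa> * \<beta> * x\<^sup>2) *\<^sub>R v t - (\<kappa> * x\<^sup>2) *\<^sub>R u t) (at t))"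

lemma m1_pos: "m1 > 0" using kpos db by (simp add: m1_def)

lemma msym_diff: "msym s - m1 = (\<kappa> - s) * (\<delta> - s)"
  by (simp add: msym_def m1_def power2_eq_square algebra_simps)

lemma msym_bounds:
  assumes "0 < s" "s < \<kappa>"
  shows "m1 \<le> msym s" "msym s \<le> \<kappa> * \<beta>"
proof -
  have "0 \<le> (\<kappa> - s) * (\<delta> - s)" using assms ksmall by (intro mult_nonneg_nonneg) auto
  then show "m1 \<le> msym s" using msym_diff[of s] by linarith
  have "s * (s - (\<delta> + \<kappa>)) \<le> 0" using assms kpos ksmall by (intro mult_nonneg_nonpos) auto
  then show "msym s \<le> \<kappa> * \<beta>" by (simp add: msym_def power2_eq_square algebra_simps)
qed

text \<open>Minus the real root of the characteristic cubic, divided by \<open>x = |\<xi>|\<^sup>2\<close>.\<close>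

lemma real_root_exists:
  assumes x: "x > 0"
  shows "\<exists>s. 0 < s \<and> s < \<kappa> \<and> \<kappa> - s = x * s * msym s"
proof -
  let ?g = "\<lambda>s. \<kappa> - s - x * s * msym s"
  have "\<exists>s\<ge>0. s \<le> \<kappa> \<and> ?g s = 0"
  proof (rule IVT2)
    have "msym \<kappa> = m1" using msym_diff[of \<kappa>] by simp
    then show "?g \<kappa> \<le> 0" using x kpos m1_pos by simp
    show "\<forall>s. 0 \<le> s \<and> s \<le> \<kappa> \<longrightarrow> isCont ?g s" unfolding msym_def by (intro allI impI continuous_intros)
  qed (use kpos in auto)
  then obtain s where s: "0 \<le> s" "s \<le> \<kappa>" "?g s = 0" by blast
  have "s \<noteq> 0" using s(3) kpos by auto
  moreover have "s \<noteq> \<kappa>"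
  proof
    assume "s = \<kappa>"
    then have "x * \<kappa> * m1 = 0" using s(3) msym_diff[of \<kappa>] by simp
    then show False using x kpos m1_pos by simp
  qed
  ultimately show ?thesis using s by (intro exI[of _ s]) auto
qed

definition rt :: "real \<Rightarrow> real" where
  "rt x = (SOME s. 0 < s \<and> s < \<kappa> \<and> \<kappa> - s = x * s * msym s)"

text \<open>The real root is - \<open>sg x\<close>, and \<lambda>^2 + \<open>pp x\<close> \<lambda>
  + \<open>qq x\<close> is the remaining quadratic factor. \<open>dd x\<close> is the value of that
  factor at the real root, the denominator in the projection onto the exponential mode.\<close>

definition sg :: "real \<Rightarrow> real" where "sg x = x * rt x"
definition pp :: "real \<Rightarrow> real" where "pp x = (\<delta> + \<kappa> - rt x) * x"
definition qq :: "real \<Rightarrow> real" where "qq x = x + x\<^sup>2 * msym (rt x)"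
definition dd :: "real \<Rightarrow> real" where "dd x = (sg x)\<^sup>2 - pp x * sg x + qq x"

section \<open>Factorisation at a fixed frequency\<close>

context
  fixes x :: real
  assumes x: "x > 0"
begin

lemma rt: "0 < rt x" "rt x < \<kappa>" "\<kappa> - rt x = x * rt x * msym (rt x)"
  using someI_ex[OF real_root_exists[OF x]] unfolding rt_def by auto

lemma sg_qq: "sg x * qq x = \<kappa> * x\<^sup>2"
proof -
  have "rt x + x * rt x * msym (rt x) = \<kappa>" using rt(3) by simp
  then have "x\<^sup>2 * (rt x + x * rt x * msym (rt x)) = x\<^sup>2 * \<kappa>" by simp
  then show ?thesis by (simp add: sg_def qq_def power2_eq_square algebra_simps)
qed

lemma pp_bounds: "\<delta> * x \<le> pp x" "pp x \<le> (\<delta> + \<kappa>) * x"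
  using rt x by (auto simp: pp_def intro!: mult_right_mono)

lemma qq_bounds: "x + m1 * x\<^sup>2 \<le> qq x" "qq x \<le> x + \<kappa> * \<beta> * x\<^sup>2"
  using mult_left_mono[OF msym_bounds(1)[OF rt(1,2)], of "x\<^sup>2"] mult_left_mono[OF msym_bounds(2)[OF rt(1,2)], of "x\<^sup>2"]
  by (auto simp: qq_def mult_ac)

lemma pp_pos: "pp x > 0"
  using pp_bounds(1) x ksmall kpos by (smt (verit) mult_pos_pos)

lemma qq_pos: "qq x > 0"
  using qq_bounds(1) x m1_pos by (smt (verit) mult_nonneg_nonneg zero_le_power2)

text \<open>Multiplication by s \<open>msym s\<close>, with s = \<open>rt x\<close>, allows the root
  equation to eliminate x from the bracket, which becomes \<kappa> m1 + (\<kappa> - s)^2 (\<delta> -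
  2 s). The last term is nonnegative because s < \<kappa> < \<delta>/4. The multiplier is removed by
  x s \<open>msym s\<close> = \<kappa> - s \<le> \<kappa>, so the bound is uniform over all
  frequencies.\<close>

lemma dd_lower: "m1 * x\<^sup>2 \<le> dd x"
proof -
  let ?s = "rt x"
  have d: "dd x = x + x\<^sup>2 * (3 * ?s\<^sup>2 - 2 * (\<delta> + \<kappa>) * ?s + \<kappa> * \<beta>)"
    by (simp add: dd_def sg_def pp_def qq_def msym_def power2_eq_square algebra_simps)
  have "dd x * (?s * msym ?s) = x * (?s * msym ?s + (x * ?s * msym ?s) * (3 * ?s\<^sup>2 - 2 * (\<delta> + \<kappa>) * ?s + \<kappa> * \<beta>))"
    unfolding d by (simp add: power2_eq_square algebra_simps)
  also have "\<dots> = x * (?s * msym ?s + (\<kappa> - ?s) * (3 * ?s\<^sup>2 - 2 * (\<delta> + \<kappa>) * ?s + \<kappa> * \<beta>))"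
    by (simp only: rt(3))
  also have "?s * msym ?s + (\<kappa> - ?s) * (3 * ?s\<^sup>2 - 2 * (\<delta> + \<kappa>) * ?s + \<kappa> * \<beta>)
     = \<kappa> * m1 + (\<kappa> - ?s)\<^sup>2 * (\<delta> - 2 * ?s)"
    by (simp add: msym_def m1_def power2_eq_square algebra_simps)
  finally have eq: "dd x * (?s * msym ?s) = x * (\<kappa> * m1 + (\<kappa> - ?s)\<^sup>2 * (\<delta> - 2 * ?s))" .
  have "\<kappa> * m1 \<le> \<kappa> * m1 + (\<kappa> - ?s)\<^sup>2 * (\<delta> - 2 * ?s)" using rt ksmall kpos by simp
  then have lb: "x * (\<kappa> * m1) \<le> dd x * (?s * msym ?s)" unfolding eq using x by (intro mult_left_mono) auto
  have smx: "x * (?s * msym ?s) \<le> \<kappa>" using rt by (simp add: mult.assoc)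
  have sm0: "0 < ?s * msym ?s" using rt msym_bounds[OF rt(1,2)] m1_pos by (intro mult_pos_pos) auto
  have "0 < dd x * (?s * msym ?s)" using lb x kpos m1_pos by (smt (verit) mult_pos_pos)
  then have d0: "0 < dd x" using sm0 by (simp add: zero_less_mult_iff)
  have "x * (x * (\<kappa> * m1)) \<le> x * (dd x * (?s * msym ?s))" using lb x by (intro mult_left_mono) auto
  also have "\<dots> = dd x * (x * (?s * msym ?s))" by (simp add: mult_ac)
  also have "\<dots> \<le> dd x * \<kappa>" using smx d0 by (intro mult_left_mono) auto
  finally have "\<kappa> * (m1 * x\<^sup>2) \<le> \<kappa> * dd x" by (simp add: power2_eq_square mult_ac)
  then show ?thesis using kpos by simp
qed

lemma dd_pos: "dd x > 0"
  using dd_lower x m1_pos by (smt (verit) mult_pos_pos zero_less_power)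

text \<open>The factorisation \<open>(\<lambda> + \<sigma>)(\<lambda>\<^sup>2 + p \<lambda> + q)\<close> of the characteristic polynomial splits every
  solution into an exponential and a damped oscillation.\<close>

lemma flow_decompose:
  assumes fl: "flow x u v w"
  defines "A \<equiv> (1 / dd x) *\<^sub>R (w 0 + pp x *\<^sub>R v 0 + qq x *\<^sub>R u 0)"
  shows "damped_oscillator (pp x) (qq x) (\<lambda>t. u t - exp (- (sg x * t)) *\<^sub>R A) (\<lambda>t. v t + (sg x * exp (- (sg x * t))) *\<^sub>R A)"
proof -
  let ?p = "pp x" and ?q = "qq x" and ?\<sigma> = "sg x"
  have du: "(u has_vector_derivative v t) (at t within {0..})" and dv: "(v has_vector_derivative w t) (at t within {0..})"
    if "t \<ge> 0" for t using fl that by (auto simp: flow_def)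
  have dw: "(w has_vector_derivative
        - (((\<kappa> + \<delta>) * x) *\<^sub>R w t) - (x + \<kappa> * \<beta> * x\<^sup>2) *\<^sub>R v t - (\<kappa> * x\<^sup>2) *\<^sub>R u t) (at t)" if "t > 0" for t
    using fl that by (auto simp: flow_def)
  have cu: "continuous_on {0..} u" and cv: "continuous_on {0..} v" and cw: "continuous_on {0..} w"
    using du dv fl by (auto intro!: continuous_on_vector_derivative simp: flow_def)
  \<comment> \<open>The quadratic factor of the differential operator applied to u; only the linear
    factor is left to act on it, so z' = - \<sigma> z.\<close>
  define z where "z t = w t + ?p *\<^sub>R v t + ?q *\<^sub>R u t" for t
  have r1: "(\<kappa> + \<delta>) * x = ?p + ?\<sigma>" by (simp add: pp_def sg_def algebra_simps)
  have r2: "x + \<kappa> * \<beta> * x\<^sup>2 = ?q + ?p * ?\<sigma>"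
    by (simp add: pp_def sg_def qq_def msym_def power2_eq_square algebra_simps)
  have dz: "(z has_vector_derivative - (?\<sigma> *\<^sub>R z t)) (at t)" if t: "t > 0" for t
  proof -
    have at: "at t within {0..} = at t" using t by (intro at_within_interior) simp
    have 1: "((\<lambda>t. ?p *\<^sub>R v t) has_vector_derivative ?p *\<^sub>R w t) (at t)"
      using bounded_linear.has_vector_derivative[OF bounded_linear_scaleR_right dv[OF less_imp_le[OF t]]] unfolding at .
    have 2: "((\<lambda>t. ?q *\<^sub>R u t) has_vector_derivative ?q *\<^sub>R v t) (at t)"
      using bounded_linear.has_vector_derivative[OF bounded_linear_scaleR_right du[OF less_imp_le[OF t]]] unfolding at .
    have "(z has_vector_derivative - (((\<kappa> + \<delta>) * x) *\<^sub>R w t) - (x + \<kappa> * \<beta> * x\<^sup>2) *\<^sub>R v t - (\<kappa> * x\<^sup>2) *\<^sub>R u t + ?p *\<^sub>R w t + ?q *\<^sub>R v t) (at t)"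
      unfolding z_def by (intro has_vector_derivative_add dw[OF t] 1 2)
    moreover have "- (((\<kappa> + \<delta>) * x) *\<^sub>R w t) - (x + \<kappa> * \<beta> * x\<^sup>2) *\<^sub>R v t - (\<kappa> * x\<^sup>2) *\<^sub>R u t + ?p *\<^sub>R w t + ?q *\<^sub>R v t = - (?\<sigma> *\<^sub>R z t)"
      unfolding r1 r2 sg_qq[symmetric] z_def by (simp add: algebra_simps)
    ultimately show ?thesis by (simp only:)
  qed
  have zt: "z t = exp (- (?\<sigma> * t)) *\<^sub>R z 0" if t: "t \<ge> 0" for t
  proof -
    let ?f = "\<lambda>t. exp (?\<sigma> * t) *\<^sub>R z t"
    have "?f t = ?f 0"
    proof (rule constant_of_zero_derivative[OF _ _ t])
      show "continuous_on {0..} ?f" unfolding z_def by (intro continuous_intros cu cv cw)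
      fix t :: real assume t: "t > 0"
      have "((\<lambda>t. exp (?\<sigma> * t)) has_real_derivative exp (?\<sigma> * t) * ?\<sigma>) (at t)" by (auto intro!: derivative_eq_intros)
      from has_vector_derivative_scaleR[OF this dz[OF t]]
      show "(?f has_vector_derivative 0) (at t)" by simp
    qed
    then have "exp (- (?\<sigma> * t)) *\<^sub>R ?f t = exp (- (?\<sigma> * t)) *\<^sub>R z 0" by simp
    then show ?thesis by (simp flip: exp_add)
  qed
  \<comment> \<open>The quadratic factor maps exp (- \<sigma> t) A to \<open>dd x\<close> times
    itself, so this A makes the exponential mode carry all of z, and the difference solves the
    homogeneous quadratic equation.\<close>
  have Az: "dd x *\<^sub>R A = z 0" unfolding A_def z_def using dd_pos by simp
  show ?thesis unfolding damped_oscillator_def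
  proof (intro allI impI conjI)
    fix t :: real assume t: "t \<ge> 0"
    have e: "((\<lambda>t. exp (- (?\<sigma> * t)) *\<^sub>R A) has_vector_derivative (- ?\<sigma> * exp (- (?\<sigma> * t))) *\<^sub>R A) (at t within {0..})"
      by (rule has_vector_derivative_scaleR_const) (auto intro!: derivative_eq_intros)
    show "((\<lambda>t. u t - exp (- (?\<sigma> * t)) *\<^sub>R A) has_vector_derivative v t + (?\<sigma> * exp (- (?\<sigma> * t))) *\<^sub>R A) (at t within {0..})"
      using has_vector_derivative_diff[OF du[OF t] e] by simp
    have e': "((\<lambda>t. (?\<sigma> * exp (- (?\<sigma> * t))) *\<^sub>R A) has_vector_derivative (- (?\<sigma>\<^sup>2 * exp (- (?\<sigma> * t)))) *\<^sub>R A) (at t within {0..})"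
      by (rule has_vector_derivative_scaleR_const) (auto intro!: derivative_eq_intros simp: power2_eq_square)
    have "w t = exp (- (?\<sigma> * t)) *\<^sub>R (dd x *\<^sub>R A) - ?p *\<^sub>R v t - ?q *\<^sub>R u t"
      using zt[OF t] unfolding Az by (simp add: z_def eq_diff_eq add_ac)
    then have "w t + (- (?\<sigma>\<^sup>2 * exp (- (?\<sigma> * t)))) *\<^sub>R A =
       - (?p *\<^sub>R (v t + (?\<sigma> * exp (- (?\<sigma> * t))) *\<^sub>R A)) - ?q *\<^sub>R (u t - exp (- (?\<sigma> * t)) *\<^sub>R A)"
      by (simp add: dd_def algebra_simps)
    then show "((\<lambda>t. v t + (?\<sigma> * exp (- (?\<sigma> * t))) *\<^sub>R A) has_vector_derivative
       - (?p *\<^sub>R (v t + (?\<sigma> * exp (- (?\<sigma> * t))) *\<^sub>R A)) - ?q *\<^sub>R (u t - exp (- (?\<sigma> * t)) *\<^sub>R A)) (at t within {0..})"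
      using has_vector_derivative_add[OF dv[OF t] e'] by (simp only:)
  qed
qed

end

text \<open>For x \<ge> X0 the coefficients scale as p ~ x and q ~ x^2, and u, v/x, w/x^2 are the
  matching units for the data; in them the energy inequality has a rate independent of x. The
  exponent \<open>sg x\<close> stays between positive constants, since x s \<open>msym s\<close> <
  \<kappa> while \<kappa> = s (1 + x \<open>msym s\<close>).\<close>

theorem high_frequency_decay:
  assumes X0: "X0 > 0"
  obtains C c where "C > 0" "c > 0"
    "\<And>x u v w t. X0 \<le> x \<Longrightarrow> flow x u v w \<Longrightarrow> t \<ge> 0 \<Longrightarrow>
       norm (u t) \<le> C * exp (- (c * t)) * (norm (u 0) + norm (v 0) / x + norm (w 0) / x\<^sup>2)"
proof -
  \<comment> \<open>P x and Q x^2 bound \<open>pp x\<close> and \<open>qq x\<close>. In units of the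
    scaled data N, \<open>a\<close> bounds the amplitude A of the exponential mode and x b the
    initial velocity of the oscillation.\<close>
  define Q where "Q = 1 / X0 + \<kappa> * \<beta>"
  define P where "P = \<delta> + \<kappa>"
  define a where "a = (1 + P + Q) / m1"
  define b where "b = 1 + \<kappa> / (m1 * X0) * a"
  \<comment> \<open>c1 and c2 meet the two rate conditions of
    \<open>damped_oscillator_energy\<close>; c3 is a lower bound for \<open>sg x\<close>, obtained
    at x = X0 by monotonicity.\<close>
  define c1 where "c1 = \<delta> * X0 / 3"
  define c2 where "c2 = \<delta> * m1 * X0 / (2 * (P\<^sup>2 + Q))"
  define c3 where "c3 = \<kappa> * X0 / (1 + \<kappa> * \<beta> * X0)"
  define c where "c = min c1 (min c2 c3)"
  define G where "G = (3 * b\<^sup>2 + 2 * (P\<^sup>2 + Q) * (1 + a)\<^sup>2) / (2 * m1)"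
  have pos: "Q > 0" "P > 0" "\<delta> > 0" "\<beta> > 0" using X0 kpos ksmall db by (auto simp: Q_def P_def add_pos_pos)
  have a: "a > 0" using pos m1_pos by (simp add: a_def)
  have b: "b > 0" using a pos m1_pos X0 kpos by (simp add: b_def add_pos_pos)
  have G: "G > 0" using a b pos m1_pos by (simp add: G_def add_pos_pos)
  have PQ: "P\<^sup>2 + Q > 0" using pos by (simp add: add_pos_pos)
  have c: "c > 0" using X0 pos m1_pos kpos PQ by (auto simp: c_def c1_def c2_def c3_def add_pos_pos)
  show thesis
  proof (rule that[of "sqrt G + a" c])
    show "sqrt G + a > 0" using a G by (simp add: add_pos_pos)
    fix x u v w and t :: real assume xX: "X0 \<le> x" and fl: "flow x u v w" and t: "t \<ge> 0"
    have x: "x > 0" using xX X0 by linarith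
    define N where "N = norm (u 0) + norm (v 0) / x + norm (w 0) / x\<^sup>2"
    have N: "N \<ge> 0" using x by (simp add: N_def)
    have Nu: "norm (u 0) \<le> N" "norm (v 0) \<le> x * N" "norm (w 0) \<le> x\<^sup>2 * N"
      using x by (auto simp: N_def field_simps power2_eq_square)
    note pb = pp_bounds[OF x, folded P_def]
    have xx: "x \<le> x\<^sup>2 / X0" using xX X0 x by (simp add: field_simps power2_eq_square)
    have qb: "m1 * x\<^sup>2 \<le> qq x" "qq x \<le> Q * x\<^sup>2"
      using qq_bounds[OF x] x xx by (auto simp: Q_def algebra_simps)
    define A where "A = (1 / dd x) *\<^sub>R (w 0 + pp x *\<^sub>R v 0 + qq x *\<^sub>R u 0)"
    define Y where "Y = (\<lambda>t. u t - exp (- (sg x * t)) *\<^sub>R A)"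
    define V where "V = (\<lambda>t. v t + (sg x * exp (- (sg x * t))) *\<^sub>R A)"
    have osc: "damped_oscillator (pp x) (qq x) Y V"
      unfolding Y_def V_def A_def by (rule flow_decompose[OF x fl])
    have A: "norm A \<le> a * N"
    proof -
      have "norm (w 0 + pp x *\<^sub>R v 0 + qq x *\<^sub>R u 0) \<le> norm (w 0) + pp x * norm (v 0) + qq x * norm (u 0)"
        using pp_pos[OF x] qq_pos[OF x] by (intro norm_triangle_le add_mono) auto
      also have "\<dots> \<le> x\<^sup>2 * N + (P * x) * (x * N) + (Q * x\<^sup>2) * N"
        using Nu pb qb pp_pos[OF x] qq_pos[OF x] by (intro add_mono mult_mono) auto
      also have "\<dots> = x\<^sup>2 * ((1 + P + Q) * N)" by (simp add: power2_eq_square algebra_simps)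
      finally have "norm (w 0 + pp x *\<^sub>R v 0 + qq x *\<^sub>R u 0) \<le> x\<^sup>2 * ((1 + P + Q) * N)" .
      moreover have "1 / dd x \<le> 1 / (m1 * x\<^sup>2)" using dd_lower[OF x] dd_pos[OF x] m1_pos x by (intro divide_left_mono mult_pos_pos) auto
      ultimately have "1 / dd x * norm (w 0 + pp x *\<^sub>R v 0 + qq x *\<^sub>R u 0) \<le> 1 / (m1 * x\<^sup>2) * (x\<^sup>2 * ((1 + P + Q) * N))"
        using m1_pos x by (intro mult_mono) auto
      moreover have "norm A = 1 / dd x * norm (w 0 + pp x *\<^sub>R v 0 + qq x *\<^sub>R u 0)"
        unfolding A_def norm_scaleR using dd_pos[OF x] by simp
      ultimately show ?thesis using x by (simp add: a_def)
    qed
    have sg_up: "0 < sg x" "sg x \<le> \<kappa> / m1"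
    proof -
      show "0 < sg x" using rt[OF x] x by (simp add: sg_def)
      have "m1 * sg x \<le> msym (rt x) * sg x" using msym_bounds[OF rt(1,2)[OF x]] \<open>0 < sg x\<close> by (intro mult_right_mono) auto
      also have "\<dots> = \<kappa> - rt x" using rt(3)[OF x] by (simp add: sg_def mult_ac)
      finally have "m1 * sg x \<le> \<kappa>" using rt(1)[OF x] by linarith
      then show "sg x \<le> \<kappa> / m1" using m1_pos by (simp add: field_simps)
    qed
    have sg_low: "c3 \<le> sg x"
    proof -
      have "\<kappa> = rt x * (1 + x * msym (rt x))" using rt(3)[OF x] by (simp add: algebra_simps)
      also have "\<dots> \<le> rt x * (1 + x * (\<kappa> * \<beta>))" using rt[OF x] x msym_bounds[OF rt(1,2)[OF x]] by (intro mult_left_mono add_left_mono) auto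
      finally have r: "\<kappa> / (1 + x * (\<kappa> * \<beta>)) \<le> rt x" using x kpos pos by (subst divide_le_eq) (auto simp: add_pos_pos mult.commute)
      have "c3 \<le> \<kappa> * x / (1 + \<kappa> * \<beta> * x)"
        unfolding c3_def using X0 x xX kpos pos by (simp add: divide_le_eq le_divide_eq add_pos_pos field_simps)
      also have "\<dots> = x * (\<kappa> / (1 + x * (\<kappa> * \<beta>)))" by (simp add: mult_ac)
      also have "\<dots> \<le> x * rt x" using r x by (intro mult_left_mono) auto
      finally show ?thesis by (simp add: sg_def)
    qed
    have Y0: "norm (Y 0) \<le> (1 + a) * N"
      unfolding Y_def using norm_triangle_ineq4[of "u 0" A] A Nu(1) by (simp add: algebra_simps)
    have V0: "norm (V 0) \<le> x * (b * N)"
    proof -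
      have "norm (V 0) \<le> norm (v 0) + sg x * norm A"
        unfolding V_def using norm_triangle_ineq[of "v 0" "sg x *\<^sub>R A"] sg_up by simp
      also have "\<dots> \<le> x * N + \<kappa> / m1 * (a * N)" using A Nu(2) sg_up kpos m1_pos by (intro add_mono mult_mono) auto
      also have "\<kappa> / m1 * (a * N) \<le> x * (\<kappa> / (m1 * X0) * a * N)"
      proof -
        have "\<kappa> / m1 * (a * N) = X0 * (\<kappa> / (m1 * X0) * a * N)" using X0 by simp
        also have "\<dots> \<le> x * (\<kappa> / (m1 * X0) * a * N)" using xX X0 kpos m1_pos a N by (intro mult_right_mono) auto
        finally show ?thesis .
      qed
      finally show ?thesis by (simp add: b_def algebra_simps)
    qed
    have P2: "2 * (pp x)\<^sup>2 + 2 * qq x \<le> 2 * (P\<^sup>2 + Q) * x\<^sup>2"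
    proof -
      have "(pp x)\<^sup>2 \<le> (P * x)\<^sup>2" using pb pp_pos[OF x] by (intro power_mono) auto
      then show ?thesis using qb by (simp add: power_mult_distrib algebra_simps)
    qed
    have d1: "3 * c \<le> pp x"
    proof -
      have "3 * c \<le> \<delta> * X0" by (simp add: c_def c1_def)
      also have "\<dots> \<le> \<delta> * x" using xX pos by (intro mult_left_mono) auto
      finally show ?thesis using pb by linarith
    qed
    have d2: "c * (2 * (pp x)\<^sup>2 + 2 * qq x) \<le> pp x * qq x"
    proof -
      have "c * (2 * (pp x)\<^sup>2 + 2 * qq x) \<le> c2 * (2 * (P\<^sup>2 + Q) * x\<^sup>2)"
        using P2 c qq_pos[OF x] by (intro mult_mono) (auto simp: c_def)
      also have "\<dots> = \<delta> * X0 * (m1 * x\<^sup>2)" using PQ by (simp add: c2_def)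
      also have "\<dots> \<le> \<delta> * x * (m1 * x\<^sup>2)" using xX pos m1_pos by (intro mult_right_mono mult_left_mono) auto
      also have "\<dots> \<le> pp x * qq x" using pb qb x pos m1_pos pp_pos[OF x] by (intro mult_mono) auto
      finally show ?thesis .
    qed
    have "2 * (m1 * x\<^sup>2) * (norm (Y t))\<^sup>2 \<le> 2 * qq x * (norm (Y t))\<^sup>2" using qb by (intro mult_right_mono) auto
    also have "\<dots> \<le> exp (- (2 * c * t)) * (3 * (norm (V 0))\<^sup>2 + (2 * (pp x)\<^sup>2 + 2 * qq x) * (norm (Y 0))\<^sup>2)"
      by (rule damped_oscillator_energy[OF osc pp_pos[OF x] qq_pos[OF x] less_imp_le[OF c] d1 d2 t])
    also have "\<dots> \<le> exp (- (2 * c * t)) * (3 * (x * (b * N))\<^sup>2 + (2 * (P\<^sup>2 + Q) * x\<^sup>2) * ((1 + a) * N)\<^sup>2)"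
      using V0 Y0 P2 PQ by (intro mult_left_mono add_mono mult_mono power_mono) auto
    also have "\<dots> = 2 * (m1 * x\<^sup>2) * ((exp (- (c * t)))\<^sup>2 * (G * N\<^sup>2))"
    proof -
      have "exp (- (2 * c * t)) = (exp (- (c * t)))\<^sup>2" by (simp add: exp_double[symmetric] mult_ac)
      moreover have "3 * (x * (b * N))\<^sup>2 + (2 * (P\<^sup>2 + Q) * x\<^sup>2) * ((1 + a) * N)\<^sup>2 = 2 * (m1 * x\<^sup>2) * (G * N\<^sup>2)"
        using m1_pos by (simp add: G_def power_mult_distrib) (simp add: algebra_simps)
      ultimately show ?thesis by (simp only:) (simp add: mult_ac)
    qed
    finally have "(norm (Y t))\<^sup>2 \<le> (exp (- (c * t)))\<^sup>2 * (G * N\<^sup>2)" using m1_pos x by simp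
    also have "\<dots> = (sqrt G * exp (- (c * t)) * N)\<^sup>2" using G by (simp add: power_mult_distrib)
    finally have Yt: "norm (Y t) \<le> sqrt G * exp (- (c * t)) * N" by (rule power2_le_imp_le) (use G N in simp)
    have "c * t \<le> sg x * t" using sg_low t by (intro mult_right_mono) (auto simp: c_def)
    then have "exp (- (sg x * t)) * norm A \<le> exp (- (c * t)) * (a * N)" using A by (intro mult_mono) auto
    moreover have "u t = Y t + exp (- (sg x * t)) *\<^sub>R A" by (simp add: Y_def)
    then have "norm (u t) \<le> norm (Y t) + exp (- (sg x * t)) * norm A" using norm_triangle_ineq[of "Y t" "exp (- (sg x * t)) *\<^sub>R A"] by simp
    ultimately show "norm (u t) \<le> (sqrt G + a) * exp (- (c * t)) * (norm (u 0) + norm (v 0) / x + norm (w 0) / x\<^sup>2)"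
      using Yt unfolding N_def[symmetric] by (simp add: algebra_simps)
  qed (rule c)
qed

end

section \<open>The low-frequency expansion\<close>

lemma exp_diff_le:
  fixes a b c :: real
  assumes "c \<le> a" "c \<le> b"
  shows "\<bar>exp (- a) - exp (- b)\<bar> \<le> \<bar>a - b\<bar> * exp (- c)"
proof -
  have *: "exp (- a) - exp (- b) \<le> (b - a) * exp (- c)" if "a \<le> b" "c \<le> a" for a b
  proof -
    have "exp (- a) - exp (- b) = exp (- a) * (1 - exp (a - b))" by (simp add: algebra_simps flip: exp_add)
    also have "1 - exp (a - b) \<le> b - a" using exp_ge_add_one_self[of "a - b"] by linarith
    then have "exp (- a) * (1 - exp (a - b)) \<le> exp (- a) * (b - a)" by (rule mult_left_mono) simp
    also have "\<dots> \<le> exp (- c) * (b - a)" using that by (intro mult_right_mono) auto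
    finally show ?thesis by (simp add: mult.commute)
  qed
  show ?thesis
  proof (cases "a \<le> b")
    case True
    then have "exp (- b) \<le> exp (- a)" by simp
    then show ?thesis using *[OF True assms(1)] True by simp
  next
    case False
    then have "exp (- a) \<le> exp (- b)" by simp
    then show ?thesis using *[of b a] assms False by simp
  qed
qed

lemma abs_sin_diff_le: "\<bar>sin a - sin b\<bar> \<le> \<bar>a - b\<bar>" for a b :: real
proof -
  have "\<bar>sin a - sin b\<bar> = 2 * \<bar>sin ((a - b) / 2)\<bar> * \<bar>cos ((a + b) / 2)\<bar>"
    by (simp add: sin_diff_sin abs_mult)
  also have "\<dots> \<le> 2 * \<bar>(a - b) / 2\<bar> * 1"
    by (intro mult_mono abs_sin_x_le_abs_x) auto
  finally show ?thesis by simp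
qed

text \<open>Used twice: for the phase shift of the oscillation in \<open>term2\<close>, and for
  differentiating under the integral in \<open>grad_cos_integral\<close>.\<close>

lemma cos_taylor2: "\<bar>cos (a + h) - cos a + h * sin a\<bar> \<le> 2 * h\<^sup>2" for a h :: real
proof -
  have c: "\<bar>cos y - 1\<bar> \<le> y\<^sup>2 / 2" for y :: real
  proof -
    have "\<bar>cos y - 1\<bar> = 2 * (sin (y / 2))\<^sup>2" using cos_double_sin[of "y / 2"] by simp
    also have "(sin (y / 2))\<^sup>2 \<le> (y / 2)\<^sup>2"
      using abs_sin_x_le_abs_x[of "y / 2"] by (simp only: abs_le_square_iff)
    finally show ?thesis by (simp add: power_divide)
  qed
  have s: "\<bar>sin h - h\<bar> \<le> h\<^sup>2"
  proof -
    have "\<bar>sin h - h\<bar> \<le> h\<^sup>2 / 2"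
      using Maclaurin_sin_bound[of h 2] by (simp add: numeral_2_eq_2 sin_coeff_def)
    then show ?thesis using zero_le_power2[of h] by linarith
  qed
  have "cos (a + h) - cos a + h * sin a = cos a * (cos h - 1) - sin a * (sin h - h)"
    by (simp add: cos_add algebra_simps)
  also have "\<bar>\<dots>\<bar> \<le> \<bar>cos a\<bar> * \<bar>cos h - 1\<bar> + \<bar>sin a\<bar> * \<bar>sin h - h\<bar>"
    by (intro order_trans[OF abs_triangle_ineq4]) (simp add: abs_mult)
  also have "\<dots> \<le> 1 * (h\<^sup>2 / 2) + 1 * h\<^sup>2"
    by (intro add_mono mult_mono c s) auto
  also have "\<dots> \<le> 2 * h\<^sup>2" by simp
  finally show ?thesis .
qed

lemma norm_scaleR_le: "\<bar>a\<bar> \<le> c \<Longrightarrow> norm v \<le> d \<Longrightarrow> norm (a *\<^sub>R v) \<le> c * d"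
  by (simp add: mult_mono')

text \<open>Half of the exponential decay is spent on the polynomial, through c y \<le> exp (c y)
  and the square of the same inequality with c/2.\<close>

lemma poly_exp_absorb:
  fixes c y :: real
  assumes c: "c > 0" and y: "y \<ge> 0"
  shows "(1 + y + y\<^sup>2) * exp (- (2 * c * y)) \<le> (1 + 1 / c + 4 / c\<^sup>2) * exp (- (c * y))"
proof -
  have 1: "y \<le> 1 / c * exp (c * y)"
  proof -
    have "c * y \<le> exp (c * y)" using exp_ge_add_one_self[of "c * y"] by linarith
    then show ?thesis using c by (simp add: field_simps)
  qed
  have "c / 2 * y \<le> exp (c / 2 * y)" using exp_ge_add_one_self[of "c / 2 * y"] by linarith
  then have "(c / 2 * y)\<^sup>2 \<le> (exp (c / 2 * y))\<^sup>2" using c y by (intro power_mono) auto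
  also have "\<dots> = exp (c * y)" by (simp flip: exp_double)
  finally have 2: "y\<^sup>2 \<le> 4 / c\<^sup>2 * exp (c * y)" using c by (simp add: power_mult_distrib power_divide field_simps)
  have "1 \<le> 1 * exp (c * y)" using c y by simp
  then have "1 + y + y\<^sup>2 \<le> (1 + 1 / c + 4 / c\<^sup>2) * exp (c * y)"
    unfolding distrib_right by (intro add_mono 1 2)
  then have "(1 + y + y\<^sup>2) * exp (- (2 * c * y)) \<le> (1 + 1 / c + 4 / c\<^sup>2) * exp (c * y) * exp (- (2 * c * y))"
    by (rule mult_right_mono) simp
  also have "\<dots> = (1 + 1 / c + 4 / c\<^sup>2) * exp (- (c * y))"
    by (simp add: mult.assoc flip: exp_add)
  finally show ?thesis .
qed

text \<open>\<open>sym0\<close>, \<open>sym1\<close> and \<open>symH\<close> are the radial symbols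
  of G_0, of G_1 and of the inverse transform inside H_0, as functions of r = |\<xi>|.\<close>

definition sym0 :: "real \<Rightarrow> real \<Rightarrow> real \<Rightarrow> real \<Rightarrow> real" where
  "sym0 \<kappa> \<delta> t r = 1 / r\<^sup>2 * (exp (- \<kappa> * r\<^sup>2 * t) - cos (r * t) * exp (- (\<delta> / 2) * r\<^sup>2 * t))"

definition sym1 :: "real \<Rightarrow> real \<Rightarrow> real \<Rightarrow> real" where
  "sym1 \<delta> t r = 1 / r * sin (r * t) * exp (- (\<delta> / 2) * r\<^sup>2 * t)"

definition symH :: "real \<Rightarrow> real \<Rightarrow> real \<Rightarrow> real" where
  "symH \<delta> t r = r * sin (r * t) * exp (- (\<delta> / 2) * r\<^sup>2 * t)"

section \<open>Expansion of roots and amplitudes for small frequencies\<close>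

context mgt begin

text \<open>The frequency of the oscillation satisfies \<omega>^2 = q - p^2/4 = x + (m1 -
  \<delta>^2/4) x^2 + O(x^3), so \<omega> = r (1 + \<open>dcorr\<close> x + O(x^2)). The number is
  the coefficient of H_0, by \<open>correction_coefficient\<close>.\<close>

definition dcorr :: real where "dcorr = \<kappa> * (\<beta> - \<delta>) / 2 - \<delta>\<^sup>2 / 8"

text \<open>Constants of the successive expansions: \<open>k1\<close> bounds (\<kappa> -
  \<open>rt x\<close>)/x, \<open>k3\<close> the error of \<omega>^2 over x^3, \<open>k4\<close>
  |\<omega> - r|/(r x), \<open>k5\<close> |\<open>dd x\<close> - x|/x^2, \<open>k6\<close> the error
  of the amplitude A relative to the data, and \<open>k7\<close> that of y1 relative to x times the
  data.\<close>

definition k1 :: real where "k1 = \<kappa>\<^sup>2 * \<beta>"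
definition k3 :: real where "k3 = k1 * (2 * \<delta> + \<kappa>) + dcorr\<^sup>2"
definition k4 :: real where "k4 = \<bar>dcorr\<bar> + 2 * k3"
definition k5 :: real where "k5 = 3 * \<kappa>\<^sup>2 + 2 * (\<delta> + \<kappa>) * \<kappa> + \<kappa> * \<beta>"
definition k6 :: real where "k6 = 2 * (k5 + \<delta> + \<kappa> + 1 + \<kappa> * \<beta>)"
definition k7 :: real where "k7 = \<kappa> * k6 + k1 + (\<delta> + \<kappa>) * (1 + k6) / 2 + k1 / 2"
text \<open>The reciprocal is a sum of nonnegative terms, so each smallness condition of
  \<open>x0_small\<close> follows from x \<le> x0 by dropping the other terms.\<close>

definition x0 :: real where "x0 = 1 / (2 + 2 * \<bar>dcorr\<bar> + 8 * k3 + 2 * k5 + 2 * k1 / \<kappa>)"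

lemma params_pos: "\<delta> > 0" "\<beta> > 0" "k1 > 0" "k3 > 0" "k4 > 0" "k5 > 0" "k6 > 0" "k7 > 0" "x0 > 0"
proof -
  show d: "\<delta> > 0" and b: "\<beta> > 0" using kpos ksmall db by auto
  show k1: "k1 > 0" using kpos b by (simp add: k1_def)
  show k3: "k3 > 0" using kpos d k1 by (simp add: k3_def add_pos_nonneg)
  show "k4 > 0" using k3 by (simp add: k4_def add_nonneg_pos)
  show k5: "k5 > 0" using kpos d b by (simp add: k5_def add_pos_pos)
  show k6: "k6 > 0" using kpos d b k5 by (simp add: k6_def add_pos_pos)
  show "k7 > 0" using kpos d k6 k1 by (simp add: k7_def add_pos_pos)
  show "x0 > 0" using kpos k1 k3 k5 by (simp add: x0_def add_pos_pos add_nonneg_pos)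
qed

lemma x0_small:
  assumes x: "0 < x" "x \<le> x0"
  shows "x \<le> 1" "\<bar>dcorr\<bar> * x \<le> 1 / 2" "k3 * x \<le> 1 / 8" "k5 * x \<le> 1 / 2" "k1 * x \<le> \<kappa> / 2"
proof -
  let ?S = "2 + 2 * \<bar>dcorr\<bar> + 8 * k3 + 2 * k5 + 2 * k1 / \<kappa>"
  have S: "?S > 0" using params_pos(9) by (simp add: x0_def zero_less_divide_iff)
  have "x * ?S \<le> 1" using x S by (simp add: x0_def pos_le_divide_eq)
  then have sum: "2 * x + 2 * (\<bar>dcorr\<bar> * x) + 8 * (k3 * x) + 2 * (k5 * x) + 2 * (k1 / \<kappa> * x) \<le> 1"
    by (simp add: algebra_simps)
  have nn: "0 \<le> \<bar>dcorr\<bar> * x" "0 \<le> k3 * x" "0 \<le> k5 * x" "0 \<le> k1 / \<kappa> * x"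
    using x params_pos kpos by auto
  show "x \<le> 1" "\<bar>dcorr\<bar> * x \<le> 1 / 2" "k3 * x \<le> 1 / 8" "k5 * x \<le> 1 / 2" using sum nn x by linarith+
  have "k1 / \<kappa> * x \<le> 1 / 2" using sum nn x by linarith
  then show "k1 * x \<le> \<kappa> / 2" using kpos by (simp add: field_simps)
qed

context
  fixes r x :: real
  assumes r: "r > 0" and xr: "x = r\<^sup>2" and xx0: "x \<le> x0"
begin

lemma xpos: "x > 0" using r xr by simp

lemmas small = x0_small[OF xpos xx0]

lemma r_le_1: "r \<le> 1"
  using small(1) r xr by (simp add: abs_square_le_1)

lemma rt_near: "0 \<le> \<kappa> - rt x" "\<kappa> - rt x \<le> k1 * x"
proof -
  note R = rt[OF xpos] and M = msym_bounds[OF rt(1,2)[OF xpos]]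
  show "0 \<le> \<kappa> - rt x" using R by simp
  have "x * rt x * msym (rt x) \<le> x * \<kappa> * (\<kappa> * \<beta>)" using R M m1_pos xpos by (intro mult_mono) auto
  then show "\<kappa> - rt x \<le> k1 * x" using R(3) by (simp add: k1_def power2_eq_square mult_ac)
qed

lemma sg_near: "\<bar>sg x - \<kappa> * x\<bar> \<le> k1 * x\<^sup>2" "\<kappa> * x / 2 \<le> sg x"
proof -
  have "sg x - \<kappa> * x = - (x * (\<kappa> - rt x))" by (simp add: sg_def algebra_simps)
  moreover have "x * (\<kappa> - rt x) \<le> x * (k1 * x)" "0 \<le> x * (\<kappa> - rt x)"
    using rt_near xpos by (auto intro!: mult_left_mono)
  ultimately show "\<bar>sg x - \<kappa> * x\<bar> \<le> k1 * x\<^sup>2" by (simp add: power2_eq_square mult_ac)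
  have "\<kappa> / 2 \<le> rt x" using rt_near(2) small(5) by linarith
  then have "x * (\<kappa> / 2) \<le> x * rt x" using xpos by (intro mult_left_mono) auto
  then show "\<kappa> * x / 2 \<le> sg x" by (simp add: sg_def mult_ac)
qed

lemma pp_near: "0 \<le> pp x - \<delta> * x" "pp x - \<delta> * x \<le> k1 * x\<^sup>2"
proof -
  have "pp x - \<delta> * x = x * (\<kappa> - rt x)" by (simp add: pp_def algebra_simps)
  moreover have "x * (\<kappa> - rt x) \<le> x * (k1 * x)" "0 \<le> x * (\<kappa> - rt x)"
    using rt_near xpos by (auto intro!: mult_left_mono)
  ultimately show "0 \<le> pp x - \<delta> * x" "pp x - \<delta> * x \<le> k1 * x\<^sup>2" by (auto simp: power2_eq_square mult_ac)
qed

definition om :: real where "om = sqrt (qq x - (pp x)\<^sup>2 / 4)"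

text \<open>The square of \<omega> is compared with that of r (1 + \<open>dcorr\<close> x); they
  differ by O(x^3). Division by the sum of the two numbers, at least r/2, leaves a frequency error
  O(r x^2), since x = r^2.\<close>

lemma om_near: "om > 0" "om\<^sup>2 = qq x - (pp x)\<^sup>2 / 4" "r / 4 \<le> om"
  "\<bar>om - r - dcorr * r * x\<bar> \<le> 2 * k3 * r * x\<^sup>2" "\<bar>om - r\<bar> \<le> k4 * r * x"
proof -
  let ?o2 = "qq x - (pp x)\<^sup>2 / 4"
  let ?a = "r * (1 + dcorr * x)"
  have x3: "x ^ 3 = x * x\<^sup>2" by (simp add: numeral_eq_Suc)
  have m: "\<bar>msym (rt x) - m1\<bar> \<le> k1 * \<delta> * x"
  proof -
    have "0 \<le> \<delta> - rt x" "\<delta> - rt x \<le> \<delta>" using rt[OF xpos] ksmall kpos by auto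
    then have "(\<kappa> - rt x) * (\<delta> - rt x) \<le> (k1 * x) * \<delta>" "0 \<le> (\<kappa> - rt x) * (\<delta> - rt x)"
      using rt_near xpos params_pos(3) by (auto intro!: mult_mono)
    then show ?thesis unfolding msym_diff by (simp add: mult_ac)
  qed
  have p2: "\<bar>(pp x)\<^sup>2 - (\<delta> * x)\<^sup>2\<bar> \<le> k1 * (2 * \<delta> + \<kappa>) * x ^ 3"
  proof -
    have "(pp x)\<^sup>2 - (\<delta> * x)\<^sup>2 = (pp x - \<delta> * x) * (pp x + \<delta> * x)" by (simp add: power2_eq_square algebra_simps)
    moreover have "pp x + \<delta> * x \<le> (2 * \<delta> + \<kappa>) * x" "0 \<le> pp x + \<delta> * x"
      using pp_bounds[OF xpos] pp_pos[OF xpos] params_pos(1) xpos by (auto simp: algebra_simps)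
    then have "(pp x - \<delta> * x) * (pp x + \<delta> * x) \<le> (k1 * x\<^sup>2) * ((2 * \<delta> + \<kappa>) * x)" "0 \<le> (pp x - \<delta> * x) * (pp x + \<delta> * x)"
      using pp_near params_pos(3) by (auto intro!: mult_mono)
    ultimately show ?thesis by (simp add: x3 mult_ac)
  qed
  \<comment> \<open>The terms of order x and x^2 cancel; this is what fixes \<open>dcorr\<close> as
    half of m1 - \<delta>^2/4.\<close>
  have eq: "?o2 - ?a\<^sup>2 = x\<^sup>2 * (msym (rt x) - m1) - ((pp x)\<^sup>2 - (\<delta> * x)\<^sup>2) / 4 - dcorr\<^sup>2 * x ^ 3"
  proof -
    have "?a\<^sup>2 = x * (1 + dcorr * x)\<^sup>2" by (simp add: power_mult_distrib xr)
    moreover have "2 * dcorr = m1 - \<delta>\<^sup>2 / 4" by (simp add: dcorr_def m1_def)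
    then have "m1 = 2 * dcorr + \<delta>\<^sup>2 / 4" by simp
    ultimately show ?thesis by (simp add: qq_def x3 power2_eq_square algebra_simps diff_divide_distrib)
  qed
  have d2: "\<bar>?o2 - ?a\<^sup>2\<bar> \<le> k3 * x ^ 3"
  proof -
    have "\<bar>x\<^sup>2 * (msym (rt x) - m1)\<bar> \<le> x\<^sup>2 * (k1 * \<delta> * x)" unfolding abs_mult using m by (intro mult_mono) auto
    then have 1: "\<bar>x\<^sup>2 * (msym (rt x) - m1)\<bar> \<le> k1 * \<delta> * x ^ 3" by (simp add: x3 mult_ac)
    have kk: "0 \<le> k1 * \<delta> * x ^ 3" "0 \<le> k1 * \<kappa> * x ^ 3" "0 \<le> dcorr\<^sup>2 * x ^ 3" using params_pos kpos xpos by auto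
    have "k3 * x ^ 3 = 2 * (k1 * \<delta> * x ^ 3) + k1 * \<kappa> * x ^ 3 + dcorr\<^sup>2 * x ^ 3" by (simp add: k3_def algebra_simps)
    moreover have "k1 * (2 * \<delta> + \<kappa>) * x ^ 3 = 2 * (k1 * \<delta> * x ^ 3) + k1 * \<kappa> * x ^ 3" by (simp add: algebra_simps)
    moreover have "\<bar>X - Y / 4 - Z\<bar> \<le> \<bar>X\<bar> + \<bar>Y\<bar> / 4 + \<bar>Z\<bar>" for X Y Z :: real by linarith
    from this[of "x\<^sup>2 * (msym (rt x) - m1)" "(pp x)\<^sup>2 - (\<delta> * x)\<^sup>2" "dcorr\<^sup>2 * x ^ 3"]
    have "\<bar>?o2 - ?a\<^sup>2\<bar> \<le> \<bar>x\<^sup>2 * (msym (rt x) - m1)\<bar> + \<bar>(pp x)\<^sup>2 - (\<delta> * x)\<^sup>2\<bar> / 4 + dcorr\<^sup>2 * x ^ 3"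
      unfolding eq using kk(3) by simp
    moreover have "T \<le> K" if "T \<le> X + Y / 4 + Z" "X \<le> a" "Y \<le> 2 * a + b" "0 \<le> a" "0 \<le> b" "K = 2 * a + b + Z"
      for T X Y Z a b K :: real using that by linarith
    ultimately show ?thesis using 1 p2 kk by metis
  qed
  have a: "r / 2 \<le> ?a"
  proof -
    have "\<bar>dcorr * x\<bar> \<le> 1 / 2" using small(2) xpos by (simp add: abs_mult)
    then have "1 / 2 \<le> 1 + dcorr * x" by linarith
    then show ?thesis using r mult_left_mono[of "1/2" "1 + dcorr * x" r] by simp
  qed
  have k3x: "k3 * x ^ 3 \<le> x / 8"
  proof -
    have "k3 * x * x\<^sup>2 \<le> 1 / 8 * x" using small(1,3) xpos params_pos(4)
      by (intro mult_mono) (auto simp: power2_eq_square mult_left_le)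
    then show ?thesis by (simp add: x3 mult_ac)
  qed
  have a2: "x / 4 \<le> ?a\<^sup>2"
  proof -
    have "(r / 2)\<^sup>2 \<le> ?a\<^sup>2" using a r by (intro power_mono) auto
    then show ?thesis by (simp add: power_divide xr)
  qed
  have o2: "x / 8 \<le> ?o2" using d2 k3x a2 by linarith
  then show 2: "om\<^sup>2 = ?o2" and 1: "om > 0" using xpos by (auto simp: om_def)
  have "(om - ?a) * (om + ?a) = ?o2 - ?a\<^sup>2" using 2 by (simp add: power2_eq_square algebra_simps)
  then have "\<bar>om - ?a\<bar> * (om + ?a) = \<bar>?o2 - ?a\<^sup>2\<bar>" using 1 a r by (metis abs_mult abs_of_pos add_pos_pos half_gt_zero less_le_trans)
  then have "\<bar>om - ?a\<bar> * (om + ?a) \<le> k3 * x ^ 3" using d2 by simp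
  moreover have "\<bar>om - ?a\<bar> * (r / 2) \<le> \<bar>om - ?a\<bar> * (om + ?a)" using 1 a by (intro mult_left_mono) auto
  ultimately have "\<bar>om - ?a\<bar> * (r / 2) \<le> k3 * x ^ 3" by linarith
  also have "k3 * x ^ 3 = (2 * k3 * r * x\<^sup>2) * (r / 2)"
    unfolding x3 by (simp add: power2_eq_square xr)
  finally have "\<bar>om - ?a\<bar> \<le> 2 * k3 * r * x\<^sup>2" using r by (simp only: mult_le_cancel_right_pos half_gt_zero)
  then show 4: "\<bar>om - r - dcorr * r * x\<bar> \<le> 2 * k3 * r * x\<^sup>2" by (simp add: algebra_simps)
  have k3x2: "2 * k3 * r * x\<^sup>2 \<le> 2 * k3 * r * x" using small(1) xpos params_pos(4) r
    by (intro mult_left_mono) (auto simp: power2_eq_square mult_left_le)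
  show "\<bar>om - r\<bar> \<le> k4 * r * x"
  proof -
    have "\<bar>dcorr * r * x\<bar> = \<bar>dcorr\<bar> * r * x" using r xpos by (simp add: abs_mult)
    moreover have "k4 * r * x = \<bar>dcorr\<bar> * r * x + 2 * k3 * r * x" by (simp add: k4_def algebra_simps)
    ultimately show ?thesis using 4 k3x2 by linarith
  qed
  have "2 * k3 * r * x \<le> r / 4" using small(3) r mult_left_mono[of "k3 * x" "1/8" "2 * r"] by (simp add: mult_ac)
  then show "r / 4 \<le> om" using 4 a k3x2 by (simp add: algebra_simps)
qed

lemma dd_near: "\<bar>dd x - x\<bar> \<le> k5 * x\<^sup>2" "x / 2 \<le> dd x"
proof -
  have d: "dd x - x = x\<^sup>2 * (3 * (rt x)\<^sup>2 - 2 * (\<delta> + \<kappa>) * rt x + \<kappa> * \<beta>)"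
    by (simp add: dd_def sg_def pp_def qq_def msym_def power2_eq_square algebra_simps)
  have R: "0 < rt x" "rt x < \<kappa>" using rt[OF xpos] by auto
  have "(rt x)\<^sup>2 \<le> \<kappa>\<^sup>2" using R by (intro power_mono) auto
  moreover have "2 * (\<delta> + \<kappa>) * rt x \<le> 2 * (\<delta> + \<kappa>) * \<kappa>" "0 \<le> 2 * (\<delta> + \<kappa>) * rt x" using R params_pos kpos by (auto intro!: mult_left_mono)
  moreover have "0 < \<kappa> * \<beta>" "0 \<le> (rt x)\<^sup>2" using kpos params_pos by auto
  ultimately have "\<bar>3 * (rt x)\<^sup>2 - 2 * (\<delta> + \<kappa>) * rt x + \<kappa> * \<beta>\<bar> \<le> k5" unfolding k5_def by linarith
  then have "x\<^sup>2 * \<bar>3 * (rt x)\<^sup>2 - 2 * (\<delta> + \<kappa>) * rt x + \<kappa> * \<beta>\<bar> \<le> x\<^sup>2 * k5" by (rule mult_left_mono) simp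
  then show 1: "\<bar>dd x - x\<bar> \<le> k5 * x\<^sup>2" unfolding d abs_mult by (simp add: mult.commute)
  have "k5 * x * x \<le> 1 / 2 * x" using small(4) xpos by (intro mult_right_mono) auto
  then show "x / 2 \<le> dd x" using 1 by (simp add: power2_eq_square mult.assoc)
qed

text \<open>\<open>A\<close> is the amplitude of the exponential mode, \<open>y0\<close> and
  \<open>y1\<close> the coefficients of the cosine and of sine over frequency. \<open>A\<close> and
  \<open>y0\<close> behave like w 0 / x and - w 0 / x, the singular parts that form G_0, while
  \<open>y1\<close> tends to \<open>Y1\<close>, the source of the G_1 term.\<close>

context
  fixes u v w :: "real \<Rightarrow> complex" and N :: real and A y0 y1 Y1 :: complex
  assumes fl: "flow x u v w"
  defines "N \<equiv> norm (u 0) + norm (v 0) + norm (w 0)"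
    and "A \<equiv> (1 / dd x) *\<^sub>R (w 0 + pp x *\<^sub>R v 0 + qq x *\<^sub>R u 0)"
    and "y0 \<equiv> u 0 - A" and "y1 \<equiv> v 0 + sg x *\<^sub>R A + (pp x / 2) *\<^sub>R y0"
    and "Y1 \<equiv> v 0 + (\<kappa> - \<delta> / 2) *\<^sub>R w 0"
begin

lemma N_ge: "norm (u 0) \<le> N" "norm (v 0) \<le> N" "norm (w 0) \<le> N" "0 \<le> N"
  by (auto simp: N_def)

lemma flow_explicit:
  assumes t: "t \<ge> 0"
  shows "u t = exp (- (sg x * t)) *\<^sub>R A + exp (- (pp x / 2 * t)) *\<^sub>R (cos (om * t) *\<^sub>R y0 + (sin (om * t) / om) *\<^sub>R y1)"
  using damped_oscillator_explicit[OF flow_decompose[OF xpos fl] pp_pos[OF xpos] om_near(1,2) t]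
  by (simp add: y0_def y1_def A_def algebra_simps)

lemma A_near: "norm (A - (1 / x) *\<^sub>R w 0) \<le> k6 * N"
proof -
  have D: "dd x > 0" using dd_pos[OF xpos] .
  have eq: "A - (1 / x) *\<^sub>R w 0 = (1 / (x * dd x)) *\<^sub>R ((x - dd x) *\<^sub>R w 0 + (x * pp x) *\<^sub>R v 0 + (x * qq x) *\<^sub>R u 0)"
    using xpos D by (simp add: A_def scaleR_add_right scaleR_diff_left) (simp add: diff_divide_distrib scaleR_diff_left field_simps)
  have q: "qq x \<le> (1 + \<kappa> * \<beta>) * x"
  proof -
    have "\<kappa> * \<beta> * x\<^sup>2 \<le> \<kappa> * \<beta> * x" using small(1) xpos kpos params_pos by (intro mult_left_mono) (auto simp: power2_eq_square mult_left_le)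
    then show ?thesis using qq_bounds(2)[OF xpos] by (simp add: algebra_simps)
  qed
  have "norm ((x - dd x) *\<^sub>R w 0 + (x * pp x) *\<^sub>R v 0 + (x * qq x) *\<^sub>R u 0)
    \<le> (k5 * x\<^sup>2) * N + (x * ((\<delta> + \<kappa>) * x)) * N + (x * ((1 + \<kappa> * \<beta>) * x)) * N"
    using dd_near(1) pp_bounds[OF xpos] pp_pos[OF xpos] q qq_pos[OF xpos] xpos N_ge
    by (intro norm_triangle_le add_mono norm_scaleR_le) (auto simp: abs_minus_commute abs_mult intro!: mult_left_mono)
  also have "\<dots> = x\<^sup>2 / 2 * (k6 * N)" by (simp add: k6_def power2_eq_square algebra_simps)
  finally have n: "norm ((x - dd x) *\<^sub>R w 0 + (x * pp x) *\<^sub>R v 0 + (x * qq x) *\<^sub>R u 0) \<le> x\<^sup>2 / 2 * (k6 * N)" .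
  have "x\<^sup>2 / 2 \<le> x * dd x" using mult_left_mono[OF dd_near(2), of x] xpos by (simp add: power2_eq_square)
  then have "1 / (x * dd x) \<le> 1 / (x\<^sup>2 / 2)" using xpos D by (intro divide_left_mono) auto
  then have "norm (A - (1 / x) *\<^sub>R w 0) \<le> 1 / (x\<^sup>2 / 2) * (x\<^sup>2 / 2 * (k6 * N))"
    unfolding eq using n xpos D by (intro norm_scaleR_le) auto
  then show ?thesis using xpos by simp
qed

lemma y0_near: "norm (y0 + (1 / x) *\<^sub>R w 0) \<le> (1 + k6) * N"
proof -
  have E: "y0 + (1 / x) *\<^sub>R w 0 = u 0 - (A - (1 / x) *\<^sub>R w 0)" by (simp add: y0_def)
  have "norm (y0 + (1 / x) *\<^sub>R w 0) \<le> norm (u 0) + norm (A - (1 / x) *\<^sub>R w 0)" unfolding E by (rule norm_triangle_ineq4)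
  then show ?thesis using A_near N_ge(1) by (simp add: algebra_simps)
qed

lemma y1_near: "norm (y1 - Y1) \<le> k7 * x * N" "norm Y1 \<le> (1 + \<kappa> + \<delta>) * N"
proof -
  \<comment> \<open>In the limit \<open>sg x\<close> A contributes \<kappa> w 0 and
    (\<open>pp x\<close> / 2) y0 contributes - (\<delta>/2) w 0; this is the combination in
    \<open>Y1\<close>. The four summands are the errors of these replacements.\<close>
  have "y1 - Y1 = (sg x) *\<^sub>R (A - (1 / x) *\<^sub>R w 0) + (sg x / x - \<kappa>) *\<^sub>R w 0
     + (pp x / 2) *\<^sub>R (y0 + (1 / x) *\<^sub>R w 0) + (- (pp x - \<delta> * x) / (2 * x)) *\<^sub>R w 0"
    using xpos by (simp add: y1_def Y1_def complex_eq_iff field_simps)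
  also have "norm \<dots> \<le> (\<kappa> * x) * (k6 * N) + (k1 * x) * N + ((\<delta> + \<kappa>) * x / 2) * ((1 + k6) * N) + (k1 * x / 2) * N"
  proof (intro A_near y0_near N_ge norm_triangle_le add_mono norm_scaleR_le)
    show "\<bar>sg x\<bar> \<le> \<kappa> * x" using rt[OF xpos] xpos by (simp add: sg_def mult.commute)
    have "sg x / x - \<kappa> = - (\<kappa> - rt x)" using xpos by (simp add: sg_def)
    then show "\<bar>sg x / x - \<kappa>\<bar> \<le> k1 * x" using rt_near by simp
    show "\<bar>pp x / 2\<bar> \<le> (\<delta> + \<kappa>) * x / 2" using pp_bounds(2)[OF xpos] pp_pos[OF xpos] by simp
    have "(pp x - \<delta> * x) / (2 * x) \<le> k1 * x\<^sup>2 / (2 * x)" using pp_near xpos by (intro divide_right_mono) auto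
    then show "\<bar>- (pp x - \<delta> * x) / (2 * x)\<bar> \<le> k1 * x / 2" using pp_near xpos
      by (simp add: power2_eq_square abs_divide)
  qed
  also have "\<dots> = k7 * x * N" by (simp add: k7_def algebra_simps)
  finally show "norm (y1 - Y1) \<le> k7 * x * N" .
  have "norm Y1 \<le> norm (v 0) + \<bar>\<kappa> - \<delta> / 2\<bar> * norm (w 0)"
    unfolding Y1_def using norm_triangle_ineq[of "v 0" "(\<kappa> - \<delta> / 2) *\<^sub>R w 0"] by simp
  also have "\<dots> \<le> N + (\<kappa> + \<delta>) * N"
    using N_ge kpos params_pos by (intro add_mono mult_mono) auto
  finally show "norm Y1 \<le> (1 + \<kappa> + \<delta>) * N" by (simp add: algebra_simps)
qed

text \<open>Besides the Gaussian \<open>e\<close>, the error bounds contain x and t only through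
  \<open>\<theta>\<close> = x t; its powers are absorbed by the Gaussian afterwards.\<close>

context
  fixes t e \<theta> :: real
  assumes t: "t \<ge> 0"
  defines "\<theta> \<equiv> x * t" and "e \<equiv> exp (- (\<kappa> * x * t / 2))"
begin

lemma th_nonneg: "\<theta> \<ge> 0" using xpos t by (simp add: \<theta>_def)

lemma e_pos: "e > 0" by (simp add: e_def)

lemma exps_le: "exp (- (sg x * t)) \<le> e" "exp (- (pp x / 2 * t)) \<le> e" "exp (- (\<delta> / 2 * x * t)) \<le> e"
proof -
  have "\<kappa> * x / 2 * t \<le> sg x * t" using sg_near(2) t by (intro mult_right_mono) auto
  then show "exp (- (sg x * t)) \<le> e" by (simp add: e_def)
  have kd: "\<kappa> * x / 2 \<le> \<delta> / 2 * x" using ksmall kpos xpos by simp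
  then have "\<kappa> * x / 2 * t \<le> \<delta> / 2 * x * t" using t by (intro mult_right_mono) auto
  then show "exp (- (\<delta> / 2 * x * t)) \<le> e" by (simp add: e_def)
  have "\<kappa> * x / 2 * t \<le> pp x / 2 * t" using kd pp_near(1) t by (intro mult_right_mono) auto
  then show "exp (- (pp x / 2 * t)) \<le> e" by (simp add: e_def)
qed

lemma exp_pp_diff: "\<bar>exp (- (pp x / 2 * t)) - exp (- (\<delta> / 2 * x * t))\<bar> \<le> k1 * x * \<theta> / 2 * e"
proof -
  have kd: "\<kappa> * x / 2 \<le> \<delta> / 2 * x" using ksmall kpos xpos by simp
  have "\<bar>exp (- (pp x / 2 * t)) - exp (- (\<delta> / 2 * x * t))\<bar> \<le> \<bar>pp x / 2 * t - \<delta> / 2 * x * t\<bar> * exp (- (\<kappa> * x / 2 * t))"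
    using kd pp_near(1) t by (intro exp_diff_le mult_right_mono) auto
  also have "\<bar>pp x / 2 * t - \<delta> / 2 * x * t\<bar> = (pp x - \<delta> * x) / 2 * t"
  proof -
    have E: "pp x / 2 * t - \<delta> / 2 * x * t = (pp x - \<delta> * x) / 2 * t" by (simp add: algebra_simps diff_divide_distrib)
    show ?thesis unfolding E by (rule abs_of_nonneg) (use pp_near(1) t in simp)
  qed
  also have "(pp x - \<delta> * x) / 2 * t * exp (- (\<kappa> * x / 2 * t)) \<le> (k1 * x\<^sup>2) / 2 * t * exp (- (\<kappa> * x / 2 * t))"
    using pp_near t by (intro mult_right_mono divide_right_mono) auto
  finally show ?thesis by (simp add: \<theta>_def e_def power2_eq_square mult_ac)
qed

lemma term1: "norm (exp (- (sg x * t)) *\<^sub>R A - (exp (- (\<kappa> * x * t)) / x) *\<^sub>R w 0) \<le> (k6 + k1 * \<theta>) * N * e"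
proof -
  have eq: "exp (- (sg x * t)) *\<^sub>R A - (exp (- (\<kappa> * x * t)) / x) *\<^sub>R w 0
    = exp (- (sg x * t)) *\<^sub>R (A - (1 / x) *\<^sub>R w 0) + ((exp (- (sg x * t)) - exp (- (\<kappa> * x * t))) / x) *\<^sub>R w 0"
    by (simp add: algebra_simps diff_divide_distrib)
  have "\<bar>exp (- (sg x * t)) - exp (- (\<kappa> * x * t))\<bar> \<le> \<bar>sg x * t - \<kappa> * x * t\<bar> * exp (- (\<kappa> * x / 2 * t))"
  proof (rule exp_diff_le)
    show "\<kappa> * x / 2 * t \<le> sg x * t" using sg_near(2) t by (intro mult_right_mono) auto
    show "\<kappa> * x / 2 * t \<le> \<kappa> * x * t" using kpos xpos t by (intro mult_right_mono) auto
  qed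
  also have "\<bar>sg x * t - \<kappa> * x * t\<bar> = \<bar>sg x - \<kappa> * x\<bar> * t" using t by (simp add: abs_mult flip: left_diff_distrib)
  also have "\<dots> \<le> k1 * x\<^sup>2 * t" using sg_near(1) t by (intro mult_right_mono) auto
  finally have "\<bar>exp (- (sg x * t)) - exp (- (\<kappa> * x * t))\<bar> \<le> k1 * x\<^sup>2 * t * e" by (simp add: e_def)
  then have "\<bar>exp (- (sg x * t)) - exp (- (\<kappa> * x * t))\<bar> / x \<le> k1 * x\<^sup>2 * t * e / x" using xpos by (intro divide_right_mono) auto
  then have d: "\<bar>(exp (- (sg x * t)) - exp (- (\<kappa> * x * t))) / x\<bar> \<le> k1 * \<theta> * e"
    using xpos by (simp add: abs_divide \<theta>_def power2_eq_square)
  have "norm (exp (- (sg x * t)) *\<^sub>R (A - (1 / x) *\<^sub>R w 0) + ((exp (- (sg x * t)) - exp (- (\<kappa> * x * t))) / x) *\<^sub>R w 0)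
     \<le> e * (k6 * N) + (k1 * \<theta> * e) * N"
    using exps_le(1) by (intro norm_triangle_le add_mono norm_scaleR_le A_near N_ge d) auto
  then show ?thesis unfolding eq by (simp add: algebra_simps)
qed

text \<open>Since y0 has size 1/x, the phase shift (\<omega> - r) t of the cosine needs a
  second-order expansion: its first-order part is the H_0 term, and the quadratic part (r x t)^2 / x
  is \<theta>^2 because r^2 = x. Replacing p by \<delta> x in the damping costs O(\<theta>).\<close>

lemma term2: "norm ((exp (- (pp x / 2 * t)) * cos (om * t)) *\<^sub>R y0
    + (1 / x * exp (- (\<delta> / 2 * x * t)) * (cos (r * t) - dcorr * r * x * t * sin (r * t))) *\<^sub>R w 0)
   \<le> ((1 + k6) + (k1 / 2 + 2 * k3) * \<theta> + 2 * k4\<^sup>2 * \<theta>\<^sup>2) * N * e"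
proof -
  let ?ep = "exp (- (pp x / 2 * t))" and ?ed = "exp (- (\<delta> / 2 * x * t))"
  let ?h = "(om - r) * t"
  have eq: "(?ep * cos (om * t)) *\<^sub>R y0 + (1 / x * ?ed * (cos (r * t) - dcorr * r * x * t * sin (r * t))) *\<^sub>R w 0
    = (?ep * cos (om * t)) *\<^sub>R (y0 + (1 / x) *\<^sub>R w 0) + (- ((?ep - ?ed) * cos (om * t) / x)) *\<^sub>R w 0
      + (- (1 / x * ?ed * (cos (om * t) - cos (r * t) + dcorr * r * x * t * sin (r * t)))) *\<^sub>R w 0"
    using xpos by (simp add: complex_eq_iff field_simps)
  have b1: "\<bar>?ep * cos (om * t)\<bar> \<le> e" 
    using exps_le(2) mult_mono[of ?ep e "\<bar>cos (om * t)\<bar>" 1] e_pos by (simp add: abs_mult)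
  have b2: "\<bar>- ((?ep - ?ed) * cos (om * t) / x)\<bar> \<le> k1 / 2 * \<theta> * e"
  proof -
    have "\<bar>?ep - ?ed\<bar> * \<bar>cos (om * t)\<bar> \<le> (k1 * x * \<theta> / 2 * e) * 1"
      using exp_pp_diff params_pos th_nonneg e_pos xpos by (intro mult_mono) auto
    then have "\<bar>?ep - ?ed\<bar> * \<bar>cos (om * t)\<bar> / x \<le> (k1 * x * \<theta> / 2 * e) * 1 / x" using xpos by (intro divide_right_mono) auto
    then show ?thesis using xpos by (simp add: abs_mult)
  qed
  have b3: "\<bar>- (1 / x * ?ed * (cos (om * t) - cos (r * t) + dcorr * r * x * t * sin (r * t)))\<bar> \<le> (2 * k4\<^sup>2 * \<theta>\<^sup>2 + 2 * k3 * \<theta>) * e"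
  proof -
    have "cos (om * t) - cos (r * t) + dcorr * r * x * t * sin (r * t)
       = (cos (r * t + ?h) - cos (r * t) + ?h * sin (r * t)) - ((om - r - dcorr * r * x) * t) * sin (r * t)"
      by (simp add: algebra_simps)
    also have "\<bar>\<dots>\<bar> \<le> 2 * ?h\<^sup>2 + (2 * k3 * r * x\<^sup>2 * t) * 1"
    proof (intro order_trans[OF abs_triangle_ineq4] add_mono cos_taylor2)
      show "\<bar>(om - r - dcorr * r * x) * t * sin (r * t)\<bar> \<le> 2 * k3 * r * x\<^sup>2 * t * 1"
        unfolding abs_mult using om_near(4) t params_pos(4) r by (intro mult_mono) auto
    qed
    also have "?h\<^sup>2 \<le> (k4 * r * x * t)\<^sup>2"
    proof -
      have "\<bar>?h\<bar> \<le> k4 * r * x * t" unfolding abs_mult using om_near(5) t by (intro mult_mono) auto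
      then show ?thesis by (simp add: abs_le_square_iff[symmetric])
    qed
    also have "(k4 * r * x * t)\<^sup>2 = x * (k4\<^sup>2 * \<theta>\<^sup>2)" by (simp add: power_mult_distrib \<theta>_def xr mult_ac)
    also have "2 * k3 * r * x\<^sup>2 * t * 1 \<le> x * (2 * k3 * \<theta>)"
    proof -
      have "2 * k3 * r * x\<^sup>2 * t = r * (x * (2 * k3 * \<theta>))" by (simp add: \<theta>_def power2_eq_square mult_ac)
      also have "\<dots> \<le> 1 * (x * (2 * k3 * \<theta>))" using r_le_1 xpos params_pos th_nonneg by (intro mult_right_mono) auto
      finally show ?thesis by simp
    qed
    finally have c: "\<bar>cos (om * t) - cos (r * t) + dcorr * r * x * t * sin (r * t)\<bar> \<le> x * (2 * k4\<^sup>2 * \<theta>\<^sup>2 + 2 * k3 * \<theta>)"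
      by (simp add: algebra_simps)
    have "1 / x * ?ed * \<bar>cos (om * t) - cos (r * t) + dcorr * r * x * t * sin (r * t)\<bar> \<le> 1 / x * e * (x * (2 * k4\<^sup>2 * \<theta>\<^sup>2 + 2 * k3 * \<theta>))"
      using c exps_le(3) xpos e_pos by (intro mult_mono) auto
    then show ?thesis using xpos by (simp add: abs_mult mult_ac)
  qed
  have "norm ((?ep * cos (om * t)) *\<^sub>R (y0 + (1 / x) *\<^sub>R w 0) + (- ((?ep - ?ed) * cos (om * t) / x)) *\<^sub>R w 0
      + (- (1 / x * ?ed * (cos (om * t) - cos (r * t) + dcorr * r * x * t * sin (r * t)))) *\<^sub>R w 0)
    \<le> e * ((1 + k6) * N) + (k1 / 2 * \<theta> * e) * N + ((2 * k4\<^sup>2 * \<theta>\<^sup>2 + 2 * k3 * \<theta>) * e) * N"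
    by (intro y0_near N_ge b1 b2 b3 norm_triangle_le add_mono norm_scaleR_le)
  then show ?thesis unfolding eq by (simp add: algebra_simps)
qed

text \<open>The amplitude is only 1/r here, so already the first-order phase error r x t / r =
  \<theta> is admissible, and no correction term appears.\<close>

lemma term3: "norm ((exp (- (pp x / 2 * t)) * sin (om * t) / om) *\<^sub>R y1
    - (1 / r * sin (r * t) * exp (- (\<delta> / 2 * x * t))) *\<^sub>R Y1)
   \<le> (4 * k7 + (1 + \<kappa> + \<delta>) * (4 * k4 + (k1 / 2 + k4) * \<theta>)) * N * e"
proof -
  let ?ep = "exp (- (pp x / 2 * t))" and ?ed = "exp (- (\<delta> / 2 * x * t))"
  have o: "om > 0" using om_near(1) .
  have eq: "(?ep * sin (om * t) / om) *\<^sub>R y1 - (1 / r * sin (r * t) * ?ed) *\<^sub>R Y1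
    = (?ep * sin (om * t) / om) *\<^sub>R (y1 - Y1) + (?ep * sin (om * t) * (1 / om - 1 / r)) *\<^sub>R Y1
      + (sin (om * t) * (?ep - ?ed) / r) *\<^sub>R Y1 + (?ed * (sin (om * t) - sin (r * t)) / r) *\<^sub>R Y1"
    using o r by (simp add: complex_eq_iff field_simps)
  have es: "\<bar>?ep * sin (om * t)\<bar> \<le> e"
    using exps_le(2) mult_mono[of ?ep e "\<bar>sin (om * t)\<bar>" 1] e_pos by (simp add: abs_mult)
  have o4: "1 / om \<le> 4 / r" using om_near(3) o r by (simp add: field_simps)
  have xr1: "x / r = r" "x / r \<le> 1" using r r_le_1 by (auto simp: xr power2_eq_square)
  have b1: "\<bar>?ep * sin (om * t) / om\<bar> \<le> e * (4 / r)"
    using es o4 o e_pos mult_mono[OF es o4] by (simp add: abs_mult)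
  have b2: "\<bar>?ep * sin (om * t) * (1 / om - 1 / r)\<bar> \<le> e * (4 * k4)"
  proof -
    have "\<bar>1 / om - 1 / r\<bar> = \<bar>om - r\<bar> * (1 / om) * (1 / r)" using o r
      by (simp add: diff_frac_eq abs_divide abs_mult abs_minus_commute)
    also have "\<dots> \<le> (k4 * r * x) * (4 / r) * (1 / r)" using om_near(5) o4 o r params_pos xpos by (intro mult_mono) auto
    also have "\<dots> = 4 * k4 * (x / r)" using r by simp
    also have "\<dots> \<le> 4 * k4 * 1" using xr1(2) params_pos by (intro mult_left_mono) auto
    finally have c: "\<bar>1 / om - 1 / r\<bar> \<le> 4 * k4" by simp
    have "\<bar>?ep * sin (om * t)\<bar> * \<bar>1 / om - 1 / r\<bar> \<le> e * (4 * k4)" using es c e_pos by (intro mult_mono) auto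
    then show ?thesis by (simp only: abs_mult)
  qed
  have b3: "\<bar>sin (om * t) * (?ep - ?ed) / r\<bar> \<le> k1 / 2 * \<theta> * e"
  proof -
    have "\<bar>sin (om * t)\<bar> * \<bar>?ep - ?ed\<bar> / r \<le> 1 * (k1 * x * \<theta> / 2 * e) / r"
      using exp_pp_diff r by (intro divide_right_mono mult_mono) auto
    also have "\<dots> = (x / r) * (k1 / 2 * \<theta> * e)" by (simp add: field_simps)
    also have "\<dots> \<le> 1 * (k1 / 2 * \<theta> * e)" using xr1(2) params_pos th_nonneg e_pos by (intro mult_right_mono) auto
    finally show ?thesis using r by (simp add: abs_mult)
  qed
  have b4: "\<bar>?ed * (sin (om * t) - sin (r * t)) / r\<bar> \<le> k4 * \<theta> * e"
  proof -
    have "\<bar>sin (om * t) - sin (r * t)\<bar> \<le> \<bar>om - r\<bar> * t"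
      using abs_sin_diff_le[of "om * t" "r * t"] t by (simp add: abs_mult flip: left_diff_distrib)
    also have "\<dots> \<le> (k4 * r * x) * t" using om_near(5) t by (intro mult_right_mono) auto
    finally have c: "\<bar>sin (om * t) - sin (r * t)\<bar> \<le> k4 * r * \<theta>" by (simp add: \<theta>_def mult_ac)
    have "?ed * \<bar>sin (om * t) - sin (r * t)\<bar> / r \<le> e * (k4 * r * \<theta>) / r"
      using c exps_le(3) r e_pos by (intro divide_right_mono mult_mono) auto
    then show ?thesis using r by (simp add: abs_mult mult_ac)
  qed
  have "norm ((?ep * sin (om * t) / om) *\<^sub>R (y1 - Y1) + (?ep * sin (om * t) * (1 / om - 1 / r)) *\<^sub>R Y1
      + (sin (om * t) * (?ep - ?ed) / r) *\<^sub>R Y1 + (?ed * (sin (om * t) - sin (r * t)) / r) *\<^sub>R Y1)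
    \<le> (e * (4 / r)) * (k7 * x * N) + (e * (4 * k4)) * ((1 + \<kappa> + \<delta>) * N) + (k1 / 2 * \<theta> * e) * ((1 + \<kappa> + \<delta>) * N)
      + (k4 * \<theta> * e) * ((1 + \<kappa> + \<delta>) * N)"
    by (intro y1_near b1 b2 b3 b4 norm_triangle_le add_mono norm_scaleR_le)
  also have "(e * (4 / r)) * (k7 * x * N) \<le> e * (4 * k7 * N)"
  proof -
    have "(e * (4 / r)) * (k7 * x * N) = (x / r) * (e * (4 * k7 * N))" by simp
    also have "\<dots> \<le> 1 * (e * (4 * k7 * N))" using xr1(2) e_pos params_pos N_ge by (intro mult_right_mono) auto
    finally show ?thesis by simp
  qed
  finally show ?thesis unfolding eq by (simp add: algebra_simps)
qed

end

end

end

text \<open>The error has no singularity at r = 0: all parts of size 1/r^2 and 1/r are captured by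
  the symbols. For small r and large t it is therefore small compared with
  \<open>wmin t r\<close>.\<close>

theorem low_frequency_expansion:
  obtains C c where "C > 0" "c > 0" "c < \<kappa>"
    "\<And>r u v w t. 0 < r \<Longrightarrow> r\<^sup>2 \<le> x0 \<Longrightarrow> flow (r\<^sup>2) u v w \<Longrightarrow> t \<ge> 0 \<Longrightarrow>
       norm (u t - ((sym0 \<kappa> \<delta> t r + dcorr * t * symH \<delta> t r) *\<^sub>R w 0
            + sym1 \<delta> t r *\<^sub>R (v 0 + (\<kappa> - \<delta> / 2) *\<^sub>R w 0)))
         \<le> C * exp (- (c * r\<^sup>2 * t)) * (norm (u 0) + norm (v 0) + norm (w 0))"
proof -
  \<comment> \<open>The sum of the coefficients in the bounds for the three terms, each of 1,
    \<theta>, \<theta>^2 being at most 1 + \<theta> + \<theta>^2. With c = \<kappa>/4 the common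
    factor exp (- \<kappa> x t / 2) is exp (- 2 c \<theta>), and half of it absorbs this
    polynomial.\<close>
  define K where "K = (k6 + k1) + ((1 + k6) + (k1 / 2 + 2 * k3) + 2 * k4\<^sup>2) + (4 * k7 + (1 + \<kappa> + \<delta>) * (4 * k4 + (k1 / 2 + k4)))"
  define c where "c = \<kappa> / 4"
  have c: "c > 0" "c < \<kappa>" using kpos by (auto simp: c_def)
  have K: "K > 0" using params_pos kpos by (simp add: K_def add_pos_pos add_pos_nonneg)
  show thesis
  proof (rule that[of "K * (1 + 1 / c + 4 / c\<^sup>2)" c, OF _ c])
    show "0 < K * (1 + 1 / c + 4 / c\<^sup>2)" using K c by (simp add: add_pos_pos)
    fix r u v w and t :: real
    assume r: "0 < r" and rx: "r\<^sup>2 \<le> x0" and fl: "flow (r\<^sup>2) u v w" and t: "t \<ge> 0"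
    note H = r refl rx
    let ?x = "r\<^sup>2"
    define N where "N = norm (u 0) + norm (v 0) + norm (w 0)"
    have N: "N \<ge> 0" by (simp add: N_def)
    define \<theta> where "\<theta> = ?x * t"
    define e where "e = exp (- (\<kappa> * ?x * t / 2))"
    have th: "\<theta> \<ge> 0" using t by (simp add: \<theta>_def)
    define A where "A = (1 / dd ?x) *\<^sub>R (w 0 + pp ?x *\<^sub>R v 0 + qq ?x *\<^sub>R u 0)"
    define y1 where "y1 = v 0 + sg ?x *\<^sub>R A + (pp ?x / 2) *\<^sub>R (u 0 - A)"
    define Y1 where "Y1 = v 0 + (\<kappa> - \<delta> / 2) *\<^sub>R w 0"
    let ?om = "om ?x"
    let ?t1 = "exp (- (sg ?x * t)) *\<^sub>R A - (exp (- (\<kappa> * ?x * t)) / ?x) *\<^sub>R w 0"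
    let ?t2 = "(exp (- (pp ?x / 2 * t)) * cos (?om * t)) *\<^sub>R (u 0 - A)
      + (1 / ?x * exp (- (\<delta> / 2 * ?x * t)) * (cos (r * t) - dcorr * r * ?x * t * sin (r * t))) *\<^sub>R w 0"
    let ?t3 = "(exp (- (pp ?x / 2 * t)) * sin (?om * t) / ?om) *\<^sub>R y1 - (1 / r * sin (r * t) * exp (- (\<delta> / 2 * ?x * t))) *\<^sub>R Y1"
    have "u t = exp (- (sg ?x * t)) *\<^sub>R A + exp (- (pp ?x / 2 * t)) *\<^sub>R (cos (?om * t) *\<^sub>R (u 0 - A) + (sin (?om * t) / ?om) *\<^sub>R y1)"
      using flow_explicit[OF H fl t] by (simp add: A_def y1_def)
    then have E1: "u t - ((sym0 \<kappa> \<delta> t r + dcorr * t * symH \<delta> t r) *\<^sub>R w 0 + sym1 \<delta> t r *\<^sub>R Y1) = ?t1 + ?t2 + ?t3"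
    proof -
      assume U: "u t = exp (- (sg ?x * t)) *\<^sub>R A + exp (- (pp ?x / 2 * t)) *\<^sub>R (cos (?om * t) *\<^sub>R (u 0 - A) + (sin (?om * t) / ?om) *\<^sub>R y1)"
      have s0: "sym0 \<kappa> \<delta> t r + dcorr * t * symH \<delta> t r = exp (- (\<kappa> * ?x * t)) / ?x
          - 1 / ?x * exp (- (\<delta> / 2 * ?x * t)) * (cos (r * t) - dcorr * r * ?x * t * sin (r * t))"
        using r by (simp add: sym0_def symH_def field_simps)
      have s1: "sym1 \<delta> t r = 1 / r * sin (r * t) * exp (- (\<delta> / 2 * ?x * t))"
        by (simp add: sym1_def)
      show ?thesis unfolding s0 s1 U
        by (simp add: scaleR_diff_left scaleR_add_right mult.assoc)
    qed
    have B: "norm (?t1 + ?t2 + ?t3) \<le> (k6 + k1 * \<theta>) * N * e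
       + ((1 + k6) + (k1 / 2 + 2 * k3) * \<theta> + 2 * k4\<^sup>2 * \<theta>\<^sup>2) * N * e
       + (4 * k7 + (1 + \<kappa> + \<delta>) * (4 * k4 + (k1 / 2 + k4) * \<theta>)) * N * e"
    proof -
      have "norm ?t1 \<le> (k6 + k1 * \<theta>) * N * e"
        using term1[OF H fl t] unfolding N_def \<theta>_def e_def A_def .
      moreover have "norm ?t2 \<le> ((1 + k6) + (k1 / 2 + 2 * k3) * \<theta> + 2 * k4\<^sup>2 * \<theta>\<^sup>2) * N * e"
        using term2[OF H fl t] unfolding N_def \<theta>_def e_def A_def .
      moreover have "norm ?t3 \<le> (4 * k7 + (1 + \<kappa> + \<delta>) * (4 * k4 + (k1 / 2 + k4) * \<theta>)) * N * e"
        using term3[OF H fl t] unfolding N_def \<theta>_def e_def A_def y1_def Y1_def .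
      moreover have "norm (?t1 + ?t2 + ?t3) \<le> norm ?t1 + norm ?t2 + norm ?t3"
        by (intro order_trans[OF norm_triangle_ineq] add_right_mono norm_triangle_ineq)
      ultimately show ?thesis by linarith
    qed
    have "(k6 + k1 * \<theta>) + ((1 + k6) + (k1 / 2 + 2 * k3) * \<theta> + 2 * k4\<^sup>2 * \<theta>\<^sup>2)
       + (4 * k7 + (1 + \<kappa> + \<delta>) * (4 * k4 + (k1 / 2 + k4) * \<theta>)) \<le> K * (1 + \<theta> + \<theta>\<^sup>2)"
    proof -
      let ?P = "1 + \<theta> + \<theta>\<^sup>2"
      have P: "1 \<le> ?P" "\<theta> \<le> ?P" "\<theta>\<^sup>2 \<le> ?P" using th by auto
      have "(k6 + k1 * \<theta>) + ((1 + k6) + (k1 / 2 + 2 * k3) * \<theta> + 2 * k4\<^sup>2 * \<theta>\<^sup>2) + (4 * k7 + (1 + \<kappa> + \<delta>) * (4 * k4 + (k1 / 2 + k4) * \<theta>))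
        \<le> (k6 * ?P + k1 * ?P) + ((1 + k6) * ?P + (k1 / 2 + 2 * k3) * ?P + 2 * k4\<^sup>2 * ?P) + (4 * k7 * ?P + (1 + \<kappa> + \<delta>) * (4 * k4 * ?P + (k1 / 2 + k4) * ?P))"
        using P params_pos kpos by (intro add_mono mult_left_mono) (auto simp: mult_le_cancel_left1)
      also have "\<dots> = K * ?P" by (simp only: K_def distrib_right distrib_left mult.assoc)
      finally show ?thesis .
    qed
    then have S: "((k6 + k1 * \<theta>) + ((1 + k6) + (k1 / 2 + 2 * k3) * \<theta> + 2 * k4\<^sup>2 * \<theta>\<^sup>2)
       + (4 * k7 + (1 + \<kappa> + \<delta>) * (4 * k4 + (k1 / 2 + k4) * \<theta>))) * (N * e) \<le> K * (1 + \<theta> + \<theta>\<^sup>2) * (N * e)"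
      using N by (intro mult_right_mono) (auto simp: e_def)
    have L: "K * (1 + \<theta> + \<theta>\<^sup>2) * (N * e) \<le> K * (1 + 1 / c + 4 / c\<^sup>2) * exp (- (c * \<theta>)) * N"
    proof -
      have "e = exp (- (2 * c * \<theta>))" by (simp add: e_def c_def \<theta>_def)
      then have "(1 + \<theta> + \<theta>\<^sup>2) * e \<le> (1 + 1 / c + 4 / c\<^sup>2) * exp (- (c * \<theta>))"
        using poly_exp_absorb[OF c(1) th] by simp
      then have "(K * N) * ((1 + \<theta> + \<theta>\<^sup>2) * e) \<le> (K * N) * ((1 + 1 / c + 4 / c\<^sup>2) * exp (- (c * \<theta>)))"
        using K N by (intro mult_left_mono) auto
      then show ?thesis by (simp only: mult_ac)
    qed
    have "norm (?t1 + ?t2 + ?t3) \<le> K * (1 + 1 / c + 4 / c\<^sup>2) * exp (- (c * \<theta>)) * N"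
      using order_trans[OF B[unfolded mult.assoc[of _ N e] distrib_right[symmetric]] order_trans[OF S L]] .
    then show "norm (u t - ((sym0 \<kappa> \<delta> t r + dcorr * t * symH \<delta> t r) *\<^sub>R w 0
            + sym1 \<delta> t r *\<^sub>R (v 0 + (\<kappa> - \<delta> / 2) *\<^sub>R w 0)))
         \<le> K * (1 + 1 / c + 4 / c\<^sup>2) * exp (- (c * r\<^sup>2 * t)) * (norm (u 0) + norm (v 0) + norm (w 0))"
      unfolding N_def[symmetric] Y1_def[symmetric] E1 by (simp only: \<theta>_def mult.assoc[of c])
  qed
qed

end

section \<open>The symbols of the profiles\<close>

lemma abs_one_minus_cos_le: "\<bar>1 - cos y\<bar> \<le> y\<^sup>2 / 2" for y :: real
proof -
  have "\<bar>1 - cos y\<bar> = 2 * (sin (y / 2))\<^sup>2" using cos_double_sin[of "y / 2"] by simp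
  also have "(sin (y / 2))\<^sup>2 \<le> (y / 2)\<^sup>2"
    using abs_sin_x_le_abs_x[of "y / 2"] by (simp only: abs_le_square_iff)
  finally show ?thesis by (simp add: power_divide)
qed

lemma sym_measurable [measurable]:
  "sym0 \<kappa> \<delta> t \<in> borel_measurable borel" "sym1 \<delta> t \<in> borel_measurable borel" "symH \<delta> t \<in> borel_measurable borel"
  unfolding sym0_def sym1_def symH_def by measurable

text \<open>The elementary majorant of |sin (r t)| / r.\<close>

definition wmin :: "real \<Rightarrow> real \<Rightarrow> real" where "wmin t r = min t (1 / r)"

lemma wmin_sq: "r > 0 \<Longrightarrow> t > 0 \<Longrightarrow> (wmin t r * exp (- (c * r\<^sup>2 * t)))\<^sup>2 = low_weight (2 * c) t r"
proof -
  assume r: "r > 0" and t: "t > 0"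
  have "(min t (1 / r))\<^sup>2 = min (t\<^sup>2) (1 / r\<^sup>2)"
  proof (cases "t \<le> 1 / r")
    case True
    then have "t\<^sup>2 \<le> (1 / r)\<^sup>2" using t by (intro power_mono) auto
    then show ?thesis using True by (simp add: power_divide)
  next
    case False
    then have "(1 / r)\<^sup>2 \<le> t\<^sup>2" using r by (intro power_mono) auto
    then show ?thesis using False by (simp add: power_divide)
  qed
  moreover have "(exp (- (c * r\<^sup>2 * t)))\<^sup>2 = exp (- (2 * c) * r\<^sup>2 * t)" by (simp flip: exp_double)
  ultimately show ?thesis by (simp add: wmin_def low_weight_def power_mult_distrib)
qed

lemma wmin_pos: "r > 0 \<Longrightarrow> t > 0 \<Longrightarrow> wmin t r > 0"
  by (simp add: wmin_def)

text \<open>For \<open>r \<ge> 1\<close>, \<open>t \<ge> 1\<close> the minimum is \<open>1 / r\<close>, so the bound by \<open>t\<close> is only needed for \<open>r \<le> 1\<close>.\<close>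

lemma le_wmin:
  assumes r: "r > 0" and t: "t \<ge> 1" and 1: "r \<le> 1 \<Longrightarrow> f \<le> C * t * e" and 2: "f \<le> C * (1 / r) * e"
  shows "f \<le> C * wmin t r * e"
proof (cases "t \<le> 1 / r")
  case True
  then have "r \<le> 1" using t r by (simp add: field_simps) (metis mult_le_cancel_right1 mult.commute mult_left_le_imp_le order_trans less_le not_le mult_le_one mult.left_neutral)
  then show ?thesis using True 1 by (simp add: wmin_def)
next
  case False
  then show ?thesis using 2 by (simp add: wmin_def)
qed

lemma sym_common:
  fixes \<kappa> \<delta> r t :: real
  assumes k: "0 < \<kappa>" and d: "4 * \<kappa> < \<delta>" and r: "r > 0" and t: "t \<ge> 1"
  shows sym0_exp: "exp (- (\<delta> / 2) * r\<^sup>2 * t) \<le> exp (- (2 * \<kappa> * r\<^sup>2 * t))"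
    and sym0_expdiff: "\<bar>exp (- \<kappa> * r\<^sup>2 * t) - exp (- (\<delta> / 2) * r\<^sup>2 * t)\<bar> \<le> \<delta> / 2 * r\<^sup>2 * t * exp (- (\<kappa> * r\<^sup>2 * t))"
proof -
  have "2 * \<kappa> * (r\<^sup>2 * t) \<le> \<delta> / 2 * (r\<^sup>2 * t)" using d t by (intro mult_right_mono) auto
  then show "exp (- (\<delta> / 2) * r\<^sup>2 * t) \<le> exp (- (2 * \<kappa> * r\<^sup>2 * t))" by (simp add: mult.assoc)
  have kd: "\<kappa> * (r\<^sup>2 * t) \<le> \<delta> / 2 * (r\<^sup>2 * t)" using k d t by (intro mult_right_mono) auto
  have "\<bar>exp (- (\<kappa> * (r\<^sup>2 * t))) - exp (- (\<delta> / 2 * (r\<^sup>2 * t)))\<bar> \<le> \<bar>\<kappa> * (r\<^sup>2 * t) - \<delta> / 2 * (r\<^sup>2 * t)\<bar> * exp (- (\<kappa> * (r\<^sup>2 * t)))"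
    using kd by (intro exp_diff_le) auto
  also have "\<bar>\<kappa> * (r\<^sup>2 * t) - \<delta> / 2 * (r\<^sup>2 * t)\<bar> \<le> \<delta> / 2 * (r\<^sup>2 * t)"
  proof -
    have "0 \<le> \<kappa> * (r\<^sup>2 * t)" using k t by simp
    then show ?thesis using kd by linarith
  qed
  finally show "\<bar>exp (- \<kappa> * r\<^sup>2 * t) - exp (- (\<delta> / 2) * r\<^sup>2 * t)\<bar> \<le> \<delta> / 2 * r\<^sup>2 * t * exp (- (\<kappa> * r\<^sup>2 * t))"
    by (simp add: mult.assoc mult_right_mono)
qed

text \<open>The numerator is split into the difference of the two exponentials, of size r^2 t, and
  (1 - cos (r t)) times an exponential. The quadratic bound for 1 - cos cancels 1/r^2 and gives
  integrability at the origin; after multiplication by r the linear bound gives t and the trivial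
  bound gives 1/r.\<close>

lemma sym0_bound:
  assumes k: "0 < \<kappa>" and d: "4 * \<kappa> < \<delta>" and r: "r > 0" and t: "t \<ge> 1"
  shows "\<bar>sym0 \<kappa> \<delta> t r\<bar> \<le> (\<delta> * t + t\<^sup>2) * exp (- (\<kappa> * r\<^sup>2 * t))"
    and "r * \<bar>sym0 \<kappa> \<delta> t r\<bar> \<le> (2 + \<delta>) * wmin t r * exp (- (\<kappa> * r\<^sup>2 * t))"
proof -
  let ?ek = "exp (- \<kappa> * r\<^sup>2 * t)" and ?ed = "exp (- (\<delta> / 2) * r\<^sup>2 * t)" and ?e = "exp (- (\<kappa> * r\<^sup>2 * t))"
  have edk: "?ed \<le> ?e"
  proof -
    have "\<kappa> * r\<^sup>2 * t \<le> 2 * \<kappa> * r\<^sup>2 * t" using k t by simp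
    then have "exp (- (2 * \<kappa> * r\<^sup>2 * t)) \<le> ?e" by simp
    then show ?thesis using sym0_exp[OF assms] by linarith
  qed
  have split: "?ek - cos (r * t) * ?ed = (?ek - ?ed) + (1 - cos (r * t)) * ?ed" by (simp add: algebra_simps)
  have n1: "\<bar>?ek - cos (r * t) * ?ed\<bar> \<le> \<delta> / 2 * r\<^sup>2 * t * ?e + \<bar>1 - cos (r * t)\<bar> * ?e"
    unfolding split using sym0_expdiff[OF assms] edk
    by (intro order_trans[OF abs_triangle_ineq] add_mono) (auto simp: abs_mult intro!: mult_left_mono)
  have n2: "\<bar>?ek - cos (r * t) * ?ed\<bar> \<le> 2 * ?e"
  proof -
    have "\<bar>?ek - cos (r * t) * ?ed\<bar> \<le> \<bar>?ek\<bar> + \<bar>cos (r * t)\<bar> * \<bar>?ed\<bar>"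
      by (metis abs_mult abs_triangle_ineq4)
    also have "\<dots> \<le> ?e + 1 * ?e" using edk by (intro add_mono mult_mono) auto
    finally show ?thesis by simp
  qed
  have s: "\<bar>sym0 \<kappa> \<delta> t r\<bar> = \<bar>?ek - cos (r * t) * ?ed\<bar> / r\<^sup>2" by (simp add: sym0_def abs_mult)
  have "\<bar>?ek - cos (r * t) * ?ed\<bar> \<le> \<delta> / 2 * r\<^sup>2 * t * ?e + (r * t)\<^sup>2 / 2 * ?e"
  proof -
    have "\<bar>1 - cos (r * t)\<bar> * ?e \<le> (r * t)\<^sup>2 / 2 * ?e" by (rule mult_right_mono[OF abs_one_minus_cos_le]) simp
    then show ?thesis using n1 by linarith
  qed
  also have "\<dots> \<le> r\<^sup>2 * ((\<delta> * t + t\<^sup>2) * ?e)"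
  proof -
    have "0 \<le> \<delta> * r\<^sup>2 * t * ?e" "0 \<le> (r * t)\<^sup>2 * ?e" using k d t by auto
    moreover have "r\<^sup>2 * ((\<delta> * t + t\<^sup>2) * ?e) = \<delta> * r\<^sup>2 * t * ?e + (r * t)\<^sup>2 * ?e" by (simp add: algebra_simps power_mult_distrib)
    moreover have "\<delta> / 2 * r\<^sup>2 * t * ?e + (r * t)\<^sup>2 / 2 * ?e = (\<delta> * r\<^sup>2 * t * ?e + (r * t)\<^sup>2 * ?e) / 2" by (simp add: field_simps)
    ultimately show ?thesis by linarith
  qed
  finally show "\<bar>sym0 \<kappa> \<delta> t r\<bar> \<le> (\<delta> * t + t\<^sup>2) * ?e" unfolding s using r by (simp add: divide_le_eq mult.commute)
  have rs: "r * \<bar>sym0 \<kappa> \<delta> t r\<bar> = \<bar>?ek - cos (r * t) * ?ed\<bar> / r" unfolding s using r by (simp add: power2_eq_square)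
  show "r * \<bar>sym0 \<kappa> \<delta> t r\<bar> \<le> (2 + \<delta>) * wmin t r * ?e"
  proof (rule le_wmin[OF r t])
    have "\<bar>?ek - cos (r * t) * ?ed\<bar> / r \<le> 2 * ?e / r" using n2 r by (intro divide_right_mono) auto
    also have "\<dots> \<le> (2 + \<delta>) * ?e / r" using r k d by (intro divide_right_mono mult_right_mono) auto
    finally show "r * \<bar>sym0 \<kappa> \<delta> t r\<bar> \<le> (2 + \<delta>) * (1 / r) * ?e" unfolding rs by simp
    assume r1: "r \<le> 1"
    have "\<bar>1 - cos (r * t)\<bar> \<le> r * t" 
    proof -
      have "\<bar>cos 0 - cos (r * t)\<bar> \<le> \<bar>0 - r * t\<bar>"
        using abs_sin_diff_le[of "pi / 2 - 0" "pi / 2 - r * t"] by (simp add: cos_sin_eq)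
      then show ?thesis using r t by simp
    qed
    then have "\<bar>?ek - cos (r * t) * ?ed\<bar> \<le> \<delta> / 2 * r\<^sup>2 * t * ?e + r * t * ?e"
      using n1 mult_right_mono[of "\<bar>1 - cos (r * t)\<bar>" "r * t" ?e, OF _ exp_ge_zero] by linarith
    also have "\<dots> = r * ((\<delta> / 2 * r + 1) * (t * ?e))" by (simp add: power2_eq_square algebra_simps)
    also have "\<dots> \<le> r * ((2 + \<delta>) * (t * ?e))"
    proof -
      have "\<delta> / 2 * r \<le> \<delta> * 1" using r1 r k d by (intro mult_mono) auto
      then show ?thesis using r t by (intro mult_left_mono mult_right_mono) auto
    qed
    finally show "r * \<bar>sym0 \<kappa> \<delta> t r\<bar> \<le> (2 + \<delta>) * t * ?e" unfolding rs using r by (simp add: divide_le_eq mult_ac)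
  qed
qed

lemma sym1_bound:
  assumes k: "0 < \<kappa>" and d: "4 * \<kappa> < \<delta>" and r: "r > 0" and t: "t \<ge> 1"
  shows "\<bar>sym1 \<delta> t r\<bar> \<le> wmin t r * exp (- (\<kappa> * r\<^sup>2 * t))"
proof -
  have "\<kappa> * r\<^sup>2 * t \<le> 2 * \<kappa> * r\<^sup>2 * t" using k t by simp
  then have e: "exp (- (\<delta> / 2) * r\<^sup>2 * t) \<le> exp (- (\<kappa> * r\<^sup>2 * t))" using sym0_exp[OF assms] by (meson exp_le_cancel_iff neg_le_iff_le order_trans)
  have "\<bar>1 / r * sin (r * t)\<bar> \<le> wmin t r"
  proof -
    have "\<bar>sin (r * t)\<bar> \<le> r * t" using abs_sin_x_le_abs_x[of "r * t"] r t by simp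
    then have "\<bar>sin (r * t)\<bar> / r \<le> t" using r by (simp add: divide_le_eq mult.commute)
    moreover have "\<bar>sin (r * t)\<bar> / r \<le> 1 / r" using r by (intro divide_right_mono) auto
    ultimately show ?thesis using r by (simp add: wmin_def abs_mult)
  qed
  then show ?thesis unfolding sym1_def abs_mult[of "1 / r * sin (r * t)"]
    using e wmin_pos[OF r, of t] t by (intro mult_mono) auto
qed

text \<open>The decay exp (- 2 \<kappa> r^2 t) is divided into two equal factors: one absorbs r^2 t,
  the other survives.\<close>

lemma symH_bound:
  assumes k: "0 < \<kappa>" and d: "4 * \<kappa> < \<delta>" and r: "r > 0" and t: "t \<ge> 1"
  shows "t * \<bar>symH \<delta> t r\<bar> \<le> (1 + 1 / \<kappa>) * wmin t r * exp (- (\<kappa> * r\<^sup>2 * t))"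
    and "r * (t * \<bar>symH \<delta> t r\<bar>) \<le> 1 / \<kappa> * exp (- (\<kappa> * r\<^sup>2 * t))"
proof -
  let ?e = "exp (- (\<kappa> * r\<^sup>2 * t))"
  have "\<bar>symH \<delta> t r\<bar> \<le> r * 1 * exp (- (2 * \<kappa> * r\<^sup>2 * t))"
    unfolding symH_def abs_mult using sym0_exp[OF assms] r by (intro mult_mono) auto
  then have b: "t * \<bar>symH \<delta> t r\<bar> \<le> t * r * exp (- (2 * \<kappa> * r\<^sup>2 * t))" using t by (simp add: mult.assoc mult_left_mono)
  have ee: "exp (- (2 * \<kappa> * r\<^sup>2 * t)) = ?e * ?e" by (simp flip: exp_add)
  have y: "r\<^sup>2 * t * ?e \<le> 1 / \<kappa>"
  proof -
    have "\<kappa> * r\<^sup>2 * t \<le> exp (\<kappa> * r\<^sup>2 * t)" using exp_ge_add_one_self[of "\<kappa> * r\<^sup>2 * t"] by linarith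
    then have "\<kappa> * r\<^sup>2 * t * ?e \<le> exp (\<kappa> * r\<^sup>2 * t) * ?e" by (rule mult_right_mono) simp
    also have "\<dots> = 1" by (simp flip: exp_add)
    finally show ?thesis using k by (simp add: field_simps)
  qed
  have "r * (t * \<bar>symH \<delta> t r\<bar>) \<le> r * (t * r * (?e * ?e))" using b r unfolding ee by (intro mult_left_mono) auto
  also have "\<dots> = (r\<^sup>2 * t * ?e) * ?e" by (simp add: power2_eq_square mult_ac)
  also have "\<dots> \<le> 1 / \<kappa> * ?e" using y by (rule mult_right_mono) simp
  finally show 2: "r * (t * \<bar>symH \<delta> t r\<bar>) \<le> 1 / \<kappa> * ?e" .
  show "t * \<bar>symH \<delta> t r\<bar> \<le> (1 + 1 / \<kappa>) * wmin t r * ?e"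
  proof (rule le_wmin[OF r t])
    have "r * (t * \<bar>symH \<delta> t r\<bar>) / r \<le> 1 / \<kappa> * ?e / r" by (rule divide_right_mono[OF 2]) (use r in simp)
    then have "t * \<bar>symH \<delta> t r\<bar> \<le> 1 / \<kappa> * ?e / r" using r by simp
    also have "\<dots> \<le> (1 + 1 / \<kappa>) * ?e / r" using r by (intro divide_right_mono mult_right_mono) auto
    finally show "t * \<bar>symH \<delta> t r\<bar> \<le> (1 + 1 / \<kappa>) * (1 / r) * ?e" by simp
    assume r1: "r \<le> 1"
    have e1: "?e \<le> 1" using k t by simp
    have "t * r * (?e * ?e) \<le> t * 1 * (1 * ?e)" using r1 r t e1 by (intro mult_mono) auto
    also have "\<dots> \<le> (1 + 1 / \<kappa>) * t * ?e" using t k by (simp add: mult_le_cancel_right1 distrib_right)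
    finally show "t * \<bar>symH \<delta> t r\<bar> \<le> (1 + 1 / \<kappa>) * t * ?e" using b unfolding ee by linarith
  qed
qed

text \<open>The origin is excluded because the symbols are bounded by expressions valid for r > 0; a
  single point is a null set.\<close>

lemma gaussian_dominated:
  fixes f :: "real^'n \<Rightarrow> 'b::{banach, second_countable_topology}"
  assumes c: "c > 0" and [measurable]: "f \<in> borel_measurable borel"
    and b: "\<And>\<xi>. \<xi> \<noteq> 0 \<Longrightarrow> norm (f \<xi>) \<le> B * exp (- c * (norm \<xi>)\<^sup>2)"
  shows "integrable lborel f" and "L2 f"
proof -
  have ae: "AE \<xi> in lborel. \<xi> \<noteq> (0::real^'n)" by (rule AE_lborel_singleton)
  show "integrable lborel f"
  proof (rule Bochner_Integration.integrable_bound[OF integrable_mult_right[OF gaussian_integrable[OF c], of B]])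
    show "AE \<xi> in lborel. norm (f \<xi>) \<le> norm (B * exp (- c * (norm \<xi>)\<^sup>2))"
      using ae by eventually_elim (metis b order_trans abs_ge_self real_norm_def)
  qed measurable
  have c2: "2 * c > 0" using c by simp
  have "integrable lborel (\<lambda>\<xi>. (norm (f \<xi>))\<^sup>2)"
  proof (rule Bochner_Integration.integrable_bound[OF integrable_mult_right[OF gaussian_integrable[OF c2], of "B\<^sup>2"]])
    show "AE \<xi> in lborel. norm ((norm (f \<xi>))\<^sup>2) \<le> norm (B\<^sup>2 * exp (- (2 * c) * (norm \<xi>)\<^sup>2))"
      using ae
    proof eventually_elim
      case (elim \<xi>)
      have "(norm (f \<xi>))\<^sup>2 \<le> (B * exp (- c * (norm \<xi>)\<^sup>2))\<^sup>2" using b[OF elim] by (rule power_mono) simp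
      also have "\<dots> = B\<^sup>2 * exp (- (2 * c) * (norm \<xi>)\<^sup>2)" by (simp add: power_mult_distrib flip: exp_double)
      finally show ?case by simp
    qed
  qed measurable
  then show "L2 f" by (simp add: L2_def)
qed

lemma poly_gaussian_bound:
  fixes c t r f B :: real
  assumes c: "c > 0" and t: "t \<ge> 1" and r: "r > 0" and f: "\<bar>f\<bar> \<le> B * exp (- (c * r\<^sup>2 * t))" and B: "B \<ge> 0"
  shows "(1 + r + r\<^sup>2) * \<bar>f\<bar> \<le> 2 * B * (1 + 2 / c + 16 / c\<^sup>2) * exp (- (c / 2) * r\<^sup>2)"
proof -
  define y where "y = r\<^sup>2"
  have y: "y \<ge> 0" by (simp add: y_def)
  have "0 \<le> (r - 1)\<^sup>2" by simp
  then have "2 * r \<le> 1 + y" by (simp add: y_def power2_eq_square algebra_simps)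
  then have "r \<le> 1 + y" using y by simp
  then have "1 + r + y \<le> 1 + (1 + y) + y" by simp
  also have "\<dots> \<le> 2 * (1 + y + y\<^sup>2)" by simp
  finally have r1: "1 + r + r\<^sup>2 \<le> 2 * (1 + y + y\<^sup>2)" by (simp only: y_def)
  have "c * r\<^sup>2 * 1 \<le> c * r\<^sup>2 * t" using c t by (intro mult_left_mono) auto
  then have e: "exp (- (c * r\<^sup>2 * t)) \<le> exp (- (2 * (c / 2) * y))" by (simp add: y_def)
  have "(1 + r + r\<^sup>2) * \<bar>f\<bar> \<le> (2 * (1 + y + y\<^sup>2)) * (B * exp (- (2 * (c / 2) * y)))"
  proof (rule mult_mono[OF r1 order_trans[OF f mult_left_mono[OF e B]]])
    show "0 \<le> 2 * (1 + y + y\<^sup>2)" using y by simp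
  qed simp
  also have "\<dots> = 2 * B * ((1 + y + y\<^sup>2) * exp (- (2 * (c / 2) * y)))" by simp
  also have "\<dots> \<le> 2 * B * ((1 + 1 / (c / 2) + 4 / (c / 2)\<^sup>2) * exp (- (c / 2 * y)))"
    using poly_exp_absorb[of "c / 2" y] c y B by (intro mult_left_mono) auto
  also have "\<dots> = 2 * B * (1 + 2 / c + 16 / c\<^sup>2) * exp (- (c / 2) * r\<^sup>2)"
    using c by (simp add: y_def power_divide)
  finally show ?thesis .
qed

text \<open>For fixed t. The factor 1 + r + r^2 provides the moments of the symbols up to order two
  that differentiation under the integral requires.\<close>

lemma sym_gaussian:
  assumes k: "0 < \<kappa>" and d: "4 * \<kappa> < \<delta>" and t: "t \<ge> 1"
  obtains B where "\<And>r. r > 0 \<Longrightarrow> (1 + r + r\<^sup>2) * \<bar>sym0 \<kappa> \<delta> t r\<bar> \<le> B * exp (- (\<kappa> / 2) * r\<^sup>2)"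
    "\<And>r. r > 0 \<Longrightarrow> (1 + r + r\<^sup>2) * \<bar>sym1 \<delta> t r\<bar> \<le> B * exp (- (\<kappa> / 2) * r\<^sup>2)"
    "\<And>r. r > 0 \<Longrightarrow> (1 + r + r\<^sup>2) * \<bar>symH \<delta> t r\<bar> \<le> B * exp (- (\<kappa> / 2) * r\<^sup>2)"
proof -
  let ?Q = "\<lambda>B. 2 * B * (1 + 2 / \<kappa> + 16 / \<kappa>\<^sup>2)"
  let ?B0 = "\<delta> * t + t\<^sup>2 + t + (1 + 1 / \<kappa>) * t"
  have w: "wmin t r \<le> t" for r by (simp add: wmin_def)
  have nn: "0 \<le> \<delta> * t" "0 \<le> t\<^sup>2" "0 \<le> t" "0 \<le> (1 + 1 / \<kappa>) * t" using k d t by auto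
  have mono: "\<bar>f\<bar> \<le> b * exp (- (\<kappa> * r\<^sup>2 * t)) \<Longrightarrow> b \<le> ?B0 \<Longrightarrow> \<bar>f\<bar> \<le> ?B0 * exp (- (\<kappa> * r\<^sup>2 * t))" for f b r :: real
    by (erule order_trans) (rule mult_right_mono, auto)
  show thesis
  proof (rule that[of "?Q ?B0"])
    fix r :: real assume r: "r > 0"
    note P = poly_gaussian_bound[OF k t r]
    have B0: "?B0 \<ge> 0" using nn by linarith
    show "(1 + r + r\<^sup>2) * \<bar>sym0 \<kappa> \<delta> t r\<bar> \<le> ?Q ?B0 * exp (- (\<kappa> / 2) * r\<^sup>2)"
      by (rule P[OF mono[OF sym0_bound(1)[OF k d r t]] B0]) (use nn in linarith)
    show "(1 + r + r\<^sup>2) * \<bar>sym1 \<delta> t r\<bar> \<le> ?Q ?B0 * exp (- (\<kappa> / 2) * r\<^sup>2)"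
      by (rule P[OF mono[OF sym1_bound[OF k d r t]] B0]) (use nn w[of r] in linarith)
    have "\<bar>symH \<delta> t r\<bar> \<le> t * \<bar>symH \<delta> t r\<bar>" using t mult_right_mono[of 1 t "\<bar>symH \<delta> t r\<bar>"] by simp
    also note symH_bound(1)[OF k d r t]
    finally have h: "\<bar>symH \<delta> t r\<bar> \<le> (1 + 1 / \<kappa>) * wmin t r * exp (- (\<kappa> * r\<^sup>2 * t))" .
    have "(1 + 1 / \<kappa>) * wmin t r \<le> (1 + 1 / \<kappa>) * t" using w k by (intro mult_left_mono) auto
    then have le: "(1 + 1 / \<kappa>) * wmin t r \<le> ?B0" using nn by linarith
    show "(1 + r + r\<^sup>2) * \<bar>symH \<delta> t r\<bar> \<le> ?Q ?B0 * exp (- (\<kappa> / 2) * r\<^sup>2)"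
      by (rule P[OF mono[OF h le] B0])
  qed
qed

section \<open>Inverse transforms of the profile symbols\<close>

lemma integrable_trig_mult:
  fixes a :: "real^'n \<Rightarrow> real"
  assumes a: "integrable lborel a"
  shows "integrable lborel (\<lambda>\<xi>. cos (x \<bullet> \<xi>) * a \<xi>)" "integrable lborel (\<lambda>\<xi>. sin (x \<bullet> \<xi>) * a \<xi>)"
proof -
  have [measurable]: "a \<in> borel_measurable borel" using a by auto
  show "integrable lborel (\<lambda>\<xi>. cos (x \<bullet> \<xi>) * a \<xi>)" "integrable lborel (\<lambda>\<xi>. sin (x \<bullet> \<xi>) * a \<xi>)"
    by (rule Bochner_Integration.integrable_bound[OF a]; auto simp: abs_mult mult_left_le_one_le)+
qed

lemma integral_odd:
  fixes f :: "real^'n \<Rightarrow> real"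
  assumes "f \<in> borel_measurable borel" "\<And>\<xi>. f (- \<xi>) = - f \<xi>"
  shows "(\<integral>\<xi>. f \<xi> \<partial>lborel) = 0"
  using lborel_uminus(1)[OF assms(1)] assms(2) by simp

text \<open>Hermitian symmetry: the imaginary part of the integrand is odd in \<xi> and integrates
  to zero. Hence the even real part and odd imaginary part of the profile symbols produce real
  functions.\<close>

lemma inv_fourier_even_odd:
  fixes a b :: "real^'n \<Rightarrow> real"
  assumes a: "integrable lborel a" "\<And>\<xi>. a (- \<xi>) = a \<xi>" and b: "integrable lborel b" "\<And>\<xi>. b (- \<xi>) = - b \<xi>"
  shows "inv_fourier (\<lambda>\<xi>. Complex (a \<xi>) (b \<xi>)) x =
    complex_of_real (1 / (2 * pi) ^ CARD('n) * ((\<integral>\<xi>. cos (x \<bullet> \<xi>) * a \<xi> \<partial>lborel) - (\<integral>\<xi>. sin (x \<bullet> \<xi>) * b \<xi> \<partial>lborel)))"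
proof -
  have [measurable]: "a \<in> borel_measurable borel" "b \<in> borel_measurable borel" using a b by auto
  let ?R = "\<lambda>\<xi>. cos (x \<bullet> \<xi>) * a \<xi> - sin (x \<bullet> \<xi>) * b \<xi>"
  let ?J = "\<lambda>\<xi>. cos (x \<bullet> \<xi>) * b \<xi> + sin (x \<bullet> \<xi>) * a \<xi>"
  note i = integrable_trig_mult[OF a(1), of x] integrable_trig_mult[OF b(1), of x]
  have eq: "exp (\<i> * complex_of_real (x \<bullet> \<xi>)) * Complex (a \<xi>) (b \<xi>) = complex_of_real (?R \<xi>) + \<i> * complex_of_real (?J \<xi>)" for \<xi>
    by (simp add: complex_eq_iff cis_conv_exp[symmetric])
  have "(\<integral>\<xi>. exp (\<i> * complex_of_real (x \<bullet> \<xi>)) * Complex (a \<xi>) (b \<xi>) \<partial>lborel)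
     = (\<integral>\<xi>. complex_of_real (?R \<xi>) \<partial>lborel) + (\<integral>\<xi>. \<i> * complex_of_real (?J \<xi>) \<partial>lborel)"
    unfolding eq using i by (intro Bochner_Integration.integral_add integrable_mult_right integrable_of_real
      Bochner_Integration.integrable_diff Bochner_Integration.integrable_add)
  also have "(\<integral>\<xi>. \<i> * complex_of_real (?J \<xi>) \<partial>lborel) = \<i> * complex_of_real (\<integral>\<xi>. ?J \<xi> \<partial>lborel)"
    by (simp only: integral_mult_right_zero integral_complex_of_real)
  also have "(\<integral>\<xi>. ?J \<xi> \<partial>lborel) = 0"
    by (rule integral_odd) (simp_all add: a(2) b(2))
  also have "(\<integral>\<xi>. complex_of_real (?R \<xi>) \<partial>lborel) = complex_of_real ((\<integral>\<xi>. cos (x \<bullet> \<xi>) * a \<xi> \<partial>lborel) - (\<integral>\<xi>. sin (x \<bullet> \<xi>) * b \<xi> \<partial>lborel))"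
    using i by (simp only: integral_complex_of_real Bochner_Integration.integral_diff)
  finally show ?thesis unfolding inv_fourier_def by (simp only: of_real_mult of_real_0 mult_zero_right add_0_right)
qed

lemma Re_inv_fourier_real:
  fixes a :: "real^'n \<Rightarrow> real"
  assumes a: "integrable lborel a"
  shows "Re (inv_fourier (\<lambda>\<xi>. complex_of_real (a \<xi>)) x) = 1 / (2 * pi) ^ CARD('n) * (\<integral>\<xi>. cos (x \<bullet> \<xi>) * a \<xi> \<partial>lborel)"
proof -
  have [measurable]: "a \<in> borel_measurable borel" using a by auto
  have i: "integrable lborel (\<lambda>\<xi>. exp (\<i> * complex_of_real (x \<bullet> \<xi>)) * complex_of_real (a \<xi>))"
    using fourier_integrand_integrable[of "\<lambda>\<xi>. complex_of_real (a \<xi>)" "- x"] a by (simp add: inner_commute)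
  have "Re (\<integral>\<xi>. exp (\<i> * complex_of_real (x \<bullet> \<xi>)) * complex_of_real (a \<xi>) \<partial>lborel)
      = (\<integral>\<xi>. Re (exp (\<i> * complex_of_real (x \<bullet> \<xi>)) * complex_of_real (a \<xi>)) \<partial>lborel)"
    by (rule integral_Re[OF i, symmetric])
  also have "\<dots> = (\<integral>\<xi>. cos (x \<bullet> \<xi>) * a \<xi> \<partial>lborel)"
    by (rule Bochner_Integration.integral_cong) (simp_all add: cis_conv_exp[symmetric])
  finally have R: "Re (\<integral>\<xi>. exp (\<i> * complex_of_real (x \<bullet> \<xi>)) * complex_of_real (a \<xi>) \<partial>lborel) = (\<integral>\<xi>. cos (x \<bullet> \<xi>) * a \<xi> \<partial>lborel)" .
  have "Re (complex_of_real c * z) = c * Re z" for c z by simp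
  then show ?thesis unfolding inv_fourier_def by (simp only: R)
qed

text \<open>The second-order remainder of the cosine, integrated against |\<xi>|^2 |a|, is O(|h|^2),
  so the derivative is obtained directly from its definition.\<close>

lemma grad_cos_integral:
  fixes a :: "real^'n \<Rightarrow> real"
  assumes a: "integrable lborel a" and a1: "integrable lborel (\<lambda>\<xi>. norm \<xi> * a \<xi>)" and a2: "integrable lborel (\<lambda>\<xi>. (norm \<xi>)\<^sup>2 * a \<xi>)"
  shows "grad (\<lambda>x. c * (\<integral>\<xi>. cos (x \<bullet> \<xi>) * a \<xi> \<partial>lborel)) x \<bullet> M = - c * (\<integral>\<xi>. sin (x \<bullet> \<xi>) * (a \<xi> * (\<xi> \<bullet> M)) \<partial>lborel)"
proof -
  have [measurable]: "a \<in> borel_measurable borel" using a by auto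
  let ?f = "\<lambda>x. c * (\<integral>\<xi>. cos (x \<bullet> \<xi>) * a \<xi> \<partial>lborel)"
  let ?v = "\<lambda>\<xi>. (sin (x \<bullet> \<xi>) * a \<xi>) *\<^sub>R \<xi>"
  have iv: "integrable lborel ?v"
  proof (rule Bochner_Integration.integrable_bound[OF a1])
    show "AE \<xi> in lborel. norm (?v \<xi>) \<le> norm (norm \<xi> * a \<xi>)"
    proof (rule AE_I2)
      fix \<xi> :: "real^'n"
      have "\<bar>sin (x \<bullet> \<xi>)\<bar> * (\<bar>a \<xi>\<bar> * norm \<xi>) \<le> 1 * (\<bar>a \<xi>\<bar> * norm \<xi>)" by (intro mult_right_mono) auto
      then show "norm (?v \<xi>) \<le> norm (norm \<xi> * a \<xi>)" by (simp add: abs_mult mult_ac)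
    qed
  qed measurable
  define D where "D = (- c) *\<^sub>R (\<integral>\<xi>. ?v \<xi> \<partial>lborel)"
  define A2 where "A2 = (\<integral>\<xi>. (norm \<xi>)\<^sup>2 * \<bar>a \<xi>\<bar> \<partial>lborel)"
  have ia2: "integrable lborel (\<lambda>\<xi>. (norm \<xi>)\<^sup>2 * \<bar>a \<xi>\<bar>)"
    using integrable_norm[OF a2] by (simp add: abs_mult)
  have quad: "norm (?f (x + h) - ?f x - h \<bullet> D) \<le> (2 * \<bar>c\<bar> * A2) * (norm h)\<^sup>2" for h
  proof -
    have ih: "integrable lborel (\<lambda>\<xi>. h \<bullet> ?v \<xi>)" by (rule integrable_inner_right[OF iv])
    note i1 = integrable_trig_mult(1)[OF a]
    have hD: "h \<bullet> D = - c * (\<integral>\<xi>. h \<bullet> ?v \<xi> \<partial>lborel)"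
      unfolding D_def using integral_inner_right[OF iv, of h] by simp
    have alg: "c * A - c * B - (- c * H) = c * ((A - B) + H)" for A B H :: real by (simp add: algebra_simps)
    define I where "I = (\<integral>\<xi>. (cos ((x + h) \<bullet> \<xi>) * a \<xi> - cos (x \<bullet> \<xi>) * a \<xi>) + h \<bullet> ?v \<xi> \<partial>lborel)"
    have fI: "?f (x + h) - ?f x - h \<bullet> D = c * I"
      unfolding I_def hD alg Bochner_Integration.integral_add[OF Bochner_Integration.integrable_diff[OF i1[of "x + h"] i1[of x]] ih]
        Bochner_Integration.integral_diff[OF i1[of "x + h"] i1[of x]] by (rule refl)
    have "norm I \<le> (\<integral>\<xi>. (2 * (norm h)\<^sup>2) * ((norm \<xi>)\<^sup>2 * \<bar>a \<xi>\<bar>) \<partial>lborel)"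
      unfolding I_def
    proof (rule Bochner_Integration.integral_norm_bound_integral)
      show "integrable lborel (\<lambda>\<xi>. (cos ((x + h) \<bullet> \<xi>) * a \<xi> - cos (x \<bullet> \<xi>) * a \<xi>) + h \<bullet> ?v \<xi>)"
        by (rule Bochner_Integration.integrable_add[OF Bochner_Integration.integrable_diff[OF i1[of "x + h"] i1[of x]] ih])
      show "integrable lborel (\<lambda>\<xi>. (2 * (norm h)\<^sup>2) * ((norm \<xi>)\<^sup>2 * \<bar>a \<xi>\<bar>))" using ia2 by simp
      fix \<xi> :: "real^'n"
      have "(cos ((x + h) \<bullet> \<xi>) * a \<xi> - cos (x \<bullet> \<xi>) * a \<xi>) + h \<bullet> ?v \<xi>
        = (cos (x \<bullet> \<xi> + h \<bullet> \<xi>) - cos (x \<bullet> \<xi>) + (h \<bullet> \<xi>) * sin (x \<bullet> \<xi>)) * a \<xi>"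
        by (simp add: inner_add_left algebra_simps)
      also have "norm \<dots> \<le> (2 * (h \<bullet> \<xi>)\<^sup>2) * \<bar>a \<xi>\<bar>"
        unfolding real_norm_def abs_mult by (intro mult_right_mono cos_taylor2) simp
      also have "\<dots> \<le> (2 * ((norm h)\<^sup>2 * (norm \<xi>)\<^sup>2)) * \<bar>a \<xi>\<bar>"
        using Cauchy_Schwarz_ineq[of h \<xi>] by (intro mult_right_mono mult_left_mono) (auto simp: power2_norm_eq_inner)
      finally show "norm ((cos ((x + h) \<bullet> \<xi>) * a \<xi> - cos (x \<bullet> \<xi>) * a \<xi>) + h \<bullet> ?v \<xi>) \<le> (2 * (norm h)\<^sup>2) * ((norm \<xi>)\<^sup>2 * \<bar>a \<xi>\<bar>)"
        by (simp add: mult_ac)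
    qed
    also have "\<dots> = (2 * (norm h)\<^sup>2) * A2" unfolding A2_def by (rule integral_mult_right_zero)
    finally have "\<bar>c\<bar> * norm I \<le> \<bar>c\<bar> * ((2 * (norm h)\<^sup>2) * A2)" by (rule mult_left_mono) simp
    then show ?thesis unfolding fI norm_mult by (simp add: mult_ac)
  qed
  have "GDERIV ?f x :> D"
    unfolding gderiv_def has_derivative_at
  proof (intro conjI bounded_linear_inner_left)
    show "(\<lambda>h. norm (?f (x + h) - ?f x - h \<bullet> D) / norm h) \<midarrow>0\<rightarrow> 0"
    proof (rule Lim_null_comparison)
      show "\<forall>\<^sub>F h in at 0. norm (norm (?f (x + h) - ?f x - h \<bullet> D) / norm h) \<le> (2 * \<bar>c\<bar> * A2) * norm h"
        unfolding eventually_at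
      proof (intro exI[of _ 1] conjI ballI impI)
        fix h :: "real^'n" assume "h \<noteq> 0 \<and> dist h 0 < 1"
        then have h: "norm h > 0" by simp
        have "norm (?f (x + h) - ?f x - h \<bullet> D) / norm h \<le> (2 * \<bar>c\<bar> * A2) * (norm h)\<^sup>2 / norm h"
          using quad h by (intro divide_right_mono) auto
        then show "norm (norm (?f (x + h) - ?f x - h \<bullet> D) / norm h) \<le> (2 * \<bar>c\<bar> * A2) * norm h"
          using h by (simp add: power2_eq_square)
      qed simp
      show "(\<lambda>h::real^'n. (2 * \<bar>c\<bar> * A2) * norm h) \<midarrow>0\<rightarrow> 0"
        by (intro tendsto_mult_right_zero tendsto_norm_zero tendsto_ident_at)
    qed
  qed
  \<comment> \<open>\<open>grad\<close> is a definite description, so uniqueness of the derivative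
    is part of the claim.\<close>
  then have "grad ?f x = D"
    unfolding grad_def
  proof (rule the_equality)
    fix D' assume "GDERIV ?f x :> D'"
    then have "(\<lambda>h. h \<bullet> D') = (\<lambda>h. h \<bullet> D)"
      using \<open>GDERIV ?f x :> D\<close> unfolding gderiv_def by (rule has_derivative_unique)
    then show "D' = D" by (metis inner_commute vector_eq_ldot)
  qed
  then show ?thesis
    using integral_inner_left[OF iv, of M] by (simp add: D_def mult.assoc inner_scaleR_left)
qed

text \<open>\<open>d = Q = 0\<close>, \<open>M = 0\<close> gives the symbol of \<open>\<psi>\<^sup>(\<^sup>1\<^sup>)\<close>, and \<open>d\<close> equal to the coefficient of \<open>H\<^sub>0\<close>
  that of \<open>\<psi>\<^sup>(\<^sup>1\<^sup>) + \<psi>\<^sup>(\<^sup>2\<^sup>)\<close>.\<close>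

definition total_symbol :: "real \<Rightarrow> real \<Rightarrow> real \<Rightarrow> real \<Rightarrow> real \<Rightarrow> real^'n \<Rightarrow> real \<Rightarrow> real^'n \<Rightarrow> complex" where
  "total_symbol \<kappa> \<delta> d P Q M t \<xi> = Complex
     ((sym0 \<kappa> \<delta> t (norm \<xi>) + d * t * symH \<delta> t (norm \<xi>)) * P + sym1 \<delta> t (norm \<xi>) * Q)
     (- (sym0 \<kappa> \<delta> t (norm \<xi>) * (\<xi> \<bullet> M)))"

lemma Complex_measurable [measurable]:
  assumes [measurable]: "f \<in> borel_measurable M" "g \<in> borel_measurable M"
  shows "(\<lambda>x. Complex (f x) (g x)) \<in> borel_measurable M"
proof -
  have "(\<lambda>x. Complex (f x) (g x)) = (\<lambda>x. complex_of_real (f x) + \<i> * complex_of_real (g x))"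
    by (simp add: complex_eq_iff fun_eq_iff)
  then show ?thesis by simp
qed

context
  fixes \<kappa> \<delta> t :: real
  assumes k: "0 < \<kappa>" and d: "4 * \<kappa> < \<delta>" and t: "t \<ge> 1"
begin

lemma sym_integrable:
  shows "integrable lborel (\<lambda>\<xi>::real^'n. sym0 \<kappa> \<delta> t (norm \<xi>))"
    "integrable lborel (\<lambda>\<xi>::real^'n. norm \<xi> * sym0 \<kappa> \<delta> t (norm \<xi>))"
    "integrable lborel (\<lambda>\<xi>::real^'n. (norm \<xi>)\<^sup>2 * sym0 \<kappa> \<delta> t (norm \<xi>))"
    "integrable lborel (\<lambda>\<xi>::real^'n. sym1 \<delta> t (norm \<xi>))"
    "integrable lborel (\<lambda>\<xi>::real^'n. symH \<delta> t (norm \<xi>))"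
    "integrable lborel (\<lambda>\<xi>::real^'n. sym0 \<kappa> \<delta> t (norm \<xi>) * (\<xi> \<bullet> M))"
proof -
  obtain B where B: "\<And>r. r > 0 \<Longrightarrow> (1 + r + r\<^sup>2) * \<bar>sym0 \<kappa> \<delta> t r\<bar> \<le> B * exp (- (\<kappa> / 2) * r\<^sup>2)"
    "\<And>r. r > 0 \<Longrightarrow> (1 + r + r\<^sup>2) * \<bar>sym1 \<delta> t r\<bar> \<le> B * exp (- (\<kappa> / 2) * r\<^sup>2)"
    "\<And>r. r > 0 \<Longrightarrow> (1 + r + r\<^sup>2) * \<bar>symH \<delta> t r\<bar> \<le> B * exp (- (\<kappa> / 2) * r\<^sup>2)"
    by (rule sym_gaussian[OF k d t]) (rule that; assumption)
  have k2: "\<kappa> / 2 > 0" using k by simp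
  have le: "g * \<bar>a\<bar> \<le> (1 + r + r\<^sup>2) * \<bar>a\<bar>" if "g \<le> 1 + r + r\<^sup>2" for g a r :: real
    using that by (rule mult_right_mono) simp
  note G = gaussian_dominated(1)[OF k2]
  show "integrable lborel (\<lambda>\<xi>::real^'n. sym0 \<kappa> \<delta> t (norm \<xi>))"
    using order_trans[OF le B(1), of 1] by (intro G[of _ B]) auto
  show "integrable lborel (\<lambda>\<xi>::real^'n. sym1 \<delta> t (norm \<xi>))"
    using order_trans[OF le B(2), of 1] by (intro G[of _ B]) auto
  show "integrable lborel (\<lambda>\<xi>::real^'n. symH \<delta> t (norm \<xi>))"
    using order_trans[OF le B(3), of 1] by (intro G[of _ B]) auto
  show 1: "integrable lborel (\<lambda>\<xi>::real^'n. norm \<xi> * sym0 \<kappa> \<delta> t (norm \<xi>))"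
    using order_trans[OF le B(1)] by (intro G[of _ B]) (auto simp: abs_mult)
  show "integrable lborel (\<lambda>\<xi>::real^'n. (norm \<xi>)\<^sup>2 * sym0 \<kappa> \<delta> t (norm \<xi>))"
    using order_trans[OF le B(1)] by (intro G[of _ B]) (auto simp: abs_mult)
  show "integrable lborel (\<lambda>\<xi>::real^'n. sym0 \<kappa> \<delta> t (norm \<xi>) * (\<xi> \<bullet> M))"
  proof (rule Bochner_Integration.integrable_bound[OF integrable_mult_left[OF 1, of "norm M"]])
    show "AE \<xi> in lborel. norm (sym0 \<kappa> \<delta> t (norm \<xi>) * (\<xi> \<bullet> M)) \<le> norm (norm \<xi> * sym0 \<kappa> \<delta> t (norm \<xi>) * norm M)"
    proof (rule AE_I2)
      fix \<xi> :: "real^'n"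
      have "\<bar>sym0 \<kappa> \<delta> t (norm \<xi>)\<bar> * \<bar>\<xi> \<bullet> M\<bar> \<le> \<bar>sym0 \<kappa> \<delta> t (norm \<xi>)\<bar> * (norm \<xi> * norm M)"
        by (intro mult_left_mono Cauchy_Schwarz_ineq2) simp
      then show "norm (sym0 \<kappa> \<delta> t (norm \<xi>) * (\<xi> \<bullet> M)) \<le> norm (norm \<xi> * sym0 \<kappa> \<delta> t (norm \<xi>) * norm M)"
        by (simp add: abs_mult mult_ac)
    qed
  qed measurable
qed

lemma total_symbol_integrable:
  shows "integrable lborel (total_symbol \<kappa> \<delta> c P Q M t :: real^'n \<Rightarrow> complex)"
    and "L2 (total_symbol \<kappa> \<delta> c P Q M t :: real^'n \<Rightarrow> complex)"
proof -
  obtain B where B: "\<And>r. r > 0 \<Longrightarrow> (1 + r + r\<^sup>2) * \<bar>sym0 \<kappa> \<delta> t r\<bar> \<le> B * exp (- (\<kappa> / 2) * r\<^sup>2)"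
    "\<And>r. r > 0 \<Longrightarrow> (1 + r + r\<^sup>2) * \<bar>sym1 \<delta> t r\<bar> \<le> B * exp (- (\<kappa> / 2) * r\<^sup>2)"
    "\<And>r. r > 0 \<Longrightarrow> (1 + r + r\<^sup>2) * \<bar>symH \<delta> t r\<bar> \<le> B * exp (- (\<kappa> / 2) * r\<^sup>2)"
    by (rule sym_gaussian[OF k d t]) (rule that; assumption)
  have k2: "\<kappa> / 2 > 0" using k by simp
  have m: "(total_symbol \<kappa> \<delta> c P Q M t :: real^'n \<Rightarrow> complex) \<in> borel_measurable borel"
    unfolding total_symbol_def[abs_def] by measurable
  have b: "norm (total_symbol \<kappa> \<delta> c P Q M t \<xi>) \<le> (B * (\<bar>P\<bar> + \<bar>c * t\<bar> * \<bar>P\<bar> + \<bar>Q\<bar> + norm M)) * exp (- (\<kappa> / 2) * (norm \<xi>)\<^sup>2)"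
    if xi: "\<xi> \<noteq> 0" for \<xi> :: "real^'n"
  proof -
    let ?r = "norm \<xi>"
    let ?E = "B * exp (- (\<kappa> / 2) * ?r\<^sup>2)"
    have r: "?r > 0" using xi by simp
    have le: "g * \<bar>a\<bar> \<le> (1 + ?r + ?r\<^sup>2) * \<bar>a\<bar>" if "g \<le> 1 + ?r + ?r\<^sup>2" for g a :: real
      using that by (rule mult_right_mono) simp
    have s0: "\<bar>sym0 \<kappa> \<delta> t ?r\<bar> \<le> ?E" and s0r: "?r * \<bar>sym0 \<kappa> \<delta> t ?r\<bar> \<le> ?E" and s1: "\<bar>sym1 \<delta> t ?r\<bar> \<le> ?E" and sH: "\<bar>symH \<delta> t ?r\<bar> \<le> ?E"
      using order_trans[OF le B(1)[OF r], of 1] order_trans[OF le B(1)[OF r], of ?r] order_trans[OF le B(2)[OF r], of 1]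
        order_trans[OF le B(3)[OF r], of 1] by auto
    have "norm (total_symbol \<kappa> \<delta> c P Q M t \<xi>) \<le> \<bar>(sym0 \<kappa> \<delta> t ?r + c * t * symH \<delta> t ?r) * P + sym1 \<delta> t ?r * Q\<bar> + \<bar>sym0 \<kappa> \<delta> t ?r * (\<xi> \<bullet> M)\<bar>"
      using cmod_le[of "total_symbol \<kappa> \<delta> c P Q M t \<xi>"] by (simp add: total_symbol_def)
    also have "\<dots> \<le> (\<bar>sym0 \<kappa> \<delta> t ?r\<bar> * \<bar>P\<bar> + \<bar>c * t\<bar> * \<bar>symH \<delta> t ?r\<bar> * \<bar>P\<bar> + \<bar>sym1 \<delta> t ?r\<bar> * \<bar>Q\<bar>) + \<bar>sym0 \<kappa> \<delta> t ?r\<bar> * (?r * norm M)"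
    proof (rule add_mono)
      have "\<bar>(sym0 \<kappa> \<delta> t ?r + c * t * symH \<delta> t ?r) * P + sym1 \<delta> t ?r * Q\<bar>
         = \<bar>sym0 \<kappa> \<delta> t ?r * P + c * t * symH \<delta> t ?r * P + sym1 \<delta> t ?r * Q\<bar>" by (simp add: algebra_simps)
      also have "\<dots> \<le> \<bar>sym0 \<kappa> \<delta> t ?r * P\<bar> + \<bar>c * t * symH \<delta> t ?r * P\<bar> + \<bar>sym1 \<delta> t ?r * Q\<bar>" by linarith
      finally show "\<bar>(sym0 \<kappa> \<delta> t ?r + c * t * symH \<delta> t ?r) * P + sym1 \<delta> t ?r * Q\<bar>
         \<le> \<bar>sym0 \<kappa> \<delta> t ?r\<bar> * \<bar>P\<bar> + \<bar>c * t\<bar> * \<bar>symH \<delta> t ?r\<bar> * \<bar>P\<bar> + \<bar>sym1 \<delta> t ?r\<bar> * \<bar>Q\<bar>"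
        by (simp only: abs_mult)
      show "\<bar>sym0 \<kappa> \<delta> t ?r * (\<xi> \<bullet> M)\<bar> \<le> \<bar>sym0 \<kappa> \<delta> t ?r\<bar> * (?r * norm M)"
        unfolding abs_mult by (intro mult_left_mono Cauchy_Schwarz_ineq2) simp
    qed
    also have "\<dots> = \<bar>sym0 \<kappa> \<delta> t ?r\<bar> * \<bar>P\<bar> + \<bar>c * t\<bar> * (\<bar>symH \<delta> t ?r\<bar> * \<bar>P\<bar>) + \<bar>sym1 \<delta> t ?r\<bar> * \<bar>Q\<bar> + (?r * \<bar>sym0 \<kappa> \<delta> t ?r\<bar>) * norm M"
      by (simp add: mult_ac)
    also have "\<dots> \<le> ?E * \<bar>P\<bar> + \<bar>c * t\<bar> * (?E * \<bar>P\<bar>) + ?E * \<bar>Q\<bar> + ?E * norm M"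
      by (intro add_mono mult_left_mono mult_right_mono s0 s1 sH s0r) auto
    finally show ?thesis by (simp add: algebra_simps)
  qed
  show "integrable lborel (total_symbol \<kappa> \<delta> c P Q M t :: real^'n \<Rightarrow> complex)"
    and "L2 (total_symbol \<kappa> \<delta> c P Q M t :: real^'n \<Rightarrow> complex)"
    by (rule gaussian_dominated[OF k2 m b]; assumption)+
qed

lemma G0_eq: "G0 \<kappa> \<delta> t (x :: real^'n) = 1 / (2 * pi) ^ CARD('n) * (\<integral>\<xi>. cos (x \<bullet> \<xi>) * sym0 \<kappa> \<delta> t (norm \<xi>) \<partial>lborel)"
  unfolding G0_def sym0_def[symmetric] by (rule Re_inv_fourier_real[OF sym_integrable(1)])

lemma G1_eq: "G1 \<delta> t (x :: real^'n) = 1 / (2 * pi) ^ CARD('n) * (\<integral>\<xi>. cos (x \<bullet> \<xi>) * sym1 \<delta> t (norm \<xi>) \<partial>lborel)"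
  unfolding G1_def sym1_def[symmetric] by (rule Re_inv_fourier_real[OF sym_integrable(4)])

lemma H0_eq: "H0 \<kappa> \<delta> dh t (x :: real^'n) = (4 * dh - \<kappa> * \<delta>\<^sup>2) / (8 * \<kappa>) * t * (1 / (2 * pi) ^ CARD('n) * (\<integral>\<xi>. cos (x \<bullet> \<xi>) * symH \<delta> t (norm \<xi>) \<partial>lborel))"
  unfolding H0_def symH_def[symmetric] Re_inv_fourier_real[OF sym_integrable(5)] by (rule refl)

lemma inv_fourier_total_symbol:
  fixes x M :: "real^'n"
  shows "inv_fourier (total_symbol \<kappa> \<delta> c P Q M t) x =
    complex_of_real (1 / (2 * pi) ^ CARD('n) *
      (((\<integral>\<xi>. cos (x \<bullet> \<xi>) * sym0 \<kappa> \<delta> t (norm \<xi>) \<partial>lborel) + c * t * (\<integral>\<xi>. cos (x \<bullet> \<xi>) * symH \<delta> t (norm \<xi>) \<partial>lborel)) * P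
        + (\<integral>\<xi>. cos (x \<bullet> \<xi>) * sym1 \<delta> t (norm \<xi>) \<partial>lborel) * Q
        + (\<integral>\<xi>. sin (x \<bullet> \<xi>) * (sym0 \<kappa> \<delta> t (norm \<xi>) * (\<xi> \<bullet> M)) \<partial>lborel)))"
proof -
  let ?a = "\<lambda>\<xi>::real^'n. (sym0 \<kappa> \<delta> t (norm \<xi>) + c * t * symH \<delta> t (norm \<xi>)) * P + sym1 \<delta> t (norm \<xi>) * Q"
  let ?b = "\<lambda>\<xi>::real^'n. - (sym0 \<kappa> \<delta> t (norm \<xi>) * (\<xi> \<bullet> M))"
  note i = integrable_trig_mult(1)[OF sym_integrable(1), of x] integrable_trig_mult(1)[OF sym_integrable(5), of x]
    integrable_trig_mult(1)[OF sym_integrable(4), of x]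
  have ia: "integrable lborel ?a" using sym_integrable(1,4,5) by (intro Bochner_Integration.integrable_add integrable_mult_left integrable_mult_right)
  have ib: "integrable lborel ?b" using sym_integrable(6) by (rule Bochner_Integration.integrable_minus)
  have A: "(\<integral>\<xi>. cos (x \<bullet> \<xi>) * ?a \<xi> \<partial>lborel) = ((\<integral>\<xi>. cos (x \<bullet> \<xi>) * sym0 \<kappa> \<delta> t (norm \<xi>) \<partial>lborel) + c * t * (\<integral>\<xi>. cos (x \<bullet> \<xi>) * symH \<delta> t (norm \<xi>) \<partial>lborel)) * P
        + (\<integral>\<xi>. cos (x \<bullet> \<xi>) * sym1 \<delta> t (norm \<xi>) \<partial>lborel) * Q"
  proof -
    have "(\<integral>\<xi>. cos (x \<bullet> \<xi>) * ?a \<xi> \<partial>lborel) = (\<integral>\<xi>. (cos (x \<bullet> \<xi>) * sym0 \<kappa> \<delta> t (norm \<xi>) + c * t * (cos (x \<bullet> \<xi>) * symH \<delta> t (norm \<xi>))) * P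
        + cos (x \<bullet> \<xi>) * sym1 \<delta> t (norm \<xi>) * Q \<partial>lborel)"
      by (rule Bochner_Integration.integral_cong) (simp_all add: algebra_simps)
    then show ?thesis
      using Bochner_Integration.integral_add[OF integrable_mult_left[OF Bochner_Integration.integrable_add[OF i(1) integrable_mult_right[OF i(2), of "c * t"]], of P] integrable_mult_left[OF i(3), of Q]]
        Bochner_Integration.integral_add[OF i(1) integrable_mult_right[OF i(2), of "c * t"]]
      by (simp only: integral_mult_left_zero integral_mult_right_zero)
  qed
  have Bq: "(\<integral>\<xi>. sin (x \<bullet> \<xi>) * ?b \<xi> \<partial>lborel) = - (\<integral>\<xi>. sin (x \<bullet> \<xi>) * (sym0 \<kappa> \<delta> t (norm \<xi>) * (\<xi> \<bullet> M)) \<partial>lborel)"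
    by (simp only: mult_minus_right Bochner_Integration.integral_minus)
  have "inv_fourier (\<lambda>\<xi>. Complex (?a \<xi>) (?b \<xi>)) x =
    complex_of_real (1 / (2 * pi) ^ CARD('n) * ((\<integral>\<xi>. cos (x \<bullet> \<xi>) * ?a \<xi> \<partial>lborel) - (\<integral>\<xi>. sin (x \<bullet> \<xi>) * ?b \<xi> \<partial>lborel)))"
    by (rule inv_fourier_even_odd[OF ia _ ib]) simp_all
  then show ?thesis unfolding A Bq total_symbol_def[abs_def] by (simp only: diff_minus_eq_add)
qed

lemma profile1_symbol:
  fixes x :: "real^'n" and \<psi>2 :: "real^'n \<Rightarrow> real"
  shows
  "complex_of_real (profile1 \<kappa> \<delta> \<psi>2 t x) = inv_fourier (total_symbol \<kappa> \<delta> 0 (P_of \<psi>2) 0 0 t) x"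
  unfolding inv_fourier_total_symbol profile1_def G0_eq by simp

lemma profile12_symbol:
  fixes x :: "real^'n" and \<psi>1 \<psi>2 :: "real^'n \<Rightarrow> real"
  shows
  "complex_of_real (profile1 \<kappa> \<delta> \<psi>2 t x + profile2 \<kappa> \<delta> dh \<psi>1 \<psi>2 t x)
    = inv_fourier (total_symbol \<kappa> \<delta> ((4 * dh - \<kappa> * \<delta>\<^sup>2) / (8 * \<kappa>)) (P_of \<psi>2) (P_Psi12 \<kappa> \<delta> \<psi>1 \<psi>2) (M_of \<psi>2) t) x"
proof -
  have g: "G0 \<kappa> \<delta> t = (\<lambda>x::real^'n. 1 / (2 * pi) ^ CARD('n) * (\<integral>\<xi>. cos (x \<bullet> \<xi>) * sym0 \<kappa> \<delta> t (norm \<xi>) \<partial>lborel))"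
    by (rule ext) (rule G0_eq)
  have gr: "grad (G0 \<kappa> \<delta> t) x \<bullet> M_of \<psi>2 = - (1 / (2 * pi) ^ CARD('n)) * (\<integral>\<xi>. sin (x \<bullet> \<xi>) * (sym0 \<kappa> \<delta> t (norm \<xi>) * (\<xi> \<bullet> M_of \<psi>2)) \<partial>lborel)"
    unfolding g by (rule grad_cos_integral[OF sym_integrable(1) sym_integrable(2) sym_integrable(3)])
  \<comment> \<open>The minus sign from differentiating the cosine meets the minus sign of the
    moment term in \<open>profile2\<close>; the result is the plus sign produced by the imaginary
    part - \<open>sym0\<close> (\<xi> \<bullet> M) of the symbol.\<close>
  have alg: "c * I0 * P + (- (- c * IS) + d * t * (c * IH) * P + c * I1 * Q) = c * ((I0 + d * t * IH) * P + I1 * Q + IS)"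
    for c I0 IS IH I1 P Q d :: real by (simp add: algebra_simps)
  show ?thesis
    unfolding inv_fourier_total_symbol profile1_def profile2_def gr G0_eq G1_eq H0_eq P_Psi12_def of_real_eq_iff
    by (rule alg)
qed

end

section \<open>Transforms of the data\<close>

lemma L1norm_nonneg: "0 \<le> L1norm f" and L11norm_nonneg: "0 \<le> L11norm f"
  by (auto simp: L1norm_def L11norm_def intro!: integral_nonneg_AE)

lemma L1norm_le_L11norm: "L11 f \<Longrightarrow> L1norm f \<le> L11norm f"
  unfolding L11_def L1norm_def L11norm_def by (intro integral_mono) (auto simp: mult_le_cancel_right1)

lemma norm_mult_integrable:
  assumes "L11 f"
  shows "integrable lborel (\<lambda>x. norm x * \<bar>f x\<bar>)" "(\<integral>x. norm x * \<bar>f x\<bar> \<partial>lborel) \<le> L11norm f"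
proof -
  have i: "integrable lborel (\<lambda>x. (1 + norm x) * \<bar>f x\<bar>)" and m: "f \<in> borel_measurable borel"
    using assms by (auto simp: L11_def)
  show 1: "integrable lborel (\<lambda>x. norm x * \<bar>f x\<bar>)"
    by (rule Bochner_Integration.integrable_bound[OF i]) (use m in \<open>auto simp: abs_mult intro!: mult_right_mono\<close>)
  show "(\<integral>x. norm x * \<bar>f x\<bar> \<partial>lborel) \<le> L11norm f"
    unfolding L11norm_def by (rule integral_mono[OF 1 i]) (auto intro!: mult_right_mono)
qed

lemma fourier_real_integrable:
  fixes f :: "real^'n \<Rightarrow> real"
  assumes "integrable lborel f"
  shows "integrable lborel (\<lambda>x. iexp (- (x \<bullet> \<xi>)) * complex_of_real (f x))"
  using fourier_integrand_integrable[of "\<lambda>x. complex_of_real (f x)" \<xi>] assms by simp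

lemma fourier_real_eq: "fourier_real f \<xi> = (\<integral>x. iexp (- (x \<bullet> \<xi>)) * complex_of_real (f x) \<partial>lborel)"
  by (simp add: fourier_real_def fourier_def)

lemma fourier_real_bound:
  assumes "L1 f" shows "norm (fourier_real f \<xi>) \<le> L1norm f"
  using norm_fourier_le[of "\<lambda>x. complex_of_real (f x)" \<xi>] assms
  by (simp add: fourier_real_def L1norm_def L1_def)

lemma P_of_bound: "\<bar>P_of f\<bar> \<le> L1norm f"
  unfolding P_of_def L1norm_def using integral_norm_bound[of lborel f] by simp

lemma M_of_bound:
  assumes "L11 f" shows "norm (M_of f) \<le> L11norm f"
proof -
  have "norm (M_of f) \<le> (\<integral>x. norm (f x *\<^sub>R x) \<partial>lborel)" unfolding M_of_def by (rule integral_norm_bound)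
  then show ?thesis using norm_mult_integrable(2)[OF assms] by (simp add: mult.commute)
qed

text \<open>Each Taylor remainder comes with two bounds: one of higher order, used on a ball, and
  one of lower order, used on the tail of the integral.\<close>

lemma iexp_remainder:
  fixes y :: real
  shows "cmod (iexp (- y) - 1) \<le> \<bar>y\<bar>" "cmod (iexp (- y) - 1) \<le> 2"
    "cmod (iexp (- y) - 1 + \<i> * y) \<le> y\<^sup>2" "cmod (iexp (- y) - 1 + \<i> * y) \<le> 2 * \<bar>y\<bar>"
proof -
  show "cmod (iexp (- y) - 1) \<le> \<bar>y\<bar>" "cmod (iexp (- y) - 1) \<le> 2"
    using iexp_approx1[of "- y" 0] iexp_approx2[of "- y" 0] by auto
  have "cmod (iexp (- y) - 1 + \<i> * y) \<le> y\<^sup>2 / 2"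
    using iexp_approx1[of "- y" 1] by (simp add: algebra_simps numeral_2_eq_2)
  then show "cmod (iexp (- y) - 1 + \<i> * y) \<le> y\<^sup>2" using zero_le_power2[of y] by linarith
  show "cmod (iexp (- y) - 1 + \<i> * y) \<le> 2 * \<bar>y\<bar>"
    using iexp_approx2[of "- y" 1] by (simp add: algebra_simps)
qed

lemma fourier_real_minus_P:
  fixes f :: "real^'n \<Rightarrow> real"
  assumes f: "integrable lborel f"
  shows "fourier_real f \<xi> - P_of f = (\<integral>x. (iexp (- (x \<bullet> \<xi>)) - 1) * complex_of_real (f x) \<partial>lborel)"
    "integrable lborel (\<lambda>x. (iexp (- (x \<bullet> \<xi>)) - 1) * complex_of_real (f x))"
proof -
  have e: "(\<lambda>x. (iexp (- (x \<bullet> \<xi>)) - 1) * complex_of_real (f x)) = (\<lambda>x. iexp (- (x \<bullet> \<xi>)) * complex_of_real (f x) - complex_of_real (f x))"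
    by (simp add: algebra_simps)
  have f': "integrable lborel (\<lambda>x. complex_of_real (f x))" using f by simp
  show "integrable lborel (\<lambda>x. (iexp (- (x \<bullet> \<xi>)) - 1) * complex_of_real (f x))"
    unfolding e by (rule Bochner_Integration.integrable_diff[OF fourier_real_integrable[OF f] f'])
  show "fourier_real f \<xi> - P_of f = (\<integral>x. (iexp (- (x \<bullet> \<xi>)) - 1) * complex_of_real (f x) \<partial>lborel)"
    unfolding e Bochner_Integration.integral_diff[OF fourier_real_integrable[OF f] f'] fourier_real_eq P_of_def
    by (simp only: integral_complex_of_real)
qed

lemma fourier_real_minus_P_le:
  fixes f :: "real^'n \<Rightarrow> real"
  assumes f: "L11 f"
  shows "norm (fourier_real f \<xi> - P_of f) \<le> norm \<xi> * L11norm f"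
proof -
  have f1: "integrable lborel f" using f by (simp add: L11_def)
  have "norm (fourier_real f \<xi> - P_of f) \<le> (\<integral>x. norm \<xi> * (norm x * \<bar>f x\<bar>) \<partial>lborel)"
    unfolding fourier_real_minus_P(1)[OF f1]
  proof (rule Bochner_Integration.integral_norm_bound_integral[OF fourier_real_minus_P(2)[OF f1]])
    show "integrable lborel (\<lambda>x. norm \<xi> * (norm x * \<bar>f x\<bar>))" using norm_mult_integrable(1)[OF f] by simp
    fix x :: "real^'n"
    have "cmod (iexp (- (x \<bullet> \<xi>)) - 1) \<le> norm x * norm \<xi>"
      by (rule order_trans[OF iexp_remainder(1) Cauchy_Schwarz_ineq2])
    then have "cmod (iexp (- (x \<bullet> \<xi>)) - 1) * \<bar>f x\<bar> \<le> (norm x * norm \<xi>) * \<bar>f x\<bar>" by (rule mult_right_mono) simp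
    then show "norm ((iexp (- (x \<bullet> \<xi>)) - 1) * complex_of_real (f x)) \<le> norm \<xi> * (norm x * \<bar>f x\<bar>)"
      by (simp add: norm_mult mult_ac)
  qed
  also have "\<dots> = norm \<xi> * (\<integral>x. norm x * \<bar>f x\<bar> \<partial>lborel)" by (rule integral_mult_right_zero)
  also have "\<dots> \<le> norm \<xi> * L11norm f" by (intro mult_left_mono norm_mult_integrable(2)[OF f]) simp
  finally show ?thesis .
qed

lemma tail_integral_small:
  fixes g :: "real^'n \<Rightarrow> real"
  assumes g: "integrable lborel g" and e: "e > 0"
  obtains k :: nat where "(\<integral>x. indicator {x. norm x > real k} x * \<bar>g x\<bar> \<partial>lborel) < e"
proof -
  have [measurable]: "g \<in> borel_measurable borel" using g by auto
  have "(\<lambda>k::nat. \<integral>x. indicator {x. norm x > real k} x * \<bar>g x\<bar> \<partial>lborel) \<longlonglongrightarrow> (\<integral>x. 0 \<partial>(lborel :: (real^'n) measure))"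
  proof (rule integral_dominated_convergence[where w = "\<lambda>x. \<bar>g x\<bar>"])
    show "AE x in lborel. (\<lambda>k::nat. indicator {x. norm x > real k} x * \<bar>g x\<bar>) \<longlonglongrightarrow> 0"
    proof (rule AE_I2)
      fix x :: "real^'n"
      obtain N :: nat where "norm x \<le> real N" using real_arch_simple by blast
      then have "\<forall>k\<ge>N. indicator {x. norm x > real k} x * \<bar>g x\<bar> = 0" by auto
      then show "(\<lambda>k::nat. indicator {x. norm x > real k} x * \<bar>g x\<bar>) \<longlonglongrightarrow> 0"
        by (intro tendsto_eventually) (auto simp: eventually_sequentially)
    qed
  qed (use g in \<open>auto simp: indicator_def\<close>)
  then have "eventually (\<lambda>k::nat. (\<integral>x. indicator {x. norm x > real k} x * \<bar>g x\<bar> \<partial>lborel) < e) sequentially"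
    using e by (intro order_tendstoD(2)[of _ 0]) auto
  then show thesis using that by (auto simp: eventually_sequentially)
qed

lemma fourier_real_continuous_0:
  fixes f :: "real^'n \<Rightarrow> real"
  assumes f: "integrable lborel f" and e: "e > 0"
  obtains \<rho> where "\<rho> > 0" "\<And>\<xi>. norm \<xi> < \<rho> \<Longrightarrow> norm (fourier_real f \<xi> - P_of f) \<le> e"
proof -
  have [measurable]: "f \<in> borel_measurable borel" using f by auto
  obtain k :: nat where k: "(\<integral>x. indicator {x. norm x > real k} x * \<bar>f x\<bar> \<partial>lborel) < e / 4"
    by (rule tail_integral_small[OF f, of "e/4"]) (use e in auto)
  let ?t = "\<lambda>x. indicator {x. norm x > real k} x * \<bar>f x\<bar>"
  have it: "integrable lborel ?t"
    by (rule Bochner_Integration.integrable_bound[OF f]) (auto simp: indicator_def)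
  let ?A = "\<integral>x. \<bar>f x\<bar> \<partial>lborel"
  have A: "?A \<ge> 0" by (intro integral_nonneg_AE) simp
  show thesis
  \<comment> \<open>This radius makes k |\<xi>| times the L1 norm at most e/2; the summands 1 keep
    the denominator positive.\<close>
  proof (rule that[of "e / (2 * (real k + 1) * (?A + 1))"])
    show "0 < e / (2 * (real k + 1) * (?A + 1))" using e A by (simp add: add_nonneg_pos)
    fix \<xi> :: "real^'n" assume xi: "norm \<xi> < e / (2 * (real k + 1) * (?A + 1))"
    have "norm (fourier_real f \<xi> - P_of f) \<le> (\<integral>x. (real k * norm \<xi>) * \<bar>f x\<bar> + 2 * ?t x \<partial>lborel)"
      unfolding fourier_real_minus_P(1)[OF f]
    proof (rule Bochner_Integration.integral_norm_bound_integral[OF fourier_real_minus_P(2)[OF f]])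
      show "integrable lborel (\<lambda>x. (real k * norm \<xi>) * \<bar>f x\<bar> + 2 * ?t x)" using f it by simp
      fix x :: "real^'n"
      have "cmod (iexp (- (x \<bullet> \<xi>)) - 1) \<le> real k * norm \<xi> + 2 * indicator {x. norm x > real k} x"
      proof (cases "norm x > real k")
        case True
        then show ?thesis using iexp_remainder(2)[of "x \<bullet> \<xi>"] by (simp add: add_increasing)
      next
        case False
        then have "norm x * norm \<xi> \<le> real k * norm \<xi>" by (intro mult_right_mono) auto
        then show ?thesis using False order_trans[OF iexp_remainder(1) Cauchy_Schwarz_ineq2, of x \<xi>] by simp
      qed
      then have "cmod (iexp (- (x \<bullet> \<xi>)) - 1) * \<bar>f x\<bar> \<le> (real k * norm \<xi> + 2 * indicator {x. norm x > real k} x) * \<bar>f x\<bar>"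
        by (rule mult_right_mono) simp
      then show "norm ((iexp (- (x \<bullet> \<xi>)) - 1) * complex_of_real (f x)) \<le> (real k * norm \<xi>) * \<bar>f x\<bar> + 2 * ?t x"
        unfolding norm_mult by (simp add: algebra_simps)
    qed
    also have "\<dots> = (real k * norm \<xi>) * ?A + 2 * (\<integral>x. ?t x \<partial>lborel)" using f it by simp
    also have "(real k * norm \<xi>) * ?A \<le> e / 2"
    proof -
      have "(real k * norm \<xi>) * ?A \<le> ((real k + 1) * (e / (2 * (real k + 1) * (?A + 1)))) * (?A + 1)"
        using xi A e by (intro mult_mono) auto
      also have "\<dots> = e / 2"
      proof -
        have *: "(a * (e / (2 * a * b))) * b = e / 2" if "a > 0" "b > 0" for a b :: real using that by simp
        show ?thesis by (rule *) (use A in linarith)+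
      qed
      finally show ?thesis .
    qed
    finally show "norm (fourier_real f \<xi> - P_of f) \<le> e" using k by linarith
  qed
qed

text \<open>Only the first moment is finite, so the remainder is o(|\<xi>|) and not quadratic. For
  |x| \<le> k the quadratic bound gains a factor k |\<xi>|; for |x| > k the linear bound is paid by
  the small tail of |x| |f|.\<close>

lemma fourier_real_first_order:
  fixes f :: "real^'n \<Rightarrow> real"
  assumes f: "L11 f" and e: "e > 0"
  obtains \<rho> where "\<rho> > 0" "\<And>\<xi>. norm \<xi> < \<rho> \<Longrightarrow> norm (fourier_real f \<xi> - Complex (P_of f) (- (\<xi> \<bullet> M_of f))) \<le> e * norm \<xi>"
proof -
  have f1: "integrable lborel f" using f by (simp add: L11_def)
  have [measurable]: "f \<in> borel_measurable borel" using f1 by auto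
  let ?g = "\<lambda>x. norm x * \<bar>f x\<bar>"
  have g: "integrable lborel ?g" by (rule norm_mult_integrable(1)[OF f])
  obtain k :: nat where k: "(\<integral>x. indicator {x. norm x > real k} x * \<bar>?g x\<bar> \<partial>lborel) < e / 4"
    by (rule tail_integral_small[OF g, of "e/4"]) (use e in auto)
  let ?t = "\<lambda>x. indicator {x. norm x > real k} x * \<bar>?g x\<bar>"
  have it: "integrable lborel ?t"
    by (rule Bochner_Integration.integrable_bound[OF g]) (auto simp: indicator_def abs_mult)
  let ?A = "\<integral>x. ?g x \<partial>lborel"
  have A: "?A \<ge> 0" by (intro integral_nonneg_AE) simp
  have iM: "integrable lborel (\<lambda>x. f x *\<^sub>R x)"
    by (rule Bochner_Integration.integrable_bound[OF g]) (auto simp: abs_mult mult.commute)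
  show thesis
  proof (rule that[of "e / (2 * (real k + 1) * (?A + 1))"])
    show "0 < e / (2 * (real k + 1) * (?A + 1))" using e A by (simp add: add_nonneg_pos)
    fix \<xi> :: "real^'n" assume xi: "norm \<xi> < e / (2 * (real k + 1) * (?A + 1))"
    let ?R = "\<lambda>x. (iexp (- (x \<bullet> \<xi>)) - 1) * complex_of_real (f x) + \<i> * complex_of_real (f x * (x \<bullet> \<xi>))"
    have im: "integrable lborel (\<lambda>x. f x * (x \<bullet> \<xi>))" using integrable_inner_left[OF iM, of \<xi>] by simp
    have iR: "integrable lborel ?R"
      using fourier_real_minus_P(2)[OF f1, of \<xi>] im by (intro Bochner_Integration.integrable_add integrable_mult_right integrable_of_real)
    have "M_of f \<bullet> \<xi> = (\<integral>x. f x * (x \<bullet> \<xi>) \<partial>lborel)"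
      unfolding M_of_def using integral_inner_left[OF iM, of \<xi>] by simp
    then have "fourier_real f \<xi> - Complex (P_of f) (- (\<xi> \<bullet> M_of f)) = (fourier_real f \<xi> - P_of f) + \<i> * complex_of_real (\<integral>x. f x * (x \<bullet> \<xi>) \<partial>lborel)"
      by (simp add: complex_eq_iff inner_commute)
    also have "\<dots> = (\<integral>x. ?R x \<partial>lborel)"
    proof -
      have "integrable lborel (\<lambda>x. \<i> * complex_of_real (f x * (x \<bullet> \<xi>)))" by (intro integrable_mult_right integrable_of_real im)
      from Bochner_Integration.integral_add[OF fourier_real_minus_P(2)[OF f1] this, of \<xi>]
      show ?thesis unfolding fourier_real_minus_P(1)[OF f1] by (simp only: integral_mult_right_zero integral_complex_of_real)
    qed
    also have "norm \<dots> \<le> (\<integral>x. norm \<xi> * ((real k * norm \<xi>) * ?g x + 2 * ?t x) \<partial>lborel)"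
    proof (rule Bochner_Integration.integral_norm_bound_integral[OF iR])
      show "integrable lborel (\<lambda>x. norm \<xi> * ((real k * norm \<xi>) * ?g x + 2 * ?t x))" using g it by simp
      fix x :: "real^'n"
      let ?y = "x \<bullet> \<xi>"
      have R: "?R x = (iexp (- ?y) - 1 + \<i> * ?y) * complex_of_real (f x)" by (simp add: algebra_simps)
      have y: "\<bar>?y\<bar> \<le> norm x * norm \<xi>" by (rule Cauchy_Schwarz_ineq2)
      have "cmod (iexp (- ?y) - 1 + \<i> * ?y) \<le> norm \<xi> * ((real k * norm \<xi>) * norm x + 2 * (indicator {x. norm x > real k} x * norm x))"
      proof (cases "norm x > real k")
        case True
        have "cmod (iexp (- ?y) - 1 + \<i> * ?y) \<le> norm \<xi> * (2 * norm x)" by (rule order_trans[OF iexp_remainder(4)]) (use y in \<open>simp add: mult_ac\<close>)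
        also have "\<dots> \<le> norm \<xi> * ((real k * norm \<xi>) * norm x + 2 * norm x)" by (intro mult_left_mono) auto
        finally show ?thesis using True by simp
      next
        case False
        have "cmod (iexp (- ?y) - 1 + \<i> * ?y) \<le> \<bar>?y\<bar> * \<bar>?y\<bar>" using iexp_remainder(3)[of ?y] by (simp add: power2_eq_square)
        also have "\<dots> \<le> (real k * norm \<xi>) * (norm x * norm \<xi>)"
        proof (rule mult_mono[OF _ y])
          show "\<bar>?y\<bar> \<le> real k * norm \<xi>" by (rule order_trans[OF y mult_right_mono]) (use False in auto)
        qed auto
        finally show ?thesis using False by (simp add: mult_ac)
      qed
      then have "cmod (iexp (- ?y) - 1 + \<i> * ?y) * \<bar>f x\<bar> \<le> (norm \<xi> * ((real k * norm \<xi>) * norm x + 2 * (indicator {x. norm x > real k} x * norm x))) * \<bar>f x\<bar>"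
        by (rule mult_right_mono) simp
      then show "norm (?R x) \<le> norm \<xi> * ((real k * norm \<xi>) * ?g x + 2 * ?t x)"
        unfolding R norm_mult by (simp add: algebra_simps abs_mult)
    qed
    also have "\<dots> = norm \<xi> * ((real k * norm \<xi>) * ?A + 2 * (\<integral>x. ?t x \<partial>lborel))"
    proof -
      have "(\<integral>x. (real k * norm \<xi>) * ?g x + 2 * ?t x \<partial>lborel) = (real k * norm \<xi>) * ?A + 2 * (\<integral>x. ?t x \<partial>lborel)"
        by (subst Bochner_Integration.integral_add) (use g it in simp_all)
      then show ?thesis by (simp only: integral_mult_right_zero)
    qed
    also have "\<dots> \<le> norm \<xi> * e"
    proof (rule mult_left_mono)
      have "(real k * norm \<xi>) * ?A \<le> ((real k + 1) * (e / (2 * (real k + 1) * (?A + 1)))) * (?A + 1)"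
        using xi A e by (intro mult_mono) auto
      also have "\<dots> = e / 2"
      proof -
        have *: "(a * (e / (2 * a * b))) * b = e / 2" if "a > 0" "b > 0" for a b :: real using that by simp
        show ?thesis by (rule *) (use A in linarith)+
      qed
      finally show "(real k * norm \<xi>) * ?A + 2 * (\<integral>x. ?t x \<partial>lborel) \<le> e" using k by linarith
    qed simp
    finally show "norm (fourier_real f \<xi> - Complex (P_of f) (- (\<xi> \<bullet> M_of f))) \<le> e * norm \<xi>" by (simp add: mult.commute)
  qed
qed

section \<open>Negative Sobolev norms on the Fourier side, and exponentially small terms\<close>

lemma bessel_weight:
  "sqrt (1 + r\<^sup>2) powr (- 0) = (1::real)" "sqrt (1 + r\<^sup>2) powr (- 2) = 1 / (1 + r\<^sup>2)" "sqrt (1 + r\<^sup>2) powr (- 4) = 1 / (1 + r\<^sup>2)\<^sup>2"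
  for r :: real
proof -
  have p: "1 + r\<^sup>2 > 0" by (simp add: add_pos_nonneg)
  show "sqrt (1 + r\<^sup>2) powr (- 0) = 1" using p by simp
  have 2: "sqrt (1 + r\<^sup>2) powr 2 = 1 + r\<^sup>2" using p by (simp add: powr_numeral)
  then show "sqrt (1 + r\<^sup>2) powr (- 2) = 1 / (1 + r\<^sup>2)" using p by (simp add: powr_minus_divide)
  have "sqrt (1 + r\<^sup>2) powr 4 = (sqrt (1 + r\<^sup>2) powr 2) powr 2" by (simp only: powr_powr) simp
  also have "\<dots> = (1 + r\<^sup>2)\<^sup>2" unfolding 2 using p by (simp add: powr_numeral)
  finally show "sqrt (1 + r\<^sup>2) powr (- 4) = 1 / (1 + r\<^sup>2)\<^sup>2" using p by (simp add: powr_minus_divide)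
qed

text \<open>\<open>Hnegnorm\<close> selects a function by choice; the isometry shows that its norm
  is that of the weighted transform of f, whichever function is selected.\<close>

lemma Hneg_fourier:
  fixes f :: "real^'n \<Rightarrow> real"
  assumes "Hneg_L1 s f"
  shows "L2 (\<lambda>\<xi>. complex_of_real (sqrt (1 + (norm \<xi>)\<^sup>2) powr (- s)) * fourier_real f \<xi>)"
    and "(L2norm (\<lambda>\<xi>. complex_of_real (sqrt (1 + (norm \<xi>)\<^sup>2) powr (- s)) * fourier_real f \<xi>))\<^sup>2 = (2 * pi) ^ CARD('n) * (Hnegnorm s f)\<^sup>2"
    and "L1 f" and "0 \<le> Hnegnorm s f"
proof -
  define g where "g = (SOME g. bessel s f g)"
  have b: "bessel s f g" using assms unfolding Hneg_L1_def g_def by (metis someI_ex)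
  then show "L2 (\<lambda>\<xi>. complex_of_real (sqrt (1 + (norm \<xi>)\<^sup>2) powr (- s)) * fourier_real f \<xi>)"
    by (simp add: bessel_def L2_fourier_def)
  show "(L2norm (\<lambda>\<xi>. complex_of_real (sqrt (1 + (norm \<xi>)\<^sup>2) powr (- s)) * fourier_real f \<xi>))\<^sup>2 = (2 * pi) ^ CARD('n) * (Hnegnorm s f)\<^sup>2"
    unfolding L2_fourier_norm[OF b[unfolded bessel_def]] Hnegnorm_def g_def[symmetric] power_mult_distrib
    by (subst real_sqrt_pow2) auto
  show "L1 f" using assms by (simp add: Hneg_L1_def)
  show "0 \<le> Hnegnorm s f" by (simp add: Hnegnorm_def)
qed

text \<open>No rate decays faster than a power of t, so exponentially small contributions of high
  frequencies are absorbed with an arbitrarily small factor.\<close>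

lemma rate_dominates_exp:
  assumes c: "c > 0" and e: "e > 0" and n: "n > 0"
  shows "eventually (\<lambda>t. B * exp (- (c * t)) \<le> e * (rate n t)\<^sup>2) at_top"
proof -
  consider "n = 1" | "n = 2" | "n \<ge> 3" using n by linarith
  then have "eventually (\<lambda>t. B * exp (- (c * t)) \<le> e * (if n = 1 then t else if n = 2 then ln t else t powr (1 - real n / 2))) at_top"
  proof cases
    case 3
    have "eventually (\<lambda>t::real. B * exp (- (c * t)) \<le> e * t powr a) at_top" for a :: real
      using c e by real_asymp
    from this[of "1 - real n / 2"] show ?thesis using 3 by simp
  next
    case 1
    have "eventually (\<lambda>t::real. B * exp (- (c * t)) \<le> e * t) at_top" using c e by real_asymp
    then show ?thesis using 1 by simp
  next
    case 2
    have "eventually (\<lambda>t::real. B * exp (- (c * t)) \<le> e * ln t) at_top" using c e by real_asymp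
    then show ?thesis using 2 by simp
  qed
  moreover have "eventually (\<lambda>t::real. t \<ge> 1) at_top" by (rule eventually_ge_at_top)
  ultimately show ?thesis by eventually_elim (use n in \<open>simp add: rate_sq\<close>)
qed

section \<open>Error estimates\<close>

lemma total_symbol_scaleR:
  "total_symbol \<kappa> \<delta> d P Q M t \<xi> = sym0 \<kappa> \<delta> t (norm \<xi>) *\<^sub>R Complex P (- (\<xi> \<bullet> M))
     + (d * t * symH \<delta> t (norm \<xi>)) *\<^sub>R complex_of_real P + sym1 \<delta> t (norm \<xi>) *\<^sub>R complex_of_real Q"
  by (simp add: total_symbol_def complex_eq_iff algebra_simps)

context mgt begin

definition solves :: "(real \<Rightarrow> real^'n \<Rightarrow> complex) \<Rightarrow> (real^'n \<Rightarrow> complex) \<Rightarrow> (real^'n \<Rightarrow> complex) \<Rightarrow> (real^'n \<Rightarrow> complex) \<Rightarrow> bool" where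
  "solves U a0 a1 a2 \<longleftrightarrow> (\<forall>\<xi>. \<exists>v w. flow ((norm \<xi>)\<^sup>2) (\<lambda>t. U t \<xi>) v w \<and> U 0 \<xi> = a0 \<xi> \<and> v 0 = a1 \<xi> \<and> w 0 = a2 \<xi>)"

text \<open>The high-frequency majorant. Its first three terms integrate to the squared norms in L2,
  H^(-2) and H^(-4), up to (2 \<pi>)^n; the Gaussian term accounts for the profile symbols.\<close>

definition datasq :: "real \<Rightarrow> (real^'n \<Rightarrow> complex) \<Rightarrow> (real^'n \<Rightarrow> complex) \<Rightarrow> (real^'n \<Rightarrow> complex) \<Rightarrow> real^'n \<Rightarrow> real" where
  "datasq N a0 a1 a2 \<xi> = (norm (a0 \<xi>))\<^sup>2 + (norm (a1 \<xi>) / (1 + (norm \<xi>)\<^sup>2))\<^sup>2 + (norm (a2 \<xi>) / (1 + (norm \<xi>)\<^sup>2)\<^sup>2)\<^sup>2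
     + N\<^sup>2 * exp (- \<kappa> * (norm \<xi>)\<^sup>2)"

lemma datasq_nonneg: "0 \<le> datasq N a0 a1 a2 \<xi>"
  by (simp add: datasq_def)

text \<open>Away from the origin nothing cancels between solution and profile: each is exponentially
  small on its own. The constants depend on \<rho> but not on the data, so \<rho> may later be
  chosen in terms of the data.\<close>

theorem high_frequency_estimate:
  assumes rho: "\<rho> > 0"
  obtains C c where "C > 0" "c > 0"
    "\<And>U a0 a1 a2 N P Q (M :: real^'n) d t \<xi>. solves U a0 a1 a2 \<Longrightarrow> t \<ge> 1 \<Longrightarrow> \<rho> \<le> norm \<xi> \<Longrightarrow> \<bar>P\<bar> \<le> N \<Longrightarrow>
       \<bar>Q\<bar> \<le> (1 + \<kappa> + \<delta>) * N \<Longrightarrow> norm M \<le> N \<Longrightarrow> \<bar>d\<bar> \<le> \<bar>dcorr\<bar> \<Longrightarrow>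
       (norm (U t \<xi> - total_symbol \<kappa> \<delta> d P Q M t \<xi>))\<^sup>2 \<le> C * exp (- (c * t)) * datasq N a0 a1 a2 \<xi>"
proof -
  have rho2: "\<rho>\<^sup>2 > 0" using rho by simp
  obtain C1 c1 where C1: "C1 > 0" "c1 > 0"
    and dec: "\<And>x u v w t. \<rho>\<^sup>2 \<le> x \<Longrightarrow> flow x u v w \<Longrightarrow> t \<ge> 0 \<Longrightarrow>
       norm (u t) \<le> C1 * exp (- (c1 * t)) * (norm (u 0) + norm (v 0) / x + norm (w 0) / x\<^sup>2)"
    using high_frequency_decay[OF rho2] by blast
  \<comment> \<open>For |\<xi>| \<ge> \<rho>, 1/|\<xi>|^2 \<le> L/(1 + |\<xi>|^2): L converts the
    homogeneous weights of \<open>high_frequency_decay\<close> into Bessel weights.\<close>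
  define L where "L = 1 + 1 / \<rho>\<^sup>2"
  have L: "L \<ge> 1" using rho by (simp add: L_def)
  define K where "K = (2 + \<delta>) / \<rho>\<^sup>2 + (2 + \<delta>) / \<rho> + \<bar>dcorr\<bar> * ((1 + 1 / \<kappa>) / \<rho>) + (1 + \<kappa> + \<delta>) / \<rho>"
  have d0: "\<delta> > 0" using params_pos by simp
  have K: "K \<ge> 0" using rho d0 kpos by (simp add: K_def)
  define c where "c = min (2 * c1) (\<kappa> * \<rho>\<^sup>2)"
  have c: "c > 0" using C1 kpos rho by (simp add: c_def)
  show thesis
  proof (rule that[of "6 * (C1 * L\<^sup>2)\<^sup>2 + 2 * K\<^sup>2" c, OF _ c])
    show "6 * (C1 * L\<^sup>2)\<^sup>2 + 2 * K\<^sup>2 > 0" using C1 L by (intro add_pos_nonneg mult_pos_pos) auto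
    fix U :: "real \<Rightarrow> real^'n \<Rightarrow> complex" and a0 a1 a2 N P Q and M :: "real^'n" and d t :: real and \<xi> :: "real^'n"
    assume sol: "solves U a0 a1 a2" and t: "t \<ge> 1" and r: "\<rho> \<le> norm \<xi>" and P: "\<bar>P\<bar> \<le> N"
      and Q: "\<bar>Q\<bar> \<le> (1 + \<kappa> + \<delta>) * N" and M: "norm M \<le> N" and d: "\<bar>d\<bar> \<le> \<bar>dcorr\<bar>"
    let ?r = "norm \<xi>"
    have r0: "?r > 0" using r rho by linarith
    have N: "N \<ge> 0" using P by linarith
    have r2: "\<rho>\<^sup>2 \<le> ?r\<^sup>2" using r rho by (intro power_mono) auto
    obtain v w where fl: "flow (?r\<^sup>2) (\<lambda>t. U t \<xi>) v w" "U 0 \<xi> = a0 \<xi>" "v 0 = a1 \<xi>" "w 0 = a2 \<xi>"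
      using sol unfolding solves_def by blast
    define w0 where "w0 = norm (a0 \<xi>)"
    define w1 where "w1 = norm (a1 \<xi>) / (1 + ?r\<^sup>2)"
    define w2 where "w2 = norm (a2 \<xi>) / (1 + ?r\<^sup>2)\<^sup>2"
    have r1: "1 + ?r\<^sup>2 > 0" by (simp add: add_pos_nonneg)
    have w: "w0 \<ge> 0" "w1 \<ge> 0" "w2 \<ge> 0" by (auto simp: w0_def w1_def w2_def)
    have rL: "1 / ?r\<^sup>2 \<le> L / (1 + ?r\<^sup>2)"
    proof -
      have "1 / ?r\<^sup>2 \<le> 1 / \<rho>\<^sup>2" using r2 rho2 r0 by (intro divide_left_mono) auto
      moreover have "(1 + ?r\<^sup>2) / ?r\<^sup>2 = 1 + 1 / ?r\<^sup>2" using r0 by (simp add: field_simps)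
      ultimately have "(1 + ?r\<^sup>2) / ?r\<^sup>2 \<le> L" by (simp add: L_def)
      then show ?thesis using r1 by (simp add: le_divide_eq)
    qed
    have b1: "norm (a1 \<xi>) / ?r\<^sup>2 \<le> L * w1"
      using mult_left_mono[OF rL, of "norm (a1 \<xi>)"] by (simp add: w1_def mult.commute)
    have b2: "norm (a2 \<xi>) / (?r\<^sup>2)\<^sup>2 \<le> L\<^sup>2 * w2"
    proof -
      have "(1 / ?r\<^sup>2)\<^sup>2 \<le> (L / (1 + ?r\<^sup>2))\<^sup>2" by (rule power_mono[OF rL]) simp
      then have "norm (a2 \<xi>) * (1 / ?r\<^sup>2)\<^sup>2 \<le> norm (a2 \<xi>) * (L / (1 + ?r\<^sup>2))\<^sup>2" by (rule mult_left_mono) simp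
      then show ?thesis by (simp add: w2_def power_divide mult.commute)
    qed
    have "norm (U t \<xi>) \<le> C1 * exp (- (c1 * t)) * (norm (a0 \<xi>) + norm (a1 \<xi>) / ?r\<^sup>2 + norm (a2 \<xi>) / (?r\<^sup>2)\<^sup>2)"
      using dec[OF r2 fl(1), of t] t fl by simp
    also have "\<dots> \<le> C1 * exp (- (c1 * t)) * (L\<^sup>2 * (w0 + w1 + w2))"
    proof (rule mult_left_mono)
      have "L * 1 \<le> L * L" using L by (intro mult_left_mono) auto
      then have L2: "1 \<le> L\<^sup>2" "L \<le> L\<^sup>2" using L unfolding power2_eq_square by linarith+
      have "norm (a0 \<xi>) \<le> L\<^sup>2 * w0" using L2 w by (simp add: w0_def mult_le_cancel_right1)
      moreover have "L * w1 \<le> L\<^sup>2 * w1" using L2 w by (intro mult_right_mono) auto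
      ultimately show "norm (a0 \<xi>) + norm (a1 \<xi>) / ?r\<^sup>2 + norm (a2 \<xi>) / (?r\<^sup>2)\<^sup>2 \<le> L\<^sup>2 * (w0 + w1 + w2)"
        using b1 b2 by (simp add: distrib_left)
    qed (use C1 in simp)
    finally have Ub: "norm (U t \<xi>) \<le> (C1 * L\<^sup>2) * exp (- (c1 * t)) * (w0 + w1 + w2)" by (simp add: mult_ac)
    have U2: "(norm (U t \<xi>))\<^sup>2 \<le> (C1 * L\<^sup>2)\<^sup>2 * exp (- (c * t)) * (3 * (w0\<^sup>2 + w1\<^sup>2 + w2\<^sup>2))"
    proof -
      have "(norm (U t \<xi>))\<^sup>2 \<le> ((C1 * L\<^sup>2) * exp (- (c1 * t)) * (w0 + w1 + w2))\<^sup>2" using Ub by (rule power_mono) simp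
      also have "\<dots> = (C1 * L\<^sup>2)\<^sup>2 * exp (- (2 * c1 * t)) * (w0 + w1 + w2)\<^sup>2"
      proof -
        have "(exp (- (c1 * t)))\<^sup>2 = exp (- (2 * c1 * t))" using exp_double[of "- (c1 * t)"] by (simp add: mult.assoc)
        then show ?thesis by (simp only: power_mult_distrib)
      qed
      also have "\<dots> \<le> (C1 * L\<^sup>2)\<^sup>2 * exp (- (c * t)) * (3 * (w0\<^sup>2 + w1\<^sup>2 + w2\<^sup>2))"
      proof (intro mult_mono mult_left_mono)
        have "c * t \<le> 2 * c1 * t" using t by (intro mult_right_mono) (auto simp: c_def)
        then show "exp (- (2 * c1 * t)) \<le> exp (- (c * t))" by simp
        have "0 \<le> (w0 - w1)\<^sup>2 + (w0 - w2)\<^sup>2 + (w1 - w2)\<^sup>2" by simp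
        then show "(w0 + w1 + w2)\<^sup>2 \<le> 3 * (w0\<^sup>2 + w1\<^sup>2 + w2\<^sup>2)" by (simp add: power2_eq_square algebra_simps)
      qed auto
      finally show ?thesis .
    qed
    let ?e = "exp (- (\<kappa> * ?r\<^sup>2 * t))"
    have wm: "wmin t ?r \<le> 1 / \<rho>"
    proof -
      have "1 / ?r \<le> 1 / \<rho>" using r rho r0 by (intro divide_left_mono) auto
      then show ?thesis by (simp add: wmin_def)
    qed
    have s0r: "?r * \<bar>sym0 \<kappa> \<delta> t ?r\<bar> \<le> (2 + \<delta>) / \<rho> * ?e"
    proof -
      have "(2 + \<delta>) * wmin t ?r * ?e \<le> (2 + \<delta>) * (1 / \<rho>) * ?e" using wm d0 by (intro mult_right_mono mult_left_mono) auto
      then show ?thesis using sym0_bound(2)[OF kpos ksmall r0 t] by simp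
    qed
    have s0: "\<bar>sym0 \<kappa> \<delta> t ?r\<bar> \<le> (2 + \<delta>) / \<rho>\<^sup>2 * ?e"
    proof -
      have "\<rho> * \<bar>sym0 \<kappa> \<delta> t ?r\<bar> \<le> ?r * \<bar>sym0 \<kappa> \<delta> t ?r\<bar>" using r by (intro mult_right_mono) auto
      then have "\<rho> * \<bar>sym0 \<kappa> \<delta> t ?r\<bar> \<le> (2 + \<delta>) / \<rho> * ?e" using s0r by linarith
      then show ?thesis using rho by (simp add: field_simps power2_eq_square)
    qed
    have sH: "t * \<bar>symH \<delta> t ?r\<bar> \<le> (1 + 1 / \<kappa>) / \<rho> * ?e"
    proof -
      have "(1 + 1 / \<kappa>) * wmin t ?r * ?e \<le> (1 + 1 / \<kappa>) * (1 / \<rho>) * ?e" using wm kpos by (intro mult_right_mono mult_left_mono) auto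
      then show ?thesis using symH_bound(1)[OF kpos ksmall r0 t] by simp
    qed
    have s1: "\<bar>sym1 \<delta> t ?r\<bar> \<le> 1 / \<rho> * ?e"
      using order_trans[OF sym1_bound[OF kpos ksmall r0 t] mult_right_mono[OF wm exp_ge_zero]] .
    have F: "norm (total_symbol \<kappa> \<delta> d P Q M t \<xi>) \<le> K * N * ?e"
    proof -
      have "norm (Complex P (- (\<xi> \<bullet> M))) \<le> \<bar>P\<bar> + \<bar>\<xi> \<bullet> M\<bar>" using cmod_le[of "Complex P (- (\<xi> \<bullet> M))"] by simp
      also have "\<dots> \<le> N + ?r * N" using P Cauchy_Schwarz_ineq2[of \<xi> M] mult_left_mono[OF M, of ?r] by simp
      finally have "\<bar>sym0 \<kappa> \<delta> t ?r\<bar> * norm (Complex P (- (\<xi> \<bullet> M))) \<le> \<bar>sym0 \<kappa> \<delta> t ?r\<bar> * (N + ?r * N)" by (rule mult_left_mono) simp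
      also have "\<dots> = \<bar>sym0 \<kappa> \<delta> t ?r\<bar> * N + (?r * \<bar>sym0 \<kappa> \<delta> t ?r\<bar>) * N" by (simp add: algebra_simps)
      also have "\<dots> \<le> ((2 + \<delta>) / \<rho>\<^sup>2 * ?e) * N + ((2 + \<delta>) / \<rho> * ?e) * N" using s0 s0r N by (intro add_mono mult_right_mono) auto
      finally have A: "norm (sym0 \<kappa> \<delta> t ?r *\<^sub>R Complex P (- (\<xi> \<bullet> M))) \<le> ((2 + \<delta>) / \<rho>\<^sup>2 * ?e) * N + ((2 + \<delta>) / \<rho> * ?e) * N" by simp
      have B: "norm ((d * t * symH \<delta> t ?r) *\<^sub>R complex_of_real P) \<le> \<bar>dcorr\<bar> * ((1 + 1 / \<kappa>) / \<rho> * ?e) * N"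
      proof (rule norm_scaleR_le)
        have "\<bar>d * t * symH \<delta> t ?r\<bar> = \<bar>d\<bar> * (t * \<bar>symH \<delta> t ?r\<bar>)" using t by (simp add: abs_mult)
        also have "\<dots> \<le> \<bar>dcorr\<bar> * ((1 + 1 / \<kappa>) / \<rho> * ?e)" by (rule mult_mono[OF d sH]) (use t in auto)
        finally show "\<bar>d * t * symH \<delta> t ?r\<bar> \<le> \<bar>dcorr\<bar> * ((1 + 1 / \<kappa>) / \<rho> * ?e)" .
      qed (use P in simp)
      have C: "norm (sym1 \<delta> t ?r *\<^sub>R complex_of_real Q) \<le> (1 / \<rho> * ?e) * ((1 + \<kappa> + \<delta>) * N)"
        by (rule norm_scaleR_le[OF s1]) (use Q in simp)
      have "norm (total_symbol \<kappa> \<delta> d P Q M t \<xi>) \<le> (((2 + \<delta>) / \<rho>\<^sup>2 * ?e) * N + ((2 + \<delta>) / \<rho> * ?e) * N) + \<bar>dcorr\<bar> * ((1 + 1 / \<kappa>) / \<rho> * ?e) * N + (1 / \<rho> * ?e) * ((1 + \<kappa> + \<delta>) * N)"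
        unfolding total_symbol_scaleR by (rule norm_triangle_le[OF add_mono[OF norm_triangle_le[OF add_mono[OF A B]] C]])
      also have "\<dots> = K * N * ?e" by (simp add: K_def algebra_simps)
      finally show ?thesis .
    qed
    have F2: "(norm (total_symbol \<kappa> \<delta> d P Q M t \<xi>))\<^sup>2 \<le> K\<^sup>2 * exp (- (c * t)) * (N\<^sup>2 * exp (- \<kappa> * ?r\<^sup>2))"
    proof -
      have "(norm (total_symbol \<kappa> \<delta> d P Q M t \<xi>))\<^sup>2 \<le> (K * N * ?e)\<^sup>2" using F by (rule power_mono) simp
      also have "\<dots> = K\<^sup>2 * N\<^sup>2 * exp (- (2 * (\<kappa> * ?r\<^sup>2 * t)))" by (simp add: power_mult_distrib flip: exp_double)
      \<comment> \<open>Half of the exponent 2 \<kappa> r^2 t gives decay in t through r \<ge>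
        \<rho>; the other half, by t \<ge> 1, keeps a Gaussian in \<xi> for integrability.\<close>
      also have "\<dots> \<le> K\<^sup>2 * N\<^sup>2 * (exp (- (c * t)) * exp (- \<kappa> * ?r\<^sup>2))"
      proof (rule mult_left_mono)
        have "c * t \<le> \<kappa> * \<rho>\<^sup>2 * t" using t by (intro mult_right_mono) (auto simp: c_def)
        also have "\<dots> \<le> \<kappa> * ?r\<^sup>2 * t" using r2 kpos t by (intro mult_right_mono mult_left_mono) auto
        finally have 1: "c * t \<le> \<kappa> * ?r\<^sup>2 * t" .
        have "\<kappa> * ?r\<^sup>2 * 1 \<le> \<kappa> * ?r\<^sup>2 * t" using kpos t by (intro mult_left_mono) auto
        then show "exp (- (2 * (\<kappa> * ?r\<^sup>2 * t))) \<le> exp (- (c * t)) * exp (- \<kappa> * ?r\<^sup>2)" using 1 by (simp flip: exp_add)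
      qed simp
      finally show ?thesis by (simp add: mult_ac)
    qed
    have "(norm (U t \<xi> - total_symbol \<kappa> \<delta> d P Q M t \<xi>))\<^sup>2 \<le> 2 * (norm (U t \<xi>))\<^sup>2 + 2 * (norm (total_symbol \<kappa> \<delta> d P Q M t \<xi>))\<^sup>2"
      using norm_add_sq_le[of 1 "U t \<xi>" "- total_symbol \<kappa> \<delta> d P Q M t \<xi>"] by simp
    also have "\<dots> \<le> 2 * ((C1 * L\<^sup>2)\<^sup>2 * exp (- (c * t)) * (3 * (w0\<^sup>2 + w1\<^sup>2 + w2\<^sup>2))) + 2 * (K\<^sup>2 * exp (- (c * t)) * (N\<^sup>2 * exp (- \<kappa> * ?r\<^sup>2)))"
      using U2 F2 by simp
    also have "\<dots> = exp (- (c * t)) * (6 * (C1 * L\<^sup>2)\<^sup>2 * (w0\<^sup>2 + w1\<^sup>2 + w2\<^sup>2) + 2 * K\<^sup>2 * (N\<^sup>2 * exp (- \<kappa> * ?r\<^sup>2)))"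
      by (simp add: algebra_simps)
    also have "\<dots> \<le> exp (- (c * t)) * ((6 * (C1 * L\<^sup>2)\<^sup>2 + 2 * K\<^sup>2) * (w0\<^sup>2 + w1\<^sup>2 + w2\<^sup>2) + (6 * (C1 * L\<^sup>2)\<^sup>2 + 2 * K\<^sup>2) * (N\<^sup>2 * exp (- \<kappa> * ?r\<^sup>2)))"
      by (intro mult_left_mono add_mono mult_right_mono) auto
    also have "\<dots> = (6 * (C1 * L\<^sup>2)\<^sup>2 + 2 * K\<^sup>2) * exp (- (c * t)) * datasq N a0 a1 a2 \<xi>"
      by (simp add: datasq_def w0_def w1_def w2_def distrib_left mult_ac)
    finally show "(norm (U t \<xi> - total_symbol \<kappa> \<delta> d P Q M t \<xi>))\<^sup>2 \<le> (6 * (C1 * L\<^sup>2)\<^sup>2 + 2 * K\<^sup>2) * exp (- (c * t)) * datasq N a0 a1 a2 \<xi>" .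
  qed
qed

text \<open>One estimate serves both the bound for \<open>\<psi> - \<psi>\<^sup>(\<^sup>1\<^sup>)\<close> (with \<open>d = Q = M = 0\<close>) and the one for
  \<open>\<psi> - \<psi>\<^sup>(\<^sup>1\<^sup>) - \<psi>\<^sup>(\<^sup>2\<^sup>)\<close> (with \<open>\<eta>\<close> small): \<open>\<eta>\<close> bounds all the data errors.\<close>

theorem low_frequency_estimate:
  obtains C c where "C > 0" "c > 0"
    "\<And>U a0 a1 a2 N P Q (M :: real^'n) d t \<xi> \<eta>. solves U a0 a1 a2 \<Longrightarrow> t \<ge> 1 \<Longrightarrow> 0 < norm \<xi> \<Longrightarrow> (norm \<xi>)\<^sup>2 \<le> x0 \<Longrightarrow>
       norm (a0 \<xi>) \<le> N \<Longrightarrow> norm (a1 \<xi>) \<le> N \<Longrightarrow> norm (a2 \<xi>) \<le> N \<Longrightarrow> N \<le> \<eta> * wmin t (norm \<xi>) \<Longrightarrow>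
       norm (a2 \<xi> - Complex P (- (\<xi> \<bullet> M))) \<le> \<eta> * norm \<xi> \<Longrightarrow>
       norm (dcorr *\<^sub>R a2 \<xi> - complex_of_real (d * P)) \<le> \<bar>dcorr\<bar> * \<eta> \<Longrightarrow>
       norm (a1 \<xi> + (\<kappa> - \<delta> / 2) *\<^sub>R a2 \<xi> - complex_of_real Q) \<le> (1 + \<kappa> + \<delta>) * \<eta> \<Longrightarrow>
       (norm (U t \<xi> - total_symbol \<kappa> \<delta> d P Q M t \<xi>))\<^sup>2 \<le> C * \<eta>\<^sup>2 * low_weight c t (norm \<xi>)"
proof -
  obtain C3 c where C3: "C3 > 0" and c: "c > 0" "c < \<kappa>" and E: "\<And>r u v w t. 0 < r \<Longrightarrow> r\<^sup>2 \<le> x0 \<Longrightarrow> flow (r\<^sup>2) u v w \<Longrightarrow> t \<ge> 0 \<Longrightarrow>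
       norm (u t - ((sym0 \<kappa> \<delta> t r + dcorr * t * symH \<delta> t r) *\<^sub>R w 0
            + sym1 \<delta> t r *\<^sub>R (v 0 + (\<kappa> - \<delta> / 2) *\<^sub>R w 0)))
         \<le> C3 * exp (- (c * r\<^sup>2 * t)) * (norm (u 0) + norm (v 0) + norm (w 0))"
    using low_frequency_expansion by blast
  define K where "K = 3 * C3 + (2 + \<delta>) + \<bar>dcorr\<bar> * (1 + 1 / \<kappa>) + (1 + \<kappa> + \<delta>)"
  have d0: "\<delta> > 0" using params_pos by simp
  have K: "K > 0" using C3 d0 kpos by (simp add: K_def add_pos_pos add_pos_nonneg)
  show thesis
  proof (rule that[of "K\<^sup>2" "2 * c"])
    show "K\<^sup>2 > 0" "2 * c > 0" using K c by auto
    fix U :: "real \<Rightarrow> real^'n \<Rightarrow> complex" and a0 a1 a2 N P Q and M :: "real^'n" and d t :: real and \<xi> :: "real^'n" and \<eta> :: real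
    assume sol: "solves U a0 a1 a2" and t: "t \<ge> 1" and r: "0 < norm \<xi>" and rx: "(norm \<xi>)\<^sup>2 \<le> x0"
      and N: "norm (a0 \<xi>) \<le> N" "norm (a1 \<xi>) \<le> N" "norm (a2 \<xi>) \<le> N" and NW: "N \<le> \<eta> * wmin t (norm \<xi>)"
      and h2: "norm (a2 \<xi> - Complex P (- (\<xi> \<bullet> M))) \<le> \<eta> * norm \<xi>"
      and hd: "norm (dcorr *\<^sub>R a2 \<xi> - complex_of_real (d * P)) \<le> \<bar>dcorr\<bar> * \<eta>"
      and hq: "norm (a1 \<xi> + (\<kappa> - \<delta> / 2) *\<^sub>R a2 \<xi> - complex_of_real Q) \<le> (1 + \<kappa> + \<delta>) * \<eta>"
    let ?r = "norm \<xi>"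
    let ?W = "wmin t ?r" and ?e = "exp (- (c * ?r\<^sup>2 * t))"
    obtain v w where fl: "flow (?r\<^sup>2) (\<lambda>t. U t \<xi>) v w" "U 0 \<xi> = a0 \<xi>" "v 0 = a1 \<xi>" "w 0 = a2 \<xi>"
      using sol unfolding solves_def by blast
    have W: "?W > 0" using wmin_pos[OF r] t by simp
    have N0: "N \<ge> 0" using N(1) norm_ge_zero order_trans by blast
    have eta: "\<eta> \<ge> 0" using NW N0 W by (meson linorder_not_le mult_neg_pos order_trans not_less)
    let ?A = "sym0 \<kappa> \<delta> t ?r" and ?H = "symH \<delta> t ?r" and ?B = "sym1 \<delta> t ?r"
    let ?E = "U t \<xi> - ((?A + dcorr * t * ?H) *\<^sub>R a2 \<xi> + ?B *\<^sub>R (a1 \<xi> + (\<kappa> - \<delta> / 2) *\<^sub>R a2 \<xi>))"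
    have ek: "exp (- (\<kappa> * ?r\<^sup>2 * t)) \<le> ?e"
    proof -
      have "c * ?r\<^sup>2 * t \<le> \<kappa> * ?r\<^sup>2 * t" using c t by (intro mult_right_mono) auto
      then show ?thesis by simp
    qed
    have tr: "z \<le> a * ?W * ?e" if "z \<le> a * ?W * exp (- (\<kappa> * ?r\<^sup>2 * t))" "a \<ge> 0" for z a
      using that(1) mult_left_mono[OF ek, of "a * ?W"] that(2) W by simp
    \<comment> \<open>The expansion error is bounded by the data, without a small factor; the
      hypothesis N \<le> \<eta> \<open>wmin t r\<close> is what brings it to the form of the other
      errors.\<close>
    have e1: "norm ?E \<le> (3 * C3 * \<eta>) * (?W * ?e)"
    proof -
      have "norm ?E \<le> C3 * ?e * (norm (a0 \<xi>) + norm (a1 \<xi>) + norm (a2 \<xi>))" using E[OF r rx fl(1), of t] t fl by simp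
      also have "\<dots> \<le> C3 * ?e * (3 * (\<eta> * ?W))" using N NW C3 by (intro mult_left_mono) auto
      finally show ?thesis by (simp add: mult_ac)
    qed
    have e2: "norm (?A *\<^sub>R (a2 \<xi> - Complex P (- (\<xi> \<bullet> M)))) \<le> ((2 + \<delta>) * \<eta>) * (?W * ?e)"
    proof -
      have "norm (?A *\<^sub>R (a2 \<xi> - Complex P (- (\<xi> \<bullet> M)))) \<le> \<bar>?A\<bar> * (\<eta> * ?r)" using h2 by (simp add: mult_left_mono)
      also have "\<dots> = (?r * \<bar>?A\<bar>) * \<eta>" by (simp add: mult_ac)
      also have "\<dots> \<le> ((2 + \<delta>) * ?W * ?e) * \<eta>"
        by (rule mult_right_mono[OF tr[OF sym0_bound(2)[OF kpos ksmall r t]] eta]) (use d0 in simp)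
      finally show ?thesis by (simp add: mult_ac)
    qed
    have e3: "norm ((t * ?H) *\<^sub>R (dcorr *\<^sub>R a2 \<xi> - complex_of_real (d * P))) \<le> (\<bar>dcorr\<bar> * (1 + 1 / \<kappa>) * \<eta>) * (?W * ?e)"
    proof -
      have "norm ((t * ?H) *\<^sub>R (dcorr *\<^sub>R a2 \<xi> - complex_of_real (d * P))) \<le> ((1 + 1 / \<kappa>) * ?W * ?e) * (\<bar>dcorr\<bar> * \<eta>)"
      proof (rule norm_scaleR_le[OF _ hd])
        have "\<bar>t * ?H\<bar> = t * \<bar>?H\<bar>" using t by (simp add: abs_mult)
        then show "\<bar>t * ?H\<bar> \<le> (1 + 1 / \<kappa>) * ?W * ?e" using tr[OF symH_bound(1)[OF kpos ksmall r t]] kpos by simp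
      qed
      then show ?thesis by (simp add: mult_ac)
    qed
    have e4: "norm (?B *\<^sub>R (a1 \<xi> + (\<kappa> - \<delta> / 2) *\<^sub>R a2 \<xi> - complex_of_real Q)) \<le> ((1 + \<kappa> + \<delta>) * \<eta>) * (?W * ?e)"
    proof -
      have "\<bar>?B\<bar> \<le> 1 * ?W * ?e" by (rule tr) (use sym1_bound[OF kpos ksmall r t] in auto)
      from norm_scaleR_le[OF this hq] show ?thesis by (simp add: mult_ac)
    qed
    have eq: "U t \<xi> - total_symbol \<kappa> \<delta> d P Q M t \<xi> = ?E + ?A *\<^sub>R (a2 \<xi> - Complex P (- (\<xi> \<bullet> M)))
       + (t * ?H) *\<^sub>R (dcorr *\<^sub>R a2 \<xi> - complex_of_real (d * P)) + ?B *\<^sub>R (a1 \<xi> + (\<kappa> - \<delta> / 2) *\<^sub>R a2 \<xi> - complex_of_real Q)"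
      unfolding total_symbol_scaleR by (simp add: complex_eq_iff algebra_simps)
    have "norm (U t \<xi> - total_symbol \<kappa> \<delta> d P Q M t \<xi>) \<le> (3 * C3 * \<eta>) * (?W * ?e) + ((2 + \<delta>) * \<eta>) * (?W * ?e) + (\<bar>dcorr\<bar> * (1 + 1 / \<kappa>) * \<eta>) * (?W * ?e) + ((1 + \<kappa> + \<delta>) * \<eta>) * (?W * ?e)"
      unfolding eq by (rule norm_triangle_le[OF add_mono[OF norm_triangle_le[OF add_mono[OF norm_triangle_le[OF add_mono[OF e1 e2]] e3]] e4]])
    also have "\<dots> = K * \<eta> * (?W * ?e)" by (simp add: K_def algebra_simps)
    finally have "(norm (U t \<xi> - total_symbol \<kappa> \<delta> d P Q M t \<xi>))\<^sup>2 \<le> (K * \<eta> * (?W * ?e))\<^sup>2" by (rule power_mono) simp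
    also have "\<dots> = K\<^sup>2 * \<eta>\<^sup>2 * low_weight (2 * c) t ?r"
      using wmin_sq[OF r, of t c] t by (simp only: power_mult_distrib)
    finally show "(norm (U t \<xi> - total_symbol \<kappa> \<delta> d P Q M t \<xi>))\<^sup>2 \<le> K\<^sup>2 * \<eta>\<^sup>2 * low_weight (2 * c) t ?r" .
  qed
qed

end

lemma L2norm_sq_split_le:
  fixes f :: "real^'n \<Rightarrow> complex" and g h :: "real^'n \<Rightarrow> real"
  assumes f: "f \<in> borel_measurable borel" and g: "integrable lborel g" "\<And>\<xi>. 0 \<le> g \<xi>" and h: "integrable lborel h" "\<And>\<xi>. 0 \<le> h \<xi>"
    and low: "\<And>\<xi>. 0 < norm \<xi> \<Longrightarrow> norm \<xi> < \<rho> \<Longrightarrow> (norm (f \<xi>))\<^sup>2 \<le> A * g \<xi>"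
    and high: "\<And>\<xi>. \<rho> \<le> norm \<xi> \<Longrightarrow> (norm (f \<xi>))\<^sup>2 \<le> B * h \<xi>"
    and AB: "A \<ge> 0" "B \<ge> 0"
  shows "(L2norm f)\<^sup>2 \<le> A * (\<integral>\<xi>. g \<xi> \<partial>lborel) + B * (\<integral>\<xi>. h \<xi> \<partial>lborel)"
proof -
  have i: "integrable lborel (\<lambda>\<xi>. A * g \<xi> + B * h \<xi>)" using g(1) h(1) by simp
  have "AE \<xi> in lborel. (norm (f \<xi>))\<^sup>2 \<le> A * g \<xi> + B * h \<xi>"
    using AE_lborel_singleton[of "0 :: real^'n"]
  proof eventually_elim
    case (elim \<xi>)
    have "0 \<le> A * g \<xi>" "0 \<le> B * h \<xi>" using AB g h by auto
    then show ?case using low[of \<xi>] high[of \<xi>] elim by (cases "norm \<xi> < \<rho>") auto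
  qed
  from L2_bound(2)[OF i f this] show ?thesis using g(1) h(1) by simp
qed

section \<open>Error bounds over all frequencies\<close>

context mgt begin

theorem profile_error_bound:
  obtains C T where "C > 0" "T \<ge> 1"
    "\<And>(U :: real \<Rightarrow> real^'n \<Rightarrow> complex) a0 a1 a2 N P t. solves U a0 a1 a2 \<Longrightarrow> L2 (U t) \<Longrightarrow> t \<ge> T \<Longrightarrow>
       (\<forall>\<xi>. norm (a0 \<xi>) \<le> N) \<Longrightarrow> (\<forall>\<xi>. norm (a1 \<xi>) \<le> N) \<Longrightarrow> (\<forall>\<xi>. norm (a2 \<xi>) \<le> N) \<Longrightarrow> \<bar>P\<bar> \<le> N \<Longrightarrow>
       (\<forall>\<xi>. norm (a2 \<xi> - complex_of_real P) \<le> norm \<xi> * N) \<Longrightarrow> integrable lborel (datasq N a0 a1 a2) \<Longrightarrow>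
       (L2norm (\<lambda>\<xi>. U t \<xi> - total_symbol \<kappa> \<delta> 0 P 0 0 t \<xi>))\<^sup>2 \<le> C * (rate CARD('n) t)\<^sup>2 * (N\<^sup>2 + (\<integral>\<xi>. datasq N a0 a1 a2 \<xi> \<partial>lborel))"
proof -
  have x0: "x0 > 0" by (rule params_pos)
  define \<rho> where "\<rho> = sqrt x0"
  have rho: "\<rho> > 0" "\<rho>\<^sup>2 = x0" using x0 by (auto simp: \<rho>_def)
  obtain C1 c1 where C1: "C1 > 0" "c1 > 0" and low:
    "\<And>(U :: real \<Rightarrow> real^'n \<Rightarrow> complex) a0 a1 a2 N P Q (M :: real^'n) d t \<xi> \<eta>. solves U a0 a1 a2 \<Longrightarrow> t \<ge> 1 \<Longrightarrow> 0 < norm \<xi> \<Longrightarrow> (norm \<xi>)\<^sup>2 \<le> x0 \<Longrightarrow>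
       norm (a0 \<xi>) \<le> N \<Longrightarrow> norm (a1 \<xi>) \<le> N \<Longrightarrow> norm (a2 \<xi>) \<le> N \<Longrightarrow> N \<le> \<eta> * wmin t (norm \<xi>) \<Longrightarrow>
       norm (a2 \<xi> - Complex P (- (\<xi> \<bullet> M))) \<le> \<eta> * norm \<xi> \<Longrightarrow>
       norm (dcorr *\<^sub>R a2 \<xi> - complex_of_real (d * P)) \<le> \<bar>dcorr\<bar> * \<eta> \<Longrightarrow>
       norm (a1 \<xi> + (\<kappa> - \<delta> / 2) *\<^sub>R a2 \<xi> - complex_of_real Q) \<le> (1 + \<kappa> + \<delta>) * \<eta> \<Longrightarrow>
       (norm (U t \<xi> - total_symbol \<kappa> \<delta> d P Q M t \<xi>))\<^sup>2 \<le> C1 * \<eta>\<^sup>2 * low_weight c1 t (norm \<xi>)"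
    by (rule low_frequency_estimate) (rule that; assumption)
  obtain C2 c2 where C2: "C2 > 0" "c2 > 0" and high:
    "\<And>(U :: real \<Rightarrow> real^'n \<Rightarrow> complex) a0 a1 a2 N P Q (M :: real^'n) d t \<xi>. solves U a0 a1 a2 \<Longrightarrow> t \<ge> 1 \<Longrightarrow> \<rho> \<le> norm \<xi> \<Longrightarrow> \<bar>P\<bar> \<le> N \<Longrightarrow>
       \<bar>Q\<bar> \<le> (1 + \<kappa> + \<delta>) * N \<Longrightarrow> norm M \<le> N \<Longrightarrow> \<bar>d\<bar> \<le> \<bar>dcorr\<bar> \<Longrightarrow>
       (norm (U t \<xi> - total_symbol \<kappa> \<delta> d P Q M t \<xi>))\<^sup>2 \<le> C2 * exp (- (c2 * t)) * datasq N a0 a1 a2 \<xi>"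
    by (rule high_frequency_estimate[OF rho(1)]) (rule that; assumption)
  obtain C3 T3 where C3: "C3 > 0" "T3 \<ge> 1" and wi: "\<And>t. t \<ge> T3 \<Longrightarrow> integrable lborel (\<lambda>\<xi>::real^'n. low_weight c1 t (norm \<xi>))"
    and wb: "\<And>t. t \<ge> T3 \<Longrightarrow> (\<integral>\<xi>. low_weight c1 t (norm \<xi>) \<partial>(lborel :: (real^'n) measure)) \<le> C3 * (rate CARD('n) t)\<^sup>2"
    by (rule low_weight_integral[OF C1(2)]) (rule that; assumption)
  have n0: "CARD('n) > 0" by simp
  obtain T4 where T4: "\<And>t. t \<ge> T4 \<Longrightarrow> C2 * exp (- (c2 * t)) \<le> 1 * (rate CARD('n) t)\<^sup>2"
    using rate_dominates_exp[OF C2(2) zero_less_one n0, of C2] unfolding eventually_at_top_linorder by blast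
  show thesis
  proof (rule that[of "C1 * C3 + 1" "max T3 T4"])
    show "C1 * C3 + 1 > 0" using C1 C3 by (simp add: add_pos_pos)
    show "max T3 T4 \<ge> 1" using C3 by simp
    fix U :: "real \<Rightarrow> real^'n \<Rightarrow> complex" and a0 a1 a2 :: "real^'n \<Rightarrow> complex" and N P t :: real
    assume sol: "solves U a0 a1 a2" and U: "L2 (U t)" and t: "t \<ge> max T3 T4"
      and bounds: "\<forall>\<xi>. norm (a0 \<xi>) \<le> N" "\<forall>\<xi>. norm (a1 \<xi>) \<le> N" "\<forall>\<xi>. norm (a2 \<xi>) \<le> N" and P: "\<bar>P\<bar> \<le> N"
        "\<forall>\<xi>. norm (a2 \<xi> - complex_of_real P) \<le> norm \<xi> * N" and D: "integrable lborel (datasq N a0 a1 a2)"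
    note b0 = bounds(1)[rule_format] and b1 = bounds(2)[rule_format] and b2 = bounds(3)[rule_format] and aP = P(2)[rule_format]
    note P = P(1)
    have t1: "t \<ge> 1" using t C3 by simp
    have N: "N \<ge> 0" using P by linarith
    let ?D = "\<integral>\<xi>. datasq N a0 a1 a2 \<xi> \<partial>lborel" and ?W = "\<integral>\<xi>. low_weight c1 t (norm \<xi>) \<partial>(lborel :: (real^'n) measure)"
    have D0: "?D \<ge> 0" by (intro integral_nonneg_AE) (simp add: datasq_nonneg)
    have "(L2norm (\<lambda>\<xi>. U t \<xi> - total_symbol \<kappa> \<delta> 0 P 0 0 t \<xi>))\<^sup>2 \<le> (C1 * N\<^sup>2) * ?W + (C2 * exp (- (c2 * t))) * ?D"
    proof (rule L2norm_sq_split_le[where \<rho> = \<rho>])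
      show "(\<lambda>\<xi>. U t \<xi> - total_symbol \<kappa> \<delta> 0 P 0 0 t \<xi>) \<in> borel_measurable borel"
        by (rule L2_measurable[OF L2_diff(1)[OF U total_symbol_integrable(2)[OF kpos ksmall t1]]])
      show "integrable lborel (\<lambda>\<xi>::real^'n. low_weight c1 t (norm \<xi>))" using wi t by simp
      show "integrable lborel (datasq N a0 a1 a2)" by (rule D)
      fix \<xi> :: "real^'n"
      show "0 \<le> low_weight c1 t (norm \<xi>)" by (rule low_weight_nonneg)
      show "0 \<le> datasq N a0 a1 a2 \<xi>" by (rule datasq_nonneg)
      show "(norm (U t \<xi> - total_symbol \<kappa> \<delta> 0 P 0 0 t \<xi>))\<^sup>2 \<le> C2 * exp (- (c2 * t)) * datasq N a0 a1 a2 \<xi>" if "\<rho> \<le> norm \<xi>"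
        by (rule high[OF sol t1 that P]) (use N kpos params_pos in auto)
      show "(norm (U t \<xi> - total_symbol \<kappa> \<delta> 0 P 0 0 t \<xi>))\<^sup>2 \<le> C1 * N\<^sup>2 * low_weight c1 t (norm \<xi>)" if r: "0 < norm \<xi>" "norm \<xi> < \<rho>"
      proof (rule low[OF sol t1 r(1) _ b0 b1 b2])
        show rx: "(norm \<xi>)\<^sup>2 \<le> x0" using power_mono[of "norm \<xi>" \<rho> 2] r rho by simp
        \<comment> \<open>Since x0 \<le> 1, all low frequencies satisfy r \<le> 1, where
          \<open>wmin t r\<close> \<ge> 1; so \<eta> = N meets the hypothesis on N.\<close>
        have "(norm \<xi>)\<^sup>2 \<le> 1" using x0_small(1)[of "(norm \<xi>)\<^sup>2"] rx r by simp
        then have "norm \<xi> \<le> 1" by (simp add: abs_square_le_1)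
        then have "1 \<le> wmin t (norm \<xi>)" using t1 r by (simp add: wmin_def)
        then show "N \<le> N * wmin t (norm \<xi>)" using N mult_left_mono by fastforce
        show "norm (a2 \<xi> - Complex P (- (\<xi> \<bullet> 0))) \<le> N * norm \<xi>" using aP[of \<xi>] by (simp add: complex_of_real_def mult.commute)
        show "norm (dcorr *\<^sub>R a2 \<xi> - complex_of_real (0 * P)) \<le> \<bar>dcorr\<bar> * N" using b2[of \<xi>] by (simp add: mult_left_mono)
        have "norm (a1 \<xi> + (\<kappa> - \<delta> / 2) *\<^sub>R a2 \<xi>) \<le> norm (a1 \<xi>) + \<bar>\<kappa> - \<delta> / 2\<bar> * norm (a2 \<xi>)"
          by (rule norm_triangle_le) simp
        also have "\<dots> \<le> N + (\<kappa> + \<delta>) * N"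
        proof (intro add_mono mult_mono)
          show "\<bar>\<kappa> - \<delta> / 2\<bar> \<le> \<kappa> + \<delta>" using kpos ksmall by linarith
        qed (use b1 b2 kpos ksmall in auto)
        finally show "norm (a1 \<xi> + (\<kappa> - \<delta> / 2) *\<^sub>R a2 \<xi> - complex_of_real 0) \<le> (1 + \<kappa> + \<delta>) * N" by (simp add: algebra_simps)
      qed
    qed (use C1 C2 in auto)
    moreover have "(C1 * N\<^sup>2) * ?W \<le> (C1 * N\<^sup>2) * (C3 * (rate CARD('n) t)\<^sup>2)" using wb[of t] t C1 by (intro mult_left_mono) auto
    moreover have "(C2 * exp (- (c2 * t))) * ?D \<le> (rate CARD('n) t)\<^sup>2 * ?D" using T4[of t] t D0 by (intro mult_right_mono) auto
    moreover have "(C1 * N\<^sup>2) * (C3 * (rate CARD('n) t)\<^sup>2) + (rate CARD('n) t)\<^sup>2 * ?D \<le> (C1 * C3 + 1) * (rate CARD('n) t)\<^sup>2 * (N\<^sup>2 + ?D)"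
    proof -
      have "0 \<le> C1 * C3 * (rate CARD('n) t)\<^sup>2 * ?D + (rate CARD('n) t)\<^sup>2 * N\<^sup>2" using C1 C3 D0 by simp
      then show ?thesis by (simp add: algebra_simps)
    qed
    ultimately show "(L2norm (\<lambda>\<xi>. U t \<xi> - total_symbol \<kappa> \<delta> 0 P 0 0 t \<xi>))\<^sup>2 \<le> (C1 * C3 + 1) * (rate CARD('n) t)\<^sup>2 * (N\<^sup>2 + ?D)"
      by linarith
  qed
qed

text \<open>The order of choices is what matters: \<eta> from e, then \<rho> from \<eta> and the
  behaviour of the data at zero frequency, then the high-frequency constants from \<rho>, and t
  last.\<close>

theorem second_profile_error_small:
  fixes U :: "real \<Rightarrow> real^'n \<Rightarrow> complex"
  assumes sol: "solves U a0 a1 a2" and U: "\<And>t. t \<ge> 0 \<Longrightarrow> L2 (U t)"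
    and b0: "\<And>\<xi>. norm (a0 \<xi>) \<le> N" and b1: "\<And>\<xi>. norm (a1 \<xi>) \<le> N" and b2: "\<And>\<xi>. norm (a2 \<xi>) \<le> N"
    and P: "\<bar>P\<bar> \<le> N" and P1: "\<bar>P1\<bar> \<le> N" and M: "norm M \<le> N"
    and aP: "\<And>\<xi>. norm (a2 \<xi> - complex_of_real P) \<le> norm \<xi> * N" and D: "integrable lborel (datasq N a0 a1 a2)"
    and lim1: "\<And>e. e > 0 \<Longrightarrow> \<exists>\<rho>>0. \<forall>\<xi>. norm \<xi> < \<rho> \<longrightarrow> norm (a1 \<xi> - complex_of_real P1) \<le> e"
    and lim2: "\<And>e. e > 0 \<Longrightarrow> \<exists>\<rho>>0. \<forall>\<xi>. norm \<xi> < \<rho> \<longrightarrow> norm (a2 \<xi> - Complex P (- (\<xi> \<bullet> M))) \<le> e * norm \<xi>"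
    and e: "e > 0"
  shows "eventually (\<lambda>t. (L2norm (\<lambda>\<xi>. U t \<xi> - total_symbol \<kappa> \<delta> dcorr P (P1 + (\<kappa> - \<delta> / 2) * P) M t \<xi>))\<^sup>2 \<le> e * (rate CARD('n) t)\<^sup>2) at_top"
proof -
  have x0: "x0 > 0" by (rule params_pos)
  have N: "N \<ge> 0" using P by linarith
  let ?Q = "P1 + (\<kappa> - \<delta> / 2) * P"
  obtain C1 c1 where C1: "C1 > 0" "c1 > 0" and low:
    "\<And>(U :: real \<Rightarrow> real^'n \<Rightarrow> complex) a0 a1 a2 N P Q (M :: real^'n) d t \<xi> \<eta>. solves U a0 a1 a2 \<Longrightarrow> t \<ge> 1 \<Longrightarrow> 0 < norm \<xi> \<Longrightarrow> (norm \<xi>)\<^sup>2 \<le> x0 \<Longrightarrow>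
       norm (a0 \<xi>) \<le> N \<Longrightarrow> norm (a1 \<xi>) \<le> N \<Longrightarrow> norm (a2 \<xi>) \<le> N \<Longrightarrow> N \<le> \<eta> * wmin t (norm \<xi>) \<Longrightarrow>
       norm (a2 \<xi> - Complex P (- (\<xi> \<bullet> M))) \<le> \<eta> * norm \<xi> \<Longrightarrow>
       norm (dcorr *\<^sub>R a2 \<xi> - complex_of_real (d * P)) \<le> \<bar>dcorr\<bar> * \<eta> \<Longrightarrow>
       norm (a1 \<xi> + (\<kappa> - \<delta> / 2) *\<^sub>R a2 \<xi> - complex_of_real Q) \<le> (1 + \<kappa> + \<delta>) * \<eta> \<Longrightarrow>
       (norm (U t \<xi> - total_symbol \<kappa> \<delta> d P Q M t \<xi>))\<^sup>2 \<le> C1 * \<eta>\<^sup>2 * low_weight c1 t (norm \<xi>)"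
    by (rule low_frequency_estimate) (rule that; assumption)
  obtain C3 T3 where C3: "C3 > 0" "T3 \<ge> 1" and wi: "\<And>t. t \<ge> T3 \<Longrightarrow> integrable lborel (\<lambda>\<xi>::real^'n. low_weight c1 t (norm \<xi>))"
    and wb: "\<And>t. t \<ge> T3 \<Longrightarrow> (\<integral>\<xi>. low_weight c1 t (norm \<xi>) \<partial>(lborel :: (real^'n) measure)) \<le> C3 * (rate CARD('n) t)\<^sup>2"
    by (rule low_weight_integral[OF C1(2)]) (rule that; assumption)
  \<comment> \<open>Chosen so that the low-frequency part is e/2 times the squared rate; the other
    half is left for high frequencies.\<close>
  define \<eta> where "\<eta> = sqrt (e / (2 * (C1 * C3)))"
  have C13: "C1 * C3 > 0" using C1 C3 by simp
  have eta: "\<eta> > 0" "\<eta>\<^sup>2 = e / (2 * (C1 * C3))" using e C13 by (auto simp: \<eta>_def)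
  obtain \<rho>1 where r1: "\<rho>1 > 0" "\<And>\<xi>. norm \<xi> < \<rho>1 \<Longrightarrow> norm (a1 \<xi> - complex_of_real P1) \<le> \<eta>" using lim1[OF eta(1)] by blast
  obtain \<rho>2 where r2: "\<rho>2 > 0" "\<And>\<xi>. norm \<xi> < \<rho>2 \<Longrightarrow> norm (a2 \<xi> - Complex P (- (\<xi> \<bullet> M))) \<le> \<eta> * norm \<xi>" using lim2[OF eta(1)] by blast
  \<comment> \<open>The first two entries give the expansions of the data with error \<eta>, sqrt x0
    gives the low-frequency regime, and \<eta>/(N + 1) gives N \<le> \<eta>/r, half of N \<le>
    \<eta> \<open>wmin t r\<close>; the other half is t \<ge> N/\<eta>.\<close>
  define \<rho> where "\<rho> = min (min \<rho>1 \<rho>2) (min (sqrt x0) (\<eta> / (N + 1)))"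
  have rho: "\<rho> > 0" using r1 r2 x0 eta N by (simp add: \<rho>_def)
  obtain C2 c2 where C2: "C2 > 0" "c2 > 0" and high:
    "\<And>(U :: real \<Rightarrow> real^'n \<Rightarrow> complex) a0 a1 a2 N P Q (M :: real^'n) d t \<xi>. solves U a0 a1 a2 \<Longrightarrow> t \<ge> 1 \<Longrightarrow> \<rho> \<le> norm \<xi> \<Longrightarrow> \<bar>P\<bar> \<le> N \<Longrightarrow>
       \<bar>Q\<bar> \<le> (1 + \<kappa> + \<delta>) * N \<Longrightarrow> norm M \<le> N \<Longrightarrow> \<bar>d\<bar> \<le> \<bar>dcorr\<bar> \<Longrightarrow>
       (norm (U t \<xi> - total_symbol \<kappa> \<delta> d P Q M t \<xi>))\<^sup>2 \<le> C2 * exp (- (c2 * t)) * datasq N a0 a1 a2 \<xi>"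
    by (rule high_frequency_estimate[OF rho]) (rule that; assumption)
  have n0: "CARD('n) > 0" by simp
  let ?D = "\<integral>\<xi>. datasq N a0 a1 a2 \<xi> \<partial>lborel"
  have D0: "?D \<ge> 0" by (intro integral_nonneg_AE) (simp add: datasq_nonneg)
  have half: "e / 2 > 0" using e by simp
  have Q: "\<bar>?Q\<bar> \<le> (1 + \<kappa> + \<delta>) * N"
  proof -
    have "\<bar>?Q\<bar> \<le> \<bar>P1\<bar> + \<bar>\<kappa> - \<delta> / 2\<bar> * \<bar>P\<bar>" using abs_triangle_ineq[of P1 "(\<kappa> - \<delta> / 2) * P"] by (simp add: abs_mult)
    also have "\<dots> \<le> N + (\<kappa> + \<delta>) * N"
    proof (intro add_mono mult_mono)
      show "\<bar>\<kappa> - \<delta> / 2\<bar> \<le> \<kappa> + \<delta>" using kpos ksmall by linarith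
    qed (use P P1 kpos ksmall in auto)
    finally show ?thesis by (simp add: algebra_simps)
  qed
  from rate_dominates_exp[OF C2(2) half n0, of "C2 * ?D"] eventually_ge_at_top[of "max T3 (N / \<eta>)"]
  show ?thesis
  proof eventually_elim
    case (elim t)
    have t1: "t \<ge> 1" and t3: "t \<ge> T3" and tN: "N \<le> \<eta> * t" using elim(2) C3 eta by (auto simp: divide_le_eq mult.commute)
    let ?W = "\<integral>\<xi>. low_weight c1 t (norm \<xi>) \<partial>(lborel :: (real^'n) measure)"
    have "(L2norm (\<lambda>\<xi>. U t \<xi> - total_symbol \<kappa> \<delta> dcorr P ?Q M t \<xi>))\<^sup>2 \<le> (C1 * \<eta>\<^sup>2) * ?W + (C2 * exp (- (c2 * t))) * ?D"
    proof (rule L2norm_sq_split_le[where \<rho> = \<rho>])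
      have "L2 (U t)" using U t1 by simp
      then show "(\<lambda>\<xi>. U t \<xi> - total_symbol \<kappa> \<delta> dcorr P ?Q M t \<xi>) \<in> borel_measurable borel"
        by (rule L2_measurable[OF L2_diff(1)[OF _ total_symbol_integrable(2)[OF kpos ksmall t1]]])
      show "integrable lborel (\<lambda>\<xi>::real^'n. low_weight c1 t (norm \<xi>))" using wi t3 by simp
      show "integrable lborel (datasq N a0 a1 a2)" by (rule D)
      fix \<xi> :: "real^'n"
      show "0 \<le> low_weight c1 t (norm \<xi>)" by (rule low_weight_nonneg)
      show "0 \<le> datasq N a0 a1 a2 \<xi>" by (rule datasq_nonneg)
      show "(norm (U t \<xi> - total_symbol \<kappa> \<delta> dcorr P ?Q M t \<xi>))\<^sup>2 \<le> C2 * exp (- (c2 * t)) * datasq N a0 a1 a2 \<xi>" if "\<rho> \<le> norm \<xi>"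
        by (rule high[OF sol t1 that P Q M]) simp
      show "(norm (U t \<xi> - total_symbol \<kappa> \<delta> dcorr P ?Q M t \<xi>))\<^sup>2 \<le> C1 * \<eta>\<^sup>2 * low_weight c1 t (norm \<xi>)" if r: "0 < norm \<xi>" "norm \<xi> < \<rho>"
      proof -
        have rs: "norm \<xi> < \<rho>1" "norm \<xi> < \<rho>2" "norm \<xi> < sqrt x0" "norm \<xi> < \<eta> / (N + 1)" using r by (auto simp: \<rho>_def)
        have rx: "(norm \<xi>)\<^sup>2 \<le> x0" using power_mono[of "norm \<xi>" "sqrt x0" 2] rs x0 by simp
        have "norm \<xi> * (N + 1) < \<eta>" using rs(4) N by (simp add: pos_less_divide_eq)
        then have rN: "norm \<xi> * N \<le> \<eta>" using norm_ge_zero[of \<xi>] unfolding distrib_left mult_1_right by linarith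
        have d2: "norm (a2 \<xi> - complex_of_real P) \<le> \<eta>" using aP[of \<xi>] rN by linarith
        show ?thesis
        proof (rule low[OF sol t1 r(1) rx b0 b1 b2 _ r2(2)[OF rs(2)]])
          show "N \<le> \<eta> * wmin t (norm \<xi>)" using tN rN r by (auto simp: wmin_def min_def le_divide_eq mult.commute)
          have "dcorr *\<^sub>R a2 \<xi> - complex_of_real (dcorr * P) = dcorr *\<^sub>R (a2 \<xi> - complex_of_real P)" by (simp add: complex_eq_iff algebra_simps)
          then show "norm (dcorr *\<^sub>R a2 \<xi> - complex_of_real (dcorr * P)) \<le> \<bar>dcorr\<bar> * \<eta>" using d2 by (simp add: mult_left_mono)
          have "a1 \<xi> + (\<kappa> - \<delta> / 2) *\<^sub>R a2 \<xi> - complex_of_real ?Q = (a1 \<xi> - complex_of_real P1) + (\<kappa> - \<delta> / 2) *\<^sub>R (a2 \<xi> - complex_of_real P)"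
            by (simp add: complex_eq_iff algebra_simps)
          also have "norm \<dots> \<le> \<eta> + (\<kappa> + \<delta>) * \<eta>"
          proof (rule norm_triangle_le[OF add_mono[OF r1(2)[OF rs(1)] norm_scaleR_le[OF _ d2]]])
            show "\<bar>\<kappa> - \<delta> / 2\<bar> \<le> \<kappa> + \<delta>" using kpos ksmall by linarith
          qed
          finally show "norm (a1 \<xi> + (\<kappa> - \<delta> / 2) *\<^sub>R a2 \<xi> - complex_of_real ?Q) \<le> (1 + \<kappa> + \<delta>) * \<eta>" by (simp add: algebra_simps)
        qed
      qed
    qed (use C1 C2 in auto)
    moreover have "(C1 * \<eta>\<^sup>2) * ?W \<le> (C1 * \<eta>\<^sup>2) * (C3 * (rate CARD('n) t)\<^sup>2)" using wb[OF t3] C1 by (intro mult_left_mono) auto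
    moreover have "(C1 * \<eta>\<^sup>2) * (C3 * (rate CARD('n) t)\<^sup>2) = e / 2 * (rate CARD('n) t)\<^sup>2"
    proof -
      have "(C1 * \<eta>\<^sup>2) * C3 = e / 2" unfolding eta(2) using C1 C3 by simp
      then show ?thesis by (metis mult.assoc)
    qed
    moreover have "(C2 * exp (- (c2 * t))) * ?D \<le> e / 2 * (rate CARD('n) t)\<^sup>2" using elim(1) by (simp add: mult_ac)
    moreover have "e / 2 * (rate CARD('n) t)\<^sup>2 + e / 2 * (rate CARD('n) t)\<^sup>2 = e * (rate CARD('n) t)\<^sup>2" by simp
    ultimately show ?case by linarith
  qed
qed

end

section \<open>Lower bounds\<close>

lemma nn_integral_norm_sq:
  fixes f :: "real^'n \<Rightarrow> complex"
  assumes "L2 f" shows "(\<integral>\<^sup>+\<xi>. ennreal ((norm (f \<xi>))\<^sup>2) \<partial>lborel) = ennreal ((L2norm f)\<^sup>2)"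
  unfolding L2norm_sq by (rule nn_integral_eq_integral) (use L2_integrable[OF assms] in auto)

lemma L2norm_sq_ge:
  fixes f :: "real^'n \<Rightarrow> complex"
  assumes f: "L2 f" and g: "g \<in> borel_measurable borel" and k: "0 \<le> k"
    and pt: "\<And>\<xi>. k * g \<xi> \<le> (norm (f \<xi>))\<^sup>2" and a: "ennreal a \<le> (\<integral>\<^sup>+\<xi>. ennreal (g \<xi>) \<partial>lborel)"
  shows "k * a \<le> (L2norm f)\<^sup>2"
proof -
  have 1: "ennreal (k * a) \<le> ennreal k * (\<integral>\<^sup>+\<xi>. ennreal (g \<xi>) \<partial>lborel)"
    unfolding ennreal_mult'[OF k] by (rule mult_left_mono[OF a]) simp
  have 2: "ennreal k * (\<integral>\<^sup>+\<xi>. ennreal (g \<xi>) \<partial>lborel) = (\<integral>\<^sup>+\<xi>. ennreal k * ennreal (g \<xi>) \<partial>lborel)"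
    by (rule nn_integral_cmult[symmetric]) (use g in measurable)
  have 3: "(\<integral>\<^sup>+\<xi>. ennreal k * ennreal (g \<xi>) \<partial>lborel) \<le> (\<integral>\<^sup>+\<xi>. ennreal ((norm (f \<xi>))\<^sup>2) \<partial>lborel)"
    by (intro nn_integral_mono) (simp add: ennreal_mult'[OF k, symmetric] pt ennreal_leI)
  have "ennreal (k * a) \<le> ennreal ((L2norm f)\<^sup>2)"
    by (rule order_trans[OF 1 order_trans[OF eq_refl[OF 2] 3[unfolded nn_integral_norm_sq[OF f]]]])
  then show ?thesis by (simp add: ennreal_le_iff)
qed

text \<open>The factor \<xi> \<bullet> M is not radial and vanishes on a hyperplane;
  \<open>nn_integral_inner_sq_radial\<close> replaces it by |\<xi>| |M| after integration, at the
  cost of the factor n^2.\<close>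

lemma L2norm_sq_ge_moment:
  fixes f :: "real^'n \<Rightarrow> complex" and h :: "real \<Rightarrow> real"
  assumes f: "L2 f" and h: "h \<in> borel_measurable borel" and g: "g \<in> borel_measurable borel" and k: "0 \<le> k"
    and hf: "\<And>\<xi>. ((\<xi> \<bullet> M) * h (norm \<xi>))\<^sup>2 \<le> (norm (f \<xi>))\<^sup>2"
    and pt: "\<And>\<xi> :: real^'n. k * g \<xi> \<le> (norm \<xi> * h (norm \<xi>))\<^sup>2" and a: "ennreal a \<le> (\<integral>\<^sup>+\<xi>. ennreal (g \<xi>) \<partial>lborel)"
  shows "k * a * (norm M)\<^sup>2 \<le> (real CARD('n))\<^sup>2 * (L2norm f)\<^sup>2"
proof -
  let ?h = "\<lambda>r. ennreal ((h r)\<^sup>2)"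
  let ?I = "\<integral>\<^sup>+\<xi>. ennreal ((norm \<xi>)\<^sup>2) * ?h (norm \<xi>) \<partial>(lborel :: (real^'n) measure)"
  have hm: "?h \<in> borel_measurable borel" using h by measurable
  have I: "ennreal (k * a) \<le> ?I"
  proof -
    have 2: "ennreal k * (\<integral>\<^sup>+\<xi>. ennreal (g \<xi>) \<partial>lborel) = (\<integral>\<^sup>+\<xi>. ennreal k * ennreal (g \<xi>) \<partial>lborel)"
      by (rule nn_integral_cmult[symmetric]) (use g in measurable)
    have 3: "(\<integral>\<^sup>+\<xi>. ennreal k * ennreal (g \<xi>) \<partial>lborel) \<le> ?I"
    proof (rule nn_integral_mono)
      fix \<xi> :: "real^'n"
      have "ennreal k * ennreal (g \<xi>) = ennreal (k * g \<xi>)" by (rule ennreal_mult'[OF k, symmetric])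
      also have "\<dots> \<le> ennreal ((norm \<xi>)\<^sup>2 * (h (norm \<xi>))\<^sup>2)" using pt[of \<xi>] by (intro ennreal_leI) (simp add: power_mult_distrib)
      also have "\<dots> = ennreal ((norm \<xi>)\<^sup>2) * ?h (norm \<xi>)" by (rule ennreal_mult') simp
      finally show "ennreal k * ennreal (g \<xi>) \<le> ennreal ((norm \<xi>)\<^sup>2) * ?h (norm \<xi>)" .
    qed
    have 1: "ennreal (k * a) \<le> ennreal k * (\<integral>\<^sup>+\<xi>. ennreal (g \<xi>) \<partial>lborel)"
      unfolding ennreal_mult'[OF k] by (rule mult_left_mono[OF a]) simp
    show ?thesis by (rule order_trans[OF 1 order_trans[OF eq_refl[OF 2] 3]])
  qed
  have J: "(\<integral>\<^sup>+\<xi>. ennreal ((\<xi> \<bullet> M)\<^sup>2) * ?h (norm \<xi>) \<partial>lborel) \<le> ennreal ((L2norm f)\<^sup>2)"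
    unfolding nn_integral_norm_sq[OF f, symmetric]
  proof (rule nn_integral_mono)
    fix \<xi>
    have "ennreal ((\<xi> \<bullet> M)\<^sup>2) * ?h (norm \<xi>) = ennreal ((\<xi> \<bullet> M)\<^sup>2 * (h (norm \<xi>))\<^sup>2)" by (rule ennreal_mult'[symmetric]) simp
    also have "\<dots> \<le> ennreal ((norm (f \<xi>))\<^sup>2)" using hf[of \<xi>] by (intro ennreal_leI) (simp add: power_mult_distrib)
    finally show "ennreal ((\<xi> \<bullet> M)\<^sup>2) * ?h (norm \<xi>) \<le> ennreal ((norm (f \<xi>))\<^sup>2)" .
  qed
  have 1: "ennreal ((norm M)\<^sup>2 * (k * a)) \<le> ennreal ((norm M)\<^sup>2) * ?I"
    unfolding ennreal_mult'[OF zero_le_power2] by (rule mult_left_mono[OF I]) simp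
  have 2: "(of_nat CARD('n))\<^sup>2 * (\<integral>\<^sup>+\<xi>. ennreal ((\<xi> \<bullet> M)\<^sup>2) * ?h (norm \<xi>) \<partial>lborel) \<le> (of_nat CARD('n))\<^sup>2 * ennreal ((L2norm f)\<^sup>2)"
    by (rule mult_left_mono[OF J]) simp
  have 3: "(of_nat CARD('n))\<^sup>2 * ennreal ((L2norm f)\<^sup>2) = ennreal ((real CARD('n))\<^sup>2 * (L2norm f)\<^sup>2)"
    by (simp add: ennreal_mult' ennreal_of_nat_eq_real_of_nat ennreal_power)
  have "ennreal ((norm M)\<^sup>2 * (k * a)) \<le> ennreal ((real CARD('n))\<^sup>2 * (L2norm f)\<^sup>2)"
    by (rule order_trans[OF 1 order_trans[OF nn_integral_inner_sq_radial[OF hm] order_trans[OF 2 eq_refl[OF 3]]]])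
  then show ?thesis by (simp add: ennreal_le_iff mult_ac)
qed

lemma add_sq_lower:
  fixes a b x y R L :: real
  assumes "a > 0" "b > 0" "R \<ge> 0" "a * x\<^sup>2 * R \<le> L" "b * y\<^sup>2 * R \<le> L"
  shows "min a b / 4 * (x + y)\<^sup>2 * R \<le> L"
proof -
  define m where "m = min a b"
  have m: "0 < m" "m \<le> a" "m \<le> b" using assms by (auto simp: m_def)
  have "m * x\<^sup>2 * R \<le> a * x\<^sup>2 * R" "m * y\<^sup>2 * R \<le> b * y\<^sup>2 * R" using m assms(3) by (auto intro!: mult_right_mono)
  then have 1: "m * x\<^sup>2 * R + m * y\<^sup>2 * R \<le> 2 * L" using assms by linarith
  have "(x + y)\<^sup>2 \<le> 2 * (x\<^sup>2 + y\<^sup>2)" using zero_le_power2[of "x - y"] by (simp add: power2_eq_square algebra_simps)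
  then have "m / 4 * (x + y)\<^sup>2 * R \<le> m / 4 * (2 * (x\<^sup>2 + y\<^sup>2)) * R" using m assms(3) by (intro mult_right_mono mult_left_mono) auto
  also have "\<dots> = (m * x\<^sup>2 * R + m * y\<^sup>2 * R) / 2" by (simp add: algebra_simps)
  also have "\<dots> \<le> L" using 1 by simp
  finally show ?thesis unfolding m_def .
qed

text \<open>An affine function has at most one zero, so it is large on one of two separate windows.
  The constant comes from the worst zero 5/2, midway between them: there |p s + q| \<ge> |p|/2 on
  both windows, while |p| + |q| = 7 |p|/2.\<close>

lemma affine_large_on_a_window:
  fixes p q :: real
  shows "(\<forall>s. 1 \<le> s \<and> s \<le> 2 \<longrightarrow> (\<bar>p\<bar> + \<bar>q\<bar>) / 7 \<le> \<bar>p * s + q\<bar>) \<or> (\<forall>s. 3 \<le> s \<and> s \<le> 4 \<longrightarrow> (\<bar>p\<bar> + \<bar>q\<bar>) / 7 \<le> \<bar>p * s + q\<bar>)"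
proof -
  have W: "(\<forall>s. 1 \<le> s \<and> s \<le> 2 \<longrightarrow> (p + \<bar>q\<bar>) / 7 \<le> \<bar>p * s + q\<bar>) \<or> (\<forall>s. 3 \<le> s \<and> s \<le> 4 \<longrightarrow> (p + \<bar>q\<bar>) / 7 \<le> \<bar>p * s + q\<bar>)"
    if p: "p \<ge> 0" for p q :: real
  proof (cases "5 * p \<le> - 2 * q")
    case True
    have "(p + \<bar>q\<bar>) / 7 \<le> \<bar>p * s + q\<bar>" if "1 \<le> s" "s \<le> 2" for s
    proof -
      have "p * s \<le> 2 * p" using mult_left_mono[OF that(2) p] by (simp add: mult.commute)
      moreover have "\<bar>q\<bar> = - q" using True p by linarith
      moreover have "- (p * s + q) \<le> \<bar>p * s + q\<bar>" by linarith
      ultimately show ?thesis using True by (simp add: field_simps)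
    qed
    then show ?thesis by blast
  next
    case False
    have "(p + \<bar>q\<bar>) / 7 \<le> \<bar>p * s + q\<bar>" if "3 \<le> s" "s \<le> 4" for s
    proof -
      have 1: "3 * p \<le> p * s" using mult_left_mono[OF that(1) p] by (simp add: mult.commute)
      have 2: "p * s + q \<le> \<bar>p * s + q\<bar>" by linarith
      have "(p + \<bar>q\<bar>) / 7 \<le> 3 * p + q" using False p by (cases "q \<ge> 0") (simp_all add: field_simps)
      then show ?thesis using 1 2 by linarith
    qed
    then show ?thesis by blast
  qed
  show ?thesis
  proof (cases "p \<ge> 0")
    case True then show ?thesis using W[of p q] by simp
  next
    case False
    have "\<bar>- p * s + - q\<bar> = \<bar>p * s + q\<bar>" for s by (simp add: abs_if)
    then show ?thesis using W[of "- p" "- q"] False by (simp only: abs_minus_cancel abs_of_neg)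
  qed
qed

text \<open>The symbol of \<psi>^(2), with p in the place of P_2 and Q in that of P_\<Psi>. Treating
  p as an independent parameter makes the lower bounds uniform in both numbers.\<close>

definition second_symbol :: "real \<Rightarrow> real \<Rightarrow> real \<Rightarrow> real \<Rightarrow> real^'n \<Rightarrow> real \<Rightarrow> real^'n \<Rightarrow> complex" where
  "second_symbol \<kappa> \<delta> p Q M t \<xi> = Complex (p * t * symH \<delta> t (norm \<xi>) + sym1 \<delta> t (norm \<xi>) * Q) (- (sym0 \<kappa> \<delta> t (norm \<xi>) * (\<xi> \<bullet> M)))"

lemma second_symbol_eq:
  "second_symbol \<kappa> \<delta> (d * P) Q M t \<xi> = total_symbol \<kappa> \<delta> d P Q M t \<xi> - total_symbol \<kappa> \<delta> 0 P 0 0 t \<xi>"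
  by (simp add: second_symbol_def total_symbol_def complex_eq_iff algebra_simps)

lemma second_symbol_Im_ge: "((\<xi> \<bullet> M) * sym0 \<kappa> \<delta> t (norm \<xi>))\<^sup>2 \<le> (norm (second_symbol \<kappa> \<delta> p Q M t \<xi>))\<^sup>2"
  unfolding second_symbol_def cmod_power2 by (simp add: mult.commute)

lemma second_symbol_Re_ge:
  assumes r: "0 < norm \<xi>" and s: "(norm \<xi>)\<^sup>2 * t \<le> s1" and d: "\<delta> \<ge> 0"
    and m: "0 \<le> m" "m \<le> \<bar>p * ((norm \<xi>)\<^sup>2 * t) + Q\<bar>"
  shows "exp (- (\<delta> * s1)) * m\<^sup>2 * ((sin (norm \<xi> * t))\<^sup>2 / (norm \<xi>)\<^sup>2) \<le> (norm (second_symbol \<kappa> \<delta> p Q M t \<xi>))\<^sup>2"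
proof -
  define r where "r = norm \<xi>"
  define z where "z = p * (r\<^sup>2 * t) + Q"
  have r0: "r > 0" using r by (simp add: r_def)
  have "p * t * symH \<delta> t r + sym1 \<delta> t r * Q = exp (- (\<delta> / 2) * r\<^sup>2 * t) * z * (sin (r * t) / r)"
    using r0 by (simp add: symH_def sym1_def z_def field_simps power2_eq_square)
  moreover have "(exp (- (\<delta> / 2) * r\<^sup>2 * t) * z * (sin (r * t) / r))\<^sup>2 = exp (- (\<delta> * (r\<^sup>2 * t))) * z\<^sup>2 * ((sin (r * t))\<^sup>2 / r\<^sup>2)"
    using exp_double[of "- (\<delta> / 2) * r\<^sup>2 * t"] by (simp add: power_mult_distrib power_divide mult.assoc)
  moreover have "exp (- (\<delta> * s1)) * m\<^sup>2 * ((sin (r * t))\<^sup>2 / r\<^sup>2) \<le> exp (- (\<delta> * (r\<^sup>2 * t))) * z\<^sup>2 * ((sin (r * t))\<^sup>2 / r\<^sup>2)"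
  proof (intro mult_right_mono mult_mono)
    show "exp (- (\<delta> * s1)) \<le> exp (- (\<delta> * (r\<^sup>2 * t)))" using s d by (simp add: r_def mult_left_mono)
    show "m\<^sup>2 \<le> z\<^sup>2" using m power_mono[of m "\<bar>z\<bar>" 2] by (simp add: z_def r_def)
  qed auto
  moreover have "(Re (second_symbol \<kappa> \<delta> p Q M t \<xi>))\<^sup>2 \<le> (norm (second_symbol \<kappa> \<delta> p Q M t \<xi>))\<^sup>2" unfolding cmod_power2 by simp
  ultimately show ?thesis by (simp add: second_symbol_def r_def)
qed

section \<open>Lower bounds for the second profile\<close>

context mgt begin

lemma second_symbol_L2:
  assumes t: "t \<ge> 1"
  shows "L2 (second_symbol \<kappa> \<delta> p Q M t :: real^'n \<Rightarrow> complex)"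
proof -
  have "second_symbol \<kappa> \<delta> p Q M t = (\<lambda>\<xi>::real^'n. total_symbol \<kappa> \<delta> p 1 Q M t \<xi> - total_symbol \<kappa> \<delta> 0 1 0 0 t \<xi>)"
    using second_symbol_eq[of \<kappa> \<delta> p 1 Q M t] by (simp add: fun_eq_iff)
  then show ?thesis using L2_diff(1)[OF total_symbol_integrable(2)[OF kpos ksmall t] total_symbol_integrable(2)[OF kpos ksmall t]] by simp
qed

text \<open>As \<kappa> < \<delta>/2, lowering the first exponential of the numerator to the second
  leaves (1 - cos (r t)) times that exponential, which is at least exp (- \<delta>/2) for r^2 t
  \<le> 1.\<close>

lemma sym0_ge_one_minus_cos:
  assumes r: "0 < r" and t: "t \<ge> 0" and s: "r\<^sup>2 * t \<le> 1"
  shows "exp (- \<delta>) * ((1 - cos (r * t))\<^sup>2 / r\<^sup>2) \<le> (r * sym0 \<kappa> \<delta> t r)\<^sup>2"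
proof -
  define s where "s = r\<^sup>2 * t"
  have s01: "0 \<le> s" "s \<le> 1" using assms by (auto simp: s_def)
  have e1: "exp (- (\<delta> / 2 * s)) \<le> exp (- (\<kappa> * s))" using mult_right_mono[of \<kappa> "\<delta> / 2" s] s01 ksmall kpos by simp
  have "exp (- (\<delta> / 2 * s)) \<ge> exp (- (\<delta> / 2))" using s01 params_pos mult_left_mono[OF s01(2), of "\<delta> / 2"] by simp
  then have "exp (- (\<delta> / 2)) * (1 - cos (r * t)) \<le> exp (- (\<delta> / 2 * s)) * (1 - cos (r * t))" by (rule mult_right_mono) simp
  also have "\<dots> \<le> exp (- (\<kappa> * s)) - cos (r * t) * exp (- (\<delta> / 2 * s))" using e1 by (simp add: algebra_simps)
  also have "\<dots> = r * (r * sym0 \<kappa> \<delta> t r)" using r by (simp add: sym0_def s_def power2_eq_square mult.assoc)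
  finally have "(exp (- (\<delta> / 2)) * (1 - cos (r * t)) / r) \<le> r * sym0 \<kappa> \<delta> t r" using r by (simp add: pos_divide_le_eq mult.commute)
  then have "(exp (- (\<delta> / 2)) * (1 - cos (r * t)) / r)\<^sup>2 \<le> (r * sym0 \<kappa> \<delta> t r)\<^sup>2" by (rule power_mono) (use r in simp)
  moreover have "(exp (- (\<delta> / 2)))\<^sup>2 = exp (- \<delta>)" using exp_double[of "- (\<delta> / 2)"] by simp
  ultimately show ?thesis by (simp add: power_mult_distrib power_divide)
qed

theorem second_symbol_lower_low_dim:
  assumes n: "CARD('n) \<in> {1, 2}"
  obtains A where "A > 0" "\<And>p Q (M :: real^'n). eventually (\<lambda>t. A * (\<bar>Q\<bar> + norm M)\<^sup>2 * (rate CARD('n) t)\<^sup>2 \<le> (L2norm (second_symbol \<kappa> \<delta> p Q M t))\<^sup>2) at_top"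
proof -
  have d0: "\<delta> > 0" by (rule params_pos)
  have pi2: "3 / 2 \<le> pi / 2" using pi_gt3 by simp
  have s1: "0 < sin (1::real)" using pi_gt3 by (intro sin_gt_zero) auto
  \<comment> \<open>For the real part the weight is sin^2, and sin^2 s + sin^2 (s + \<pi>/2) =
    1.\<close>
  obtain cR TR where cR: "cR > 0" and R: "\<And>t. t \<ge> TR \<Longrightarrow> ennreal (cR * (rate CARD('n) t)\<^sup>2) \<le>
    (\<integral>\<^sup>+\<xi>. ennreal (indicator {1 / t..t powr (- 3 / 4)} (norm \<xi>) * ((sin (norm \<xi> * t))\<^sup>2 / (norm \<xi>)\<^sup>2)) \<partial>(lborel :: (real^'n) measure))"
  proof (rule low_dim_lower_bound[where q = "\<lambda>s. (sin s)\<^sup>2" and p = "pi / 2" and a = "(sin 1)\<^sup>2"])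
    show "(sin 1)\<^sup>2 \<le> (sin s)\<^sup>2" if "1 \<le> s" "s \<le> 3 / 2" for s :: real
      using that s1 pi2 by (intro power_mono sin_monotone_2pi_le) auto
    show "1 \<le> (sin s)\<^sup>2 + (sin (s + pi / 2))\<^sup>2" for s :: real by (simp add: sin_add)
  qed (use s1 n in \<open>auto intro: that\<close>)
  have c1: "cos (1::real) < 1" using cos_monotone_0_pi[of 0 "1::real"] pi_gt3 by simp
  \<comment> \<open>For the moment part the weight is (1 - cos)^2, and (1 - cos s)^2 + (1 + cos s)^2
    = 2 + 2 cos^2 s.\<close>
  obtain cI TI where cI: "cI > 0" and I: "\<And>t. t \<ge> TI \<Longrightarrow> ennreal (cI * (rate CARD('n) t)\<^sup>2) \<le>
    (\<integral>\<^sup>+\<xi>. ennreal (indicator {1 / t..t powr (- 3 / 4)} (norm \<xi>) * ((1 - cos (norm \<xi> * t))\<^sup>2 / (norm \<xi>)\<^sup>2)) \<partial>(lborel :: (real^'n) measure))"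
  proof (rule low_dim_lower_bound[where q = "\<lambda>s. (1 - cos s)\<^sup>2" and p = pi and a = "(1 - cos 1)\<^sup>2"])
    show "(1 - cos 1)\<^sup>2 \<le> (1 - cos s)\<^sup>2" if "1 \<le> s" "s \<le> 3 / 2" for s :: real
      using that c1 pi2 cos_monotone_0_pi_le[of 1 s] by (intro power_mono) auto
    show "1 \<le> (1 - cos s)\<^sup>2 + (1 - cos (s + pi))\<^sup>2" for s :: real by (simp add: power2_eq_square algebra_simps)
  qed (use c1 n in \<open>auto intro: that\<close>)
  define a where "a = exp (- \<delta>) * cR / 4"
  define b where "b = exp (- \<delta>) * cI / (real CARD('n))\<^sup>2"
  have a0: "a > 0" using cR by (simp add: a_def)
  have b0: "b > 0" using cI by (simp add: b_def)
  show thesis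
  proof (rule that[of "min a b / 4"])
    show "min a b / 4 > 0" using a0 b0 by simp
    fix p Q :: real and M :: "real^'n"
    \<comment> \<open>On the annulus r^2 t \<le> t^(-1/2), so p r^2 t finally drops below half of Q
      and cannot cancel it; for Q = 0 the bound for the real part is trivial.\<close>
    have "eventually (\<lambda>t. \<bar>p\<bar> * t powr (- 1 / 2) \<le> \<bar>Q\<bar> / 2 \<or> Q = 0) at_top"
    proof (cases "Q = 0")
      case False
      have "((\<lambda>t. \<bar>p\<bar> * t powr (- 1 / 2)) \<longlongrightarrow> 0) at_top" by real_asymp
      from order_tendstoD(2)[OF this, of "\<bar>Q\<bar> / 2"] False show ?thesis
        by (auto elim!: eventually_mono)
    qed simp
    then show "eventually (\<lambda>t. min a b / 4 * (\<bar>Q\<bar> + norm M)\<^sup>2 * (rate CARD('n) t)\<^sup>2 \<le> (L2norm (second_symbol \<kappa> \<delta> p Q M t))\<^sup>2) at_top"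
      using eventually_ge_at_top[of "max 1 (max TR TI)"]
    proof eventually_elim
      case (elim t)
      have t: "t \<ge> 1" "t \<ge> TR" "t \<ge> TI" using elim(2) by auto
      note f = second_symbol_L2[OF t(1)]
      have win: "0 < r \<and> r\<^sup>2 * t \<le> t powr (- 1 / 2) \<and> r\<^sup>2 * t \<le> 1" if "r \<in> {1 / t..t powr (- 3 / 4)}" for r
      proof -
        have r: "0 < r" "r \<le> t powr (- 3 / 4)" using that t(1) by (auto intro: less_le_trans[of 0 "1 / t"])
        have "r\<^sup>2 \<le> (t powr (- 3 / 4))\<^sup>2" using r by (intro power_mono) auto
        then have "r\<^sup>2 * t \<le> (t powr (- 3 / 4))\<^sup>2 * t powr 1" using t(1) by (simp add: mult_right_mono)
        also have "\<dots> = t powr (- 1 / 2)" unfolding power2_eq_square powr_add[symmetric] by simp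
        finally have "r\<^sup>2 * t \<le> t powr (- 1 / 2)" .
        moreover have "t powr (- 1 / 2) \<le> 1" using powr_mono[of "- 1 / 2" 0 t] t(1) by simp
        ultimately show ?thesis using r by linarith
      qed
      have "(exp (- (\<delta> * 1)) * (\<bar>Q\<bar> / 2)\<^sup>2) * (cR * (rate CARD('n) t)\<^sup>2) \<le> (L2norm (second_symbol \<kappa> \<delta> p Q M t))\<^sup>2"
      proof (rule L2norm_sq_ge[OF f _ _ _ R[OF t(2)]])
        fix \<xi> :: "real^'n"
        show "(exp (- (\<delta> * 1)) * (\<bar>Q\<bar> / 2)\<^sup>2) * (indicator {1 / t..t powr (- 3 / 4)} (norm \<xi>) * ((sin (norm \<xi> * t))\<^sup>2 / (norm \<xi>)\<^sup>2)) \<le> (norm (second_symbol \<kappa> \<delta> p Q M t \<xi>))\<^sup>2"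
        proof (cases "norm \<xi> \<in> {1 / t..t powr (- 3 / 4)}")
          case True
          note w = win[OF True]
          have "\<bar>Q\<bar> / 2 \<le> \<bar>p * ((norm \<xi>)\<^sup>2 * t) + Q\<bar>"
          proof (cases "Q = 0")
            case False
            have "\<bar>p * ((norm \<xi>)\<^sup>2 * t)\<bar> = \<bar>p\<bar> * ((norm \<xi>)\<^sup>2 * t)" using t(1) by (simp add: abs_mult)
            also have "\<dots> \<le> \<bar>p\<bar> * t powr (- 1 / 2)" using w by (intro mult_left_mono) auto
            also have "\<dots> \<le> \<bar>Q\<bar> / 2" using elim(1) False by simp
            finally show ?thesis by linarith
          qed simp
          then have "exp (- (\<delta> * 1)) * (\<bar>Q\<bar> / 2)\<^sup>2 * ((sin (norm \<xi> * t))\<^sup>2 / (norm \<xi>)\<^sup>2) \<le> (norm (second_symbol \<kappa> \<delta> p Q M t \<xi>))\<^sup>2"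
            using w d0 by (intro second_symbol_Re_ge) auto
          then show ?thesis using True by simp
        qed simp
      qed simp_all
      then have 1: "a * \<bar>Q\<bar>\<^sup>2 * (rate CARD('n) t)\<^sup>2 \<le> (L2norm (second_symbol \<kappa> \<delta> p Q M t))\<^sup>2"
        by (simp add: a_def power_divide mult_ac)
      have "exp (- \<delta>) * (cI * (rate CARD('n) t)\<^sup>2) * (norm M)\<^sup>2 \<le> (real CARD('n))\<^sup>2 * (L2norm (second_symbol \<kappa> \<delta> p Q M t))\<^sup>2"
      proof (rule L2norm_sq_ge_moment[OF f sym_measurable(1) _ _ second_symbol_Im_ge _ I[OF t(3)]])
        fix \<xi> :: "real^'n"
        show "exp (- \<delta>) * (indicator {1 / t..t powr (- 3 / 4)} (norm \<xi>) * ((1 - cos (norm \<xi> * t))\<^sup>2 / (norm \<xi>)\<^sup>2)) \<le> (norm \<xi> * sym0 \<kappa> \<delta> t (norm \<xi>))\<^sup>2"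
        proof (cases "norm \<xi> \<in> {1 / t..t powr (- 3 / 4)}")
          case True
          then show ?thesis using sym0_ge_one_minus_cos[of "norm \<xi>" t] win[OF True] t(1) by simp
        qed simp
      qed simp_all
      then have 2: "b * (norm M)\<^sup>2 * (rate CARD('n) t)\<^sup>2 \<le> (L2norm (second_symbol \<kappa> \<delta> p Q M t))\<^sup>2"
        by (simp add: b_def pos_divide_le_eq mult_ac)
      show ?case by (rule add_sq_lower[OF a0 b0 _ 1 2]) simp
    qed
  qed
qed

text \<open>For r^2 t between 1 and 2 the two exponentials differ by a definite amount, so the
  cosine cannot make the numerator small. The factor sin^2, at most 1, is inserted to match the
  integrand of \<open>high_dim_lower_bound\<close>.\<close>

lemma sym0_ge_high_dim:
  assumes r: "0 < r" and t: "t \<ge> 0" and s: "1 \<le> r\<^sup>2 * t" "r\<^sup>2 * t \<le> 2"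
  shows "(exp (- (2 * \<kappa>)) * (1 - exp (- (\<delta> / 2 - \<kappa>))))\<^sup>2 * ((sin (r * t))\<^sup>2 / r\<^sup>2) \<le> (r * sym0 \<kappa> \<delta> t r)\<^sup>2"
proof -
  define s where "s = r\<^sup>2 * t"
  have s12: "1 \<le> s" "s \<le> 2" using s by (auto simp: s_def)
  let ?h = "exp (- (2 * \<kappa>)) * (1 - exp (- (\<delta> / 2 - \<kappa>)))"
  have dk: "0 < \<delta> / 2 - \<kappa>" using ksmall kpos by linarith
  have h0: "?h \<ge> 0" using dk by simp
  have "?h \<le> exp (- (\<kappa> * s)) * (1 - exp (- ((\<delta> / 2 - \<kappa>) * s)))"
  proof (intro mult_mono)
    show "exp (- (2 * \<kappa>)) \<le> exp (- (\<kappa> * s))" using mult_left_mono[OF s12(2), of \<kappa>] kpos by simp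
    show "1 - exp (- (\<delta> / 2 - \<kappa>)) \<le> 1 - exp (- ((\<delta> / 2 - \<kappa>) * s))" 
      by (rule diff_left_mono, rule exp_le_cancel_iff[THEN iffD2], rule le_imp_neg_le) (use s12 dk in simp)
  qed (use dk in auto)
  also have "\<dots> = exp (- (\<kappa> * s)) - 1 * exp (- (\<delta> / 2 * s))" by (simp add: right_diff_distrib algebra_simps flip: exp_add)
  also have "\<dots> \<le> exp (- (\<kappa> * s)) - cos (r * t) * exp (- (\<delta> / 2 * s))" by (intro diff_left_mono mult_right_mono) auto
  also have "\<dots> = r * (r * sym0 \<kappa> \<delta> t r)" using r by (simp add: sym0_def s_def power2_eq_square mult.assoc)
  finally have "?h / r \<le> r * sym0 \<kappa> \<delta> t r" using r by (simp add: pos_divide_le_eq mult.commute)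
  then have le: "(?h / r)\<^sup>2 \<le> (r * sym0 \<kappa> \<delta> t r)\<^sup>2" by (rule power_mono) (use r h0 in simp)
  have "?h\<^sup>2 * ((sin (r * t))\<^sup>2 / r\<^sup>2) \<le> ?h\<^sup>2 * (1 / r\<^sup>2)"
    by (intro mult_left_mono divide_right_mono) (auto simp: abs_square_le_1)
  also have "\<dots> = (?h / r)\<^sup>2" by (simp add: power_divide)
  finally show ?thesis using le by linarith
qed

text \<open>The real part is bounded below through |p| + |Q|, which controls the combination 2
  \<delta> Q + n p. Two annuli are prepared because the one on which p s + Q is large depends on p
  and Q; the smaller of their constants serves both.\<close>

theorem second_symbol_lower_high_dim:
  assumes n: "CARD('n) \<ge> 3"
  obtains A where "A > 0" "\<And>p Q (M :: real^'n). eventually (\<lambda>t. A * (\<bar>2 * \<delta> * Q + real CARD('n) * p\<bar> + norm M)\<^sup>2 * (rate CARD('n) t)\<^sup>2 \<le> (L2norm (second_symbol \<kappa> \<delta> p Q M t))\<^sup>2) at_top"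
proof -
  have d0: "\<delta> > 0" by (rule params_pos)
  have dk: "0 < \<delta> / 2 - \<kappa>" using ksmall kpos by linarith
  have sq: "0 < sqrt (1::real)" "sqrt 1 < sqrt (2::real)" "0 < sqrt (3::real)" "sqrt 3 < sqrt (4::real)"
    by (simp_all only: real_sqrt_less_iff real_sqrt_gt_0_iff)
  obtain c1 T1 where c1: "c1 > 0" and w1: "\<And>t. t \<ge> T1 \<Longrightarrow> ennreal (c1 * (rate CARD('n) t)\<^sup>2) \<le>
    (\<integral>\<^sup>+\<xi>. ennreal (indicator {sqrt 1 / sqrt t..sqrt 2 / sqrt t} (norm \<xi>) * ((sin (norm \<xi> * t))\<^sup>2 / (norm \<xi>)\<^sup>2)) \<partial>(lborel :: (real^'n) measure))"
    by (rule high_dim_lower_bound[OF sq(1,2) n]) (rule that; assumption)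
  obtain c2 T2 where c2: "c2 > 0" and w2: "\<And>t. t \<ge> T2 \<Longrightarrow> ennreal (c2 * (rate CARD('n) t)\<^sup>2) \<le>
    (\<integral>\<^sup>+\<xi>. ennreal (indicator {sqrt 3 / sqrt t..sqrt 4 / sqrt t} (norm \<xi>) * ((sin (norm \<xi> * t))\<^sup>2 / (norm \<xi>)\<^sup>2)) \<partial>(lborel :: (real^'n) measure))"
    by (rule high_dim_lower_bound[OF sq(3,4) n]) (rule that; assumption)
  have win: "0 < r \<and> a \<le> r\<^sup>2 * t \<and> r\<^sup>2 * t \<le> b" if "r \<in> {sqrt a / sqrt t..sqrt b / sqrt t}" "t \<ge> 1" "0 < a" "0 < b" for r t a b :: real
  proof -
    have st: "sqrt t > 0" using that by simp
    have "0 < sqrt a / sqrt t" using that by simp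
    then have r: "0 < r" using that(1) by (auto intro: less_le_trans)
    have "sqrt (a::real) \<le> r * sqrt t" and "r * sqrt t \<le> sqrt b" using that(1) st by (auto simp: pos_divide_le_eq pos_le_divide_eq)
    from power_mono[OF this(1), of 2] power_mono[OF this(2), of 2]
    have "(sqrt a)\<^sup>2 \<le> (r * sqrt t)\<^sup>2" "(r * sqrt t)\<^sup>2 \<le> (sqrt b)\<^sup>2" using that r by simp_all
    then show ?thesis using r that by (simp add: power_mult_distrib)
  qed
  define c where "c = min c1 c2"
  define h where "h = exp (- (2 * \<kappa>)) * (1 - exp (- (\<delta> / 2 - \<kappa>)))"
  have h: "h > 0" using dk by (simp add: h_def)
  define a where "a = exp (- (\<delta> * 4)) * c / (49 * (2 * \<delta> + real CARD('n))\<^sup>2)"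
  define b where "b = h\<^sup>2 * c1 / (real CARD('n))\<^sup>2"
  have c: "c > 0" using c1 c2 by (simp add: c_def)
  have D: "2 * \<delta> + real CARD('n) > 0" using d0 by (simp add: add_pos_pos)
  have a0: "a > 0" using c D by (simp add: a_def)
  have b0: "b > 0" using c1 h by (simp add: b_def)
  show thesis
  proof (rule that[of "min a b / 4"])
    show "min a b / 4 > 0" using a0 b0 by simp
    fix p Q :: real and M :: "real^'n"
    let ?S = "\<bar>2 * \<delta> * Q + real CARD('n) * p\<bar>"
    define m where "m = (\<bar>p\<bar> + \<bar>Q\<bar>) / 7"
    have m0: "m \<ge> 0" by (simp add: m_def)
    \<comment> \<open>This is where the combination in the statement is replaced by m, a seventh of
      |p| + |Q|; it explains the factor 49 (2 \<delta> + n)^2 in the denominator of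
      \<open>a\<close>.\<close>
    have Sm: "?S \<le> (2 * \<delta> + real CARD('n)) * (7 * m)"
    proof -
      have "?S \<le> 2 * \<delta> * \<bar>Q\<bar> + real CARD('n) * \<bar>p\<bar>" using abs_triangle_ineq[of "2 * \<delta> * Q" "real CARD('n) * p"] d0 by (simp add: abs_mult)
      moreover have "0 \<le> 2 * \<delta> * \<bar>p\<bar> + real CARD('n) * \<bar>Q\<bar>" using d0 by simp
      ultimately show ?thesis by (simp add: m_def algebra_simps)
    qed
    show "eventually (\<lambda>t. min a b / 4 * (?S + norm M)\<^sup>2 * (rate CARD('n) t)\<^sup>2 \<le> (L2norm (second_symbol \<kappa> \<delta> p Q M t))\<^sup>2) at_top"
      using eventually_ge_at_top[of "max 1 (max T1 T2)"]
    proof eventually_elim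
      case (elim t)
      have t: "t \<ge> 1" "t \<ge> T1" "t \<ge> T2" using elim by auto
      note f = second_symbol_L2[OF t(1)]
      have Re: "exp (- (\<delta> * 4)) * m\<^sup>2 * (c' * (rate CARD('n) t)\<^sup>2) \<le> (L2norm (second_symbol \<kappa> \<delta> p Q M t))\<^sup>2"
        if nn: "ennreal (c' * (rate CARD('n) t)\<^sup>2) \<le> (\<integral>\<^sup>+\<xi>. ennreal (indicator {sqrt u / sqrt t..sqrt v / sqrt t} (norm \<xi>) * ((sin (norm \<xi> * t))\<^sup>2 / (norm \<xi>)\<^sup>2)) \<partial>(lborel :: (real^'n) measure))"
          and uv: "0 < u" "0 < v" "v \<le> 4" and large: "\<And>s. u \<le> s \<Longrightarrow> s \<le> v \<Longrightarrow> m \<le> \<bar>p * s + Q\<bar>" for c' u v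
      proof (rule L2norm_sq_ge[OF f _ _ _ nn])
        fix \<xi> :: "real^'n"
        show "(exp (- (\<delta> * 4)) * m\<^sup>2) * (indicator {sqrt u / sqrt t..sqrt v / sqrt t} (norm \<xi>) * ((sin (norm \<xi> * t))\<^sup>2 / (norm \<xi>)\<^sup>2)) \<le> (norm (second_symbol \<kappa> \<delta> p Q M t \<xi>))\<^sup>2"
        proof (cases "norm \<xi> \<in> {sqrt u / sqrt t..sqrt v / sqrt t}")
          case True
          note w = win[OF True t(1) uv(1,2)]
          have "exp (- (\<delta> * 4)) * m\<^sup>2 * ((sin (norm \<xi> * t))\<^sup>2 / (norm \<xi>)\<^sup>2) \<le> (norm (second_symbol \<kappa> \<delta> p Q M t \<xi>))\<^sup>2"
            by (rule second_symbol_Re_ge) (use w uv large d0 m0 in auto)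
          then show ?thesis using True by simp
        qed simp
      qed simp_all
      have cm: "exp (- (\<delta> * 4)) * m\<^sup>2 * (c * (rate CARD('n) t)\<^sup>2) \<le> exp (- (\<delta> * 4)) * m\<^sup>2 * (c' * (rate CARD('n) t)\<^sup>2)" if "c \<le> c'" for c'
        using that by (intro mult_left_mono mult_right_mono) auto
      have Rc: "exp (- (\<delta> * 4)) * m\<^sup>2 * (c * (rate CARD('n) t)\<^sup>2) \<le> (L2norm (second_symbol \<kappa> \<delta> p Q M t))\<^sup>2"
        using affine_large_on_a_window[of p Q] unfolding m_def[symmetric]
      proof
        assume "\<forall>s. 1 \<le> s \<and> s \<le> 2 \<longrightarrow> m \<le> \<bar>p * s + Q\<bar>"
        then show ?thesis by (intro order_trans[OF cm Re[OF w1[OF t(2)]]]) (simp_all add: c_def)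
      next
        assume "\<forall>s. 3 \<le> s \<and> s \<le> 4 \<longrightarrow> m \<le> \<bar>p * s + Q\<bar>"
        then show ?thesis by (intro order_trans[OF cm Re[OF w2[OF t(3)]]]) (simp_all add: c_def)
      qed
      have 1: "a * ?S\<^sup>2 * (rate CARD('n) t)\<^sup>2 \<le> (L2norm (second_symbol \<kappa> \<delta> p Q M t))\<^sup>2"
      proof -
        have "?S\<^sup>2 \<le> ((2 * \<delta> + real CARD('n)) * (7 * m))\<^sup>2" using Sm by (rule power_mono) simp
        then have "a * ?S\<^sup>2 \<le> a * ((2 * \<delta> + real CARD('n)) * (7 * m))\<^sup>2" using a0 by (intro mult_left_mono) auto
        also have "\<dots> = exp (- (\<delta> * 4)) * m\<^sup>2 * c" using D by (simp add: a_def power_mult_distrib)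
        finally have "a * ?S\<^sup>2 * (rate CARD('n) t)\<^sup>2 \<le> exp (- (\<delta> * 4)) * m\<^sup>2 * c * (rate CARD('n) t)\<^sup>2" by (rule mult_right_mono) simp
        then show ?thesis using Rc by (simp add: mult.assoc)
      qed
      have "h\<^sup>2 * (c1 * (rate CARD('n) t)\<^sup>2) * (norm M)\<^sup>2 \<le> (real CARD('n))\<^sup>2 * (L2norm (second_symbol \<kappa> \<delta> p Q M t))\<^sup>2"
      proof (rule L2norm_sq_ge_moment[OF f sym_measurable(1) _ _ second_symbol_Im_ge _ w1[OF t(2)]])
        fix \<xi> :: "real^'n"
        show "h\<^sup>2 * (indicator {sqrt 1 / sqrt t..sqrt 2 / sqrt t} (norm \<xi>) * ((sin (norm \<xi> * t))\<^sup>2 / (norm \<xi>)\<^sup>2)) \<le> (norm \<xi> * sym0 \<kappa> \<delta> t (norm \<xi>))\<^sup>2"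
        proof (cases "norm \<xi> \<in> {sqrt 1 / sqrt t..sqrt 2 / sqrt t}")
          case True
          then have "indicator {sqrt 1 / sqrt t..sqrt 2 / sqrt t} (norm \<xi>) = (1::real)" by (rule indicator_simps(1))
          then show ?thesis using sym0_ge_high_dim[of "norm \<xi>" t] win[OF True t(1)] t(1) unfolding h_def by simp
        qed simp
      qed simp_all
      then have 2: "b * (norm M)\<^sup>2 * (rate CARD('n) t)\<^sup>2 \<le> (L2norm (second_symbol \<kappa> \<delta> p Q M t))\<^sup>2"
        by (simp add: b_def pos_divide_le_eq mult_ac)
      show ?case by (rule add_sq_lower[OF a0 b0 _ 1 2]) simp
    qed
  qed
qed

end

section \<open>The refined asymptotics\<close>

lemma rate_nonneg: "0 \<le> rate n t"
  by (simp add: rate_def)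

lemma Hneg_weighted_sq:
  fixes f :: "real^'n \<Rightarrow> real"
  assumes "Hneg_L1 s f"
  shows "integrable lborel (\<lambda>\<xi>. (sqrt (1 + (norm \<xi>)\<^sup>2) powr (- s) * norm (fourier_real f \<xi>))\<^sup>2)"
    and "(\<integral>\<xi>. (sqrt (1 + (norm \<xi>)\<^sup>2) powr (- s) * norm (fourier_real f \<xi>))\<^sup>2 \<partial>lborel) = (2 * pi) ^ CARD('n) * (Hnegnorm s f)\<^sup>2"
  using L2_integrable[OF Hneg_fourier(1)[OF assms]] Hneg_fourier(2)[OF assms] unfolding L2norm_sq
  by (simp_all add: norm_mult)

lemma profile_isometry:
  fixes f p :: "real^'n \<Rightarrow> real"
  assumes V: "L2_fourier (\<lambda>x. complex_of_real (f x)) V" and F: "integrable lborel F" "L2 F"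
    and p: "\<And>x. complex_of_real (p x) = inv_fourier F x"
  shows "L2 (\<lambda>x. f x - p x)" "L2norm (\<lambda>x. f x - p x) = sqrt (1 / (2 * pi) ^ CARD('n)) * L2norm (\<lambda>\<xi>. V \<xi> - F \<xi>)"
proof -
  have "(\<lambda>x. complex_of_real (f x - p x)) = (\<lambda>x. complex_of_real (f x) - inv_fourier F x)" by (simp add: p)
  then show "L2 (\<lambda>x. f x - p x)" "L2norm (\<lambda>x. f x - p x) = sqrt (1 / (2 * pi) ^ CARD('n)) * L2norm (\<lambda>\<xi>. V \<xi> - F \<xi>)"
    using L2_fourier_isometry[OF V F] L2_of_real_iff[of "\<lambda>x. f x - p x"] by simp_all
qed

context mgt begin

lemma cauchy_solution_solves:
  fixes \<psi>0 \<psi>1 \<psi>2 :: "real^'n \<Rightarrow> real"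
  assumes "\<delta> = dlt \<gamma> b \<nu> \<kappa>" "\<beta> = \<gamma> * b * \<nu>" "cauchy_solution \<gamma> b \<nu> \<kappa> \<psi>0 \<psi>1 \<psi>2 \<psi>"
  obtains U where "solves U (fourier_real \<psi>0) (fourier_real \<psi>1) (fourier_real \<psi>2)"
    "\<And>t. t \<ge> 0 \<Longrightarrow> L2_fourier (\<lambda>x. complex_of_real (\<psi> t x)) (U t)"
proof -
  from assms(3) obtain U where
    U: "\<And>\<xi>. ode_solution \<gamma> b \<nu> \<kappa> (- (norm \<xi>)\<^sup>2) (fourier_real \<psi>0 \<xi>) (fourier_real \<psi>1 \<xi>) (fourier_real \<psi>2 \<xi>) (\<lambda>t. U t \<xi>)"
    and V: "\<And>t. t \<ge> 0 \<Longrightarrow> L2_fourier (\<lambda>x. complex_of_real (\<psi> t x)) (U t)"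
    unfolding cauchy_solution_def by blast
  have "solves U (fourier_real \<psi>0) (fourier_real \<psi>1) (fourier_real \<psi>2)"
    unfolding solves_def
  proof
    fix \<xi>
    from ode_solution_third_order[OF U[of \<xi>], folded assms(1,2)]
    show "\<exists>v w. flow ((norm \<xi>)\<^sup>2) (\<lambda>t. U t \<xi>) v w \<and> U 0 \<xi> = fourier_real \<psi>0 \<xi> \<and> v 0 = fourier_real \<psi>1 \<xi> \<and> w 0 = fourier_real \<psi>2 \<xi>"
      unfolding flow_def by metis
  qed
  then show thesis using V by (rule that)
qed

lemma datasq_integral:
  fixes \<psi>0 \<psi>1 \<psi>2 :: "real^'n \<Rightarrow> real"
  assumes h: "Hneg_L1 0 \<psi>0" "Hneg_L1 2 \<psi>1" "Hneg_L1 4 \<psi>2"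
  shows "integrable lborel (datasq N (fourier_real \<psi>0) (fourier_real \<psi>1) (fourier_real \<psi>2))"
    and "(\<integral>\<xi>. datasq N (fourier_real \<psi>0) (fourier_real \<psi>1) (fourier_real \<psi>2) \<xi> \<partial>lborel)
      = (2 * pi) ^ CARD('n) * ((Hnegnorm 0 \<psi>0)\<^sup>2 + (Hnegnorm 2 \<psi>1)\<^sup>2 + (Hnegnorm 4 \<psi>2)\<^sup>2)
        + N\<^sup>2 * (\<integral>\<xi>. exp (- \<kappa> * (norm \<xi>)\<^sup>2) \<partial>(lborel :: (real^'n) measure))"
proof -
  note w = Hneg_weighted_sq[OF h(1)] Hneg_weighted_sq[OF h(2)] Hneg_weighted_sq[OF h(3)]
  note w' = w[unfolded bessel_weight mult_1_left times_divide_eq_left]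
  note g = gaussian_integrable[OF kpos]
  have eq: "datasq N (fourier_real \<psi>0) (fourier_real \<psi>1) (fourier_real \<psi>2) = (\<lambda>\<xi>. (norm (fourier_real \<psi>0 \<xi>))\<^sup>2
    + (norm (fourier_real \<psi>1 \<xi>) / (1 + (norm \<xi>)\<^sup>2))\<^sup>2 + (norm (fourier_real \<psi>2 \<xi>) / (1 + (norm \<xi>)\<^sup>2)\<^sup>2)\<^sup>2 + N\<^sup>2 * exp (- \<kappa> * (norm \<xi>)\<^sup>2))"
    by (simp add: datasq_def fun_eq_iff)
  note i = w'(1) w'(3) w'(5) g
  have i2: "integrable lborel (\<lambda>\<xi>::real^'n. N\<^sup>2 * exp (- \<kappa> * (norm \<xi>)\<^sup>2))" using g by (rule integrable_mult_right)
  note i01 = Bochner_Integration.integrable_add[OF w'(1) w'(3)]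
  note i02 = Bochner_Integration.integrable_add[OF i01 w'(5)]
  show "integrable lborel (datasq N (fourier_real \<psi>0) (fourier_real \<psi>1) (fourier_real \<psi>2))"
    unfolding eq by (rule Bochner_Integration.integrable_add[OF i02 i2])
  show "(\<integral>\<xi>. datasq N (fourier_real \<psi>0) (fourier_real \<psi>1) (fourier_real \<psi>2) \<xi> \<partial>lborel)
      = (2 * pi) ^ CARD('n) * ((Hnegnorm 0 \<psi>0)\<^sup>2 + (Hnegnorm 2 \<psi>1)\<^sup>2 + (Hnegnorm 4 \<psi>2)\<^sup>2)
        + N\<^sup>2 * (\<integral>\<xi>. exp (- \<kappa> * (norm \<xi>)\<^sup>2) \<partial>(lborel :: (real^'n) measure))"
    unfolding eq Bochner_Integration.integral_add[OF i02 i2] Bochner_Integration.integral_add[OF i01 w'(5)]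
      Bochner_Integration.integral_add[OF w'(1) w'(3)] w'(2) w'(4) w'(6) integral_mult_right_zero
    by (simp add: distrib_left)
qed

text \<open>The second profile is the difference of the two errors. With e = (m/2)^2 the error after
  both profiles is at most half of the lower bound for the second profile, so the error after the
  first keeps the other half.\<close>

lemma lower_bound_transfer:
  fixes U :: "real \<Rightarrow> real^'n \<Rightarrow> complex"
  assumes U: "\<And>t. t \<ge> 0 \<Longrightarrow> L2 (U t)" and A: "A > 0" and X: "X > 0"
    and low: "eventually (\<lambda>t. A * X\<^sup>2 * (rate CARD('n) t)\<^sup>2 \<le> (L2norm (second_symbol \<kappa> \<delta> (d * P) Q M t :: real^'n \<Rightarrow> complex))\<^sup>2) at_top"
    and small: "\<And>e. e > 0 \<Longrightarrow> eventually (\<lambda>t. (L2norm (\<lambda>\<xi>. U t \<xi> - total_symbol \<kappa> \<delta> d P Q M t \<xi>))\<^sup>2 \<le> e * (rate CARD('n) t)\<^sup>2) at_top"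
  shows "eventually (\<lambda>t. sqrt A * X * rate CARD('n) t \<le> 2 * L2norm (\<lambda>\<xi>. U t \<xi> - total_symbol \<kappa> \<delta> 0 P 0 0 t \<xi>)) at_top"
proof -
  define m where "m = sqrt A * X"
  have m: "m > 0" "m\<^sup>2 = A * X\<^sup>2" using A X by (auto simp: m_def power_mult_distrib)
  have "(m / 2)\<^sup>2 > 0" using m by simp
  from small[OF this] low eventually_ge_at_top[of 1]
  show ?thesis
  proof eventually_elim
    case (elim t)
    let ?r = "rate CARD('n) t"
    let ?F1 = "total_symbol \<kappa> \<delta> 0 P 0 0 t :: real^'n \<Rightarrow> complex" and ?F = "total_symbol \<kappa> \<delta> d P Q M t"
    have "L2 (U t)" using U elim(3) by simp
    note d1 = L2_diff(1)[OF this total_symbol_integrable(2)[OF kpos ksmall elim(3)]]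
    have "(\<lambda>\<xi>. (U t \<xi> - ?F1 \<xi>) - (U t \<xi> - ?F \<xi>)) = second_symbol \<kappa> \<delta> (d * P) Q M t"
      by (simp add: fun_eq_iff second_symbol_eq)
    from L2_diff(2)[OF d1[of 0 P 0 0] d1[of d P Q M], unfolded this]
    have tri: "L2norm (second_symbol \<kappa> \<delta> (d * P) Q M t) \<le> L2norm (\<lambda>\<xi>. U t \<xi> - ?F1 \<xi>) + L2norm (\<lambda>\<xi>. U t \<xi> - ?F \<xi>)"
      .
    have "(m * ?r)\<^sup>2 \<le> (L2norm (second_symbol \<kappa> \<delta> (d * P) Q M t))\<^sup>2" using elim(2) m by (simp add: power_mult_distrib)
    then have 1: "m * ?r \<le> L2norm (second_symbol \<kappa> \<delta> (d * P) Q M t)" by (rule power2_le_imp_le) simp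
    have "(L2norm (\<lambda>\<xi>. U t \<xi> - ?F \<xi>))\<^sup>2 \<le> (m / 2 * ?r)\<^sup>2" using elim(1) by (simp only: power_mult_distrib)
    then have "L2norm (\<lambda>\<xi>. U t \<xi> - ?F \<xi>) \<le> m / 2 * ?r" by (rule power2_le_imp_le) (use m rate_nonneg[of "CARD('n)" t] in simp)
    then have "m * ?r \<le> 2 * L2norm (\<lambda>\<xi>. U t \<xi> - ?F1 \<xi>)" using 1 tri by simp
    then show ?case by (simp only: m_def)
  qed
qed

text \<open>One constant for whichever case the dimension falls into, so that it can be fixed before
  the cases of the final statement are separated.\<close>

lemma second_symbol_lower:
  obtains A where "A > 0"
    "\<And>p Q (M :: real^'n). CARD('n) \<in> {1, 2} \<Longrightarrow> eventually (\<lambda>t. A * (\<bar>Q\<bar> + norm M)\<^sup>2 * (rate CARD('n) t)\<^sup>2 \<le> (L2norm (second_symbol \<kappa> \<delta> p Q M t))\<^sup>2) at_top"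
    "\<And>p Q (M :: real^'n). CARD('n) \<ge> 3 \<Longrightarrow> eventually (\<lambda>t. A * (\<bar>2 * \<delta> * Q + real CARD('n) * p\<bar> + norm M)\<^sup>2 * (rate CARD('n) t)\<^sup>2 \<le> (L2norm (second_symbol \<kappa> \<delta> p Q M t))\<^sup>2) at_top"
proof (cases "CARD('n) \<ge> 3")
  case True
  obtain A where A: "A > 0" "\<And>p Q (M :: real^'n). eventually (\<lambda>t. A * (\<bar>2 * \<delta> * Q + real CARD('n) * p\<bar> + norm M)\<^sup>2 * (rate CARD('n) t)\<^sup>2 \<le> (L2norm (second_symbol \<kappa> \<delta> p Q M t))\<^sup>2) at_top"
    by (rule second_symbol_lower_high_dim[OF True]) (rule that; assumption)
  show thesis by (rule that[OF A(1) _ A(2)]) (use True in auto)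
next
  case False
  moreover have "CARD('n) > 0" by simp
  ultimately have n: "CARD('n) \<in> {1, 2}" by (auto simp del: zero_less_card_finite)
  obtain A where A: "A > 0" "\<And>p Q (M :: real^'n). eventually (\<lambda>t. A * (\<bar>Q\<bar> + norm M)\<^sup>2 * (rate CARD('n) t)\<^sup>2 \<le> (L2norm (second_symbol \<kappa> \<delta> p Q M t))\<^sup>2) at_top"
    by (rule second_symbol_lower_low_dim[OF n]) (rule that; assumption)
  show thesis by (rule that[OF A(1) A(2)]) (use False in auto)
qed

text \<open>Identifies the number obtained from the expansion of the oscillation frequency with the
  coefficient prescribed in H_0; it holds because \<open>dlt_hat\<close> is \<kappa>^2 (\<beta> -
  \<delta>).\<close>

lemma correction_coefficient:
  assumes "\<delta> = dlt \<gamma> b \<nu> \<kappa>" "\<beta> = \<gamma> * b * \<nu>"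
  shows "(4 * dlt_hat \<gamma> b \<nu> \<kappa> - \<kappa> * \<delta>\<^sup>2) / (8 * \<kappa>) = dcorr"
  using kpos unfolding dlt_hat_def dcorr_def assms(1)[symmetric] assms(2)[symmetric]
  by (simp add: field_simps power2_eq_square)

text \<open>C, T and C' are obtained before the data are introduced, so they depend on the
  parameters and the dimension only. The times after which the little-o relation and the lower
  bounds take effect may depend on the data.\<close>

theorem refined_asymptotics:
  assumes dl: "\<delta> = dlt \<gamma> b \<nu> \<kappa>" "\<beta> = \<gamma> * b * \<nu>"
  defines "\<delta>h \<equiv> dlt_hat \<gamma> b \<nu> \<kappa>"
  obtains C T C' where "C > 0" "C' > 0"
    "\<And>(\<psi>0 :: real^'n \<Rightarrow> real) \<psi>1 \<psi>2 \<psi>. Hneg_L1 0 \<psi>0 \<Longrightarrow> Hneg_L1 2 \<psi>1 \<Longrightarrow> Hneg_L1 4 \<psi>2 \<Longrightarrow> L11 \<psi>2 \<Longrightarrow>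
       cauchy_solution \<gamma> b \<nu> \<kappa> \<psi>0 \<psi>1 \<psi>2 \<psi> \<Longrightarrow>
       (\<forall>\<^sub>F t in at_top. L2 (\<lambda>x. \<psi> t x - profile1 \<kappa> \<delta> \<psi>2 t x - profile2 \<kappa> \<delta> \<delta>h \<psi>1 \<psi>2 t x)) \<and>
       (\<lambda>t. L2norm (\<lambda>x. \<psi> t x - profile1 \<kappa> \<delta> \<psi>2 t x - profile2 \<kappa> \<delta> \<delta>h \<psi>1 \<psi>2 t x)) \<in> o[at_top](rate CARD('n)) \<and>
       (\<forall>t\<ge>T. L2 (\<lambda>x. \<psi> t x - profile1 \<kappa> \<delta> \<psi>2 t x) \<and>
          L2norm (\<lambda>x. \<psi> t x - profile1 \<kappa> \<delta> \<psi>2 t x) \<le>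
            C * (rate CARD('n) t * ((Hnegnorm 0 \<psi>0 + L1norm \<psi>0) + (Hnegnorm 2 \<psi>1 + L1norm \<psi>1) + (Hnegnorm 4 \<psi>2 + L11norm \<psi>2)))) \<and>
       (CARD('n) \<in> {1, 2} \<and> \<not> (norm (M_of \<psi>2) = 0 \<and> \<bar>P_Psi12 \<kappa> \<delta> \<psi>1 \<psi>2\<bar> = 0) \<longrightarrow>
          (\<forall>\<^sub>F t in at_top. (\<bar>P_Psi12 \<kappa> \<delta> \<psi>1 \<psi>2\<bar> + norm (M_of \<psi>2)) * rate CARD('n) t \<le>
               C' * L2norm (\<lambda>x. \<psi> t x - profile1 \<kappa> \<delta> \<psi>2 t x))) \<and>
       (CARD('n) \<ge> 3 \<and> \<not> (norm (M_of \<psi>2) = 0 \<and> \<bar>2 * \<delta> * P_Psi12 \<kappa> \<delta> \<psi>1 \<psi>2 + real CARD('n) * P_2 \<kappa> \<delta> \<delta>h \<psi>2\<bar> = 0) \<longrightarrow>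
          (\<forall>\<^sub>F t in at_top. (\<bar>2 * \<delta> * P_Psi12 \<kappa> \<delta> \<psi>1 \<psi>2 + real CARD('n) * P_2 \<kappa> \<delta> \<delta>h \<psi>2\<bar> + norm (M_of \<psi>2)) * rate CARD('n) t \<le>
               C' * L2norm (\<lambda>x. \<psi> t x - profile1 \<kappa> \<delta> \<psi>2 t x)))"
proof -
  obtain C1 T where C1: "C1 > 0" and T: "T \<ge> 1" and ub:
    "\<And>(U :: real \<Rightarrow> real^'n \<Rightarrow> complex) a0 a1 a2 N P t. solves U a0 a1 a2 \<Longrightarrow> L2 (U t) \<Longrightarrow> t \<ge> T \<Longrightarrow>
       (\<forall>\<xi>. norm (a0 \<xi>) \<le> N) \<Longrightarrow> (\<forall>\<xi>. norm (a1 \<xi>) \<le> N) \<Longrightarrow> (\<forall>\<xi>. norm (a2 \<xi>) \<le> N) \<Longrightarrow> \<bar>P\<bar> \<le> N \<Longrightarrow>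
       (\<forall>\<xi>. norm (a2 \<xi> - complex_of_real P) \<le> norm \<xi> * N) \<Longrightarrow> integrable lborel (datasq N a0 a1 a2) \<Longrightarrow>
       (L2norm (\<lambda>\<xi>. U t \<xi> - total_symbol \<kappa> \<delta> 0 P 0 0 t \<xi>))\<^sup>2 \<le> C1 * (rate CARD('n) t)\<^sup>2 * (N\<^sup>2 + (\<integral>\<xi>. datasq N a0 a1 a2 \<xi> \<partial>lborel))"
    by (rule profile_error_bound[where 'n = 'n]) (rule that; assumption)
  obtain A where A: "A > 0" and lb:
    "\<And>p Q (M :: real^'n). CARD('n) \<in> {1, 2} \<Longrightarrow> eventually (\<lambda>t. A * (\<bar>Q\<bar> + norm M)\<^sup>2 * (rate CARD('n) t)\<^sup>2 \<le> (L2norm (second_symbol \<kappa> \<delta> p Q M t))\<^sup>2) at_top"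
    "\<And>p Q (M :: real^'n). CARD('n) \<ge> 3 \<Longrightarrow> eventually (\<lambda>t. A * (\<bar>2 * \<delta> * Q + real CARD('n) * p\<bar> + norm M)\<^sup>2 * (rate CARD('n) t)\<^sup>2 \<le> (L2norm (second_symbol \<kappa> \<delta> p Q M t))\<^sup>2) at_top"
    by (rule second_symbol_lower) (rule that; assumption)
  define c where "c = sqrt (1 / (2 * pi) ^ CARD('n))"
  have c: "c > 0" by (simp add: c_def)
  define G where "G = (\<integral>\<xi>. exp (- \<kappa> * (norm \<xi>)\<^sup>2) \<partial>(lborel :: (real^'n) measure))"
  have G: "G \<ge> 0" unfolding G_def by (intro integral_nonneg_AE) simp
  \<comment> \<open>The three summands collect the contributions of N^2, of the Sobolev norms with
    their Plancherel factor, and of the Gaussian term of \<open>datasq\<close>.\<close>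
  define K where "K = 1 + (2 * pi) ^ CARD('n) + G"
  have K: "K > 0" using G by (simp add: K_def add_pos_nonneg)
  note co = correction_coefficient[OF dl, folded \<delta>h_def]
  show thesis
  proof (rule that[of "c * sqrt (C1 * K)" "2 / (c * sqrt A)"])
    show "c * sqrt (C1 * K) > 0" "2 / (c * sqrt A) > 0" using c C1 K A by auto
    fix \<psi>0 \<psi>1 \<psi>2 :: "real^'n \<Rightarrow> real" and \<psi> :: "real \<Rightarrow> real^'n \<Rightarrow> real"
    assume h: "Hneg_L1 0 \<psi>0" "Hneg_L1 2 \<psi>1" "Hneg_L1 4 \<psi>2" and l11: "L11 \<psi>2" and cs: "cauchy_solution \<gamma> b \<nu> \<kappa> \<psi>0 \<psi>1 \<psi>2 \<psi>"
    obtain U where sol: "solves U (fourier_real \<psi>0) (fourier_real \<psi>1) (fourier_real \<psi>2)"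
      and V: "\<And>t. t \<ge> 0 \<Longrightarrow> L2_fourier (\<lambda>x. complex_of_real (\<psi> t x)) (U t)"
      using cauchy_solution_solves[OF dl cs] by blast
    have U: "L2 (U t)" if "t \<ge> 0" for t using V[OF that] by (simp add: L2_fourier_def)
    note l1 = Hneg_fourier(3)[OF h(1)] Hneg_fourier(3)[OF h(2)] Hneg_fourier(3)[OF h(3)]
    \<comment> \<open>A single number bounding the transforms, the masses and the first moment of
      the data at once.\<close>
    define N where "N = L1norm \<psi>0 + L1norm \<psi>1 + L11norm \<psi>2"
    have Nb: "L1norm \<psi>0 \<le> N" "L1norm \<psi>1 \<le> N" "L1norm \<psi>2 \<le> N" "L11norm \<psi>2 \<le> N" "N \<ge> 0"
      using L1norm_nonneg[of \<psi>0] L1norm_nonneg[of \<psi>1] L11norm_nonneg[of \<psi>2] L1norm_le_L11norm[OF l11] by (auto simp: N_def)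
    let ?P = "P_of \<psi>2" and ?Q = "P_Psi12 \<kappa> \<delta> \<psi>1 \<psi>2" and ?M = "M_of \<psi>2"
    let ?F1 = "\<lambda>t. total_symbol \<kappa> \<delta> 0 ?P 0 0 t :: real^'n \<Rightarrow> complex"
    let ?F = "\<lambda>t. total_symbol \<kappa> \<delta> dcorr ?P ?Q ?M t :: real^'n \<Rightarrow> complex"
    let ?\<phi>1 = "\<lambda>t x. \<psi> t x - profile1 \<kappa> \<delta> \<psi>2 t x"
    let ?\<phi>2 = "\<lambda>t x. \<psi> t x - profile1 \<kappa> \<delta> \<psi>2 t x - profile2 \<kappa> \<delta> \<delta>h \<psi>1 \<psi>2 t x"
    have b: "norm (fourier_real \<psi>0 \<xi>) \<le> N" "norm (fourier_real \<psi>1 \<xi>) \<le> N" "norm (fourier_real \<psi>2 \<xi>) \<le> N" for \<xi>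
      using fourier_real_bound[OF l1(1), of \<xi>] fourier_real_bound[OF l1(2), of \<xi>] fourier_real_bound[OF l1(3), of \<xi>] Nb by linarith+
    have P: "\<bar>?P\<bar> \<le> N" "\<bar>P_of \<psi>1\<bar> \<le> N" using P_of_bound[of \<psi>2] P_of_bound[of \<psi>1] Nb by linarith+
    have M: "norm ?M \<le> N" using M_of_bound[OF l11] Nb by linarith
    have aP: "norm (fourier_real \<psi>2 \<xi> - complex_of_real ?P) \<le> norm \<xi> * N" for \<xi>
      using order_trans[OF fourier_real_minus_P_le[OF l11, of \<xi>] mult_left_mono[OF Nb(4) norm_ge_zero]] .
    note D = datasq_integral[OF h, of N]
    have iso1: "L2 (?\<phi>1 t)" "L2norm (?\<phi>1 t) = c * L2norm (\<lambda>\<xi>. U t \<xi> - ?F1 t \<xi>)" if t: "t \<ge> 1" for t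
    proof -
      have V': "L2_fourier (\<lambda>x. complex_of_real (\<psi> t x)) (U t)" using V t by simp
      note iso = profile_isometry[OF V' total_symbol_integrable[OF kpos ksmall t] profile1_symbol[OF kpos ksmall t]]
      show "L2 (?\<phi>1 t)" by (rule iso(1))
      show "L2norm (?\<phi>1 t) = c * L2norm (\<lambda>\<xi>. U t \<xi> - ?F1 t \<xi>)" unfolding c_def by (rule iso(2))
    qed
    have iso2: "L2 (?\<phi>2 t)" "L2norm (?\<phi>2 t) = c * L2norm (\<lambda>\<xi>. U t \<xi> - ?F t \<xi>)" if t: "t \<ge> 1" for t
    proof -
      have V': "L2_fourier (\<lambda>x. complex_of_real (\<psi> t x)) (U t)" using V t by simp
      note iso = profile_isometry[OF V' total_symbol_integrable[OF kpos ksmall t] profile12_symbol[OF kpos ksmall t, where dh = \<delta>h, unfolded co], folded diff_diff_eq]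
      show "L2 (?\<phi>2 t)" by (rule iso(1))
      show "L2norm (?\<phi>2 t) = c * L2norm (\<lambda>\<xi>. U t \<xi> - ?F t \<xi>)" unfolding c_def by (rule iso(2))
    qed
    have Qeq: "?Q = P_of \<psi>1 + (\<kappa> - \<delta> / 2) * ?P" by (simp add: P_Psi12_def diff_divide_distrib)
    have small: "eventually (\<lambda>t. (L2norm (\<lambda>\<xi>. U t \<xi> - ?F t \<xi>))\<^sup>2 \<le> e * (rate CARD('n) t)\<^sup>2) at_top" if e: "e > 0" for e
      unfolding Qeq
    proof (rule second_profile_error_small[OF sol U b P M aP D(1) _ _ e])
      show "\<exists>\<rho>>0. \<forall>\<xi>. norm \<xi> < \<rho> \<longrightarrow> norm (fourier_real \<psi>1 \<xi> - complex_of_real (P_of \<psi>1)) \<le> e'" if "e' > 0" for e'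
        using fourier_real_continuous_0[OF l1(2)[unfolded L1_def] that] by blast
      show "\<exists>\<rho>>0. \<forall>\<xi>. norm \<xi> < \<rho> \<longrightarrow> norm (fourier_real \<psi>2 \<xi> - Complex ?P (- (\<xi> \<bullet> ?M))) \<le> e' * norm \<xi>" if "e' > 0" for e'
        using fourier_real_first_order[OF l11 that] by blast
    qed
    have A1: "\<forall>\<^sub>F t in at_top. L2 (?\<phi>2 t)"
      using eventually_ge_at_top[of 1] by eventually_elim (rule iso2)
    have A2: "(\<lambda>t. L2norm (?\<phi>2 t)) \<in> o[at_top](rate CARD('n))"
    proof (rule landau_o.smallI)
      fix e :: real assume e: "e > 0"
      have "(e / c)\<^sup>2 > 0" using e c by simp
      from small[OF this] eventually_ge_at_top[of 1]
      show "\<forall>\<^sub>F t in at_top. norm (L2norm (?\<phi>2 t)) \<le> e * norm (rate CARD('n) t)"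
      proof eventually_elim
        case (elim t)
        have "(L2norm (\<lambda>\<xi>. U t \<xi> - ?F t \<xi>))\<^sup>2 \<le> (e / c * rate CARD('n) t)\<^sup>2" using elim(1) by (simp only: power_mult_distrib)
        then have "L2norm (\<lambda>\<xi>. U t \<xi> - ?F t \<xi>) \<le> e / c * rate CARD('n) t"
          by (rule power2_le_imp_le) (use e c rate_nonneg[of "CARD('n)" t] in simp)
        from mult_left_mono[OF this, of c] have "L2norm (?\<phi>2 t) \<le> e * rate CARD('n) t" using c iso2(2)[OF elim(2)] by simp
        then show ?case using rate_nonneg[of "CARD('n)" t] by simp
      qed
    qed
    have A3: "\<forall>t\<ge>T. L2 (?\<phi>1 t) \<and> L2norm (?\<phi>1 t) \<le> c * sqrt (C1 * K) *
        (rate CARD('n) t * ((Hnegnorm 0 \<psi>0 + L1norm \<psi>0) + (Hnegnorm 2 \<psi>1 + L1norm \<psi>1) + (Hnegnorm 4 \<psi>2 + L11norm \<psi>2)))"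
    proof (intro allI impI conjI)
      fix t assume t: "t \<ge> T"
      then have t1: "t \<ge> 1" using T by simp
      show "L2 (?\<phi>1 t)" by (rule iso1[OF t1])
      define Z where "Z = (Hnegnorm 0 \<psi>0 + L1norm \<psi>0) + (Hnegnorm 2 \<psi>1 + L1norm \<psi>1) + (Hnegnorm 4 \<psi>2 + L11norm \<psi>2)"
      note H = Hneg_fourier(4)[OF h(1)] Hneg_fourier(4)[OF h(2)] Hneg_fourier(4)[OF h(3)]
      have Z: "Z = N + Hnegnorm 0 \<psi>0 + Hnegnorm 2 \<psi>1 + Hnegnorm 4 \<psi>2" by (simp add: Z_def N_def)
      have Z0: "Z \<ge> 0" using H Nb(5) Z by linarith
      have NZ: "N\<^sup>2 \<le> Z\<^sup>2" using H Nb(5) Z by (intro power_mono) auto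
      have HZ: "(Hnegnorm 0 \<psi>0)\<^sup>2 + (Hnegnorm 2 \<psi>1)\<^sup>2 + (Hnegnorm 4 \<psi>2)\<^sup>2 \<le> Z\<^sup>2"
      proof -
        have sq: "x\<^sup>2 + y\<^sup>2 + z\<^sup>2 \<le> (N + x + y + z)\<^sup>2" if "x \<ge> 0" "y \<ge> 0" "z \<ge> 0" for x y z :: real
        proof -
          have "x\<^sup>2 + y\<^sup>2 + z\<^sup>2 \<le> (x + y + z)\<^sup>2" using that by (simp add: power2_eq_square algebra_simps)
          also have "\<dots> \<le> (N + x + y + z)\<^sup>2" using that Nb(5) by (intro power_mono) auto
          finally show ?thesis .
        qed
        show ?thesis unfolding Z by (rule sq) (use H in auto)
      qed
      have t0: "t \<ge> 0" using t1 by simp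
      have "(L2norm (\<lambda>\<xi>. U t \<xi> - ?F1 t \<xi>))\<^sup>2 \<le> C1 * (rate CARD('n) t)\<^sup>2 * (N\<^sup>2 + ((2 * pi) ^ CARD('n) * ((Hnegnorm 0 \<psi>0)\<^sup>2 + (Hnegnorm 2 \<psi>1)\<^sup>2 + (Hnegnorm 4 \<psi>2)\<^sup>2) + N\<^sup>2 * G))"
        using ub[OF sol U[OF t0] t _ _ _ P(1) _ D(1)] b aP unfolding D(2) G_def by blast
      also have "\<dots> \<le> C1 * (rate CARD('n) t)\<^sup>2 * (Z\<^sup>2 + ((2 * pi) ^ CARD('n) * Z\<^sup>2 + Z\<^sup>2 * G))"
        using C1 by (intro mult_left_mono add_mono mult_right_mono NZ HZ G) auto
      also have "\<dots> = (sqrt (C1 * K) * rate CARD('n) t * Z)\<^sup>2"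
      proof -
        have "(sqrt (C1 * K))\<^sup>2 = C1 * K" using C1 K by simp
        then show ?thesis by (simp add: power_mult_distrib K_def algebra_simps)
      qed
      finally have "L2norm (\<lambda>\<xi>. U t \<xi> - ?F1 t \<xi>) \<le> sqrt (C1 * K) * rate CARD('n) t * Z"
        by (rule power2_le_imp_le) (use C1 K Z0 rate_nonneg[of "CARD('n)" t] in simp)
      from mult_left_mono[OF this, of c] show "L2norm (?\<phi>1 t) \<le> c * sqrt (C1 * K) *
        (rate CARD('n) t * ((Hnegnorm 0 \<psi>0 + L1norm \<psi>0) + (Hnegnorm 2 \<psi>1 + L1norm \<psi>1) + (Hnegnorm 4 \<psi>2 + L11norm \<psi>2)))"
        using c unfolding iso1(2)[OF t1] Z_def[symmetric] by (simp add: mult.assoc)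
    qed
    have low: "\<forall>\<^sub>F t in at_top. X * rate CARD('n) t \<le> 2 / (c * sqrt A) * L2norm (?\<phi>1 t)"
      if X: "X > 0" and ev: "\<forall>\<^sub>F t in at_top. A * X\<^sup>2 * (rate CARD('n) t)\<^sup>2 \<le> (L2norm (second_symbol \<kappa> \<delta> (dcorr * ?P) ?Q ?M t :: real^'n \<Rightarrow> complex))\<^sup>2" for X
    proof -
      have "\<forall>\<^sub>F t in at_top. sqrt A * X * rate CARD('n) t \<le> 2 * L2norm (\<lambda>\<xi>. U t \<xi> - ?F1 t \<xi>)"
        by (rule lower_bound_transfer[OF _ A X ev]) (fact U, fact small)
      then show ?thesis using eventually_ge_at_top[of 1]
    proof eventually_elim
      case (elim t)
      have sA: "sqrt A > 0" using A by simp
      have "X * rate CARD('n) t \<le> 2 * L2norm (\<lambda>\<xi>. U t \<xi> - ?F1 t \<xi>) / sqrt A"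
        using elim(1) sA by (simp add: pos_le_divide_eq mult_ac)
      then show ?case using c unfolding iso1(2)[OF elim(2)] by simp
    qed
    qed
    have P2: "P_2 \<kappa> \<delta> \<delta>h \<psi>2 = dcorr * ?P" unfolding P_2_def co ..
    have A4: "CARD('n) \<in> {1, 2} \<and> \<not> (norm ?M = 0 \<and> \<bar>?Q\<bar> = 0) \<longrightarrow>
          (\<forall>\<^sub>F t in at_top. (\<bar>?Q\<bar> + norm ?M) * rate CARD('n) t \<le> 2 / (c * sqrt A) * L2norm (?\<phi>1 t))"
    proof
      assume a: "CARD('n) \<in> {1, 2} \<and> \<not> (norm ?M = 0 \<and> \<bar>?Q\<bar> = 0)"
      then have "\<bar>?Q\<bar> + norm ?M > 0" using norm_ge_zero[of ?M] abs_ge_zero[of ?Q] by linarith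
      then show "\<forall>\<^sub>F t in at_top. (\<bar>?Q\<bar> + norm ?M) * rate CARD('n) t \<le> 2 / (c * sqrt A) * L2norm (?\<phi>1 t)"
        by (rule low[OF _ lb(1)[OF conjunct1[OF a]]])
    qed
    have A5: "CARD('n) \<ge> 3 \<and> \<not> (norm ?M = 0 \<and> \<bar>2 * \<delta> * ?Q + real CARD('n) * P_2 \<kappa> \<delta> \<delta>h \<psi>2\<bar> = 0) \<longrightarrow>
          (\<forall>\<^sub>F t in at_top. (\<bar>2 * \<delta> * ?Q + real CARD('n) * P_2 \<kappa> \<delta> \<delta>h \<psi>2\<bar> + norm ?M) * rate CARD('n) t \<le> 2 / (c * sqrt A) * L2norm (?\<phi>1 t))"
      unfolding P2
    proof
      let ?S = "\<bar>2 * \<delta> * ?Q + real CARD('n) * (dcorr * ?P)\<bar>"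
      assume a: "CARD('n) \<ge> 3 \<and> \<not> (norm ?M = 0 \<and> ?S = 0)"
      then have "?S + norm ?M > 0" using norm_ge_zero[of ?M] abs_ge_zero[of "2 * \<delta> * ?Q + real CARD('n) * (dcorr * ?P)"] by linarith
      then show "\<forall>\<^sub>F t in at_top. (?S + norm ?M) * rate CARD('n) t \<le> 2 / (c * sqrt A) * L2norm (?\<phi>1 t)"
        by (rule low[OF _ lb(2)[OF conjunct1[OF a]]])
    qed
    show "(\<forall>\<^sub>F t in at_top. L2 (?\<phi>2 t)) \<and> (\<lambda>t. L2norm (?\<phi>2 t)) \<in> o[at_top](rate CARD('n)) \<and>
       (\<forall>t\<ge>T. L2 (?\<phi>1 t) \<and> L2norm (?\<phi>1 t) \<le> c * sqrt (C1 * K) *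
          (rate CARD('n) t * ((Hnegnorm 0 \<psi>0 + L1norm \<psi>0) + (Hnegnorm 2 \<psi>1 + L1norm \<psi>1) + (Hnegnorm 4 \<psi>2 + L11norm \<psi>2)))) \<and>
       (CARD('n) \<in> {1, 2} \<and> \<not> (norm ?M = 0 \<and> \<bar>?Q\<bar> = 0) \<longrightarrow>
          (\<forall>\<^sub>F t in at_top. (\<bar>?Q\<bar> + norm ?M) * rate CARD('n) t \<le> 2 / (c * sqrt A) * L2norm (?\<phi>1 t))) \<and>
       (CARD('n) \<ge> 3 \<and> \<not> (norm ?M = 0 \<and> \<bar>2 * \<delta> * ?Q + real CARD('n) * P_2 \<kappa> \<delta> \<delta>h \<psi>2\<bar> = 0) \<longrightarrow>
          (\<forall>\<^sub>F t in at_top. (\<bar>2 * \<delta> * ?Q + real CARD('n) * P_2 \<kappa> \<delta> \<delta>h \<psi>2\<bar> + norm ?M) * rate CARD('n) t \<le> 2 / (c * sqrt A) * L2norm (?\<phi>1 t)))"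
      by (rule conjI[OF A1 conjI[OF A2 conjI[OF A3 conjI[OF A4 A5]]]])
  qed
qed

end

text \<open>From 4 \<kappa> < b \<nu> + (\<gamma> - 1) \<kappa> and \<gamma> - 1 \<le> 1 follows
  \<kappa> < b \<nu>, which is the remaining inequality because \<gamma> b \<nu> - \<delta> =
  (\<gamma> - 1)(b \<nu> - \<kappa>).\<close>

lemma mgt_parameters:
  assumes "1 < \<gamma>" "b > 0" "\<nu> > 0" "0 < \<kappa>" "\<kappa> < 1 / 4 * dlt \<gamma> b \<nu> \<kappa>" "\<gamma> \<le> 5 / 3"
  shows "mgt \<kappa> (dlt \<gamma> b \<nu> \<kappa>) (\<gamma> * b * \<nu>)"
proof
  show "0 < \<kappa>" "4 * \<kappa> < dlt \<gamma> b \<nu> \<kappa>" using assms by auto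
  have "(\<gamma> - 1) * \<kappa> \<le> 1 * \<kappa>" using assms by (intro mult_right_mono) auto
  moreover have "k < x" if "y \<le> 1 * k" "k < 1 / 4 * (x + y)" "0 < k" for k x y :: real
    using that by (simp add: field_simps)
  ultimately have "\<kappa> < b * \<nu>" using assms(4,5) unfolding dlt_def by blast
  then have "(\<gamma> - 1) * \<kappa> < (\<gamma> - 1) * (b * \<nu>)" using assms by simp
  then show "dlt \<gamma> b \<nu> \<kappa> < \<gamma> * b * \<nu>" by (simp add: dlt_def algebra_simps)
qed

theorem theorem2p2:
  shows "\<exists>\<epsilon>>0. \<forall>\<gamma> b \<nu> \<kappa> \<delta> \<delta>h :: real.
    1 < \<gamma> \<and> \<gamma> \<le> 5/3 \<and> b > 0 \<and> \<nu> > 0 \<and>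
    \<delta> = dlt \<gamma> b \<nu> \<kappa> \<and> \<delta>h = dlt_hat \<gamma> b \<nu> \<kappa> \<and>
    0 < \<kappa> \<and> \<kappa> < \<epsilon> * \<delta> \<longrightarrow>
    (\<exists>C>0. \<exists>T. \<exists>C'>0. \<forall>\<psi>0 \<psi>1 \<psi>2 :: real^'n \<Rightarrow> real. \<forall>\<psi> :: real \<Rightarrow> real^'n \<Rightarrow> real.
       Hneg_L1 0 \<psi>0 \<and> Hneg_L1 2 \<psi>1 \<and> Hneg_L1 4 \<psi>2 \<and> L11 \<psi>2 \<and>
       cauchy_solution \<gamma> b \<nu> \<kappa> \<psi>0 \<psi>1 \<psi>2 \<psi> \<longrightarrow>
       (\<forall>\<^sub>F t in at_top.
          L2 (\<lambda>x. \<psi> t x - profile1 \<kappa> \<delta> \<psi>2 t x - profile2 \<kappa> \<delta> \<delta>h \<psi>1 \<psi>2 t x)) \<and>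
       (\<lambda>t. L2norm (\<lambda>x. \<psi> t x - profile1 \<kappa> \<delta> \<psi>2 t x - profile2 \<kappa> \<delta> \<delta>h \<psi>1 \<psi>2 t x))
         \<in> o[at_top](rate CARD('n)) \<and>
       (\<forall>t\<ge>T.
          L2 (\<lambda>x. \<psi> t x - profile1 \<kappa> \<delta> \<psi>2 t x) \<and>
          L2norm (\<lambda>x. \<psi> t x - profile1 \<kappa> \<delta> \<psi>2 t x) \<le>
            C * (rate CARD('n) t *
              ((Hnegnorm 0 \<psi>0 + L1norm \<psi>0) + (Hnegnorm 2 \<psi>1 + L1norm \<psi>1)
               + (Hnegnorm 4 \<psi>2 + L11norm \<psi>2)))) \<and>
       (CARD('n) \<in> {1, 2} \<and>
        \<not> (norm (M_of \<psi>2) = 0 \<and> \<bar>P_Psi12 \<kappa> \<delta> \<psi>1 \<psi>2\<bar> = 0) \<longrightarrow>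
          (\<forall>\<^sub>F t in at_top.
             (\<bar>P_Psi12 \<kappa> \<delta> \<psi>1 \<psi>2\<bar> + norm (M_of \<psi>2)) * rate CARD('n) t \<le>
               C' * L2norm (\<lambda>x. \<psi> t x - profile1 \<kappa> \<delta> \<psi>2 t x))) \<and>
       (CARD('n) \<ge> 3 \<and>
        \<not> (norm (M_of \<psi>2) = 0 \<and>
            \<bar>2 * \<delta> * P_Psi12 \<kappa> \<delta> \<psi>1 \<psi>2 + real CARD('n) * P_2 \<kappa> \<delta> \<delta>h \<psi>2\<bar> = 0) \<longrightarrow>
          (\<forall>\<^sub>F t in at_top.
             (\<bar>2 * \<delta> * P_Psi12 \<kappa> \<delta> \<psi>1 \<psi>2 + real CARD('n) * P_2 \<kappa> \<delta> \<delta>h \<psi>2\<bar>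
               + norm (M_of \<psi>2)) * rate CARD('n) t \<le>
               C' * L2norm (\<lambda>x. \<psi> t x - profile1 \<kappa> \<delta> \<psi>2 t x))))"
proof (rule exI[of _ "1 / 4"], intro conjI allI impI)
  \<comment> \<open>The threshold 1/4 gives 2 \<kappa> < \<delta>/2, so the oscillation is damped
    faster than the exponential mode with room to spare, and it yields \<kappa> < b \<nu> in
    \<open>mgt_parameters\<close>.\<close>
  fix \<gamma> b \<nu> \<kappa> \<delta> \<delta>h :: real
  assume "1 < \<gamma> \<and> \<gamma> \<le> 5/3 \<and> b > 0 \<and> \<nu> > 0 \<and> \<delta> = dlt \<gamma> b \<nu> \<kappa> \<and> \<delta>h = dlt_hat \<gamma> b \<nu> \<kappa> \<and> 0 < \<kappa> \<and> \<kappa> < 1 / 4 * \<delta>"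
  then have d: "\<delta> = dlt \<gamma> b \<nu> \<kappa>" and dh: "\<delta>h = dlt_hat \<gamma> b \<nu> \<kappa>" and m: "mgt \<kappa> \<delta> (\<gamma> * b * \<nu>)"
    using mgt_parameters[of \<gamma> b \<nu> \<kappa>] by auto
  show "(\<exists>C>0. \<exists>T. \<exists>C'>0. \<forall>\<psi>0 \<psi>1 \<psi>2 :: real^'n \<Rightarrow> real. \<forall>\<psi> :: real \<Rightarrow> real^'n \<Rightarrow> real.
       Hneg_L1 0 \<psi>0 \<and> Hneg_L1 2 \<psi>1 \<and> Hneg_L1 4 \<psi>2 \<and> L11 \<psi>2 \<and>
       cauchy_solution \<gamma> b \<nu> \<kappa> \<psi>0 \<psi>1 \<psi>2 \<psi> \<longrightarrow>
       (\<forall>\<^sub>F t in at_top.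
          L2 (\<lambda>x. \<psi> t x - profile1 \<kappa> \<delta> \<psi>2 t x - profile2 \<kappa> \<delta> \<delta>h \<psi>1 \<psi>2 t x)) \<and>
       (\<lambda>t. L2norm (\<lambda>x. \<psi> t x - profile1 \<kappa> \<delta> \<psi>2 t x - profile2 \<kappa> \<delta> \<delta>h \<psi>1 \<psi>2 t x))
         \<in> o[at_top](rate CARD('n)) \<and>
       (\<forall>t\<ge>T.
          L2 (\<lambda>x. \<psi> t x - profile1 \<kappa> \<delta> \<psi>2 t x) \<and>
          L2norm (\<lambda>x. \<psi> t x - profile1 \<kappa> \<delta> \<psi>2 t x) \<le>
            C * (rate CARD('n) t *
              ((Hnegnorm 0 \<psi>0 + L1norm \<psi>0) + (Hnegnorm 2 \<psi>1 + L1norm \<psi>1)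
               + (Hnegnorm 4 \<psi>2 + L11norm \<psi>2)))) \<and>
       (CARD('n) \<in> {1, 2} \<and>
        \<not> (norm (M_of \<psi>2) = 0 \<and> \<bar>P_Psi12 \<kappa> \<delta> \<psi>1 \<psi>2\<bar> = 0) \<longrightarrow>
          (\<forall>\<^sub>F t in at_top.
             (\<bar>P_Psi12 \<kappa> \<delta> \<psi>1 \<psi>2\<bar> + norm (M_of \<psi>2)) * rate CARD('n) t \<le>
               C' * L2norm (\<lambda>x. \<psi> t x - profile1 \<kappa> \<delta> \<psi>2 t x))) \<and>
       (CARD('n) \<ge> 3 \<and>
        \<not> (norm (M_of \<psi>2) = 0 \<and>
            \<bar>2 * \<delta> * P_Psi12 \<kappa> \<delta> \<psi>1 \<psi>2 + real CARD('n) * P_2 \<kappa> \<delta> \<delta>h \<psi>2\<bar> = 0) \<longrightarrow>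
          (\<forall>\<^sub>F t in at_top.
             (\<bar>2 * \<delta> * P_Psi12 \<kappa> \<delta> \<psi>1 \<psi>2 + real CARD('n) * P_2 \<kappa> \<delta> \<delta>h \<psi>2\<bar>
               + norm (M_of \<psi>2)) * rate CARD('n) t \<le>
               C' * L2norm (\<lambda>x. \<psi> t x - profile1 \<kappa> \<delta> \<psi>2 t x))))"
    by (rule mgt.refined_asymptotics[OF m d refl, where 'n = 'n]) (unfold dh, blast)
qed simp

end
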